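(* Consider on $\mathbb{R}$ the $2n\times2n$ symmetric system $\tilde Jf'+\tilde Bf=\tilde{\mathcal H}g$ with $$\tilde J=\begin{pmatrix}0 & J^* \\ -J & 0\end{pmatrix},\quad \tilde B=\begin{pmatrix}V & B \\ {B^*-J'} & -A\end{pmatrix},\quad \tilde{\mathcal H}=\begin{pmatrix}\mathcal H & 0 \\ 0 & 0\end{pmatrix},$$ with coefficients as in the context and $A\ge0$. Let $$c(x)=\begin{cases}\max\bigl(1,\|A(x)^{-1/2}J(x)\mathcal{H}(x)^{-1/2}\|\bigr),&\det(A(x)\mathcal{H}(x))\neq0,\\ \infty,&\text{otherwise}.\end{cases}$$ Let $\delta>0$ and let $q\ge\delta$ be a function on $\mathbb{R}$ such that $V\ge-q\mathcal{H}$ and $$\int_0^\infty\frac{dx}{c(x)q(x)^{1/2}}=\infty,\qquad\int_{-\infty}^0\frac{dx}{c(x)q(x)^{1/2}}=\infty.$$ Assume moreover that one of the following holds: (1) $q$ is absolutely continuous and, for some constant $C_1$, $\bigl|\frac{d}{dx}q^{-1/2}(x)\bigr|\,c(x)\le C_1$ for $x\in\mathbb{R}$; (2) $q$ is non-increasing on $\mathbb{R}_-$ and non-decreasing on $\mathbb{R}_+$. Then the minimal relation $\tilde S_{\min}=S_{\min}(\tilde J,\tilde B,\tilde{\mathcal H})$ is essentially self-adjoint.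
   Context: Assumptions on coefficients: $J\in AC(\mathbb{R},\mathrm{Mat}(n,\mathbb{C}))$ (absolutely continuous on compact intervals), $\det J(x)\ne0$; $V,B,A,\mathcal{H}\in L^1_{loc}(\mathbb{R},\mathrm{Mat}(n,\mathbb{C}))$; $V=V^*$, $A=A^*$, $\mathcal{H}=\mathcal{H}^*\ge0$. Conventions: $1/\infty=0$, $0\cdot\infty=0$, so (1) means $|\frac{d}{dx}q^{-1/2}|\le C_1/c(x)$ a.e. $\mathbb{R}_+=[0,\infty)$, $\mathbb{R}_-=(-\infty,0]$. "Absolutely continuous" means on compact intervals. $\mathcal{L}^2_{\tilde{\mathcal H}}(\mathbb{R})$: Borel measurable $f:\mathbb{R}\to\mathbb{C}^{2n}$ with $\int f^*\tilde{\mathcal H}f<\infty$, $\langle f,g\rangle=\int f^*\tilde{\mathcal H}g$; $L^2_{\tilde{\mathcal H}}(\mathbb{R})$ is the quotient Hilbert space by the null functions; $[f]$ is the class of $f$. $\tilde S_{\min}$ is the set of pairs $\{[f],[g]\}$ with $f\in AC(\mathbb{R},\mathbb{C}^{2n})$, $g\in\mathcal{L}^2_{\tilde{\mathcal H}}(\mathbb{R})$, both compactly supported, and $\tilde Jf'+\tilde Bf=\tilde{\mathcal H}g$ a.e. Its adjoint is $\tilde S_{\min}^*=\{\{u,v\}:\langle u,\psi\rangle=\langle v,\varphi\rangle\ \forall\{\varphi,\psi\}\in\tilde S_{\min}\}$; essentially self-adjoint means that the closure of $\tilde S_{\min}$ in $L^2_{\tilde{\mathcal H}}(\mathbb R)^2$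 equals $\tilde S_{\min}^*$. *)

theory Defs
  imports "HOL-Analysis.Analysis"
begin

section \<open>Matrices\<close>

definition adj :: "complex^'n^'m \<Rightarrow> complex^'m^'n" where
  "adj M = (\<chi> i j. cnj (M $ j $ i))"

definition cdot :: "complex^'n \<Rightarrow> complex^'n \<Rightarrow> complex" where
  "cdot v w = (\<Sum>i\<in>UNIV. cnj (v $ i) * w $ i)"

definition hermitian :: "complex^'n^'n \<Rightarrow> bool" where
  "hermitian M \<longleftrightarrow> adj M = M"

definition psd :: "complex^'n^'n \<Rightarrow> bool" where
  "psd M \<longleftrightarrow> hermitian M \<and> (\<forall>v. 0 \<le> Re (cdot v (M *v v)))"

definition loewner_le :: "complex^'n^'n \<Rightarrow> complex^'n^'n \<Rightarrow> bool" where
  "loewner_le M N \<longleftrightarrow> psd (N - M)"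

definition mat_sqrt :: "complex^'n^'n \<Rightarrow> complex^'n^'n" where
  "mat_sqrt M = (THE R. psd R \<and> R ** R = M)"

definition mat_inv_sqrt :: "complex^'n^'n \<Rightarrow> complex^'n^'n" where
  "mat_inv_sqrt M = matrix_inv (mat_sqrt M)"

text \<open>The library norm on matrices is the Frobenius norm; this is the operator norm.\<close>
definition op_norm :: "complex^'n^'m \<Rightarrow> real" where
  "op_norm M = onorm (\<lambda>v. M *v v)"

definition block :: "'a^'n^'n \<Rightarrow> 'a^'n^'n \<Rightarrow> 'a^'n^'n \<Rightarrow> 'a^'n^'n \<Rightarrow> 'a^('n + 'n)^('n + 'n)" where
  "block P Q R S = (\<chi> i j. case i of
      Inl a \<Rightarrow> (case j of Inl b \<Rightarrow> P $ a $ b | Inr b \<Rightarrow> Q $ a $ b)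
    | Inr a \<Rightarrow> (case j of Inl b \<Rightarrow> R $ a $ b | Inr b \<Rightarrow> S $ a $ b))"


section \<open>Functions on the real line\<close>

text \<open>Absolute continuity on every compact interval. A finite family \<open>D\<close> with
  \<open>D division_of \<Union>D\<close> is a finite set of nonempty compact intervals with pairwise
  disjoint interiors.\<close>
definition loc_abs_cont :: "(real \<Rightarrow> 'a::real_normed_vector) \<Rightarrow> bool" where
  "loc_abs_cont f \<longleftrightarrow> (\<forall>a b. \<forall>\<epsilon>>0. \<exists>\<eta>>0. \<forall>D.
     D division_of \<Union>D \<and> \<Union>D \<subseteq> {a..b} \<and> (\<Sum>k\<in>D. Sup k - Inf k) < \<eta>
       \<longrightarrow> (\<Sum>k\<in>D. norm (f (Sup k) - f (Inf k))) < \<epsilon>)"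

definition loc_integrable :: "(real \<Rightarrow> 'a::euclidean_space) \<Rightarrow> bool" where
  "loc_integrable f \<longleftrightarrow> (\<forall>a b. f absolutely_integrable_on {a..b})"

definition compactly_supported :: "(real \<Rightarrow> 'a::{topological_space,zero}) \<Rightarrow> bool" where
  "compactly_supported f \<longleftrightarrow> compact (closure {x. f x \<noteq> 0})"


section \<open>The space of square-integrable functions with a matrix weight\<close>

definition form :: "(real \<Rightarrow> complex^'m^'m) \<Rightarrow> (real \<Rightarrow> complex^'m) \<Rightarrow> (real \<Rightarrow> complex^'m) \<Rightarrow> complex" where
  "form H f g = (LINT x|lebesgue. cdot (f x) (H x *v g x))"

definition L2_fun :: "(real \<Rightarrow> complex^'m^'m) \<Rightarrow> (real \<Rightarrow> complex^'m) set" where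
  "L2_fun H = {f \<in> borel_measurable borel. integrable lebesgue (\<lambda>x. cdot (f x) (H x *v f x))}"

definition L2_rel :: "(real \<Rightarrow> complex^'m^'m) \<Rightarrow> ((real \<Rightarrow> complex^'m) \<times> (real \<Rightarrow> complex^'m)) set" where
  "L2_rel H = {(f, g). f \<in> L2_fun H \<and> g \<in> L2_fun H \<and>
     form H (\<lambda>x. f x - g x) (\<lambda>x. f x - g x) = 0}"

definition L2_class :: "(real \<Rightarrow> complex^'m^'m) \<Rightarrow> (real \<Rightarrow> complex^'m) \<Rightarrow> (real \<Rightarrow> complex^'m) set" where
  "L2_class H f = L2_rel H `` {f}"

definition L2_space :: "(real \<Rightarrow> complex^'m^'m) \<Rightarrow> (real \<Rightarrow> complex^'m) set set" where
  "L2_space H = L2_fun H // L2_rel H"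

text \<open>Inner product and distance of classes, by way of representatives. For a weight that is
  positive semidefinite almost everywhere the values do not depend on the choice.\<close>
definition L2_inner :: "(real \<Rightarrow> complex^'m^'m) \<Rightarrow>
    (real \<Rightarrow> complex^'m) set \<Rightarrow> (real \<Rightarrow> complex^'m) set \<Rightarrow> complex" where
  "L2_inner H u v = form H (SOME f. f \<in> u) (SOME g. g \<in> v)"

definition L2_dist :: "(real \<Rightarrow> complex^'m^'m) \<Rightarrow>
    (real \<Rightarrow> complex^'m) set \<Rightarrow> (real \<Rightarrow> complex^'m) set \<Rightarrow> real" where
  "L2_dist H u v = (let f = (SOME f. f \<in> u); g = (SOME g. g \<in> v)
     in sqrt (Re (form H (\<lambda>x. f x - g x) (\<lambda>x. f x - g x))))"

definition L2_topology :: "(real \<Rightarrow> complex^'m^'m) \<Rightarrow> (real \<Rightarrow> complex^'m) set topology" where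
  "L2_topology H = Metric_space.mtopology (L2_space H) (L2_dist H)"


section \<open>Linear relations of the symmetric system\<close>

type_synonym 'm relation = "((real \<Rightarrow> complex^'m) set \<times> (real \<Rightarrow> complex^'m) set) set"

definition S_min :: "(real \<Rightarrow> complex^'m^'m) \<Rightarrow> (real \<Rightarrow> complex^'m^'m) \<Rightarrow>
    (real \<Rightarrow> complex^'m^'m) \<Rightarrow> 'm relation" where
  "S_min J B H = {(L2_class H f, L2_class H g) | f g.
     loc_abs_cont f \<and> g \<in> L2_fun H \<and> compactly_supported f \<and> compactly_supported g \<and>
     (AE x in lebesgue. J x *v vector_derivative f (at x) + B x *v f x = H x *v g x)}"

definition rel_adjoint :: "(real \<Rightarrow> complex^'m^'m) \<Rightarrow> 'm relation \<Rightarrow> 'm relation" where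
  "rel_adjoint H S = {(u, v). u \<in> L2_space H \<and> v \<in> L2_space H \<and>
     (\<forall>(\<phi>, \<psi>) \<in> S. L2_inner H u \<psi> = L2_inner H v \<phi>)}"

definition ess_self_adjoint :: "(real \<Rightarrow> complex^'m^'m) \<Rightarrow> 'm relation \<Rightarrow> bool" where
  "ess_self_adjoint H S \<longleftrightarrow>
     prod_topology (L2_topology H) (L2_topology H) closure_of S = rel_adjoint H S"


section \<open>Coefficients of the \<open>2n \<times> 2n\<close> system\<close>

definition J_tilde :: "(real \<Rightarrow> complex^'n^'n) \<Rightarrow> real \<Rightarrow> complex^('n + 'n)^('n + 'n)" where
  "J_tilde J x = block 0 (adj (J x)) (- J x) 0"

definition B_tilde :: "(real \<Rightarrow> complex^'n^'n) \<Rightarrow> (real \<Rightarrow> complex^'n^'n) \<Rightarrow>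
    (real \<Rightarrow> complex^'n^'n) \<Rightarrow> (real \<Rightarrow> complex^'n^'n) \<Rightarrow> real \<Rightarrow> complex^('n + 'n)^('n + 'n)" where
  "B_tilde J V B A x = block (V x) (B x) (adj (B x) - vector_derivative J (at x)) (- A x)"

definition H_tilde :: "(real \<Rightarrow> complex^'n^'n) \<Rightarrow> real \<Rightarrow> complex^('n + 'n)^('n + 'n)" where
  "H_tilde H x = block (H x) 0 0 0"

text \<open>In \<open>ennreal\<close> the conventions \<open>1 / \<infinity> = 0\<close> and \<open>0 * \<infinity> = 0\<close> hold.\<close>
definition c_fun :: "(real \<Rightarrow> complex^'n^'n) \<Rightarrow> (real \<Rightarrow> complex^'n^'n) \<Rightarrow>
    (real \<Rightarrow> complex^'n^'n) \<Rightarrow> real \<Rightarrow> ennreal" where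
  "c_fun J A H x =
     (if det (A x ** H x) \<noteq> 0
      then ennreal (max 1 (op_norm (mat_inv_sqrt (A x) ** J x ** mat_inv_sqrt (H x))))
      else \<infinity>)"

end

theory Submission
  imports Defs
begin

text \<open>
  By duality with compactly supported solutions, every pair in the adjoint of the minimal relation
  is represented by a pair \<open>(f, g)\<close> with \<open>f\<close> absolutely continuous that solves the system almost
  everywhere. Essential self-adjointness is therefore the symmetry of the maximal relation: the
  boundary terms \<open>f\<^sup>* J h\<close> in Green's formula must vanish at both ends.

  Write \<open>u\<close> and \<open>p\<close> for the upper and lower half of \<open>f\<close>. There are a bounded weight
  \<open>\<rho> \<le> q\<^sup>-\<^sup>1\<^sup>/\<^sup>2\<close> and a function \<open>k \<le> 1 / c\<close> with \<open>\<bar>\<rho>'\<bar> c\<close> bounded and \<open>\<integral> \<rho> k = \<infinity>\<close> on both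
  half-lines. Multiplying the identity for \<open>(Re p\<^sup>* J u)'\<close> by \<open>(\<rho> \<phi>)\<^sup>2\<close>, where \<open>\<phi>\<close> is a cut-off that
  decreases linearly in the primitive of \<open>\<rho> k\<close>, and using \<open>\<bar>p\<^sup>* J u\<bar>\<^sup>2 \<le> c\<^sup>2 (p\<^sup>* A p) (u\<^sup>* H u)\<close>
  together with \<open>V \<ge> - q H\<close>, one obtains \<open>\<integral> \<rho>\<^sup>2 p\<^sup>* A p < \<infinity>\<close>. Consequently \<open>\<rho> k\<close> times the boundary
  form of two such solutions is integrable, and since \<open>\<bar>\<phi>'\<bar> \<le> \<rho> k / N\<close> the boundary term in
  Green's formula with the cut-off tends to \<open>0\<close> as \<open>N\<close> tends to infinity.
\<close>

section \<open>Absolutely continuous functions and their densities\<close>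

text \<open>The weight \<open>H_tilde\<close> sees only the upper half \<open>u\<close>, so
  membership in the maximal relation says nothing about the size of \<open>p\<close>, while every
  boundary term pairs \<open>u\<close> with \<open>p\<close>. The energy identity is the source of
  information on \<open>p\<close>, and it dictates the multiplier: \<open>V\<close> is bounded below
  only by \<open>- q H\<close>, so the square of the multiplier has to absorb \<open>q\<close>; its
  derivative meets \<open>p^* J u\<close>, which \<open>A\<close> and \<open>H\<close> control up to
  the factor \<open>c\<close>, so that derivative has to absorb \<open>c\<close>. The boundary form
  is then controlled only after multiplication by \<open>\<rho> k\<close>, and the divergence of the
  integral of \<open>\<rho> k\<close> is what lets cut-offs with slope \<open>\<rho> k / N\<close>
  reach compact support. Degeneracy of the weight also shapes the functional analysis. Elements of
  the space are classes modulo functions that \<open>H_tilde\<close> does not see, homogeneous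
  solutions may be invisible on whole intervals, and a Cauchy sequence need not converge pointwise
  along any subsequence, so that measurable limits are selected by an explicit iteration.\<close>

definition has_density :: "(real \<Rightarrow> 'a::euclidean_space) \<Rightarrow> (real \<Rightarrow> 'a) \<Rightarrow> bool" where
  "has_density f g \<longleftrightarrow> loc_integrable g \<and> (\<forall>a b. a \<le> b \<longrightarrow> f b - f a = integral {a..b} g)"

lemma has_densityD: "has_density f g \<Longrightarrow> a \<le> b \<Longrightarrow> f b - f a = integral {a..b} g"
  by (simp add: has_density_def)

lemma loc_integrable_integrable_on: "loc_integrable g \<Longrightarrow> g integrable_on {a..b}"
  by (simp add: loc_integrable_def absolutely_integrable_on_def)

lemma loc_integrable_norm_integrable_on: "loc_integrable g \<Longrightarrow> (\<lambda>x. norm (g x)) integrable_on {a..b}"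
  by (simp add: loc_integrable_def absolutely_integrable_on_def)

section \<open>Differentiation of indefinite integrals\<close>

lemma right_derivative_ae:
  fixes g :: "real \<Rightarrow> 'a::euclidean_space"
  assumes "loc_integrable g"
  shows "AE x in lebesgue. \<forall>e>0. \<exists>d>0. \<forall>h. 0 < h \<and> h < d \<longrightarrow>
           norm (integral {x..x+h} g /\<^sub>R h - g x) < e"
proof -
  have "\<And>a b. g integrable_on cbox a b"
    using loc_integrable_integrable_on[OF assms] by simp
  then obtain N where N: "negligible N"
      "\<And>x e. \<lbrakk>x \<notin> N; 0 < e\<rbrakk> \<Longrightarrow> \<exists>d>0. \<forall>h. 0 < h \<and> h < d \<longrightarrow>
          norm(integral (cbox x (x + h *\<^sub>R One)) g /\<^sub>R h ^ DIM(real) - g x) < e"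
    using integrable_ccontinuous_explicit by blast
  have "{x. \<not> (\<forall>e>0. \<exists>d>0. \<forall>h. 0 < h \<and> h < d \<longrightarrow>
           norm (integral {x..x+h} g /\<^sub>R h - g x) < e)} \<subseteq> N"
    using N(2) by (auto simp: Basis_real_def) blast
  with N(1) show ?thesis
    unfolding eventually_ae_filter_negligible by blast
qed

lemma AE_lebesgue_reflect:
  assumes "AE x in lebesgue. P (x::real)"
  shows "AE x in lebesgue. P (- x)"
proof -
  obtain N where N: "negligible N" "{x. \<not> P x} \<subseteq> N"
    using assms eventually_ae_filter_negligible by blast
  have "negligible (uminus ` N)"
    by (rule negligible_differentiable_image_negligible)
       (auto simp: N(1) differentiable_on_def intro!: derivative_intros)
  moreover have "{x. \<not> P (- x)} \<subseteq> uminus ` N"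
    using N(2) by (force simp: image_iff)
  ultimately show ?thesis
    using eventually_ae_filter_negligible by blast
qed

lemma loc_integrable_reflect:
  "loc_integrable g \<Longrightarrow> loc_integrable (\<lambda>x. g (- x))"
  unfolding loc_integrable_def
proof (intro allI)
  fix a b :: real
  assume "\<forall>a b. g absolutely_integrable_on {a..b}"
  then show "(\<lambda>x. g (- x)) absolutely_integrable_on {a..b}"
    using absolutely_integrable_reflect_real[where f = g and a = "-b" and b = "-a"] by simp
qed

lemma has_density_reflect:
  assumes "has_density f g"
  shows "has_density (\<lambda>x. f (- x)) (\<lambda>x. - g (- x))"
  unfolding has_density_def
proof (intro conjI allI impI)
  have "loc_integrable (\<lambda>x. g (- x))"
    using assms loc_integrable_reflect has_density_def by blast
  then show "loc_integrable (\<lambda>x. - g (- x))"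
    unfolding loc_integrable_def by (simp add: absolutely_integrable_on_def integrable_neg_iff)
  fix a b :: real assume "a \<le> b"
  have "integral {a..b} (\<lambda>x. g (- x)) = integral {-b..-a} g"
    using Henstock_Kurzweil_Integration.integral_reflect_real[of "-a" "-b" g] by simp
  then show "f (- b) - f (- a) = integral {a..b} (\<lambda>x. - g (- x))"
    using \<open>a \<le> b\<close> has_densityD[OF assms, of "-b" "-a"] by (simp add: algebra_simps)
qed

lemma has_density_loc_integrable: "has_density f g \<Longrightarrow> loc_integrable g"
  by (simp add: has_density_def)

text \<open>Lebesgue's differentiation theorem for boxes \<open>[x, x + h]\<close> yields only the
  right derivative. Applied to the reflected density it yields the left one, and off the union of
  the two null sets both combine to a two-sided derivative.\<close>

theorem has_density_AE_derivative:
  assumes "has_density f g"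
  shows "AE x in lebesgue. (f has_vector_derivative g x) (at x)"
proof -
  have 1: "AE x in lebesgue. \<forall>e>0. \<exists>d>0. \<forall>h. 0 < h \<and> h < d \<longrightarrow>
           norm (integral {x..x+h} g /\<^sub>R h - g x) < e"
    by (rule right_derivative_ae[OF has_density_loc_integrable[OF assms]])
  have "AE x in lebesgue. \<forall>e>0. \<exists>d>0. \<forall>h. 0 < h \<and> h < d \<longrightarrow>
           norm (integral {x..x+h} (\<lambda>x. - g (- x)) /\<^sub>R h - (- g (- x))) < e"
    by (rule right_derivative_ae[OF has_density_loc_integrable[OF has_density_reflect[OF assms]]])
  from AE_lebesgue_reflect[OF this]
  have 2: "AE x in lebesgue. \<forall>e>0. \<exists>d>0. \<forall>h. 0 < h \<and> h < d \<longrightarrow>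
           norm (integral {-x..-x+h} (\<lambda>x. - g (- x)) /\<^sub>R h - (- g x)) < e"
    by simp
  show ?thesis
    using 1 2
  proof eventually_elim
    case (elim x)
    show ?case
      unfolding has_vector_derivative_def has_derivative_at_alt
    proof (intro conjI allI impI bounded_linear_scaleR_left)
      fix e :: real assume "e > 0"
      from elim(1)[rule_format, OF \<open>e > 0\<close>] obtain d1 where d1: "d1 > 0" "\<And>h. 0 < h \<Longrightarrow> h < d1 \<Longrightarrow>
          norm (integral {x..x+h} g /\<^sub>R h - g x) < e" by auto
      from elim(2)[rule_format, OF \<open>e > 0\<close>] obtain d2 where d2: "d2 > 0" "\<And>h. 0 < h \<Longrightarrow> h < d2 \<Longrightarrow>
          norm (integral {-x..-x+h} (\<lambda>x. - g (- x)) /\<^sub>R h - (- g x)) < e" by blast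
      show "\<exists>d>0. \<forall>y. norm (y - x) < d \<longrightarrow> norm (f y - f x - (y - x) *\<^sub>R g x) \<le> e * norm (y - x)"
      proof (intro exI[of _ "min d1 d2"] conjI allI impI)
        fix y assume y: "norm (y - x) < min d1 d2"
        consider "y = x" | "y > x" | "y < x" by linarith
        then show "norm (f y - f x - (y - x) *\<^sub>R g x) \<le> e * norm (y - x)"
        proof cases
          case 2
          let ?h = "y - x"
          have "f y - f x = integral {x..x+?h} g"
            using assms 2 by (simp add: has_density_def)
          moreover have "norm (integral {x..x+?h} g /\<^sub>R ?h - g x) < e"
            using d1(2)[of ?h] 2 y by auto
          moreover have "integral {x..x+?h} g - ?h *\<^sub>R g x = ?h *\<^sub>R (integral {x..x+?h} g /\<^sub>R ?h - g x)"
            using 2 by (simp add: scaleR_diff_right)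
          ultimately show ?thesis using 2
            by (metis abs_of_pos diff_gt_0_iff_gt less_imp_le mult.commute mult_left_mono norm_scaleR real_norm_def norm_ge_zero)
        next
          case 3
          let ?h = "x - y"
          define I where "I = integral {-x..-x+?h} (\<lambda>x. - g (- x))"
          have "f (- (- x + ?h)) - f (- (- x)) = I"
            unfolding I_def by (rule has_densityD[OF has_density_reflect[OF assms]]) (use 3 in simp)
          then have fI: "f y - f x = I" by (simp only: minus_minus minus_add_distrib) simp
          moreover have "norm (I /\<^sub>R ?h - - g x) < e"
            unfolding I_def by (rule d2(2)) (use 3 y in auto)
          moreover have "I - (y - x) *\<^sub>R g x = ?h *\<^sub>R (I /\<^sub>R ?h - - g x)"
            using 3 by (simp add: scaleR_add_right scaleR_diff_left)
          moreover have "norm (?h *\<^sub>R (I /\<^sub>R ?h - - g x)) \<le> e * ?h"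
            using \<open>norm (I /\<^sub>R ?h - - g x) < e\<close> 3 by (simp add: mult.commute)
          ultimately show ?thesis using 3 unfolding fI by simp
        qed auto
      qed (use d1 d2 in auto)
    qed
  qed
qed

section \<open>Absolute continuity of indefinite integrals\<close>

lemma division_real:
  fixes S :: "real set"
  assumes "D division_of S" "k \<in> D"
  shows "k = {Inf k..Sup k}" "Inf k \<le> Sup k"
proof -
  obtain a b where "k = cbox a b" "k \<noteq> {}"
    using division_ofD(3,4)[OF assms(1,2)] by blast
  then show "k = {Inf k..Sup k}" "Inf k \<le> Sup k" by auto
qed

lemma division_sum_content:
  fixes S :: "real set"
  assumes "D division_of S"
  shows "(\<Sum>k\<in>D. Sup k - Inf k) = measure lebesgue S"
proof -
  have "(\<Sum>k\<in>D. Sup k - Inf k) = (\<Sum>k\<in>D. measure lebesgue k)"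
  proof (rule sum.cong[OF refl])
    fix k assume "k \<in> D"
    then show "Sup k - Inf k = measure lebesgue k"
      using division_real[OF assms, of k] by (metis content_real measure_completion sets_completionI_sets atLeastAtMost_borel sets_lborel)
  qed
  then show ?thesis using content_division[OF assms] by simp
qed

text \<open>Truncation at a height \<open>n\<close>: the excess of \<open>g\<close> above
  \<open>n\<close> has integral below \<open>e/2\<close> once \<open>n\<close> is large, and what
  lies below \<open>n\<close> contributes at most \<open>n\<close> times the total length of the
  intervals.\<close>

lemma integrable_abs_continuity:
  fixes g :: "real \<Rightarrow> real"
  assumes g: "g integrable_on {a..b}" and nn: "\<And>x. 0 \<le> g x" and e: "e > 0"
  obtains \<eta> where "\<eta> > 0" "\<And>D. D division_of \<Union>D \<Longrightarrow> \<Union>D \<subseteq> {a..b} \<Longrightarrow> (\<Sum>k\<in>D. Sup k - Inf k) < \<eta>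
      \<Longrightarrow> (\<Sum>k\<in>D. integral k g) < e"
proof -
  let ?t = "\<lambda>n x. max (g x - real n) 0"
  have gabs: "g absolutely_integrable_on {a..b}"
    using g nn by (intro nonnegative_absolutely_integrable_1) auto
  have ti: "?t n integrable_on {a..b}" for n
  proof -
    have "(\<lambda>x. g x - real n) absolutely_integrable_on {a..b}"
      using gabs by (auto intro!: set_integral_diff absolutely_integrable_on_const)
    then show ?thesis
      by (intro set_lebesgue_integral_eq_integral(1) absolutely_integrable_max_1) auto
  qed
  have "(\<lambda>n. integral {a..b} (?t n)) \<longlonglongrightarrow> integral {a..b} (\<lambda>x. 0)"
  proof (rule dominated_convergence(2)[OF ti g])
    show "norm (?t n x) \<le> g x" for n x using nn[of x] by auto
    fix x
    obtain m where "g x \<le> real m" using real_arch_simple by blast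
    then have "eventually (\<lambda>n. ?t n x = 0) sequentially"
      unfolding eventually_sequentially by (intro exI[of _ m]) auto
    then show "(\<lambda>n. ?t n x) \<longlonglongrightarrow> 0" by (simp add: tendsto_eventually)
  qed
  then have "eventually (\<lambda>n. integral {a..b} (?t n) < e/2) sequentially"
    using e by (intro order_tendstoD(2)) auto
  then obtain n where n: "integral {a..b} (?t n) < e/2" by (auto simp: eventually_sequentially)
  \<comment> \<open>The \<open>+ 1\<close> keeps the quotient meaningful when the truncation height
    is \<open>0\<close>.\<close>
  show thesis
  proof (rule that[of "e/2/(real n + 1)"])
    fix D assume D: "D division_of \<Union>D" "\<Union>D \<subseteq> {a..b}" "(\<Sum>k\<in>D. Sup k - Inf k) < e/2/(real n+1)"
    have sub: "k \<subseteq> {a..b}" if "k \<in> D" for k using that D(2) by auto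
    have ti': "?t n integrable_on k" if "k \<in> D" for k
      using division_real[OF D(1) that] sub[OF that] ti[of n] by (metis integrable_on_subinterval)
    have "integral k g \<le> real n * (Sup k - Inf k) + integral k (?t n)" if "k \<in> D" for k
    proof -
      have k: "k = {Inf k..Sup k}" "Inf k \<le> Sup k" using division_real[OF D(1) that] by auto
      have gi: "g integrable_on k" using k sub[OF that] g by (metis integrable_on_subinterval)
      have c: "(\<lambda>x. real n) integrable_on k" using k by (metis integrable_const_ivl)
      have "integral k g \<le> integral k (\<lambda>x. real n + ?t n x)"
        by (rule integral_le[OF gi integrable_add[OF c ti'[OF that]]]) auto
      also have "\<dots> = integral k (\<lambda>x. real n) + integral k (?t n)"
        by (rule integral_add[OF c ti'[OF that]])
      also have "integral k (\<lambda>x. real n) = real n * (Sup k - Inf k)"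
        using k by (metis integral_const_real content_real mult.commute real_scaleR_def)
      finally show ?thesis .
    qed
    then have "(\<Sum>k\<in>D. integral k g) \<le> (\<Sum>k\<in>D. real n * (Sup k - Inf k) + integral k (?t n))"
      by (rule sum_mono)
    also have "\<dots> = real n * (\<Sum>k\<in>D. Sup k - Inf k) + (\<Sum>k\<in>D. integral k (?t n))"
      by (simp add: sum.distrib sum_distrib_left)
    also have "(\<Sum>k\<in>D. integral k (?t n)) = integral (\<Union>D) (?t n)"
      using integral_combine_division_bottomup[OF D(1) ti'] by simp
    also have "\<dots> \<le> integral {a..b} (?t n)"
      by (rule integral_subset_le[OF D(2) integrable_on_subdivision[OF D(1) ti D(2)] ti]) auto
    also have "real n * (\<Sum>k\<in>D. Sup k - Inf k) \<le> real n * (e/2/(real n + 1))"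
      using D(3) by (intro mult_left_mono) auto
    also have "real n * (e/2/(real n + 1)) \<le> e/2" using e by (simp add: field_simps)
    finally show "(\<Sum>k\<in>D. integral k g) < e" using n by linarith
  qed (use e in auto)
qed

lemma has_density_imp_loc_abs_cont:
  assumes "has_density f g"
  shows "loc_abs_cont f"
  unfolding loc_abs_cont_def
proof (intro allI impI)
  fix a b \<epsilon> :: real assume "\<epsilon> > 0"
  have "(\<lambda>x. norm (g x)) integrable_on {a..b}"
    using assms has_density_loc_integrable loc_integrable_norm_integrable_on by blast
  then obtain \<eta> where \<eta>: "\<eta> > 0" "\<And>D. D division_of \<Union>D \<Longrightarrow> \<Union>D \<subseteq> {a..b} \<Longrightarrow> (\<Sum>k\<in>D. Sup k - Inf k) < \<eta>
      \<Longrightarrow> (\<Sum>k\<in>D. integral k (\<lambda>x. norm (g x))) < \<epsilon>"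
    by (rule integrable_abs_continuity[OF _ norm_ge_zero \<open>\<epsilon> > 0\<close>]) blast
  show "\<exists>\<eta>>0. \<forall>D. D division_of \<Union> D \<and> \<Union> D \<subseteq> {a..b} \<and> (\<Sum>k\<in>D. Sup k - Inf k) < \<eta> \<longrightarrow>
             (\<Sum>k\<in>D. norm (f (Sup k) - f (Inf k))) < \<epsilon>"
  proof (intro exI[of _ \<eta>] conjI allI impI \<eta>(1); elim conjE)
    fix D assume D: "D division_of \<Union>D" "\<Union>D \<subseteq> {a..b}" "(\<Sum>k\<in>D. Sup k - Inf k) < \<eta>"
    have "norm (f (Sup k) - f (Inf k)) \<le> integral k (\<lambda>x. norm (g x))" if "k \<in> D" for k
    proof -
      have k: "k = {Inf k..Sup k}" "Inf k \<le> Sup k" using division_real[OF D(1) that] by auto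
      have "f (Sup k) - f (Inf k) = integral k g"
        using assms k by (simp add: has_density_def)
      also have "norm \<dots> \<le> integral k (\<lambda>x. norm (g x))"
        by (subst (1 2) k(1), rule integral_norm_bound_integral)
           (use assms has_density_loc_integrable loc_integrable_norm_integrable_on loc_integrable_integrable_on in blast)+
      finally show ?thesis .
    qed
    then have "(\<Sum>k\<in>D. norm (f (Sup k) - f (Inf k))) \<le> (\<Sum>k\<in>D. integral k (\<lambda>x. norm (g x)))"
      by (rule sum_mono)
    also have "\<dots> < \<epsilon>" by (rule \<eta>(2)[OF D])
    finally show "(\<Sum>k\<in>D. norm (f (Sup k) - f (Inf k))) < \<epsilon>" .
  qed
qed

section \<open>Total variation\<close>

lemma ennreal_SUP_add_SUP_le:
  fixes f g :: "_ \<Rightarrow> ennreal"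
  assumes "\<And>i j. i \<in> I \<Longrightarrow> j \<in> J \<Longrightarrow> f i + g j \<le> c" "I \<noteq> {}" "J \<noteq> {}"
  shows "(SUP i\<in>I. f i) + (SUP j\<in>J. g j) \<le> c"
proof -
  have le: "f i \<le> c" if "i \<in> I" for i
  proof -
    obtain j where "j \<in> J" using assms(3) by blast
    have "f i \<le> f i + g j" by (simp add: add_increasing2)
    also have "\<dots> \<le> c" by (rule assms(1)[OF that \<open>j \<in> J\<close>])
    finally show ?thesis .
  qed
  have le2: "g j \<le> c" if "j \<in> J" for j
  proof -
    obtain i where "i \<in> I" using assms(2) by blast
    have "g j \<le> f i + g j" by (simp add: add_increasing)
    also have "\<dots> \<le> c" by (rule assms(1)[OF \<open>i \<in> I\<close> that])
    finally show ?thesis .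
  qed
  have Fc: "(SUP i\<in>I. f i) \<le> c" by (rule SUP_least[OF le])
  \<comment> \<open>Subtraction in \<open>ennreal\<close> is truncated at \<open>0\<close>, so
    moving a term back across \<open>\<le>\<close> requires the subtracted quantity to be at most
    \<open>c\<close>; \<open>le2\<close> and \<open>Fc\<close> supply this.\<close>
  have "g j \<le> c - (SUP i\<in>I. f i)" if j: "j \<in> J" for j
  proof -
    have "(SUP i\<in>I. f i) \<le> c - g j"
      by (rule SUP_least) (use assms(1) j in \<open>simp add: ennreal_le_minus_iff\<close>)
    then have "(SUP i\<in>I. f i) + g j \<le> c"
      using le2[OF j] by (auto simp: ennreal_le_minus_iff)
    then show ?thesis by (simp add: ennreal_le_minus_iff add.commute)
  qed
  then have "(SUP j\<in>J. g j) \<le> c - (SUP i\<in>I. f i)" by (rule SUP_least)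
  then show ?thesis using Fc by (auto simp: ennreal_le_minus_iff add.commute)
qed

definition variation :: "(real \<Rightarrow> real) \<Rightarrow> real set \<Rightarrow> ennreal" where
  "variation f S = (SUP D\<in>{D. D division_of \<Union>D \<and> \<Union>D \<subseteq> S}.
     \<Sum>k\<in>D. ennreal \<bar>f (Sup k) - f (Inf k)\<bar>)"

lemma variation_upper:
  "D division_of \<Union>D \<Longrightarrow> \<Union>D \<subseteq> S \<Longrightarrow> (\<Sum>k\<in>D. ennreal \<bar>f (Sup k) - f (Inf k)\<bar>) \<le> variation f S"
  unfolding variation_def by (rule SUP_upper) auto

lemma variation_least:
  "(\<And>D. D division_of \<Union>D \<Longrightarrow> \<Union>D \<subseteq> S \<Longrightarrow> (\<Sum>k\<in>D. ennreal \<bar>f (Sup k) - f (Inf k)\<bar>) \<le> c)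
   \<Longrightarrow> variation f S \<le> c"
  unfolding variation_def by (rule SUP_least) auto

lemma variation_mono: "S \<subseteq> T \<Longrightarrow> variation f S \<le> variation f T"
  by (rule variation_least, rule variation_upper) auto

lemma variation_empty [simp]: "variation f {} = 0"
proof -
  have "variation f {} \<le> 0"
  proof (rule variation_least)
    fix D assume "D division_of \<Union>D" "\<Union>D \<subseteq> ({}::real set)"
    then have "D = {}" by (auto dest: division_ofD(3))
    then show "(\<Sum>k\<in>D. ennreal \<bar>f (Sup k) - f (Inf k)\<bar>) \<le> 0" by simp
  qed
  then show ?thesis by simp
qed

lemma variation_ge: "a \<le> b \<Longrightarrow> ennreal \<bar>f b - f a\<bar> \<le> variation f {a..b}"
  using variation_upper[of "{{a..b}}" "{a..b}" f] division_of_self[of a b] by simp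

lemma interior_empty_Inf_eq_Sup:
  fixes k :: "real set"
  assumes "k = {a..b}" "k \<noteq> {}" "interior k = {}"
  shows "Sup k = Inf k"
  using assms by (auto simp: interior_atLeastAtMost_real)

text \<open>Divisions of parts of \<open>S\<close> and \<open>T\<close> join to a division of a part
  of \<open>S \<union> T\<close>. A set belonging to both has empty interior, hence is a single
  point and contributes \<open>0\<close>, so nothing is lost when the union counts it once.\<close>

lemma variation_superadd:
  assumes "interior S \<inter> interior T = {}"
  shows "variation f S + variation f T \<le> variation f (S \<union> T)"
  unfolding variation_def[of f S] variation_def[of f T]
proof (rule ennreal_SUP_add_SUP_le)
  let ?w = "\<lambda>k. ennreal \<bar>f (Sup k) - f (Inf k)\<bar>"
  fix D E assume "D \<in> {D. D division_of \<Union> D \<and> \<Union> D \<subseteq> S}" "E \<in> {D. D division_of \<Union> D \<and> \<Union> D \<subseteq> T}"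
  then have D: "D division_of \<Union>D" "\<Union>D \<subseteq> S" and E: "E division_of \<Union>E" "\<Union>E \<subseteq> T" by auto
  have disj: "interior k \<inter> interior l = {}" if "k \<in> D" "l \<in> E" for k l
  proof -
    have "k \<subseteq> S" "l \<subseteq> T" using that D E by auto
    then show ?thesis using assms interior_mono by blast
  qed
  have U: "D \<union> E division_of \<Union>(D \<union> E)"
    unfolding Union_Un_distrib
  proof (rule division_disjoint_union[OF D(1) E(1)])
    have "interior (\<Union>D) \<subseteq> interior S" "interior (\<Union>E) \<subseteq> interior T"
      by (rule interior_mono[OF D(2)], rule interior_mono[OF E(2)])
    then show "interior (\<Union>D) \<inter> interior (\<Union>E) = {}" using assms by auto
  qed
  have "?w k = 0" if "k \<in> D \<inter> E" for k
  proof -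
    have "interior k = {}" using disj[of k k] that by auto
    moreover have "k = {Inf k..Sup k}" "k \<noteq> {}"
      using division_real[OF D(1)] division_ofD(3)[OF D(1)] that by blast+
    ultimately have "Sup k = Inf k" by (intro interior_empty_Inf_eq_Sup)
    then show ?thesis by simp
  qed
  then have "sum ?w (D \<inter> E) = 0" by simp
  then have "sum ?w D + sum ?w E = sum ?w (D \<union> E)"
    using sum.union_inter[of D E ?w] D E by (simp add: division_of_finite)
  also have "\<dots> \<le> variation f (S \<union> T)"
    by (rule variation_upper[OF U]) (use D E in auto)
  finally show "sum ?w D + sum ?w E \<le> variation f (S \<union> T)" .
next
  have "{} \<in> {D. D division_of \<Union> D \<and> \<Union> D \<subseteq> X}" for X :: "real set" by simp
  then show "{D. D division_of \<Union> D \<and> \<Union> D \<subseteq> S} \<noteq> {}" "{D. D division_of \<Union> D \<and> \<Union> D \<subseteq> T} \<noteq> {}" by blast+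
qed

lemma variation_sum_division:
  assumes D: "D division_of \<Union>D"
  shows "(\<Sum>k\<in>D. variation f k) \<le> variation f (\<Union>D)"
proof -
  have "(\<Sum>k\<in>F. variation f k) \<le> variation f (\<Union>F)" if "finite F" "F \<subseteq> D" for F
    using that
  proof (induction F rule: finite_induct)
    case (insert k F)
    have cb: "\<exists>a b. T = cbox a b" if "T \<in> F" for T
      using that insert.prems division_ofD(4)[OF D] by blast
    have "interior k \<inter> interior (\<Union>F) = {}"
    proof (rule Int_interior_Union_intervals)
      fix T assume "T \<in> F"
      then show "interior k \<inter> interior T = {}"
        using insert division_ofD(5)[OF D] by blast
    qed (use insert cb in auto)
    from variation_superadd[OF this]
    have "variation f k + variation f (\<Union>F) \<le> variation f (\<Union>(insert k F))" by simp
    moreover have "(\<Sum>k\<in>F. variation f k) \<le> variation f (\<Union>F)" using insert by auto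
    ultimately show ?case using insert
      by simp (meson add_left_mono order_trans)
  qed simp
  from this[of D] show ?thesis using D division_of_finite by blast
qed

text \<open>Cutting with \<open>{p..q}\<close> may send different members of \<open>D\<close> to the
  same set. Such a set has empty interior and is a point, so the reindexed sum does not
  change.\<close>

lemma variation_cap:
  fixes D :: "real set set"
  assumes D: "D division_of \<Union>D" "\<Union>D \<subseteq> S"
  shows "(\<Sum>k\<in>{k\<in>D. k \<inter> {p..q} \<noteq> {}}. ennreal \<bar>f (Sup (k \<inter> {p..q})) - f (Inf (k \<inter> {p..q}))\<bar>)
     \<le> variation f (S \<inter> {p..q})"
proof -
  let ?D = "{k\<in>D. k \<inter> {p..q} \<noteq> {}}" and ?c = "\<lambda>k. k \<inter> {p..q}"
  let ?w = "\<lambda>k. ennreal \<bar>f (Sup k) - f (Inf k)\<bar>"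
  have fin: "finite D" using D division_of_finite by blast
  have ci: "\<exists>a b. k \<inter> {p..q} = cbox a b" if k: "k \<in> D" for k
  proof -
    obtain a b where "k = cbox a b" using division_ofD(4)[OF D(1) k] by blast
    then have "k \<inter> {p..q} = cbox (max a p) (min b q)" by auto
    then show ?thesis by blast
  qed
  have ii: "interior (?c k) \<inter> interior (?c l) = {}" if "k \<in> D" "l \<in> D" "k \<noteq> l" for k l
    using division_ofD(5)[OF D(1) that] by (simp only: interior_Int) blast
  have div: "?c ` ?D division_of \<Union>(?c ` ?D)"
  proof (rule division_ofI)
    show "finite (?c ` ?D)" using fin by auto
    show "\<And>K. K \<in> ?c ` ?D \<Longrightarrow> \<exists>a b. K = cbox a b" using ci by auto
    fix K L assume "K \<in> ?c ` ?D" "L \<in> ?c ` ?D" "K \<noteq> L"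
    then show "interior K \<inter> interior L = {}" using ii by blast
  qed auto
  have "sum ?w (?c ` ?D) = sum (?w \<circ> ?c) ?D"
  proof (rule sum.reindex_nontrivial)
    fix k l assume kl: "k \<in> ?D" "l \<in> ?D" "k \<noteq> l" "?c k = ?c l"
    then have int: "interior (?c k) = {}" using ii[of k l] by auto
    obtain a b where ab: "?c k = {a..b}" using ci[of k] kl(1) by auto
    have "Sup (?c k) = Inf (?c k)"
      by (rule interior_empty_Inf_eq_Sup[OF ab _ int]) (use kl(1) in blast)
    then show "?w (?c k) = 0" by simp
  qed (use fin in auto)
  moreover have "sum ?w (?c ` ?D) \<le> variation f (S \<inter> {p..q})"
    by (rule variation_upper[OF div]) (use D in auto)
  ultimately show ?thesis by (simp add: o_def)
qed

text \<open>A member of the division either lies on one side of \<open>x\<close>, or is cut at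
  \<open>x\<close> and the triangle inequality applies; the pieces form divisions of subsets of the
  two halves.\<close>

lemma variation_split:
  assumes "a \<le> x" "x \<le> b"
  shows "variation f {a..b} \<le> variation f {a..x} + variation f {x..b}"
proof (rule variation_least)
  fix D assume D: "D division_of \<Union>D" "\<Union>D \<subseteq> {a..b}"
  let ?w = "\<lambda>k. ennreal \<bar>f (Sup k) - f (Inf k)\<bar>"
  let ?v = "\<lambda>I k. if k \<inter> I \<noteq> {} then ?w (k \<inter> I) else 0"
  have fin: "finite D" using D division_of_finite by blast
  have "?w k \<le> ?v {a..x} k + ?v {x..b} k" if "k \<in> D" for k
  proof -
    define u v where "u = Inf k" and "v = Sup k"
    have k: "k = {u..v}" "u \<le> v" using division_real[OF D(1) that] by (auto simp: u_def v_def)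
    have "k \<subseteq> {a..b}" using D(2) that by blast
    then have ab: "a \<le> u" "v \<le> b" using k by auto
    consider "v \<le> x" | "x \<le> u" | "u < x" "x < v" by linarith
    then show ?thesis
    proof cases
      case 1
      then have "k \<inter> {a..x} = k" using k ab by auto
      then show ?thesis using k by (auto simp: add_increasing2)
    next
      case 2
      then have "k \<inter> {x..b} = k" using k ab by auto
      then show ?thesis using k by (auto simp: add_increasing)
    next
      case 3
      then have "k \<inter> {a..x} = {u..x}" "k \<inter> {x..b} = {x..v}" using k ab by auto
      then show ?thesis using k 3 by (simp flip: ennreal_plus)
    qed
  qed
  then have "sum ?w D \<le> (\<Sum>k\<in>D. ?v {a..x} k + ?v {x..b} k)" by (rule sum_mono)
  also have "\<dots> = sum (?v {a..x}) D + sum (?v {x..b}) D" by (simp add: sum.distrib)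
  also have "sum (?v {a..x}) D \<le> variation f ({a..b} \<inter> {a..x})"
    using variation_cap[OF D, where p = a and q = x and f = f] fin by (simp add: sum.If_cases Int_def)
  also have "sum (?v {x..b}) D \<le> variation f ({a..b} \<inter> {x..b})"
    using variation_cap[OF D, where p = x and q = b and f = f] fin by (simp add: sum.If_cases Int_def)
  finally have "sum ?w D \<le> variation f ({a..b} \<inter> {a..x}) + variation f ({a..b} \<inter> {x..b})"
    by (simp add: add_mono)
  moreover have "{a..b} \<inter> {a..x} = {a..x}" "{a..b} \<inter> {x..b} = {x..b}" using assms by auto
  ultimately show "sum ?w D \<le> variation f {a..x} + variation f {x..b}" by (simp only:)
qed

text \<open>Every division of a subset of \<open>\<Union>D\<close> is no longer in total than
  \<open>D\<close>, so the same \<open>\<eta>\<close> bounds its sum. Passing to the supremum turns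
  \<open><\<close> into \<open>\<le>\<close>.\<close>

lemma loc_abs_cont_variation_small:
  assumes "loc_abs_cont f" "\<epsilon> > 0"
  shows "\<exists>\<eta>>0. \<forall>D. D division_of \<Union>D \<and> \<Union>D \<subseteq> {a..b} \<and> (\<Sum>k\<in>D. Sup k - Inf k) < \<eta>
     \<longrightarrow> variation f (\<Union>D) \<le> ennreal \<epsilon>"
proof -
  obtain \<eta> where \<eta>: "\<eta> > 0" "\<And>D. D division_of \<Union>D \<Longrightarrow> \<Union>D \<subseteq> {a..b} \<Longrightarrow> (\<Sum>k\<in>D. Sup k - Inf k) < \<eta>
       \<Longrightarrow> (\<Sum>k\<in>D. norm (f (Sup k) - f (Inf k))) < \<epsilon>"
    using assms unfolding loc_abs_cont_def by meson
  show ?thesis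
  proof (intro exI[of _ \<eta>] conjI \<eta>(1) allI impI; elim conjE)
    fix D assume D: "D division_of \<Union>D" "\<Union>D \<subseteq> {a..b}" "(\<Sum>k\<in>D. Sup k - Inf k) < \<eta>"
    show "variation f (\<Union>D) \<le> ennreal \<epsilon>"
    proof (rule variation_least)
      fix E assume E: "E division_of \<Union>E" "\<Union>E \<subseteq> \<Union>D"
      have "(\<Sum>k\<in>E. Sup k - Inf k) = measure lebesgue (\<Union>E)" by (rule division_sum_content[OF E(1)])
      also have "\<dots> \<le> measure lebesgue (\<Union>D)"
        using E D lmeasurable_division by (intro measure_mono_fmeasurable) (auto intro: fmeasurableD)
      also have "\<dots> < \<eta>" using division_sum_content[OF D(1)] D(3) by simp
      finally have "(\<Sum>k\<in>E. \<bar>f (Sup k) - f (Inf k)\<bar>) < \<epsilon>"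
        using \<eta>(2)[of E] E D(2) by auto
      then show "(\<Sum>k\<in>E. ennreal \<bar>f (Sup k) - f (Inf k)\<bar>) \<le> ennreal \<epsilon>"
        by (simp add: sum_ennreal ennreal_leI)
    qed
  qed
qed

text \<open>With \<open>\<eta>\<close> belonging to the tolerance \<open>1\<close>, steps of length
  \<open>\<eta>/2\<close> add at most \<open>1\<close> each, and finitely many of them exhaust
  \<open>{a..b}\<close>.\<close>

lemma variation_finite:
  assumes "loc_abs_cont f"
  shows "variation f {a..b} < \<infinity>"
proof (cases "a \<le> b")
  case True
  obtain \<eta> where \<eta>: "\<eta> > 0" "\<And>D. D division_of \<Union>D \<Longrightarrow> \<Union>D \<subseteq> {a..b} \<Longrightarrow> (\<Sum>k\<in>D. Sup k - Inf k) < \<eta>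
     \<Longrightarrow> variation f (\<Union>D) \<le> ennreal 1"
    using loc_abs_cont_variation_small[OF assms zero_less_one] by meson
  have small: "variation f {x..y} \<le> 1" if "a \<le> x" "x \<le> y" "y \<le> b" "y - x < \<eta>" for x y
    using \<eta>(2)[of "{{x..y}}"] that division_of_self[of x y] by auto
  \<comment> \<open>\<open>Suc n\<close> rather than \<open>n\<close>: for \<open>n = 0\<close> the
    interval is the point \<open>a\<close>, to which the bound \<open>1\<close> is applied as
    well.\<close>
  have "variation f {a..y} \<le> of_nat (Suc n)" if "a \<le> y" "y \<le> b" "y \<le> a + n * (\<eta>/2)" for n y
    using that
  proof (induction n arbitrary: y)
    case 0
    then show ?case using small[of a y] \<eta> by simp
  next
    case (Suc n)
    let ?y = "max a (y - \<eta>/2)"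
    have "variation f {a..y} \<le> variation f {a..?y} + variation f {?y..y}"
      by (rule variation_split) (use Suc.prems \<eta> in auto)
    also have "\<dots> \<le> of_nat (Suc n) + 1"
    proof (rule add_mono)
      show "variation f {a..?y} \<le> of_nat (Suc n)"
      proof (rule Suc.IH)
        show "?y \<le> a + n * (\<eta>/2)" using Suc.prems \<eta>(1) by (auto simp: max_def field_simps)
      qed (use Suc.prems \<eta> in auto)
      show "variation f {?y..y} \<le> 1" by (rule small) (use Suc.prems \<eta> in \<open>auto simp: max_def\<close>)
    qed
    finally show ?case by (simp add: add.commute)
  qed
  moreover obtain n where "(b - a) / (\<eta>/2) \<le> real n" using real_arch_simple by blast
  ultimately have "variation f {a..b} \<le> of_nat (Suc n)"
    using True \<eta> by (simp add: field_simps)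
  also have "\<dots> < \<infinity>" by (simp add: of_nat_less_top)
  finally show ?thesis .
qed simp

lemma loc_abs_cont_dominated_variation:
  fixes h :: "real \<Rightarrow> real"
  assumes f: "loc_abs_cont f" and h: "\<And>x y. x \<le> y \<Longrightarrow> ennreal \<bar>h y - h x\<bar> \<le> ennreal C * variation f {x..y}"
    and C: "C > 0"
  shows "loc_abs_cont h"
  unfolding loc_abs_cont_def
proof (intro allI impI)
  fix a b \<epsilon> :: real assume "\<epsilon> > 0"
  \<comment> \<open>Half of the tolerance is given away because \<open>variation\<close> is bounded
    only by \<open>\<le>\<close>, while the final sum must be strictly below
    \<open>\<epsilon>\<close>.\<close>
  then have "\<epsilon>/(2*C) > 0" using C by simp
  then obtain \<eta> where \<eta>: "\<eta> > 0" "\<And>D. D division_of \<Union>D \<Longrightarrow> \<Union>D \<subseteq> {a..b} \<Longrightarrow> (\<Sum>k\<in>D. Sup k - Inf k) < \<eta>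
     \<Longrightarrow> variation f (\<Union>D) \<le> ennreal (\<epsilon>/(2*C))"
    using loc_abs_cont_variation_small[OF f] by meson
  show "\<exists>\<eta>>0. \<forall>D. D division_of \<Union> D \<and> \<Union> D \<subseteq> {a..b} \<and> (\<Sum>k\<in>D. Sup k - Inf k) < \<eta> \<longrightarrow>
             (\<Sum>k\<in>D. norm (h (Sup k) - h (Inf k))) < \<epsilon>"
  proof (intro exI[of _ \<eta>] conjI \<eta>(1) allI impI; elim conjE)
    fix D assume D: "D division_of \<Union>D" "\<Union>D \<subseteq> {a..b}" "(\<Sum>k\<in>D. Sup k - Inf k) < \<eta>"
    have "(\<Sum>k\<in>D. ennreal \<bar>h (Sup k) - h (Inf k)\<bar>) \<le> (\<Sum>k\<in>D. ennreal C * variation f k)"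
    proof (rule sum_mono)
      fix k assume "k \<in> D"
      then show "ennreal \<bar>h (Sup k) - h (Inf k)\<bar> \<le> ennreal C * variation f k"
        using h[of "Inf k" "Sup k"] division_real[OF D(1)] by auto
    qed
    also have "\<dots> = ennreal C * (\<Sum>k\<in>D. variation f k)" by (simp add: sum_distrib_left)
    also have "\<dots> \<le> ennreal C * ennreal (\<epsilon>/(2*C))"
      using variation_sum_division[OF D(1)] \<eta>(2)[OF D] by (intro mult_left_mono) (auto intro: order_trans)
    also have "\<dots> = ennreal (\<epsilon>/2)" using C \<open>\<epsilon> > 0\<close> by (simp flip: ennreal_mult add: field_simps)
    finally have "ennreal (\<Sum>k\<in>D. \<bar>h (Sup k) - h (Inf k)\<bar>) \<le> ennreal (\<epsilon>/2)" by (simp add: sum_ennreal)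
    then have "(\<Sum>k\<in>D. \<bar>h (Sup k) - h (Inf k)\<bar>) \<le> \<epsilon>/2" using \<open>\<epsilon> > 0\<close> by (simp add: ennreal_le_iff)
    then show "(\<Sum>k\<in>D. norm (h (Sup k) - h (Inf k))) < \<epsilon>" using \<open>\<epsilon> > 0\<close> by simp
  qed
qed

section \<open>Continuity, and the Stieltjes measure of a monotone function\<close>

lemma loc_abs_cont_small:
  assumes "loc_abs_cont f" "\<epsilon> > 0"
  shows "\<exists>\<eta>>0. \<forall>x y. a \<le> x \<and> x \<le> y \<and> y \<le> b \<and> y - x < \<eta> \<longrightarrow> norm (f y - f x) < \<epsilon>"
proof -
  obtain \<eta> where \<eta>: "\<eta> > 0" "\<And>D. D division_of \<Union>D \<Longrightarrow> \<Union>D \<subseteq> {a..b} \<Longrightarrow> (\<Sum>k\<in>D. Sup k - Inf k) < \<eta>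
       \<Longrightarrow> (\<Sum>k\<in>D. norm (f (Sup k) - f (Inf k))) < \<epsilon>"
    using assms unfolding loc_abs_cont_def by meson
  have "norm (f y - f x) < \<epsilon>" if "a \<le> x" "x \<le> y" "y \<le> b" "y - x < \<eta>" for x y
    using \<eta>(2)[of "{{x..y}}"] that division_of_self[of x y] by auto
  with \<eta>(1) show ?thesis by blast
qed

lemma loc_abs_cont_continuous:
  assumes "loc_abs_cont f"
  shows "continuous_on S f"
proof -
  have "isCont f x" for x
    unfolding continuous_at_eps_delta
  proof (intro allI impI)
    fix e :: real assume "e > 0"
    from loc_abs_cont_small[OF assms this, of "x-1" "x+1"] obtain \<eta> where \<eta>: "\<eta> > 0"
      "\<And>u v. x - 1 \<le> u \<Longrightarrow> u \<le> v \<Longrightarrow> v \<le> x + 1 \<Longrightarrow> v - u < \<eta> \<Longrightarrow> norm (f v - f u) < e" by auto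
    show "\<exists>d>0. \<forall>x'. dist x' x < d \<longrightarrow> dist (f x') (f x) < e"
    proof (intro exI[of _ "min 1 \<eta>"] conjI allI impI)
      fix y assume "dist y x < min 1 \<eta>"
      then show "dist (f y) (f x) < e"
        using \<eta>(2)[of x y] \<eta>(2)[of y x] by (cases "x \<le> y") (auto simp: dist_norm norm_minus_commute)
    qed (use \<eta> in auto)
  qed
  then show ?thesis by (simp add: continuous_at_imp_continuous_on)
qed

text \<open>A null set lies in an open set of measure below \<open>\<eta>\<close>. An open set is a
  countable union of boxes; each finite subunion \<open>S m\<close> has a division of total length
  below \<open>\<eta>\<close>, hence Stieltjes measure at most \<open>\<epsilon>\<close>, and
  continuity from below carries the bound over to the open set.\<close>

lemma interval_measure_absolutely_continuous:
  fixes h :: "real \<Rightarrow> real"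
  assumes mono: "\<And>x y. x \<le> y \<Longrightarrow> h x \<le> h y" and ac: "loc_abs_cont h"
  shows "absolutely_continuous lborel (interval_measure h)"
  unfolding absolutely_continuous_def
proof
  let ?\<mu> = "interval_measure h"
  have Icc: "emeasure ?\<mu> {a..b} = ennreal (h b - h a)" if "a \<le> b" for a b
    by (rule emeasure_interval_measure_Icc[OF that mono loc_abs_cont_continuous[OF ac]])
  fix N :: "real set" assume N: "N \<in> null_sets lborel"
  \<comment> \<open>Absolute continuity is uniform only on compact intervals, so the null set is
    first cut to bounded pieces; the covering open set is then kept within one unit of
    \<open>{- real n..real n}\<close>.\<close>
  have N0: "N \<inter> {- real n..real n} \<in> null_sets ?\<mu>" for n
  proof (rule null_setsI)
    let ?N = "N \<inter> {- real n..real n}"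
    have Nb: "?N \<in> sets borel" using N by auto
    then show "?N \<in> sets ?\<mu>" by simp
    have "emeasure ?\<mu> ?N \<le> 0"
    proof (rule ennreal_le_epsilon)
      fix \<epsilon> :: real assume \<epsilon>: "0 < \<epsilon>"
      obtain \<eta> where \<eta>: "\<eta> > 0" "\<And>D. D division_of \<Union>D \<Longrightarrow> \<Union>D \<subseteq> {-real n-1..real n+1} \<Longrightarrow> (\<Sum>k\<in>D. Sup k - Inf k) < \<eta>
           \<Longrightarrow> (\<Sum>k\<in>D. norm (h (Sup k) - h (Inf k))) < \<epsilon>"
        using ac \<epsilon> unfolding loc_abs_cont_def by meson
      obtain U where U: "open U" "?N \<subseteq> U" "emeasure lborel (U - ?N) < ennreal \<eta>"
        using outer_regular_lborel[OF Nb \<eta>(1)] by blast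
      define W where "W = U \<inter> {-real n-1<..<real n+1}"
      have W: "open W" "?N \<subseteq> W" using U by (auto simp: W_def)
      have "emeasure lborel ?N = 0"
        using N Nb by (metis Int_lower1 emeasure_mono le_zero_eq null_setsD1 null_setsD2)
      then have "?N \<in> null_sets lborel" using Nb by (intro null_setsI) auto
      then have "emeasure lborel ((U - ?N) \<union> ?N) = emeasure lborel (U - ?N)"
        using U(1) Nb by (intro emeasure_Un_null_set) auto
      moreover have "emeasure lborel W \<le> emeasure lborel ((U - ?N) \<union> ?N)"
        using U(1) Nb by (intro emeasure_mono) (auto simp: W_def)
      ultimately have lW: "emeasure lborel W < ennreal \<eta>" using U(3) by (metis le_less_trans)
      obtain \<D> where \<D>: "countable \<D>" "\<D> \<subseteq> Pow W" "\<And>X. X \<in> \<D> \<Longrightarrow> \<exists>a b. X = cbox a b" "\<Union>\<D> = W"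
        using open_countable_Union_open_cbox[OF W(1)] by metis
      have "emeasure ?\<mu> W \<le> ennreal \<epsilon>"
      proof (cases "\<D> = {}")
        case True
        then show ?thesis using \<D> by auto
      next
        case False
        define K where "K = from_nat_into \<D>"
        have rK: "range K = \<D>" using \<D>(1) False by (simp add: K_def)
        define S where "S m = (\<Union>i\<le>m. K i)" for m
        have Sb: "S m \<in> sets borel" for m
        proof -
          have "K i \<in> sets borel" for i
          proof -
            obtain a b where "K i = cbox a b" using \<D>(3)[of "K i"] rK by blast
            then show ?thesis by simp
          qed
          then show ?thesis unfolding S_def by (intro sets.finite_UN) auto
        qed
        have SW: "S m \<subseteq> W" for m unfolding S_def using rK \<D>(2) by blast
        have US: "(\<Union>m. S m) = W" unfolding S_def using \<D>(4) rK by blast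
        have "emeasure ?\<mu> (S m) \<le> ennreal \<epsilon>" for m
        proof -
          obtain p where "p division_of (\<Union>(K ` {..m}))"
            by (rule elementary_unions_intervals[of "K ` {..m}"]) (use rK \<D>(3) in auto)
          then have p: "p division_of S m" by (simp add: S_def)
          have Up: "\<Union>p = S m" using division_ofD(6)[OF p] .
          have p': "p division_of \<Union>p" using p Up by simp
          have k: "k = {Inf k..Sup k}" "Inf k \<le> Sup k" if "k \<in> p" for k
            using division_real[OF p that] by auto
          have "ennreal (measure lebesgue (S m)) = emeasure lebesgue (S m)"
            using lmeasurable_division[OF p] by (simp add: emeasure_eq_measure2)
          also have "\<dots> = emeasure lborel (S m)" using Sb by simp
          also have "\<dots> \<le> emeasure lborel W" using SW W by (intro emeasure_mono) auto
          finally have "measure lebesgue (S m) < \<eta>" using lW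
            by (metis ennreal_less_iff measure_nonneg order_le_less_trans)
          then have "(\<Sum>k\<in>p. norm (h (Sup k) - h (Inf k))) < \<epsilon>"
            using division_sum_content[OF p] SW[of m] Up by (intro \<eta>(2)[OF p']) (auto simp: W_def)
          moreover have "emeasure ?\<mu> (S m) \<le> (\<Sum>k\<in>p. emeasure ?\<mu> k)"
            unfolding Up[symmetric]
          proof -
            have "k \<in> sets borel" if "k \<in> p" for k using k(1)[OF that] by (metis atLeastAtMost_borel)
            then show "emeasure ?\<mu> (\<Union>p) \<le> (\<Sum>k\<in>p. emeasure ?\<mu> k)"
              using emeasure_subadditive_finite[of p "\<lambda>x. x" ?\<mu>] division_of_finite[OF p] by auto
          qed
          moreover have "(\<Sum>k\<in>p. emeasure ?\<mu> k) = (\<Sum>k\<in>p. ennreal (norm (h (Sup k) - h (Inf k))))"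
          proof (rule sum.cong[OF refl])
            fix l assume "l \<in> p"
            from k[OF this] Icc[of "Inf l" "Sup l"] mono[of "Inf l" "Sup l"]
            show "emeasure ?\<mu> l = ennreal (norm (h (Sup l) - h (Inf l)))" by auto
          qed
          ultimately show ?thesis by (simp add: sum_ennreal) (meson ennreal_leI less_imp_le order_trans)
        qed
        moreover have "(SUP m. emeasure ?\<mu> (S m)) = emeasure ?\<mu> (\<Union>m. S m)"
        proof (rule SUP_emeasure_incseq)
          show "incseq S" by (rule incseq_SucI) (auto simp: S_def atMost_Suc)
        qed (use Sb in auto)
        ultimately show ?thesis using US by (metis SUP_least)
      qed
      moreover have "emeasure ?\<mu> ?N \<le> emeasure ?\<mu> W" using W by (intro emeasure_mono) auto
      ultimately show "emeasure ?\<mu> ?N \<le> 0 + ennreal \<epsilon>" by simp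
    qed
    then show "emeasure ?\<mu> ?N = 0" by simp
  qed
  have "N = (\<Union>n. N \<inter> {- real n..real n})"
  proof -
    have "\<exists>n. x \<in> {- real n..real n}" for x
    proof -
      obtain n where "\<bar>x\<bar> \<le> real n" using real_arch_simple by blast
      then have "x \<in> {- real n..real n}" by auto
      then show ?thesis by blast
    qed
    then show ?thesis by auto
  qed
  moreover have "(\<Union>n. N \<inter> {- real n..real n}) \<in> null_sets ?\<mu>" by (rule null_sets_UN[OF N0])
  ultimately show "N \<in> null_sets ?\<mu>" by simp
qed

text \<open>The density is the Radon-Nikodym derivative of the Stieltjes measure with respect to
  Lebesgue measure; it is finite almost everywhere because bounded intervals have finite mass, so
  \<open>enn2real\<close> changes nothing that integrals can see.\<close>

lemma mono_loc_abs_cont_density: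
  fixes h :: "real \<Rightarrow> real"
  assumes mono: "\<And>x y. x \<le> y \<Longrightarrow> h x \<le> h y" and ac: "loc_abs_cont h"
  shows "\<exists>g. has_density h g"
proof -
  let ?\<mu> = "interval_measure h"
  have Icc: "emeasure ?\<mu> {a..b} = ennreal (h b - h a)" if "a \<le> b" for a b
    by (rule emeasure_interval_measure_Icc[OF that mono loc_abs_cont_continuous[OF ac]])
  obtain F where F: "F \<in> borel_measurable lborel" "density lborel F = ?\<mu>"
    using sigma_finite_measure.Radon_Nikodym[OF sigma_finite_lborel interval_measure_absolutely_continuous[OF assms]] by auto
  have FI: "(\<integral>\<^sup>+x. F x * indicator {a..b} x \<partial>lborel) = ennreal (h b - h a)" if "a \<le> b" for a b
  proof -
    have "emeasure (density lborel F) {a..b} = (\<integral>\<^sup>+x. F x * indicator {a..b} x \<partial>lborel)"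
      by (rule emeasure_density[OF F(1)]) auto
    then show ?thesis using Icc[OF that] F(2) by simp
  qed
  have [measurable]: "F \<in> borel_measurable borel" using F(1) by simp
  have "AE x in lborel. F x * indicator {- real n..real n} x \<noteq> \<infinity>" for n
    by (rule nn_integral_PInf_AE) (use FI[of "- real n" "real n"] in auto)
  then have "AE x in lborel. \<forall>n. F x * indicator {- real n..real n} x \<noteq> \<infinity>"
    by (simp add: AE_all_countable)
  then have fin: "AE x in lborel. F x \<noteq> \<infinity>"
  proof eventually_elim
    case (elim x)
    obtain n where "\<bar>x\<bar> \<le> real n" using real_arch_simple by blast
    then show ?case using elim[rule_format, of n] by (auto simp: indicator_def abs_le_iff)
  qed
  define g where "g x = enn2real (F x)" for x
  have gm [measurable]: "g \<in> borel_measurable borel" unfolding g_def by measurable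
  have hi: "(g has_integral (h b - h a)) {a..b}" if "a \<le> b" for a b
  proof -
    have "((\<lambda>x. if x \<in> {a..b} then g x else 0) has_integral (h b - h a)) UNIV"
    proof (rule nn_integral_has_integral)
      have "(\<integral>\<^sup>+x. ennreal (if x \<in> {a..b} then g x else 0) \<partial>lborel) = (\<integral>\<^sup>+x. F x * indicator {a..b} x \<partial>lborel)"
        by (rule nn_integral_cong_AE) (use fin in eventually_elim, auto simp: g_def indicator_def less_top)
      then show "(\<integral>\<^sup>+x. ennreal (if x \<in> {a..b} then g x else 0) \<partial>lborel) = ennreal (h b - h a)"
        using FI[OF that] by simp
    qed (use mono[OF that] in \<open>auto simp: g_def\<close>)
    then show ?thesis by (simp only: has_integral_restrict_UNIV)
  qed
  have "has_density h g"
    unfolding has_density_def loc_integrable_def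
  proof (intro conjI allI impI)
    fix a b :: real
    have "g integrable_on {a..b}"
      using hi[of a b] by (cases "a \<le> b") auto
    then show "g absolutely_integrable_on {a..b}"
      by (rule nonnegative_absolutely_integrable_1) (simp add: g_def)
    assume "a \<le> b"
    then show "h b - h a = integral {a..b} g" using hi[of a b] by (simp add: integral_unique)
  qed
  then show ?thesis by blast
qed

section \<open>Fundamental theorem of calculus\<close>

lemma has_density_diff:
  assumes "has_density f f'" "has_density g g'"
  shows "has_density (\<lambda>x. f x - g x) (\<lambda>x. f' x - g' x)"
  unfolding has_density_def
proof (intro conjI allI impI)
  show "loc_integrable (\<lambda>x. f' x - g' x)"
    using assms by (auto simp: has_density_def loc_integrable_def intro!: set_integral_diff)
  fix a b :: real assume "a \<le> b"
  then show "f b - g b - (f a - g a) = integral {a..b} (\<lambda>x. f' x - g' x)"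
    using assms has_densityD[OF assms(1)] has_densityD[OF assms(2)]
    by (subst Henstock_Kurzweil_Integration.integral_diff)
       (auto simp: algebra_simps intro: loc_integrable_integrable_on has_density_loc_integrable)
qed

lemma loc_integrableD: "loc_integrable g \<Longrightarrow> g absolutely_integrable_on {a..b}"
  by (simp add: loc_integrable_def)

lemma AE_lebesgue_negligible:
  assumes "AE x in lebesgue. P x"
  obtains N where "negligible N" "\<And>x. x \<notin> N \<Longrightarrow> P x"
  using assms by (auto simp: eventually_ae_filter_negligible)

lemma loc_integrable_cong_AE:
  assumes "loc_integrable g" "AE x in lebesgue. g x = g' x"
  shows "loc_integrable g'"
proof -
  obtain N where N: "negligible N" "\<And>x. x \<notin> N \<Longrightarrow> g x = g' x"
    using AE_lebesgue_negligible[OF assms(2)] by metis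
  show ?thesis
    unfolding loc_integrable_def
  proof (intro allI)
    fix a b
    show "g' absolutely_integrable_on {a..b}"
      by (rule absolutely_integrable_spike[OF loc_integrableD[OF assms(1)] N(1)]) (use N(2) in auto)
  qed
qed

lemma has_density_cong_AE:
  assumes "has_density f g" "AE x in lebesgue. g x = g' x"
  shows "has_density f g'"
proof -
  obtain N where N: "negligible N" "\<And>x. x \<notin> N \<Longrightarrow> g x = g' x"
    using AE_lebesgue_negligible[OF assms(2)] by metis
  have "integral {a..b} g = integral {a..b} g'" for a b
    by (rule integral_spike[OF N(1)]) (use N(2) in auto)
  then show ?thesis
    using assms loc_integrable_cong_AE[OF _ assms(2)] by (simp add: has_density_def)
qed

text \<open>Jordan decomposition: \<open>f (max a x)\<close> is the difference of
  \<open>V x + f (max a x)\<close> and \<open>V x\<close>, both monotone and absolutely continuous.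
  Freezing \<open>f\<close> to the left of \<open>a\<close> makes a variation that starts at
  \<open>a\<close> serve on the whole line.\<close>

lemma loc_abs_cont_density_right:
  fixes f :: "real \<Rightarrow> real"
  assumes f: "loc_abs_cont f"
  shows "\<exists>g. has_density (\<lambda>x. f (max a x)) g"
proof -
  define V where "V x = enn2real (variation f {a..x})" for x
  have fin: "variation f {x..y} < top" for x y using variation_finite[OF f] by simp
  have V: "ennreal (V x) = variation f {a..x}" for x using fin by (simp add: V_def)
  have V0: "V x \<ge> 0" for x by (simp add: V_def)
  have VE: "V y - V x \<le> enn2real (variation f {x..y})" "V x \<le> V y" if "x \<le> y" for x y
  proof -
    have "variation f {a..y} \<le> variation f {a..x} + variation f {x..y}"
    proof (cases "a \<le> x")
      case True
      then show ?thesis using variation_split that by blast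
    next
      case False
      then have "variation f {a..y} \<le> variation f {x..y}" by (intro variation_mono) auto
      then show ?thesis by (simp add: add_increasing)
    qed
    then have "ennreal (V y) \<le> ennreal (V x + enn2real (variation f {x..y}))"
      using fin V V0 by simp
    then show "V y - V x \<le> enn2real (variation f {x..y})"
      using V0 by (subst (asm) ennreal_le_iff) auto
    have "variation f {a..x} \<le> variation f {a..y}" using that by (intro variation_mono) auto
    then show "V x \<le> V y" using V V0 by (metis ennreal_le_iff)
  qed
  have ff: "\<bar>f (max a y) - f (max a x)\<bar> \<le> V y - V x" if "x \<le> y" for x y
  proof (cases "a \<le> y")
    case False
    then have "max a y = a" "max a x = a" using that by auto
    then show ?thesis using VE(2)[OF that] by simp
  next
    case True
    let ?x = "max a x"
    have "ennreal \<bar>f y - f ?x\<bar> \<le> variation f {?x..y}" by (rule variation_ge) (use True that in auto)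
    moreover have "variation f {a..?x} + variation f {?x..y} \<le> variation f ({a..?x} \<union> {?x..y})"
      by (rule variation_superadd) (auto simp: interior_atLeastAtMost_real)
    moreover have "{a..?x} \<union> {?x..y} = {a..y}" using True that by auto
    moreover have "variation f {a..x} \<le> variation f {a..?x}" by (rule variation_mono) auto
    ultimately have "variation f {a..x} + ennreal \<bar>f y - f ?x\<bar> \<le> variation f {a..y}"
      using add_mono[of "variation f {a..x}" "variation f {a..?x}"] by (simp only:) (meson order_trans)
    then have "ennreal (V x + \<bar>f y - f ?x\<bar>) \<le> ennreal (V y)" using V V0 by simp
    then show ?thesis using V0 True by (subst (asm) ennreal_le_iff) (auto simp: max_def)
  qed
  have acV: "loc_abs_cont V"
  proof (rule loc_abs_cont_dominated_variation[OF f, of _ 1])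
    fix x y :: real assume "x \<le> y"
    then show "ennreal \<bar>V y - V x\<bar> \<le> ennreal 1 * variation f {x..y}"
      using VE[of x y] fin[of x y] by (metis abs_of_nonneg diff_ge_0_iff_ge ennreal_1 ennreal_enn2real ennreal_leI mult_1)
  qed simp
  have ac1: "loc_abs_cont (\<lambda>x. V x + f (max a x))"
  proof (rule loc_abs_cont_dominated_variation[OF f, of _ 2])
    fix x y :: real assume xy: "x \<le> y"
    have "\<bar>V y + f (max a y) - (V x + f (max a x))\<bar> \<le> 2 * enn2real (variation f {x..y})"
      using VE[OF xy] ff[OF xy] by linarith
    then have "ennreal \<bar>V y + f (max a y) - (V x + f (max a x))\<bar> \<le> ennreal (2 * enn2real (variation f {x..y}))"
      by (rule ennreal_leI)
    then show "ennreal \<bar>V y + f (max a y) - (V x + f (max a x))\<bar> \<le> ennreal 2 * variation f {x..y}"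
      using fin[of x y] by (simp add: ennreal_mult)
  qed simp
  obtain g2 where g2: "has_density V g2"
    using mono_loc_abs_cont_density[OF VE(2) acV] by blast
  have "V x + f (max a x) \<le> V y + f (max a y)" if "x \<le> y" for x y
    using ff[OF that] by linarith
  then obtain g1 where g1: "has_density (\<lambda>x. V x + f (max a x)) g1"
    using mono_loc_abs_cont_density[OF _ ac1] by blast
  show ?thesis using has_density_diff[OF g1 g2] by auto
qed

lemma loc_abs_cont_has_density_real:
  fixes f :: "real \<Rightarrow> real"
  assumes f: "loc_abs_cont f"
  shows "has_density f (\<lambda>x. vector_derivative f (at x))"
proof -
  let ?g = "\<lambda>x. vector_derivative f (at x)"
  have "?g absolutely_integrable_on {x..y} \<and> (x \<le> y \<longrightarrow> f y - f x = integral {x..y} ?g)" for x y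
  proof -
    define a where "a = x - 1"
    obtain d where d: "has_density (\<lambda>x. f (max a x)) d"
      using loc_abs_cont_density_right[OF f] by blast
    obtain N where N: "negligible N" "\<And>t. t \<notin> N \<Longrightarrow> ((\<lambda>x. f (max a x)) has_vector_derivative d t) (at t)"
      using AE_lebesgue_negligible[OF has_density_AE_derivative[OF d]] by metis
    have eq: "?g t = d t" if "t \<in> {x..y} - N" for t
    proof -
      have "(f has_vector_derivative d t) (at t)"
      proof (rule has_vector_derivative_transform_within_open[OF N(2)])
        show "open {a<..}" "t \<in> {a<..}" "t \<notin> N" using that by (auto simp: a_def)
      qed auto
      then show ?thesis by (rule vector_derivative_at)
    qed
    have dl: "d absolutely_integrable_on {x..y}" using d by (simp add: has_density_def loc_integrable_def)
    show ?thesis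
    proof (intro conjI impI)
      show "?g absolutely_integrable_on {x..y}"
        by (rule absolutely_integrable_spike[OF dl N(1) eq])
      assume "x \<le> y"
      then have "f y - f x = integral {x..y} d"
        using has_densityD[OF d, of x y] by (simp add: a_def max_def)
      also have "\<dots> = integral {x..y} ?g" by (rule integral_spike[OF N(1)]) (use eq in auto)
      finally show "f y - f x = integral {x..y} ?g" .
    qed
  qed
  then show ?thesis by (simp add: has_density_def loc_integrable_def)
qed

text \<open>The common source of Lipschitz images and of products: on a compact interval the
  increments of \<open>F\<close> are dominated by those of \<open>f\<close> and \<open>g\<close>,
  with a constant that may depend on the interval.\<close>

lemma loc_abs_cont_dominated:
  fixes F :: "real \<Rightarrow> 'c::real_normed_vector"
  assumes f: "loc_abs_cont f" and g: "loc_abs_cont g"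
    and dom: "\<And>a b. \<exists>C. \<forall>x y. a \<le> x \<longrightarrow> x \<le> y \<longrightarrow> y \<le> b \<longrightarrow>
        norm (F y - F x) \<le> C * (norm (f y - f x) + norm (g y - g x))"
  shows "loc_abs_cont F"
  unfolding loc_abs_cont_def
proof (intro allI impI)
  fix a b \<epsilon> :: real assume \<epsilon>: "\<epsilon> > 0"
  obtain C0 where C0: "\<And>x y. a \<le> x \<Longrightarrow> x \<le> y \<Longrightarrow> y \<le> b \<Longrightarrow>
        norm (F y - F x) \<le> C0 * (norm (f y - f x) + norm (g y - g x))" using dom by metis
  define C where "C = max C0 1"
  have C: "C > 0" by (simp add: C_def)
  have CC: "norm (F y - F x) \<le> C * (norm (f y - f x) + norm (g y - g x))" if "a \<le> x" "x \<le> y" "y \<le> b" for x y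
    using C0[OF that] mult_right_mono[of C0 C "norm (f y - f x) + norm (g y - g x)"] by (auto simp: C_def)
  let ?e = "\<epsilon>/(2*C)"
  have e: "?e > 0" using \<epsilon> C by simp
  obtain \<eta>1 where \<eta>1: "\<eta>1 > 0" "\<And>D. D division_of \<Union>D \<Longrightarrow> \<Union>D \<subseteq> {a..b} \<Longrightarrow> (\<Sum>k\<in>D. Sup k - Inf k) < \<eta>1
       \<Longrightarrow> (\<Sum>k\<in>D. norm (f (Sup k) - f (Inf k))) < ?e"
    using f e unfolding loc_abs_cont_def by meson
  obtain \<eta>2 where \<eta>2: "\<eta>2 > 0" "\<And>D. D division_of \<Union>D \<Longrightarrow> \<Union>D \<subseteq> {a..b} \<Longrightarrow> (\<Sum>k\<in>D. Sup k - Inf k) < \<eta>2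
       \<Longrightarrow> (\<Sum>k\<in>D. norm (g (Sup k) - g (Inf k))) < ?e"
    using g e unfolding loc_abs_cont_def by meson
  show "\<exists>\<eta>>0. \<forall>D. D division_of \<Union> D \<and> \<Union> D \<subseteq> {a..b} \<and> (\<Sum>k\<in>D. Sup k - Inf k) < \<eta> \<longrightarrow>
             (\<Sum>k\<in>D. norm (F (Sup k) - F (Inf k))) < \<epsilon>"
  proof (intro exI[of _ "min \<eta>1 \<eta>2"] conjI allI impI; (elim conjE)?)
    fix D assume D: "D division_of \<Union>D" "\<Union>D \<subseteq> {a..b}" "(\<Sum>k\<in>D. Sup k - Inf k) < min \<eta>1 \<eta>2"
    have "(\<Sum>k\<in>D. norm (F (Sup k) - F (Inf k)))
      \<le> (\<Sum>k\<in>D. C * (norm (f (Sup k) - f (Inf k)) + norm (g (Sup k) - g (Inf k))))"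
    proof (rule sum_mono, rule CC)
      fix k assume kD: "k \<in> D"
      have k: "k = {Inf k..Sup k}" "Inf k \<le> Sup k" using division_real[OF D(1) kD] by auto
      have "k \<subseteq> {a..b}" using D(2) kD by blast
      then show "a \<le> Inf k" "Inf k \<le> Sup k" "Sup k \<le> b" using k
        by (metis atLeastatMost_subset_iff linorder_not_le)+
    qed
    also have "\<dots> = C * ((\<Sum>k\<in>D. norm (f (Sup k) - f (Inf k))) + (\<Sum>k\<in>D. norm (g (Sup k) - g (Inf k))))"
      by (simp only: sum.distrib flip: sum_distrib_left)
    also have "\<dots> < C * (?e + ?e)"
      using \<eta>1(2)[of D] \<eta>2(2)[of D] D C by (intro mult_strict_left_mono add_strict_mono) auto
    also have "\<dots> = \<epsilon>" using C by simp
    finally show "(\<Sum>k\<in>D. norm (F (Sup k) - F (Inf k))) < \<epsilon>" .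
  qed (use \<eta>1 \<eta>2 in auto)
qed

lemma loc_abs_cont_lipschitz:
  assumes f: "loc_abs_cont f" and dom: "\<And>a b. \<exists>C. \<forall>x y. a \<le> x \<longrightarrow> x \<le> y \<longrightarrow> y \<le> b \<longrightarrow>
        norm (F y - F x) \<le> C * norm (f y - f x)"
  shows "loc_abs_cont F"
proof (rule loc_abs_cont_dominated[OF f f])
  fix a b
  obtain C where C: "\<And>x y. a \<le> x \<Longrightarrow> x \<le> y \<Longrightarrow> y \<le> b \<Longrightarrow> norm (F y - F x) \<le> C * norm (f y - f x)"
    using dom by metis
  show "\<exists>C. \<forall>x y. a \<le> x \<longrightarrow> x \<le> y \<longrightarrow> y \<le> b \<longrightarrow>
        norm (F y - F x) \<le> C * (norm (f y - f x) + norm (f y - f x))"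
    using C by (intro exI[of _ "C/2"]) auto
qed

lemma loc_abs_cont_linear:
  assumes f: "loc_abs_cont f" and "bounded_linear L"
  shows "loc_abs_cont (\<lambda>x. L (f x))"
proof (rule loc_abs_cont_lipschitz[OF f])
  interpret bounded_linear L by fact
  obtain K where "\<And>x. norm (L x) \<le> norm x * K" using bounded by blast
  then show "\<exists>C. \<forall>x y. a \<le> x \<longrightarrow> x \<le> y \<longrightarrow> y \<le> b \<longrightarrow> norm (L (f y) - L (f x)) \<le> C * norm (f y - f x)" for a b
    by (intro exI[of _ K]) (metis diff mult.commute)
qed

text \<open>Reduction to the components. Together with \<open>has_density_imp_loc_abs_cont\<close>
  this identifies the epsilon-delta notion with that of an indefinite integral, and the density may
  always be taken to be \<open>vector_derivative\<close>, whatever value that has on the exceptional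
  null set.\<close>

theorem loc_abs_cont_has_density:
  fixes f :: "real \<Rightarrow> 'a::euclidean_space"
  assumes f: "loc_abs_cont f"
  shows "has_density f (\<lambda>x. vector_derivative f (at x))"
proof -
  define d where "d b = (\<lambda>x. vector_derivative (\<lambda>x. f x \<bullet> b) (at x))" for b
  define g where "g x = (\<Sum>b\<in>Basis. d b x *\<^sub>R b)" for x
  have c: "has_density (\<lambda>x. f x \<bullet> b) (d b)" for b
    unfolding d_def
    by (rule loc_abs_cont_has_density_real[OF loc_abs_cont_linear[OF f bounded_linear_inner_left]])
  have gb: "g x \<bullet> b = d b x" if "b \<in> Basis" for x b
    using that by (simp add: g_def inner_sum_left_Basis)
  have di: "d b absolutely_integrable_on {x..y}" for b x y
    by (rule loc_integrableD[OF has_density_loc_integrable[OF c]])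
  have "loc_integrable g"
    unfolding loc_integrable_def
  proof (intro allI, rule absolutely_integrable_componentwise)
    fix x y and b :: 'a assume b: "b \<in> Basis"
    show "(\<lambda>t. g t \<bullet> b) absolutely_integrable_on {x..y}"
      unfolding gb[OF b] by (rule di)
  qed
  moreover have "f y - f x = integral {x..y} g" if "x \<le> y" for x y
  proof -
    have "(g has_integral (f y - f x)) {x..y}"
    proof (rule has_integral_componentwise)
      fix b :: 'a assume b: "b \<in> Basis"
      have "(f y - f x) \<bullet> b = integral {x..y} (d b)"
        unfolding inner_diff_left by (rule has_densityD[OF c that])
      moreover have "(d b has_integral integral {x..y} (d b)) {x..y}"
        by (rule integrable_integral[OF loc_integrable_integrable_on[OF has_density_loc_integrable[OF c]]])
      ultimately show "((\<lambda>t. g t \<bullet> b) has_integral (f y - f x) \<bullet> b) {x..y}"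
        unfolding gb[OF b] by simp
    qed
    then show ?thesis by (rule integral_unique[symmetric])
  qed
  ultimately have fg: "has_density f g"
    unfolding has_density_def by blast
  have "AE x in lebesgue. g x = vector_derivative f (at x)"
  proof (rule eventually_mono[OF has_density_AE_derivative[OF fg]])
    show "g x = vector_derivative f (at x)" if "(f has_vector_derivative g x) (at x)" for x
      using vector_derivative_at[OF that] by (rule sym)
  qed
  with fg show ?thesis by (rule has_density_cong_AE)
qed

lemma loc_abs_cont_AE_derivative:
  fixes f :: "real \<Rightarrow> 'a::euclidean_space"
  assumes f: "loc_abs_cont f"
  shows "AE x in lebesgue. (f has_vector_derivative vector_derivative f (at x)) (at x)"
  using has_density_AE_derivative[OF loc_abs_cont_has_density[OF f]] .

lemma has_densityI_AE:
  fixes f :: "real \<Rightarrow> 'a::euclidean_space"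
  assumes f: "loc_abs_cont f" and "AE x in lebesgue. (f has_vector_derivative g x) (at x)"
  shows "has_density f g"
  by (rule has_density_cong_AE[OF loc_abs_cont_has_density[OF f]])
     (use assms(2) in eventually_elim, simp add: vector_derivative_at)

section \<open>Calculus of densities\<close>

lemma loc_abs_cont_bilinear:
  fixes f :: "real \<Rightarrow> 'a::real_normed_vector" and g :: "real \<Rightarrow> 'b::real_normed_vector"
  assumes f: "loc_abs_cont f" and g: "loc_abs_cont g" and "bounded_bilinear h"
  shows "loc_abs_cont (\<lambda>x. h (f x) (g x))"
proof (rule loc_abs_cont_dominated[OF f g])
  fix a b :: real
  interpret bounded_bilinear h by fact
  obtain K where K: "K \<ge> 0" "\<And>x y. norm (h x y) \<le> norm x * norm y * K" using nonneg_bounded by blast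
  have "bounded (f ` {a..b})" "bounded (g ` {a..b})"
    using f g by (simp_all add: compact_continuous_image compact_imp_bounded loc_abs_cont_continuous)
  then obtain A B where A: "\<And>x. x \<in> {a..b} \<Longrightarrow> norm (f x) \<le> A" and B: "\<And>x. x \<in> {a..b} \<Longrightarrow> norm (g x) \<le> B"
    unfolding bounded_iff by (metis imageI)
  show "\<exists>C. \<forall>x y. a \<le> x \<longrightarrow> x \<le> y \<longrightarrow> y \<le> b \<longrightarrow>
      norm (h (f y) (g y) - h (f x) (g x)) \<le> C * (norm (f y - f x) + norm (g y - g x))"
  proof (intro exI[of _ "K * (\<bar>A\<bar> + \<bar>B\<bar>)"] allI impI)
    fix x y assume xy: "a \<le> x" "x \<le> y" "y \<le> b"
    have fx: "norm (f x) \<le> \<bar>A\<bar>" and gy: "norm (g y) \<le> \<bar>B\<bar>" using A[of x] B[of y] xy by auto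
    have "h (f y) (g y) - h (f x) (g x) = h (f y - f x) (g y) + h (f x) (g y - g x)"
      by (simp add: diff_left diff_right)
    also have "norm \<dots> \<le> norm (f y - f x) * norm (g y) * K + norm (f x) * norm (g y - g x) * K"
      by (intro norm_triangle_mono K)
    also have "\<dots> \<le> norm (f y - f x) * \<bar>B\<bar> * K + \<bar>A\<bar> * norm (g y - g x) * K"
      by (intro add_mono mult_right_mono mult_left_mono fx gy K) auto
    also have "\<dots> \<le> K * (\<bar>A\<bar> + \<bar>B\<bar>) * (norm (f y - f x) + norm (g y - g x))"
      using K by (simp add: algebra_simps)
    finally show "norm (h (f y) (g y) - h (f x) (g x)) \<le> K * (\<bar>A\<bar> + \<bar>B\<bar>) * (norm (f y - f x) + norm (g y - g x))" .
  qed
qed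

theorem has_density_bilinear:
  fixes f :: "real \<Rightarrow> 'a::euclidean_space" and g :: "real \<Rightarrow> 'b::euclidean_space"
    and h :: "'a \<Rightarrow> 'b \<Rightarrow> 'c::euclidean_space"
  assumes f: "has_density f f'" and g: "has_density g g'" and "bounded_bilinear h"
  shows "has_density (\<lambda>x. h (f x) (g x)) (\<lambda>x. h (f x) (g' x) + h (f' x) (g x))"
proof (rule has_densityI_AE)
  show "loc_abs_cont (\<lambda>x. h (f x) (g x))"
    by (rule loc_abs_cont_bilinear) (use assms has_density_imp_loc_abs_cont in auto)
  show "AE x in lebesgue. ((\<lambda>x. h (f x) (g x)) has_vector_derivative h (f x) (g' x) + h (f' x) (g x)) (at x)"
    using has_density_AE_derivative[OF f] has_density_AE_derivative[OF g]
    by eventually_elim (rule bounded_bilinear.has_vector_derivative[OF assms(3)])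
qed

lemma has_density_compose_linear:
  fixes f :: "real \<Rightarrow> 'a::euclidean_space" and L :: "'a \<Rightarrow> 'c::euclidean_space"
  assumes f: "has_density f f'" and L: "bounded_linear L"
  shows "has_density (\<lambda>x. L (f x)) (\<lambda>x. L (f' x))"
proof (rule has_densityI_AE)
  show "loc_abs_cont (\<lambda>x. L (f x))"
    by (rule loc_abs_cont_linear[OF _ L]) (use f has_density_imp_loc_abs_cont in auto)
  show "AE x in lebesgue. ((\<lambda>x. L (f x)) has_vector_derivative L (f' x)) (at x)"
    using has_density_AE_derivative[OF f]
    by eventually_elim (rule bounded_linear.has_vector_derivative[OF L])
qed

lemma has_density_add:
  fixes f :: "real \<Rightarrow> 'a::euclidean_space"
  assumes "has_density f f'" "has_density g g'"
  shows "has_density (\<lambda>x. f x + g x) (\<lambda>x. f' x + g' x)"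
  using has_density_diff[OF assms(1) has_density_compose_linear[OF assms(2) bounded_linear_minus[OF bounded_linear_ident]]]
  by simp

section \<open>Linear systems with locally integrable coefficients\<close>

lemma loc_integrableI: "(\<And>a b. g absolutely_integrable_on {a..b}) \<Longrightarrow> loc_integrable g"
  by (simp add: loc_integrable_def)

lemma loc_integrable_borel_measurable:
  fixes g :: "real \<Rightarrow> 'a::euclidean_space"
  assumes "loc_integrable g"
  shows "g \<in> borel_measurable lebesgue"
proof (rule borel_measurable_LIMSEQ_metric)
  fix n :: nat
  have "set_integrable lebesgue {- real n..real n} g" by (rule loc_integrableD[OF assms])
  then show "(\<lambda>x. indicator {- real n..real n} x *\<^sub>R g x) \<in> borel_measurable lebesgue"
    by (simp add: set_integrable_def)
next
  fix x :: real
  obtain m where m: "\<bar>x\<bar> \<le> real m" using real_arch_simple by blast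
  have "eventually (\<lambda>n. indicator {- real n..real n} x *\<^sub>R g x = g x) sequentially"
    unfolding eventually_sequentially
    by (intro exI[of _ m] allI impI) (use m in \<open>auto simp: indicator_def\<close>)
  then show "(\<lambda>n. indicator {- real n..real n} x *\<^sub>R g x) \<longlonglongrightarrow> g x" by (rule tendsto_eventually)
qed

lemma integrable_imp_loc_integrable:
  fixes g :: "real \<Rightarrow> 'a::euclidean_space"
  assumes "integrable lebesgue g"
  shows "loc_integrable g"
  by (rule loc_integrableI) (simp add: set_integrable_def integrable_mult_indicator[OF _ assms])

lemma loc_integrable_bounded_support:
  fixes g :: "real \<Rightarrow> 'a::euclidean_space"
  assumes "loc_integrable g" "AE x in lebesgue. x \<notin> {a..b} \<longrightarrow> g x = 0"
  shows "integrable lebesgue g" "integral\<^sup>L lebesgue g = integral {a..b} g"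
proof -
  have i: "integrable lebesgue (\<lambda>x. indicator {a..b} x *\<^sub>R g x)"
    using loc_integrableD[OF assms(1), of a b] by (simp add: set_integrable_def)
  have m: "g \<in> borel_measurable lebesgue" by (rule loc_integrable_borel_measurable[OF assms(1)])
  have ae: "AE x in lebesgue. indicator {a..b} x *\<^sub>R g x = g x"
    using assms(2) by eventually_elim (auto simp: indicator_def)
  show "integrable lebesgue g"
    by (rule Bochner_Integration.integrable_cong_AE_imp[OF i m]) (use ae in eventually_elim, simp)
  have "integral\<^sup>L lebesgue g = (LINT x:{a..b}|lebesgue. g x)"
    unfolding set_lebesgue_integral_def
    by (rule integral_cong_AE) (use m i ae in auto)
  also have "\<dots> = integral {a..b} g"
    by (rule set_lebesgue_integral_eq_integral(2)[OF loc_integrableD[OF assms(1)]])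
  finally show "integral\<^sup>L lebesgue g = integral {a..b} g" .
qed

lemma loc_integrable_bilinear:
  fixes f :: "real \<Rightarrow> 'a::euclidean_space" and g :: "real \<Rightarrow> 'b::euclidean_space"
    and h :: "'a \<Rightarrow> 'b \<Rightarrow> 'c::euclidean_space"
  assumes f: "continuous_on UNIV f" and g: "loc_integrable g" and h: "bounded_bilinear h"
  shows "loc_integrable (\<lambda>x. h (f x) (g x))"
proof (rule loc_integrableI)
  fix a b
  have fc: "continuous_on {a..b} f" using f continuous_on_subset by blast
  show "(\<lambda>x. h (f x) (g x)) absolutely_integrable_on {a..b}"
  proof (rule absolutely_integrable_bounded_measurable_product[where h = h and f = f and g = g, OF _ _ _ _ loc_integrableD[OF g]])
    show "bilinear h" using h by (simp add: bilinear_conv_bounded_bilinear)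
    show "f \<in> borel_measurable (lebesgue_on {a..b})"
      by (rule continuous_imp_measurable_on_sets_lebesgue[OF fc]) auto
    show "bounded (f ` {a..b})" using fc compact_continuous_image compact_imp_bounded by blast
  qed auto
qed

lemma loc_integrable_bilinear':
  fixes f :: "real \<Rightarrow> 'a::euclidean_space" and g :: "real \<Rightarrow> 'b::euclidean_space"
    and h :: "'b \<Rightarrow> 'a \<Rightarrow> 'c::euclidean_space"
  assumes "continuous_on UNIV f" "loc_integrable g" "bounded_bilinear h"
  shows "loc_integrable (\<lambda>x. h (g x) (f x))"
  using loc_integrable_bilinear[OF assms(1,2) bounded_bilinear.flip[OF assms(3)]] .

lemma loc_integrable_linear:
  fixes g :: "real \<Rightarrow> 'a::euclidean_space" and L :: "'a \<Rightarrow> 'c::euclidean_space"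
  assumes "loc_integrable g" "bounded_linear L"
  shows "loc_integrable (\<lambda>x. L (g x))"
proof (rule loc_integrableI)
  fix a b
  show "(\<lambda>x. L (g x)) absolutely_integrable_on {a..b}"
    using absolutely_integrable_linear[OF loc_integrableD[OF assms(1)] assms(2)] by (simp add: o_def)
qed

lemma loc_integrable_add:
  fixes f :: "real \<Rightarrow> 'a::euclidean_space"
  assumes "loc_integrable f" "loc_integrable g"
  shows "loc_integrable (\<lambda>x. f x + g x)"
  using assms by (auto simp: loc_integrable_def intro!: set_integral_add)

lemma loc_integrable_norm:
  fixes f :: "real \<Rightarrow> 'a::euclidean_space"
  shows "loc_integrable f \<Longrightarrow> loc_integrable (\<lambda>x. norm (f x))"
  by (simp add: loc_integrable_def absolutely_integrable_norm[unfolded o_def])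

text \<open>Integration by parts without boundary terms: the identities with test functions and with
  cut-offs below are reduced to it.\<close>

lemma has_density_integral_zero:
  fixes f :: "real \<Rightarrow> 'a::euclidean_space"
  assumes f: "has_density f g" and supp: "\<And>x. \<bar>x\<bar> > R \<Longrightarrow> f x = 0"
  shows "integrable lebesgue g" "integral\<^sup>L lebesgue g = 0"
proof -
  \<comment> \<open>The complement of this interval is open and \<open>f\<close> vanishes on it, so
    the derivative is \<open>0\<close> there. The absolute value allows for a negative
    \<open>R\<close>, and the extra unit makes \<open>f\<close> vanish at the endpoints too.\<close>
  have ae: "AE x in lebesgue. x \<notin> {-\<bar>R\<bar>-1..\<bar>R\<bar>+1} \<longrightarrow> g x = 0"
    using has_density_AE_derivative[OF f]
  proof eventually_elim
    case (elim x)
    show ?case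
    proof
      assume x: "x \<notin> {-\<bar>R\<bar>-1..\<bar>R\<bar>+1}"
      have "((\<lambda>_. 0) has_vector_derivative g x) (at x)"
        by (rule has_vector_derivative_transform_within_open[OF elim, of "- {-\<bar>R\<bar>-1..\<bar>R\<bar>+1}"])
           (use x supp in \<open>auto intro!: supp\<close>)
      then show "g x = 0" using vector_derivative_at by (metis vector_derivative_const_at)
    qed
  qed
  show "integrable lebesgue g"
    by (rule loc_integrable_bounded_support(1)[OF has_density_loc_integrable[OF f] ae])
  have "integral\<^sup>L lebesgue g = integral {-\<bar>R\<bar>-1..\<bar>R\<bar>+1} g"
    by (rule loc_integrable_bounded_support(2)[OF has_density_loc_integrable[OF f] ae])
  also have "\<dots> = f (\<bar>R\<bar>+1) - f (-\<bar>R\<bar>-1)" using has_densityD[OF f, of "-\<bar>R\<bar>-1" "\<bar>R\<bar>+1"] by simp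
  also have "\<dots> = 0" using supp[of "\<bar>R\<bar>+1"] supp[of "-\<bar>R\<bar>-1"] by simp
  finally show "integral\<^sup>L lebesgue g = 0" .
qed

text \<open>For \<open>x < 0\<close> the interval \<open>{0..x}\<close> is empty and the integral is
  \<open>0\<close>; the expression is a primitive on the whole line because \<open>g\<close>
  vanishes to the left of \<open>0\<close>.\<close>

lemma has_density_primitive:
  fixes g :: "real \<Rightarrow> 'a::euclidean_space"
  assumes g: "loc_integrable g" and g0: "\<And>x. x < 0 \<Longrightarrow> g x = 0"
  shows "has_density (\<lambda>x. integral {0..x} g) g"
  unfolding has_density_def
proof (intro conjI allI impI g)
  fix a b :: real assume ab: "a \<le> b"
  note gi = loc_integrable_integrable_on[OF g]
  have neg: "integral {x..y} g = 0" if "y \<le> 0" for x y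
  proof -
    have "integral {x..y} g = integral {x..y} (\<lambda>_. 0)"
      by (rule integral_spike[of "{0}"]) (use g0 that in auto)
    then show ?thesis by simp
  qed
  consider "0 \<le> a" | "a < 0" "0 \<le> b" | "b < 0" by linarith
  then show "integral {0..b} g - integral {0..a} g = integral {a..b} g"
  proof cases
    case 1
    then show ?thesis using Henstock_Kurzweil_Integration.integral_combine[OF 1 ab gi] by (simp add: algebra_simps)
  next
    case 2
    then show ?thesis using Henstock_Kurzweil_Integration.integral_combine[of a 0 b g] gi neg[of 0 a] neg[of 0 0] by simp
  next
    case 3
    then show ?thesis using neg[of b a] neg[of b 0] neg[of a 0] ab by simp
  qed
qed

lemma integrable_on_real_mult_left:
  fixes f :: "real \<Rightarrow> real"
  shows "f integrable_on S \<Longrightarrow> (\<lambda>x. c * f x) integrable_on S"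
  using integrable_on_cmult_left[of f S c] by simp

lemma integrable_on_real_mult_right:
  fixes f :: "real \<Rightarrow> real"
  shows "f integrable_on S \<Longrightarrow> (\<lambda>x. f x * c) integrable_on S"
  using integrable_on_real_mult_left[of f S c] by (simp add: mult.commute)

lemma has_density_exp:
  fixes m :: "real \<Rightarrow> real"
  assumes m: "has_density m m'"
  shows "has_density (\<lambda>x. exp (c * m x)) (\<lambda>x. c * m' x * exp (c * m x))"
proof (rule has_densityI_AE)
  have ac: "loc_abs_cont m" by (rule has_density_imp_loc_abs_cont[OF m])
  show "loc_abs_cont (\<lambda>x. exp (c * m x))"
  proof (rule loc_abs_cont_lipschitz[OF ac])
    fix a b
    have "bounded (m ` {a..b})"
      using ac by (simp add: compact_continuous_image compact_imp_bounded loc_abs_cont_continuous)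
    then obtain A where A: "\<And>x. x \<in> {a..b} \<Longrightarrow> \<bar>m x\<bar> \<le> A"
      unfolding bounded_iff by (metis imageI real_norm_def)
    have "norm (exp (c * m y) - exp (c * m x)) \<le> (\<bar>c\<bar> * exp (\<bar>c\<bar> * A)) * norm (m y - m x)"
      if "a \<le> x" "x \<le> y" "y \<le> b" for x y
    proof (rule field_differentiable_bound[where S = "{-A..A}" and f = "\<lambda>t. exp (c * t)" and x = "m y" and y = "m x" and f' = "\<lambda>t. c * exp (c * t)"])
      show "((\<lambda>t. exp (c * t)) has_field_derivative c * exp (c * z)) (at z within {-A..A})" for z
        by (auto intro!: derivative_eq_intros)
      fix z assume "z \<in> {-A..A}"
      then have "\<bar>c * z\<bar> \<le> \<bar>c\<bar> * A" by (auto simp: abs_mult intro!: mult_left_mono)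
      then have "exp (c * z) \<le> exp (\<bar>c\<bar> * A)" by simp
      then show "norm (c * exp (c * z)) \<le> \<bar>c\<bar> * exp (\<bar>c\<bar> * A)" by (simp add: abs_mult mult_left_mono)
    qed (use A[of x] A[of y] that in auto)
    then show "\<exists>C. \<forall>x y. a \<le> x \<longrightarrow> x \<le> y \<longrightarrow> y \<le> b \<longrightarrow>
        norm (exp (c * m y) - exp (c * m x)) \<le> C * norm (m y - m x)" by blast
  qed
  show "AE x in lebesgue. ((\<lambda>x. exp (c * m x)) has_vector_derivative c * m' x * exp (c * m x)) (at x)"
    using has_density_AE_derivative[OF m]
  proof eventually_elim
    case (elim x)
    then have "(m has_field_derivative m' x) (at x)"
      by (simp add: has_real_derivative_iff_has_vector_derivative)
    then show ?case
      unfolding has_real_derivative_iff_has_vector_derivative[symmetric]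
      by (auto intro!: derivative_eq_intros)
  qed
qed

section \<open>Fundamental matrices by Picard iteration\<close>

lemma bounded_bilinear_matrix_mult:
  "bounded_bilinear ((**) :: complex^'n^'m \<Rightarrow> complex^'k^'n \<Rightarrow> complex^'k^'m)"
  unfolding bilinear_conv_bounded_bilinear[symmetric] bilinear_def
  by (auto intro!: linearI simp: vec_eq_iff matrix_matrix_mult_def algebra_simps sum.distrib scaleR_sum_right)

lemma matrix_mult_norm_bound:
  "\<exists>K>0. \<forall>(A :: complex^'n^'m) (B :: complex^'k^'n). norm (A ** B) \<le> norm A * norm B * K"
  by (rule bounded_bilinear.pos_bounded[OF bounded_bilinear_matrix_mult])

text \<open>Picard iteration measured against \<open>exp (2 * m x)\<close>, where \<open>m\<close>
  is a primitive of \<open>K * norm (M x)\<close>. In this weight one step is a contraction with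
  factor \<open>1/2\<close> on the whole half-line, because the integral of
  \<open>w * exp (2 * m)\<close> is at most \<open>exp (2 * m) / 2\<close>.\<close>

lemma forward_fundamental_matrix:
  fixes M :: "real \<Rightarrow> complex^'m^'m"
  assumes M: "loc_integrable M" and M0: "\<And>x. x < 0 \<Longrightarrow> M x = 0"
  shows "\<exists>Y. has_density Y (\<lambda>x. M x ** Y x) \<and> (\<forall>x\<le>0. Y x = mat 1)"
proof -
  obtain K where K1: "K > 0" and K2: "\<forall>(A :: complex^'m^'m) (B :: complex^'m^'m). norm (A ** B) \<le> norm A * norm B * K"
    using matrix_mult_norm_bound by blast
  note K = K1 K2[rule_format]
  let ?I = "mat 1 :: complex^'m^'m"
  define w where "w x = K * norm (M x)" for x
  define m where "m x = integral {0..x} w" for x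
  have w: "loc_integrable w" unfolding w_def
    by (rule loc_integrable_linear[OF loc_integrable_norm[OF M] bounded_linear_mult_right])
  have w0: "w x = 0" if "x < 0" for x using M0[OF that] by (simp add: w_def)
  have wn: "w x \<ge> 0" for x using K by (simp add: w_def)
  have md: "has_density m w" unfolding m_def by (rule has_density_primitive[OF w w0])
  have m_mono: "m x \<le> m y" if "x \<le> y" for x y
  proof -
    have "m y - m x = integral {x..y} w" by (rule has_densityD[OF md that])
    also have "\<dots> \<ge> 0" by (rule integral_nonneg[OF loc_integrable_integrable_on[OF w]]) (rule wn)
    finally show ?thesis by simp
  qed
  have m0: "m 0 = 0" by (simp add: m_def)
  have ed: "has_density (\<lambda>x. exp (2 * m x)) (\<lambda>x. 2 * w x * exp (2 * m x))"
    by (rule has_density_exp[OF md])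
  have ew: "(\<lambda>t. w t * exp (2 * m t)) integrable_on {0..x}" for x
    using integrable_on_real_mult_left[OF loc_integrable_integrable_on[OF has_density_loc_integrable[OF ed]], where c = "1/2"]
    by simp
  have eint: "integral {0..x} (\<lambda>t. w t * exp (2 * m t)) \<le> exp (2 * m x) / 2" if "0 \<le> x" for x
  proof -
    have "exp (2 * m x) - exp (2 * m 0) = integral {0..x} (\<lambda>x. 2 * w x * exp (2 * m x))"
      by (rule has_densityD[OF ed that])
    also have "\<dots> = integral {0..x} (\<lambda>t. 2 * (w t * exp (2 * m t)))" by (simp add: mult.assoc)
    also have "\<dots> = 2 * integral {0..x} (\<lambda>t. w t * exp (2 * m t))" by (rule integral_mult_right)
    finally show ?thesis by (simp add: m0)
  qed
  define Y where "Y = rec_nat (\<lambda>x::real. ?I) (\<lambda>k y x. ?I + integral {0..x} (\<lambda>t. M t ** y t))"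
  have Y0: "Y 0 x = ?I" and YS: "Y (Suc k) x = ?I + integral {0..x} (\<lambda>t. M t ** Y k t)" for k x
    by (simp_all add: Y_def)
  have Yc: "continuous_on UNIV (Y k)" for k
  proof (induction k)
    case 0
    have "Y 0 = (\<lambda>x. ?I)" using Y0 by auto
    then show ?case by simp
  next
    case (Suc k)
    have "loc_integrable (\<lambda>t. M t ** Y k t)"
      by (rule loc_integrable_bilinear'[OF Suc M bounded_bilinear_matrix_mult])
    then have "has_density (\<lambda>x. integral {0..x} (\<lambda>t. M t ** Y k t)) (\<lambda>t. M t ** Y k t)"
      by (rule has_density_primitive) (simp add: M0)
    then have "continuous_on UNIV (\<lambda>x. integral {0..x} (\<lambda>t. M t ** Y k t))"
      using has_density_imp_loc_abs_cont loc_abs_cont_continuous by blast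
    moreover have "Y (Suc k) = (\<lambda>x. ?I + integral {0..x} (\<lambda>t. M t ** Y k t))" using YS by auto
    ultimately show ?case by (simp add: continuous_on_add)
  qed
  have MYi: "(\<lambda>t. M t ** Y k t) integrable_on {a..b}" for k a b
    by (rule loc_integrable_integrable_on[OF loc_integrable_bilinear'[OF Yc M bounded_bilinear_matrix_mult]])
  define D where "D k x = Y (Suc k) x - Y k x" for k x
  have neg: "Y k x = ?I" if "x \<le> 0" for k x
  proof (cases k)
    case (Suc j)
    have "integral {0..x} (\<lambda>t. M t ** Y j t) = 0" using that by (cases "x = 0") auto
    then show ?thesis by (simp add: Suc YS)
  qed (simp add: Y0)
  let ?C = "norm ?I"
  have Dk: "norm (D k x) \<le> ?C * (1/2)^k * exp (2 * m x)" for k x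
  proof (cases "x \<le> 0")
    case True
    then show ?thesis by (simp add: D_def neg)
  next
    case False
    then have "0 \<le> x" by simp
    then show ?thesis
    proof (induction k arbitrary: x)
      case 0
      have "norm (D 0 x) = norm (integral {0..x} (\<lambda>t. M t ** Y 0 t))" by (simp add: D_def YS Y0)
      also have "\<dots> \<le> integral {0..x} (\<lambda>t. ?C * w t)"
      proof (rule integral_norm_bound_integral[OF MYi])
        show "(\<lambda>t. ?C * w t) integrable_on {0..x}"
          by (rule integrable_on_real_mult_left[OF loc_integrable_integrable_on[OF w]])
        show "norm (M t ** Y 0 t) \<le> ?C * w t" for t
          using K(2)[of "M t" "Y 0 t"] by (simp add: Y0 w_def mult_ac)
      qed
      also have "\<dots> = ?C * m x" by (simp add: m_def)
      also have "m x \<le> exp (2 * m x)" using exp_ge_add_one_self[of "2 * m x"] m_mono[OF 0] m0 by linarith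
      finally show ?case by (simp add: mult_left_mono)
    next
      case (Suc k)
      have "D (Suc k) x = integral {0..x} (\<lambda>t. M t ** Y (Suc k) t) - integral {0..x} (\<lambda>t. M t ** Y k t)"
        by (simp add: D_def YS)
      also have "\<dots> = integral {0..x} (\<lambda>t. M t ** Y (Suc k) t - M t ** Y k t)"
        by (rule Henstock_Kurzweil_Integration.integral_diff[symmetric, OF MYi MYi])
      also have "norm \<dots> \<le> integral {0..x} (\<lambda>t. (?C * (1/2)^k) * (w t * exp (2 * m t)))"
      proof (rule integral_norm_bound_integral[OF integrable_diff[OF MYi MYi] integrable_on_real_mult_left[OF ew]])
        fix t assume t: "t \<in> {0..x}"
        have "M t ** Y (Suc k) t - M t ** Y k t = M t ** D k t"
          unfolding D_def by (rule bounded_bilinear.diff_right[OF bounded_bilinear_matrix_mult, symmetric])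
        also have "norm \<dots> \<le> norm (M t) * norm (D k t) * K" by (rule K)
        also have "\<dots> = w t * norm (D k t)" by (simp add: w_def mult_ac)
        also have "\<dots> \<le> w t * (?C * (1/2)^k * exp (2 * m t))"
          using t by (intro mult_left_mono Suc.IH wn) auto
        finally show "norm (M t ** Y (Suc k) t - M t ** Y k t) \<le> (?C * (1/2)^k) * (w t * exp (2 * m t))"
          by (simp add: mult_ac)
      qed
      also have "\<dots> = (?C * (1/2)^k) * integral {0..x} (\<lambda>t. w t * exp (2 * m t))" by (rule integral_mult_right)
      also have "\<dots> \<le> (?C * (1/2)^k) * (exp (2 * m x) / 2)"
        by (rule mult_left_mono[OF eint[OF Suc.prems]]) simp
      finally show ?case by simp
    qed
  qed
  \<comment> \<open>The limit is written as a telescoping series, so that the geometric bound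
    \<open>Dk\<close> gives uniform convergence on every half-line \<open>{..R}\<close>.\<close>
  define Z where "Z x = ?I + (\<Sum>k. D k x)" for x
  have Ysum: "Y n x = ?I + (\<Sum>k<n. D k x)" for n x
    by (induction n) (simp_all add: Y0 D_def)
  have unif: "uniform_limit {..R} Y Z sequentially" for R
  proof -
    have "uniform_limit {..R} (\<lambda>n x. \<Sum>k<n. D k x) (\<lambda>x. \<Sum>k. D k x) sequentially"
    proof (rule Weierstrass_m_test)
      show "norm (D n x) \<le> ?C * (1/2)^n * exp (2 * m R)" if "x \<in> {..R}" for n x
      proof -
        have "?C * (1/2)^n * exp (2 * m x) \<le> ?C * (1/2)^n * exp (2 * m R)"
          using m_mono[of x R] that by (intro mult_left_mono) auto
        then show ?thesis using Dk[of n x] by linarith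
      qed
      show "summable (\<lambda>n. ?C * (1/2)^n * exp (2 * m R))"
        by (intro summable_mult2 summable_mult summable_geometric) simp
    qed
    then have "uniform_limit {..R} (\<lambda>n x. ?I + (\<Sum>k<n. D k x)) (\<lambda>x. ?I + (\<Sum>k. D k x)) sequentially"
      by (intro uniform_limit_add uniform_limit_const)
    moreover have "Y = (\<lambda>n x. ?I + (\<Sum>k<n. D k x))" "Z = (\<lambda>x. ?I + (\<Sum>k. D k x))"
      using Ysum Z_def by auto
    ultimately show ?thesis by (simp only:)
  qed
  have lim: "(\<lambda>n. Y n x) \<longlonglongrightarrow> Z x" for x
    using tendsto_uniform_limitI[OF unif[of x], of x] by simp
  have Zc: "continuous_on UNIV Z"
  proof -
    have "isCont Z x" for x
    proof -
      have "continuous_on {..x+1} Z"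
        by (rule uniform_limit_theorem[OF _ unif]) (auto intro!: always_eventually continuous_on_subset[OF Yc])
      then have "continuous_on {..<x+1} Z" by (rule continuous_on_subset) auto
      then show ?thesis by (simp add: continuous_on_eq_continuous_at)
    qed
    then show ?thesis by (simp add: continuous_at_imp_continuous_on)
  qed
  have MZ: "loc_integrable (\<lambda>t. M t ** Z t)"
    by (rule loc_integrable_bilinear'[OF Zc M bounded_bilinear_matrix_mult])
  have Zeq: "Z x = ?I + integral {0..x} (\<lambda>t. M t ** Z t)" for x
  proof -
    \<comment> \<open>Uniform convergence bounds all iterates from \<open>N\<close> on by
      \<open>B + 1\<close>, which provides the majorant for passing to the limit under the
      integral.\<close>
    obtain N where N: "\<And>t. t \<in> {..x} \<Longrightarrow> norm (Y N t - Z t) < 1" and N2: "\<And>n t. n \<ge> N \<Longrightarrow> t \<in> {..x} \<Longrightarrow> norm (Y n t - Z t) < 1"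
      using uniform_limitD[OF unif[of x], of 1] by (auto simp: eventually_sequentially dist_norm)
    have "bounded (Z ` {0..x})"
      using Zc by (meson compact_Icc compact_continuous_image compact_imp_bounded continuous_on_subset subset_UNIV)
    then obtain B where B: "\<And>t. t \<in> {0..x} \<Longrightarrow> norm (Z t) \<le> B"
      unfolding bounded_iff by (metis imageI)
    have "(\<lambda>n. integral {0..x} (\<lambda>t. M t ** Y (n + N) t)) \<longlonglongrightarrow> integral {0..x} (\<lambda>t. M t ** Z t)"
    proof (rule dominated_convergence(2)[OF MYi])
      show "(\<lambda>t. w t * (B + 1)) integrable_on {0..x}"
        by (rule integrable_on_real_mult_right[OF loc_integrable_integrable_on[OF w]])
      fix n t assume t: "t \<in> {0..x}"
      have "norm (Y (n + N) t) \<le> norm (Z t) + norm (Y (n + N) t - Z t)"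
        by (metis add.commute norm_triangle_sub)
      also have "\<dots> \<le> B + 1" using B[OF t] N2[of "n + N" t] t by force
      finally have "norm (M t) * norm (Y (n + N) t) * K \<le> norm (M t) * (B + 1) * K"
        using K by (intro mult_right_mono mult_left_mono) auto
      then show "norm (M t ** Y (n + N) t) \<le> w t * (B + 1)"
        using K(2)[of "M t" "Y (n + N) t"] by (simp add: w_def mult_ac)
    next
      fix t assume "t \<in> {0..x}"
      show "(\<lambda>n. M t ** Y (n + N) t) \<longlonglongrightarrow> M t ** Z t"
        by (rule bounded_bilinear.tendsto[OF bounded_bilinear_matrix_mult tendsto_const LIMSEQ_ignore_initial_segment[OF lim]])
    qed
    then have "(\<lambda>n. Y (Suc (n + N)) x) \<longlonglongrightarrow> ?I + integral {0..x} (\<lambda>t. M t ** Z t)"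
      unfolding YS by (intro tendsto_add tendsto_const)
    moreover have "(\<lambda>n. Y (Suc (n + N)) x) \<longlonglongrightarrow> Z x"
      using LIMSEQ_ignore_initial_segment[OF lim, of "Suc N" x] by simp
    ultimately show ?thesis using LIMSEQ_unique by blast
  qed
  have "has_density (\<lambda>x. integral {0..x} (\<lambda>t. M t ** Z t)) (\<lambda>t. M t ** Z t)"
    by (rule has_density_primitive[OF MZ]) (simp add: M0)
  then have "has_density Z (\<lambda>t. M t ** Z t)"
    unfolding has_density_def using Zeq by (metis (no_types, lifting) add_diff_cancel_left)
  moreover have "Z x = ?I" if "x \<le> 0" for x
    using lim[of x] neg[OF that] by (simp add: LIMSEQ_const_iff)
  ultimately show ?thesis by blast
qed

text \<open>The solution to the left is the reflected solution of a forward problem, and the two are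
  glued by multiplication. At every point one of the factors \<open>y x\<close> and
  \<open>z (- x)\<close> is the identity, so the product is simply the other factor.\<close>

theorem fundamental_matrix_exists:
  fixes M :: "real \<Rightarrow> complex^'m^'m"
  assumes M: "loc_integrable M"
  shows "\<exists>Y. has_density Y (\<lambda>x. M x ** Y x) \<and> Y 0 = mat 1"
proof -
  define P where "P x = (if x < 0 then 0 else M x)" for x
  define Q where "Q x = (if x < 0 then 0 else - M (- x))" for x
  have cut: "loc_integrable (\<lambda>x. if x < 0 then 0 else G x)" if "loc_integrable G" for G :: "real \<Rightarrow> complex^'m^'m"
  proof (rule loc_integrableI)
    fix a b
    have "(\<lambda>x. if x \<in> {a..b} then G x else 0) absolutely_integrable_on UNIV"
      unfolding absolutely_integrable_restrict_UNIV by (rule loc_integrableD[OF that])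
    then have "(\<lambda>x. if x \<in> {a..b} then G x else 0) absolutely_integrable_on {0..}"
      by (rule set_integrable_subset) auto
    then have "(\<lambda>x. if x \<in> {0..} then (if x \<in> {a..b} then G x else 0) else 0) absolutely_integrable_on UNIV"
      by (simp only: absolutely_integrable_restrict_UNIV)
    moreover have "(\<lambda>x. if x \<in> {0..} then (if x \<in> {a..b} then G x else 0) else 0)
       = (\<lambda>x. if x \<in> {a..b} then (if x < 0 then 0 else G x) else 0)" by auto
    ultimately show "(\<lambda>x. if x < 0 then 0 else G x) absolutely_integrable_on {a..b}"
      by (simp only: absolutely_integrable_restrict_UNIV)
  qed
  have "loc_integrable P" unfolding P_def by (rule cut[OF M])
  then obtain y where y: "has_density y (\<lambda>x. P x ** y x)" "\<And>x. x \<le> 0 \<Longrightarrow> y x = mat 1"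
    using forward_fundamental_matrix[of P] by (auto simp: P_def)
  have "loc_integrable (\<lambda>x. - M (- x))"
    by (rule loc_integrable_linear[OF loc_integrable_reflect[OF M] bounded_linear_minus[OF bounded_linear_ident]])
  then have "loc_integrable Q" unfolding Q_def by (rule cut)
  then obtain z where z: "has_density z (\<lambda>x. Q x ** z x)" "\<And>x. x \<le> 0 \<Longrightarrow> z x = mat 1"
    using forward_fundamental_matrix[of Q] by (auto simp: Q_def)
  define Y where "Y x = y x ** z (- x)" for x
  have "has_density Y (\<lambda>x. y x ** (- (Q (- x) ** z (- x))) + (P x ** y x) ** z (- x))"
    unfolding Y_def by (rule has_density_bilinear[OF y(1) has_density_reflect[OF z(1)] bounded_bilinear_matrix_mult])
  then have "has_density Y (\<lambda>x. M x ** Y x)"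
  proof (rule has_density_cong_AE)
    \<comment> \<open>At \<open>0\<close> both cut coefficients are active and the product rule
      would give \<open>2 M\<close>, hence the exclusion of this null set.\<close>
    have "AE x in lebesgue. x \<noteq> (0::real)"
      by (simp add: eventually_ae_filter_negligible) (metis negligible_sing singletonI)
    then show "AE x in lebesgue. y x ** (- (Q (- x) ** z (- x))) + (P x ** y x) ** z (- x) = M x ** Y x"
    proof eventually_elim
      case (elim x)
      have neg: "- ((- A) ** B) = A ** B" for A B :: "complex^'m^'m"
        using bounded_bilinear.minus_left[OF bounded_bilinear_matrix_mult, of A B] by simp
      show ?case
      proof (cases "x < 0")
        case True
        then show ?thesis using y(2)[of x] by (simp add: P_def Q_def Y_def neg)
      next
        case False
        then show ?thesis using z(2)[of "-x"] elim by (simp add: P_def Q_def Y_def)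
      qed
    qed
  qed
  moreover have "Y 0 = mat 1" using y(2)[of 0] z(2)[of 0] by (simp add: Y_def)
  ultimately show ?thesis by blast
qed

section \<open>Positive semidefinite matrices\<close>

lemma adj_adj [simp]: "adj (adj M) = M"
  by (simp add: adj_def vec_eq_iff)

lemma adj_add: "adj (M + N) = adj M + adj N"
  and adj_diff: "adj (M - N) = adj M - adj N"
  and adj_minus: "adj (- M) = - adj M"
  and adj_scaleR: "adj (c *\<^sub>R M) = c *\<^sub>R adj M"
  and adj_0 [simp]: "adj 0 = 0"
  by (simp_all add: adj_def vec_eq_iff)

lemma adj_mat_1 [simp]: "adj (mat 1) = mat 1"
  by (auto simp: adj_def vec_eq_iff mat_def)

lemma adj_mult: "adj (M ** N) = adj N ** adj M"
  by (simp add: adj_def vec_eq_iff matrix_matrix_mult_def mult.commute)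

lemma cdot_add_left: "cdot (u + v) w = cdot u w + cdot v w"
  and cdot_add_right: "cdot w (u + v) = cdot w u + cdot w v"
  and cdot_diff_left: "cdot (u - v) w = cdot u w - cdot v w"
  and cdot_diff_right: "cdot w (u - v) = cdot w u - cdot w v"
  and cdot_minus_left: "cdot (- u) w = - cdot u w"
  and cdot_minus_right: "cdot w (- u) = - cdot w u"
  and cdot_zero_left [simp]: "cdot 0 w = 0"
  and cdot_zero_right [simp]: "cdot w 0 = 0"
  by (simp_all add: cdot_def algebra_simps sum.distrib sum_subtractf sum_negf)

lemma cdot_smult_left: "cdot (c *s u) w = cnj c * cdot u w"
  and cdot_smult_right: "cdot w (c *s u) = c * cdot w u"
  and cdot_scaleR_left: "cdot (r *\<^sub>R u) w = r *\<^sub>R cdot u w"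
  and cdot_scaleR_right: "cdot w (r *\<^sub>R u) = r *\<^sub>R cdot w u"
  by (simp_all add: cdot_def algebra_simps sum_distrib_left scaleR_sum_right)

lemma cnj_cdot: "cnj (cdot v w) = cdot w v"
  by (simp add: cdot_def mult.commute)

lemma cdot_mult_left: "cdot (M *v v) w = cdot v (adj M *v w)"
proof -
  have "cdot (M *v v) w = (\<Sum>i\<in>UNIV. \<Sum>j\<in>UNIV. cnj (M $ i $ j) * cnj (v $ j) * w $ i)"
    by (simp add: cdot_def matrix_vector_mult_def sum_distrib_right)
  also have "\<dots> = (\<Sum>j\<in>UNIV. \<Sum>i\<in>UNIV. cnj (M $ i $ j) * cnj (v $ j) * w $ i)" by (rule sum.swap)
  also have "\<dots> = cdot v (adj M *v w)"
    by (simp add: cdot_def matrix_vector_mult_def adj_def sum_distrib_left mult_ac)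
  finally show ?thesis .
qed

lemma cdot_mult_right: "cdot v (M *v w) = cdot (adj M *v v) w"
  by (simp add: cdot_mult_left)

lemma cdot_self: "cdot v v = complex_of_real ((norm v)\<^sup>2)"
proof -
  have "(norm v)\<^sup>2 = (\<Sum>i\<in>UNIV. (cmod (v $ i))\<^sup>2)"
    by (simp add: norm_vec_def L2_set_def sum_nonneg)
  moreover have "cdot v v = (\<Sum>i\<in>UNIV. complex_of_real ((cmod (v $ i))\<^sup>2))"
    unfolding cdot_def by (rule sum.cong) (simp_all only: complex_norm_square mult.commute)
  ultimately show ?thesis by simp
qed

lemma Re_cdot: "Re (cdot v w) = inner v w"
  by (simp add: cdot_def inner_vec_def inner_complex_def)

lemma bounded_bilinear_cdot: "bounded_bilinear (cdot :: complex^'n \<Rightarrow> complex^'n \<Rightarrow> complex)"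
  unfolding bilinear_conv_bounded_bilinear[symmetric] bilinear_def
  by (auto intro!: linearI simp: cdot_add_left cdot_add_right cdot_scaleR_left cdot_scaleR_right)

lemma bounded_bilinear_mult_vec: "bounded_bilinear ((*v) :: complex^'n^'m \<Rightarrow> complex^'n \<Rightarrow> complex^'m)"
  unfolding bilinear_conv_bounded_bilinear[symmetric] bilinear_def
  by (auto intro!: linearI simp: vec_eq_iff matrix_vector_mult_def algebra_simps sum.distrib scaleR_sum_right)

lemma mult_vec_norm_bound:
  "\<exists>K>0. \<forall>(A :: complex^'n^'m) v. norm (A *v v) \<le> norm A * norm v * K"
  by (rule bounded_bilinear.pos_bounded[OF bounded_bilinear_mult_vec])

lemma bounded_linear_adj: "bounded_linear (adj :: complex^'n^'m \<Rightarrow> complex^'m^'n)"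
  unfolding linear_conv_bounded_linear[symmetric]
  by (auto intro!: linearI simp: adj_add adj_scaleR)

lemmas mult_vec_simps =
  bounded_bilinear.add_left[OF bounded_bilinear_mult_vec]
  bounded_bilinear.add_right[OF bounded_bilinear_mult_vec]
  bounded_bilinear.diff_left[OF bounded_bilinear_mult_vec]
  bounded_bilinear.diff_right[OF bounded_bilinear_mult_vec]
  bounded_bilinear.minus_left[OF bounded_bilinear_mult_vec]
  bounded_bilinear.minus_right[OF bounded_bilinear_mult_vec]
  bounded_bilinear.scaleR_left[OF bounded_bilinear_mult_vec]
  bounded_bilinear.scaleR_right[OF bounded_bilinear_mult_vec]

lemmas mat_mult_simps =
  bounded_bilinear.add_left[OF bounded_bilinear_matrix_mult]
  bounded_bilinear.add_right[OF bounded_bilinear_matrix_mult]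
  bounded_bilinear.diff_left[OF bounded_bilinear_matrix_mult]
  bounded_bilinear.diff_right[OF bounded_bilinear_matrix_mult]
  bounded_bilinear.minus_left[OF bounded_bilinear_matrix_mult]
  bounded_bilinear.minus_right[OF bounded_bilinear_matrix_mult]
  bounded_bilinear.scaleR_left[OF bounded_bilinear_matrix_mult]
  bounded_bilinear.scaleR_right[OF bounded_bilinear_matrix_mult]

lemma quadratic_nonneg_discriminant:
  fixes a b c :: real
  assumes "\<And>t. 0 \<le> a + 2 * t * b + t\<^sup>2 * c" "c \<ge> 0"
  shows "b\<^sup>2 \<le> a * c"
proof (cases "c = 0")
  case True
  have "b = 0"
  proof (rule ccontr)
    assume "b \<noteq> 0"
    \<comment> \<open>With \<open>c = 0\<close> the polynomial is affine in \<open>t\<close>; at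
      this \<open>t\<close> it takes the value \<open>- 1\<close>.\<close>
    then show False using assms(1)[of "- (a + 1) / (2 * b)"] True by (simp add: field_simps)
  qed
  then show ?thesis using True by simp
next
  case False
  have "0 \<le> c * (a + 2 * (- b / c) * b + (- b / c)\<^sup>2 * c)"
    using assms(1)[of "- b / c"] assms(2) by (intro mult_nonneg_nonneg)
  also have "\<dots> = a * c - b\<^sup>2" using False by (simp add: field_simps power2_eq_square)
  finally show ?thesis by simp
qed

text \<open>The real part makes the quadratic form real for every matrix; for Hermitian ones nothing
  is lost, by \<open>hermitian_cdot_self\<close>.\<close>

definition qf :: "complex^'n^'n \<Rightarrow> complex^'n \<Rightarrow> real" where
  "qf K v = Re (cdot v (K *v v))"

lemma hermitian_cdot: "hermitian K \<Longrightarrow> cdot v (K *v w) = cdot (K *v v) w"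
  by (simp add: cdot_mult_left hermitian_def)

lemma psd_qf_nonneg: "psd K \<Longrightarrow> 0 \<le> qf K v"
  by (simp add: psd_def qf_def)

lemma hermitian_cdot_self: "hermitian K \<Longrightarrow> cdot v (K *v v) = complex_of_real (qf K v)"
proof -
  assume "hermitian K"
  then have "cnj (cdot v (K *v v)) = cdot v (K *v v)" by (simp add: cnj_cdot hermitian_cdot)
  then show ?thesis by (simp add: qf_def complex_eq_iff)
qed

lemma qf_add_scale:
  assumes "hermitian K"
  shows "qf K (v + c *s w) = qf K v + 2 * Re (c * cdot v (K *v w)) + (cmod c)\<^sup>2 * qf K w"
proof -
  have "cdot (c *s w) (K *v v) = cnj (c * cdot v (K *v w))"
  proof -
    have "cdot w (K *v v) = cnj (cdot v (K *v w))" by (metis cnj_cdot hermitian_cdot[OF assms])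
    then show ?thesis by (simp add: cdot_smult_left)
  qed
  moreover have "cdot (c *s w) (c *s (K *v w)) = complex_of_real ((cmod c)\<^sup>2) * cdot w (K *v w)"
    by (simp only: cdot_smult_left cdot_smult_right complex_norm_square) (simp add: mult_ac)
  ultimately have "cdot (v + c *s w) (K *v (v + c *s w)) =
      cdot v (K *v v) + (c * cdot v (K *v w) + cnj (c * cdot v (K *v w))) + complex_of_real ((cmod c)\<^sup>2) * cdot w (K *v w)"
    by (simp only: mult_vec_simps(2) vector_scalar_commute cdot_add_left cdot_add_right cdot_smult_right[where w = v] add_ac)
  then show ?thesis
    unfolding qf_def by simp
qed

lemma psd_cauchy_schwarz:
  assumes K: "psd K"
  shows "(cmod (cdot v (K *v w)))\<^sup>2 \<le> qf K v * qf K w"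
proof -
  have h: "hermitian K" using K by (simp add: psd_def)
  define z where "z = cdot v (K *v w)"
  \<comment> \<open>A phase of modulus \<open>1\<close> that rotates \<open>z\<close> to
    \<open>cmod z\<close>; the real quadratic polynomial in \<open>t\<close> then has the full
    modulus in its middle coefficient.\<close>
  define e where "e = (if z = 0 then 1 else cnj z / cmod z)"
  have e: "cmod e = 1" "e * z = cmod z"
    by (auto simp: e_def norm_divide complex_norm_square[symmetric] mult.commute power2_eq_square divide_simps)
  have "0 \<le> qf K v + 2 * t * cmod z + t\<^sup>2 * qf K w" for t
  proof -
    have "0 \<le> qf K (v + (complex_of_real t * e) *s w)" by (rule psd_qf_nonneg[OF K])
    also have "\<dots> = qf K v + 2 * Re (t * (e * z)) + t\<^sup>2 * qf K w"
      by (simp only: qf_add_scale[OF h]) (simp add: z_def mult.assoc norm_mult e(1) power_mult_distrib)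
    also have "\<dots> = qf K v + 2 * t * cmod z + t\<^sup>2 * qf K w" by (simp only: e(2)) simp
    finally show ?thesis .
  qed
  from quadratic_nonneg_discriminant[OF this psd_qf_nonneg[OF K]] show ?thesis by (simp add: z_def)
qed

lemma psd_mat_1: "psd (mat 1)"
  by (simp add: psd_def hermitian_def cdot_self)

lemma norm_cdot_le: "cmod (cdot v w) \<le> norm v * norm w"
proof -
  have "(cmod (cdot v w))\<^sup>2 \<le> (norm v * norm w)\<^sup>2"
    using psd_cauchy_schwarz[OF psd_mat_1, of v w] by (simp add: qf_def cdot_self power_mult_distrib)
  then show ?thesis by (rule power2_le_imp_le) simp
qed

lemma psd_cauchy_schwarz_sqrt:
  assumes K: "psd K"
  shows "cmod (cdot v (K *v w)) \<le> sqrt (qf K v) * sqrt (qf K w)"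
  using psd_cauchy_schwarz[OF K, of v w] by (simp add: real_le_rsqrt flip: real_sqrt_mult)

text \<open>The Cauchy-Schwarz inequality for the form, with \<open>K *v v\<close> in the first
  slot, bounds the fourth power of \<open>norm (K *v v)\<close> by
  \<open>L * (norm (K *v v))^2 * qf K v\<close>; the common square cancels.\<close>

lemma psd_norm_mult_le:
  assumes K: "psd K" and L: "\<And>v. qf K v \<le> L * (norm v)\<^sup>2"
  shows "(norm (K *v v))\<^sup>2 \<le> L * qf K v"
proof (cases "K *v v = 0")
  case True
  \<comment> \<open>A nonzero vector is needed to conclude \<open>L \<ge> 0\<close>; any basis
    vector will do.\<close>
  have "0 \<le> L * (norm (SOME b :: complex^'a. b \<in> Basis))\<^sup>2"
    using L[of "SOME b. b \<in> Basis"] psd_qf_nonneg[OF K] order_trans by blast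
  then have "0 \<le> L" by simp
  then show ?thesis using True psd_qf_nonneg[OF K] by simp
next
  case False
  let ?w = "K *v v"
  have "((norm ?w)\<^sup>2)\<^sup>2 \<le> qf K ?w * qf K v"
    using psd_cauchy_schwarz[OF K, of ?w v] by (simp add: cdot_self norm_power)
  also have "\<dots> \<le> (L * (norm ?w)\<^sup>2) * qf K v"
    by (rule mult_right_mono[OF L psd_qf_nonneg[OF K]])
  finally have "(norm ?w)\<^sup>2 * (norm ?w)\<^sup>2 \<le> (norm ?w)\<^sup>2 * (L * qf K v)"
    by (simp only: power2_eq_square mult_ac)
  moreover have "0 < (norm ?w)\<^sup>2" using False by simp
  ultimately show ?thesis by (simp only: mult_le_cancel_left_pos)
qed

lemma qf_le_norm:
  assumes "\<And>v. norm (K *v v) \<le> L * norm v"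
  shows "qf K v \<le> L * (norm v)\<^sup>2"
proof -
  have "qf K v \<le> cmod (cdot v (K *v v))" unfolding qf_def by (rule complex_Re_le_cmod)
  also have "\<dots> \<le> norm v * norm (K *v v)" by (rule norm_cdot_le)
  also have "\<dots> \<le> norm v * (L * norm v)" by (rule mult_left_mono[OF assms]) simp
  finally show ?thesis by (simp add: power2_eq_square mult_ac)
qed

lemma qf_norm_bound:
  "\<exists>L>0. \<forall>(K::complex^'n^'n) v. norm (K *v v) \<le> norm K * L * norm v"
proof -
  obtain L where L: "L > 0" "\<forall>(A :: complex^'n^'n) v. norm (A *v v) \<le> norm A * norm v * L"
    using mult_vec_norm_bound by blast
  then show ?thesis by (intro exI[of _ L]) (simp add: mult_ac)
qed

lemma psd_qf_zero:
  assumes K: "psd K" and "qf K v = 0"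
  shows "K *v v = 0"
proof -
  obtain L where "\<forall>(K::complex^'a^'a) v. norm (K *v v) \<le> norm K * L * norm v"
    using qf_norm_bound by blast
  then have "(norm (K *v v))\<^sup>2 \<le> (norm K * L) * qf K v"
    by (intro psd_norm_mult_le[OF K] qf_le_norm) auto
  then show ?thesis using assms(2) by simp
qed

text \<open>Richardson iteration for \<open>H w = h\<close>. It makes the choice of a solution measurable
  in the coefficients.\<close>
fun richardson :: "real \<Rightarrow> complex^'n^'n \<Rightarrow> complex^'n \<Rightarrow> nat \<Rightarrow> complex^'n" where
  "richardson t H h 0 = 0"
| "richardson t H h (Suc k) = richardson t H h k - t *\<^sub>R (H *v richardson t H h k - h)"

text \<open>\<open>H\<close> may be singular, so there is no contraction. The iterates have the form
  \<open>y - H *v B k\<close> with \<open>y\<close> the solution lying in the range of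
  \<open>H\<close>, and \<open>t * L \<le> 1\<close> makes the squared norm of \<open>B k\<close>
  drop by at least \<open>t^2\<close> times that of \<open>H *v B k\<close>; hence the latter are
  summable and the error tends to \<open>0\<close>.\<close>

lemma richardson_convergent:
  fixes H :: "complex^'n^'n"
  assumes H: "psd H" and L: "\<And>v. norm (H *v v) \<le> L * norm v" and t: "t > 0" "t * L \<le> 1"
    and h: "h \<in> range ((*v) H)"
  shows "\<exists>w. richardson t H h \<longlonglongrightarrow> w \<and> H *v w = h"
proof -
  have herm: "hermitian H" using H by (simp add: psd_def)
  let ?S = "range ((*v) H)"
  have lin: "linear ((*v) H)"
    by (rule bounded_linear.linear[OF bounded_bilinear.bounded_linear_right[OF bounded_bilinear_mult_vec]])
  then have sub: "subspace ?S" by (metis linear_subspace_image subspace_UNIV)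
  \<comment> \<open>\<open>u\<close> is split into a component \<open>y\<close> in the range and a
    part \<open>z\<close> in the kernel of \<open>H\<close>; \<open>y\<close> is again a solution
    and has a preimage \<open>b\<close>, from which \<open>B\<close> starts.\<close>
  obtain u where u: "h = H *v u" using h by blast
  obtain y z where yz: "y \<in> span ?S" "\<And>w. w \<in> span ?S \<Longrightarrow> orthogonal z w" "u = y + z"
    using orthogonal_subspace_decomp_exists by metis
  have "y \<in> ?S" using yz(1) sub by (metis span_eq_iff)
  then obtain b where b: "y = H *v b" by blast
  have "orthogonal z (H *v (H *v z))" by (rule yz(2)) (simp add: span_base)
  then have "Re (cdot z (H *v (H *v z))) = 0" by (simp add: orthogonal_def Re_cdot)
  then have "H *v z = 0" by (simp add: hermitian_cdot[OF herm, of z] cdot_self)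
  then have hy: "h = H *v y" by (simp add: u yz(3) mult_vec_simps)
  define B where "B = rec_nat b (\<lambda>_ v. v - t *\<^sub>R (H *v v))"
  have B0: "B 0 = b" and BS: "B (Suc k) = B k - t *\<^sub>R (H *v B k)" for k by (simp_all add: B_def)
  have e: "richardson t H h k = y - H *v B k" for k
  proof (induction k)
    case (Suc k)
    show ?case unfolding richardson.simps Suc BS unfolding hy
      by (simp add: mult_vec_simps algebra_simps)
  qed (simp add: B0 b)
  have dec: "t\<^sup>2 * (norm (H *v B k))\<^sup>2 \<le> (norm (B k))\<^sup>2 - (norm (B (Suc k)))\<^sup>2" for k
  proof -
    let ?v = "B k"
    have "(norm (B (Suc k)))\<^sup>2 = (norm ?v)\<^sup>2 - 2 * t * qf H ?v + t\<^sup>2 * (norm (H *v ?v))\<^sup>2"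
      unfolding BS power2_norm_eq_inner
      by (simp add: inner_diff_left inner_diff_right inner_commute qf_def Re_cdot power2_eq_square algebra_simps)
    moreover have "(norm (H *v ?v))\<^sup>2 \<le> L * qf H ?v"
      by (rule psd_norm_mult_le[OF H qf_le_norm[OF L]])
    then have "t * (t * (norm (H *v ?v))\<^sup>2) \<le> t * (t * (L * qf H ?v))"
      using t by (intro mult_left_mono) auto
    moreover have "t * (t * (L * qf H ?v)) \<le> t * qf H ?v"
      using t psd_qf_nonneg[OF H, of ?v] mult_right_mono[OF t(2), of "qf H ?v"] by (intro mult_left_mono) (auto simp: mult.assoc)
    ultimately show ?thesis by (simp add: power2_eq_square mult.assoc)
  qed
  have "summable (\<lambda>k. t\<^sup>2 * (norm (H *v B k))\<^sup>2)"
  proof (rule summableI_nonneg_bounded)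
    fix n
    have "(\<Sum>k<n. t\<^sup>2 * (norm (H *v B k))\<^sup>2) \<le> (\<Sum>k<n. (norm (B k))\<^sup>2 - (norm (B (Suc k)))\<^sup>2)"
      by (rule sum_mono[OF dec])
    also have "\<dots> = (norm (B 0))\<^sup>2 - (norm (B n))\<^sup>2" by (rule sum_lessThan_telescope')
    also have "\<dots> \<le> (norm (B 0))\<^sup>2" by simp
    finally show "(\<Sum>k<n. t\<^sup>2 * (norm (H *v B k))\<^sup>2) \<le> (norm (B 0))\<^sup>2" .
  qed simp
  then have "(\<lambda>k. (1/t\<^sup>2) * (t\<^sup>2 * (norm (H *v B k))\<^sup>2)) \<longlonglongrightarrow> (1/t\<^sup>2) * 0"
    by (intro tendsto_mult tendsto_const summable_LIMSEQ_zero)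
  then have "(\<lambda>k. sqrt ((norm (H *v B k))\<^sup>2)) \<longlonglongrightarrow> sqrt 0"
    using t by (intro tendsto_real_sqrt) simp
  then have "(\<lambda>k. H *v B k) \<longlonglongrightarrow> 0" by (simp add: tendsto_norm_zero_iff)
  then have "(\<lambda>k. y - H *v B k) \<longlonglongrightarrow> y - 0" by (intro tendsto_diff tendsto_const)
  moreover have "richardson t H h = (\<lambda>k. y - H *v B k)" using e by auto
  ultimately show ?thesis using hy by (intro exI[of _ y]) simp
qed

section \<open>Square roots of positive definite matrices\<close>

lemma norm_matrix_columns: "(norm (A :: complex^'n^'m))\<^sup>2 = (\<Sum>j\<in>UNIV. (norm (A *v axis j 1))\<^sup>2)"
proof -
  have "(norm A)\<^sup>2 = (\<Sum>i\<in>UNIV. \<Sum>j\<in>UNIV. (cmod (A $ i $ j))\<^sup>2)"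
    by (simp add: norm_vec_def L2_set_def sum_nonneg)
  also have "\<dots> = (\<Sum>j\<in>UNIV. \<Sum>i\<in>UNIV. (cmod (A $ i $ j))\<^sup>2)" by (rule sum.swap)
  also have "\<dots> = (\<Sum>j\<in>UNIV. (norm (A *v axis j 1))\<^sup>2)"
    by (simp add: norm_vec_def L2_set_def sum_nonneg matrix_vector_mul_component inner_axis matrix_vector_mult_def axis_def if_distrib cong: if_cong)
  finally show ?thesis .
qed

lemma norm_adj: "norm (adj A) = norm A"
proof -
  have "(norm (adj A))\<^sup>2 = (\<Sum>j\<in>UNIV. \<Sum>i\<in>UNIV. (cmod (A $ i $ j))\<^sup>2)"
    by (simp add: norm_vec_def L2_set_def sum_nonneg adj_def)
  also have "\<dots> = (\<Sum>i\<in>UNIV. \<Sum>j\<in>UNIV. (cmod (A $ i $ j))\<^sup>2)" by (rule sum.swap)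
  also have "\<dots> = (norm A)\<^sup>2" by (simp add: norm_vec_def L2_set_def sum_nonneg)
  finally show ?thesis by (simp add: power2_eq_iff_nonneg)
qed

text \<open>The Frobenius norm is the Euclidean norm of the columns, so an operator bound on the
  left factor passes to products; this makes the fixed point map below a contraction in the library
  norm.\<close>

lemma norm_mult_contraction:
  fixes Y :: "complex^'n^'n" and D :: "complex^'k^'n"
  assumes "\<And>v. norm (Y *v v) \<le> r * norm v" "r \<ge> 0"
  shows "norm (Y ** D) \<le> r * norm D"
proof -
  have "(norm (Y ** D))\<^sup>2 = (\<Sum>j\<in>UNIV. (norm (Y *v (D *v axis j 1)))\<^sup>2)"
    by (simp add: norm_matrix_columns matrix_vector_mul_assoc)
  also have "\<dots> \<le> (\<Sum>j\<in>UNIV. (r * norm (D *v axis j 1))\<^sup>2)"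
    by (intro sum_mono power_mono assms) auto
  also have "\<dots> = (r * norm D)\<^sup>2"
    by (simp add: power_mult_distrib norm_matrix_columns[of D] sum_distrib_left)
  finally show ?thesis by (rule power2_le_imp_le) (use assms(2) in simp)
qed

text \<open>The square root of \<open>1 - X\<close> is \<open>1 - Y\<close> for the fixed point \<open>Y\<close> of the contraction
  \<open>Y \<mapsto> (X + Y\<^sup>2) / 2\<close>.\<close>
lemma psd_sqrt_near_one:
  fixes X :: "complex^'n^'n"
  assumes X: "hermitian X" "\<And>v. norm (X *v v) \<le> r * norm v" and r: "0 \<le> r" "r < 1"
  shows "\<exists>R. psd R \<and> R ** R = mat 1 - X"
proof -
  let ?S = "{Y :: complex^'n^'n. hermitian Y \<and> (\<forall>v. norm (Y *v v) \<le> r * norm v)}"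
  let ?f = "\<lambda>Y. (1/2) *\<^sub>R (X + Y ** Y)"
  have "\<exists>!Y\<in>?S. ?f Y = Y"
  proof (rule Banach_fix)
    have "closed {Y :: complex^'n^'n. hermitian Y}"
      unfolding hermitian_def
      by (intro closed_Collect_eq linear_continuous_on bounded_linear_adj continuous_on_id)
    moreover have "closed {Y :: complex^'n^'n. norm (Y *v v) \<le> r * norm v}" for v
      by (intro closed_Collect_le continuous_on_norm continuous_on_const linear_continuous_on
          bounded_bilinear.bounded_linear_left[OF bounded_bilinear_mult_vec])
    ultimately have "closed ({Y. hermitian Y} \<inter> (\<Inter>v. {Y :: complex^'n^'n. norm (Y *v v) \<le> r * norm v}))"
      by (intro closed_Int closed_INT ballI)
    moreover have "{Y. hermitian Y} \<inter> (\<Inter>v. {Y :: complex^'n^'n. norm (Y *v v) \<le> r * norm v}) = ?S" by auto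
    ultimately show "complete ?S" by (simp only: complete_eq_closed)
    have "0 \<in> ?S" using r by (simp add: hermitian_def)
    then show "?S \<noteq> {}" by blast
    show "?f ` ?S \<subseteq> ?S"
    proof clarify
      fix Y :: "complex^'n^'n" assume Y: "hermitian Y" "\<forall>v. norm (Y *v v) \<le> r * norm v"
      have "hermitian (?f Y)" using X(1) Y(1) by (simp add: hermitian_def adj_scaleR adj_add adj_mult)
      moreover have "norm (?f Y *v v) \<le> r * norm v" for v
      proof -
        have "norm (Y *v (Y *v v)) \<le> r * (r * norm v)"
          using Y(2) r by (meson mult_left_mono order_trans)
        also have "\<dots> \<le> 1 * (r * norm v)" using r by (intro mult_right_mono) auto
        finally have "norm (X *v v + Y *v (Y *v v)) \<le> r * norm v + r * norm v"
          using X(2)[of v] norm_triangle_ineq[of "X *v v" "Y *v (Y *v v)"] by linarith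
        moreover have "?f Y *v v = (1/2) *\<^sub>R (X *v v + Y *v (Y *v v))"
          by (simp add: mult_vec_simps matrix_vector_mul_assoc)
        ultimately show ?thesis by simp
      qed
      ultimately show "hermitian (?f Y) \<and> (\<forall>v. norm (?f Y *v v) \<le> r * norm v)" by blast
    qed
    show "dist (?f Y) (?f Z) \<le> r * dist Y Z" if "Y \<in> ?S" "Z \<in> ?S" for Y Z
    proof -
      let ?D = "Y - Z"
      have "?f Y - ?f Z = (1/2) *\<^sub>R (Y ** ?D + ?D ** Z)"
        by (simp add: mat_mult_simps algebra_simps)
      moreover have "norm (Y ** ?D) \<le> r * norm ?D"
        by (rule norm_mult_contraction) (use that r in auto)
      \<comment> \<open>A bounded right factor is moved to the left by taking adjoints, which
        preserve the Frobenius norm.\<close>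
      moreover have "norm (?D ** Z) \<le> r * norm ?D"
      proof -
        have "norm (?D ** Z) = norm (Z ** adj ?D)"
          using that by (metis (no_types, lifting) adj_mult hermitian_def mem_Collect_eq norm_adj)
        also have "\<dots> \<le> r * norm (adj ?D)" by (rule norm_mult_contraction) (use that r in auto)
        finally show ?thesis by (simp add: norm_adj)
      qed
      ultimately show ?thesis
        using norm_triangle_ineq[of "Y ** ?D" "?D ** Z"] by (simp add: dist_norm)
    qed
  qed (use r in auto)
  then obtain Y where Y: "hermitian Y" "\<And>v. norm (Y *v v) \<le> r * norm v" "?f Y = Y" by auto
  have YY: "X + Y ** Y = Y + Y"
    using arg_cong[OF Y(3), of "\<lambda>A. A + A"] by (simp flip: scaleR_left.add)
  have "psd (mat 1 - Y)"
    unfolding psd_def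
  proof (intro conjI allI)
    show "hermitian (mat 1 - Y)" using Y(1) by (simp add: hermitian_def adj_diff)
    fix v
    have "Re (cdot v (Y *v v)) \<le> norm v * norm (Y *v v)"
      using complex_Re_le_cmod norm_cdot_le order_trans by blast
    also have "\<dots> \<le> norm v * (1 * norm v)"
      using Y(2)[of v] r mult_right_mono[of r 1 "norm v"] by (intro mult_left_mono) auto
    finally show "0 \<le> Re (cdot v ((mat 1 - Y) *v v))"
      by (simp add: mult_vec_simps cdot_diff_right cdot_self power2_eq_square)
  qed
  moreover have "(mat 1 - Y) ** (mat 1 - Y) = mat 1 - X"
  proof -
    have "(mat 1 - Y) ** (mat 1 - Y) = mat 1 - (Y + Y) + Y ** Y"
      by (simp add: mat_mult_simps algebra_simps)
    then show ?thesis unfolding YY[symmetric] by simp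
  qed
  ultimately show ?thesis by blast
qed

lemma invertible_matrix_inv:
  assumes "invertible A"
  shows "A ** matrix_inv A = mat 1" "matrix_inv A ** A = mat 1"
  using someI_ex[OF assms[unfolded invertible_def]] by (simp_all add: matrix_inv_def)

text \<open>The minimum of the form over the unit sphere is attained, and it cannot be
  \<open>0\<close> because then \<open>A\<close> would have a kernel vector.\<close>

lemma psd_invertible_lower_bound:
  assumes A: "psd A" "det A \<noteq> 0"
  shows "\<exists>\<mu>>0. \<forall>v. \<mu> * (norm v)\<^sup>2 \<le> qf A v"
proof -
  let ?S = "sphere (0::complex^'a) 1"
  have cont: "continuous_on ?S (qf A)"
    unfolding qf_def
    by (intro continuous_on_Re bounded_bilinear.continuous_on[OF bounded_bilinear_cdot] continuous_on_id
        linear_continuous_on bounded_bilinear.bounded_linear_right[OF bounded_bilinear_mult_vec])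
  have "(SOME b :: complex^'a. b \<in> Basis) \<in> ?S" by simp
  then have "?S \<noteq> {}" by blast
  then obtain v0 where v0: "v0 \<in> ?S" "\<And>v. v \<in> ?S \<Longrightarrow> qf A v0 \<le> qf A v"
    using continuous_attains_inf[OF compact_sphere _ cont] by blast
  have "qf A v0 \<noteq> 0"
  proof
    assume "qf A v0 = 0"
    then have "A *v v0 = 0" by (rule psd_qf_zero[OF A(1)])
    moreover have "invertible A" using A(2) by (simp add: invertible_det_nz)
    ultimately have "v0 = 0"
      by (metis invertible_matrix_inv(2) matrix_vector_mul_assoc matrix_vector_mul_lid matrix_vector_mult_0_right)
    then show False using v0(1) by simp
  qed
  then have "qf A v0 > 0" using psd_qf_nonneg[OF A(1), of v0] by linarith
  moreover have "qf A v0 * (norm v)\<^sup>2 \<le> qf A v" for v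
  proof (cases "v = 0")
    case False
    let ?u = "(1 / norm v) *\<^sub>R v"
    have "?u \<in> ?S" using False by simp
    then have "qf A v0 \<le> qf A ?u" by (rule v0(2))
    also have "\<dots> = qf A v / (norm v)\<^sup>2"
      by (simp add: qf_def mult_vec_simps cdot_scaleR_left cdot_scaleR_right power2_eq_square)
    finally show ?thesis using False by (simp add: field_simps)
  qed (simp add: qf_def)
  ultimately show ?thesis by blast
qed

lemma psd_scaleR: "psd R \<Longrightarrow> c \<ge> 0 \<Longrightarrow> psd (c *\<^sub>R R)"
  by (simp add: psd_def hermitian_def adj_scaleR mult_vec_simps cdot_scaleR_right)

lemma psd_sqrt_exists:
  fixes A :: "complex^'n^'n"
  assumes A: "psd A" "det A \<noteq> 0"
  shows "\<exists>R. psd R \<and> R ** R = A"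
proof -
  obtain \<mu> where \<mu>: "\<mu> > 0" "\<And>v. \<mu> * (norm v)\<^sup>2 \<le> qf A v"
    using psd_invertible_lower_bound[OF A] by blast
  obtain L where L: "L > 0" "\<forall>(K::complex^'n^'n) v. norm (K *v v) \<le> norm K * L * norm v"
    using qf_norm_bound by blast
  define M where "M = max (norm A * L) \<mu>"
  have M: "M > 0" "\<mu> \<le> M" using \<mu> by (auto simp: M_def)
  have qM: "qf A v \<le> M * (norm v)\<^sup>2" for v
  proof -
    have "qf A v \<le> (norm A * L) * (norm v)\<^sup>2" by (rule qf_le_norm) (use L in auto)
    also have "\<dots> \<le> M * (norm v)\<^sup>2" by (rule mult_right_mono) (auto simp: M_def)
    finally show ?thesis .
  qed
  \<comment> \<open>Scaling by \<open>M\<close> puts the form of \<open>A\<close> on unit vectors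
    between \<open>\<mu> / M\<close> and \<open>1\<close>, so \<open>X\<close> is positive with norm
    at most \<open>r < 1\<close>, as the fixed point construction requires.\<close>
  define X where "X = mat 1 - (1/M) *\<^sub>R A"
  define r where "r = 1 - \<mu> / M"
  have r: "0 \<le> r" "r < 1" using M \<mu> by (auto simp: r_def field_simps)
  have hA: "hermitian A" using A by (simp add: psd_def)
  have hX: "hermitian X" using hA by (simp add: X_def hermitian_def adj_diff adj_scaleR)
  have qX: "qf X v = (norm v)\<^sup>2 - qf A v / M" for v
    by (simp add: X_def qf_def mult_vec_simps cdot_diff_right cdot_scaleR_right cdot_self)
  have "psd X"
    unfolding psd_def qf_def[symmetric]
  proof (intro conjI hX allI)
    show "0 \<le> qf X v" for v using qM[of v] M unfolding qX by (simp add: field_simps)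
  qed
  have q_le: "qf X v \<le> r * (norm v)\<^sup>2" for v
    using \<mu>(2)[of v] M unfolding qX r_def by (simp add: field_simps)
  have Xr: "norm (X *v v) \<le> r * norm v" for v
  proof -
    have "(norm (X *v v))\<^sup>2 \<le> r * qf X v" by (rule psd_norm_mult_le[OF \<open>psd X\<close> q_le])
    also have "\<dots> \<le> r * (r * (norm v)\<^sup>2)" by (rule mult_left_mono[OF q_le r(1)])
    also have "\<dots> = (r * norm v)\<^sup>2" by (simp add: power2_eq_square mult_ac)
    finally show ?thesis by (rule power2_le_imp_le) (use r in simp)
  qed
  obtain R where R: "psd R" "R ** R = mat 1 - X"
    using psd_sqrt_near_one[OF hX Xr r] by metis
  have "(sqrt M *\<^sub>R R) ** (sqrt M *\<^sub>R R) = A"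
    using M R(2) by (simp add: mat_mult_simps X_def)
  moreover have "psd (sqrt M *\<^sub>R R)" using psd_scaleR[OF R(1)] M by simp
  ultimately show ?thesis by blast
qed

text \<open>With \<open>D = R - S\<close> the hypothesis reads \<open>R ** D + D ** S = 0\<close>.
  Multiplying by \<open>D\<close> and taking the trace gives a sum of values of the forms of
  \<open>R\<close> and \<open>S\<close> on the columns of \<open>D\<close>; all are nonnegative, so
  all vanish, whence \<open>R ** D\<close> and \<open>S ** D\<close> vanish and
  \<open>D ** D = 0\<close>, which for Hermitian \<open>D\<close> means
  \<open>D = 0\<close>.\<close>

lemma psd_sqrt_unique:
  fixes R S :: "complex^'n^'n"
  assumes R: "psd R" and S: "psd S" and eq: "R ** R = S ** S"
  shows "R = S"
proof -
  define D where "D = R - S"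
  have hD: "adj D = D" using R S by (simp add: D_def adj_diff psd_def hermitian_def)
  have "R ** D + D ** S = 0" using eq by (simp add: D_def mat_mult_simps)
  then have "D ** (R ** D + D ** S) = 0" by (simp add: bounded_bilinear.zero_right[OF bounded_bilinear_matrix_mult])
  then have "D ** (R ** D) + D ** (D ** S) = 0" by (simp only: mat_mult_simps)
  from arg_cong[OF this, of trace]
  have "trace (D ** (R ** D)) + trace (D ** (D ** S)) = 0"
    by (simp only: trace_add) (simp add: trace_def)
  moreover have "trace (D ** (D ** S)) = trace (D ** (S ** D))"
    by (subst trace_mul_sym) (simp only: matrix_mul_assoc)
  moreover have tr: "trace (D ** (K ** D)) = complex_of_real (\<Sum>i\<in>UNIV. qf K (D *v axis i 1))" if "psd K" for K
  proof -
    have "(M :: complex^'n^'n) $ i $ i = cdot (axis i 1) (M *v axis i 1)" for M i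
    proof -
      have "cdot (axis i 1) w = w $ i" for w :: "complex^'n"
        unfolding cdot_def by (subst sum.mono_neutral_right[of UNIV "{i}"]) (auto simp: axis_def)
      moreover have "(M *v axis i 1) $ i = M $ i $ i"
        unfolding matrix_vector_mult_def vec_lambda_beta
        by (subst sum.mono_neutral_right[of UNIV "{i}"]) (auto simp: axis_def)
      ultimately show ?thesis by simp
    qed
    then have "trace (D ** (K ** D)) = (\<Sum>i\<in>UNIV. cdot (axis i 1) (D *v (K *v (D *v axis i 1))))"
      unfolding trace_def by (simp add: matrix_vector_mul_assoc matrix_mul_assoc)
    also have "\<dots> = (\<Sum>i\<in>UNIV. cdot (D *v axis i 1) (K *v (D *v axis i 1)))"
      by (simp add: cdot_mult_left hD)
    finally show ?thesis using that by (simp add: hermitian_cdot_self psd_def)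
  qed
  ultimately have "complex_of_real (\<Sum>i\<in>UNIV. qf R (D *v axis i 1)) + complex_of_real (\<Sum>i\<in>UNIV. qf S (D *v axis i 1)) = 0"
    by (simp only: tr[OF R] tr[OF S])
  then have sum0: "(\<Sum>i\<in>UNIV. qf R (D *v axis i 1)) + (\<Sum>i\<in>UNIV. qf S (D *v axis i 1)) = 0"
    by (simp only: of_real_eq_0_iff flip: of_real_add)
  have nn: "0 \<le> (\<Sum>i\<in>UNIV. qf R (D *v axis i 1))" "0 \<le> (\<Sum>i\<in>UNIV. qf S (D *v axis i 1))"
    using psd_qf_nonneg[OF R] psd_qf_nonneg[OF S] by (auto intro!: sum_nonneg)
  then have "(\<Sum>i\<in>UNIV. qf R (D *v axis i 1)) = 0" "(\<Sum>i\<in>UNIV. qf S (D *v axis i 1)) = 0"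
    using sum0 by linarith+
  then have "qf R (D *v axis i 1) = 0" "qf S (D *v axis i 1) = 0" for i
    using psd_qf_nonneg[OF R] psd_qf_nonneg[OF S] by (auto simp: sum_nonneg_eq_0_iff)
  then have "R *v (D *v axis i 1) = 0" "S *v (D *v axis i 1) = 0" for i
    using psd_qf_zero R S by blast+
  then have DD: "D *v (D *v axis i 1) = 0" for i
    by (subst D_def) (simp add: mult_vec_simps)
  have "D *v axis i 1 = 0" for i
  proof -
    have "cdot (D *v axis i 1) (D *v axis i 1) = cdot (axis i 1) (D *v (D *v axis i 1))"
      by (simp add: cdot_mult_left hD)
    then show ?thesis using DD by (simp add: cdot_self)
  qed
  then have "norm D = 0" using norm_matrix_columns[of D] by simp
  then show ?thesis by (simp add: D_def)
qed

lemma mat_sqrt: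
  assumes "psd A" "det A \<noteq> 0"
  shows "psd (mat_sqrt A)" "mat_sqrt A ** mat_sqrt A = A"
proof -
  have "\<exists>!R. psd R \<and> R ** R = A"
    using psd_sqrt_exists[OF assms] psd_sqrt_unique by blast
  from theI'[OF this] show "psd (mat_sqrt A)" "mat_sqrt A ** mat_sqrt A = A"
    by (simp_all add: mat_sqrt_def)
qed

lemma qf_mat_sqrt:
  assumes "psd A" "det A \<noteq> 0"
  shows "norm (mat_sqrt A *v v) = sqrt (qf A v)"
proof -
  have "qf A v = (norm (mat_sqrt A *v v))\<^sup>2"
    unfolding qf_def
    using mat_sqrt[OF assms] hermitian_cdot[of "mat_sqrt A" v "mat_sqrt A *v v"]
    by (simp add: psd_def cdot_self matrix_vector_mul_assoc)
  then show ?thesis by simp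
qed

lemma mat_inv_sqrt:
  assumes "psd A" "det A \<noteq> 0"
  shows "mat_inv_sqrt A *v (mat_sqrt A *v v) = v" "hermitian (mat_inv_sqrt A)"
proof -
  have "det (mat_sqrt A) \<noteq> 0" using mat_sqrt(2)[OF assms] assms(2) by (metis det_mul mult_zero_left)
  then have inv: "invertible (mat_sqrt A)" by (simp add: invertible_det_nz)
  then have 1: "mat_inv_sqrt A ** mat_sqrt A = mat 1" "mat_sqrt A ** mat_inv_sqrt A = mat 1"
    using invertible_matrix_inv[OF inv] by (simp_all add: mat_inv_sqrt_def)
  then show "mat_inv_sqrt A *v (mat_sqrt A *v v) = v" by (simp add: matrix_vector_mul_assoc)
  have h: "adj (mat_sqrt A) = mat_sqrt A" using mat_sqrt(1)[OF assms] by (simp add: psd_def hermitian_def)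
  have "mat_sqrt A ** adj (mat_inv_sqrt A) = mat 1"
    using arg_cong[OF 1(1), of adj] by (simp add: adj_mult h)
  then have "adj (mat_inv_sqrt A) = mat_inv_sqrt A ** (mat_sqrt A ** mat_inv_sqrt A)"
    by (metis 1 matrix_mul_assoc matrix_mul_lid matrix_mul_rid)
  then show "hermitian (mat_inv_sqrt A)" using 1 by (simp add: hermitian_def)
qed

lemma op_norm_bound: "norm (M *v v) \<le> op_norm M * norm v"
  unfolding op_norm_def
  by (rule onorm[OF bounded_bilinear.bounded_linear_right[OF bounded_bilinear_mult_vec]])

text \<open>Inserting the square roots and their inverses on both sides of \<open>J\<close> produces
  the matrix whose operator norm defines \<open>c_fun\<close>; this estimate is the reason for the
  form of \<open>c_fun\<close>.\<close>

lemma sandwich_cdot_bound: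
  fixes A H J :: "complex^'n^'n"
  assumes "psd A" "psd H" "det (A ** H) \<noteq> 0"
  shows "cmod (cdot p (J *v u)) \<le> op_norm (mat_inv_sqrt A ** J ** mat_inv_sqrt H) * (sqrt (qf A p) * sqrt (qf H u))"
proof -
  have dA: "det A \<noteq> 0" and dH: "det H \<noteq> 0" using assms(3) by (auto simp: det_mul)
  let ?P = "mat_inv_sqrt A" and ?Q = "mat_inv_sqrt H"
  have "cdot p (J *v u) = cdot (?P *v (mat_sqrt A *v p)) (J *v (?Q *v (mat_sqrt H *v u)))"
    by (simp add: mat_inv_sqrt assms dA dH)
  also have "\<dots> = cdot (mat_sqrt A *v p) (?P *v (J *v (?Q *v (mat_sqrt H *v u))))"
    using mat_inv_sqrt(2)[OF assms(1) dA] by (simp add: hermitian_cdot)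
  also have "\<dots> = cdot (mat_sqrt A *v p) ((?P ** J ** ?Q) *v (mat_sqrt H *v u))"
    by (simp add: matrix_vector_mul_assoc matrix_mul_assoc)
  also have "cmod \<dots> \<le> norm (mat_sqrt A *v p) * (op_norm (?P ** J ** ?Q) * norm (mat_sqrt H *v u))"
    by (rule order_trans[OF norm_cdot_le mult_left_mono[OF op_norm_bound]]) simp
  finally show ?thesis
    by (simp add: qf_mat_sqrt assms dA dH mult_ac)
qed

section \<open>Square-integrable functions with a matrix weight\<close>

lemma bilinear_lebesgue_measurable:
  fixes h :: "'a::euclidean_space \<Rightarrow> 'b::euclidean_space \<Rightarrow> 'c::euclidean_space"
    and f :: "real \<Rightarrow> 'a"
  assumes "bounded_bilinear h" "f \<in> borel_measurable lebesgue" "g \<in> borel_measurable lebesgue"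
  shows "(\<lambda>x. h (f x) (g x)) \<in> borel_measurable lebesgue"
  using borel_measurable_bilinear[of h f UNIV g] assms
  by (simp add: bilinear_conv_bounded_bilinear lebesgue_on_UNIV_eq)

lemma borel_imp_lebesgue_measurable:
  "f \<in> borel_measurable borel \<Longrightarrow> f \<in> borel_measurable lebesgue"
  by (simp add: measurable_completion)

text \<open>\<open>L2_fun\<close> asks for Borel functions, whereas limits and selections made with
  the coefficients are only Lebesgue measurable.\<close>

lemma lebesgue_measurable_ex_borel:
  fixes g :: "real \<Rightarrow> 'a::euclidean_space"
  assumes "g \<in> borel_measurable lebesgue"
  shows "\<exists>f\<in>borel_measurable borel. AE x in lebesgue. g x = f x"
proof -
  have "\<exists>f\<in>borel_measurable lborel. AE x in lborel. g x \<bullet> b = f x" for b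
    by (rule completion_ex_borel_measurable_real) (use assms in measurable)
  then obtain F where F: "\<And>b. F b \<in> borel_measurable lborel" "\<And>b. AE x in lborel. g x \<bullet> b = F b x"
    by metis
  have "AE x in lebesgue. \<forall>b\<in>Basis. g x \<bullet> b = F b x"
    by (rule AE_finite_allI[OF finite_Basis]) (use AE_completion[OF F(2)] in auto)
  then have "AE x in lebesgue. g x = (\<Sum>b\<in>Basis. F b x *\<^sub>R b)"
  proof eventually_elim
    case (elim x)
    then have "(\<Sum>b\<in>Basis. F b x *\<^sub>R b) = (\<Sum>b\<in>Basis. (g x \<bullet> b) *\<^sub>R b)" by (intro sum.cong) auto
    then show ?case by (simp add: euclidean_representation)
  qed
  moreover have "(\<lambda>x. \<Sum>b\<in>Basis. F b x *\<^sub>R b) \<in> borel_measurable borel" using F(1) by simp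
  ultimately show ?thesis by (intro bexI[where x = "\<lambda>x. \<Sum>b\<in>Basis. F b x *\<^sub>R b"])
qed

lemma qf_parallelogram: "qf K (v + w) + qf K (v - w) = 2 * qf K v + 2 * qf K w"
  by (simp add: qf_def mult_vec_simps cdot_add_left cdot_add_right cdot_diff_left cdot_diff_right)

lemma qf_minus: "qf K (- v) = qf K v"
  by (simp add: qf_def mult_vec_simps cdot_minus_left cdot_minus_right)

lemma qf_smult: "qf K (c *s v) = (cmod c)\<^sup>2 * qf K v"
proof -
  have "cdot (c *s v) (K *v (c *s v)) = complex_of_real ((cmod c)\<^sup>2) * cdot v (K *v v)"
    by (simp only: vector_scalar_commute cdot_smult_left cdot_smult_right complex_norm_square) (simp add: mult_ac)
  then show ?thesis by (simp add: qf_def)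
qed

lemma qf_zero [simp]: "qf K 0 = 0" by (simp add: qf_def)

lemma scaleR_eq_smult: "r *\<^sub>R (v :: complex^'n) = complex_of_real r *s v"
  unfolding vec_eq_iff vector_scaleR_component vector_smult_component by (simp add: scaleR_conv_of_real)

lemma psd_sqrt_qf_triangle:
  assumes "psd K"
  shows "sqrt (qf K (v + w)) \<le> sqrt (qf K v) + sqrt (qf K w)"
proof -
  note nn = psd_qf_nonneg[OF assms]
  have "qf K (v + w) = qf K v + 2 * Re (cdot v (K *v w)) + qf K w"
    using qf_add_scale[of K v 1 w] assms by (simp add: psd_def)
  also have "\<dots> \<le> qf K v + 2 * (sqrt (qf K v) * sqrt (qf K w)) + qf K w"
    using psd_cauchy_schwarz_sqrt[OF assms, of v w] complex_Re_le_cmod[of "cdot v (K *v w)"] by linarith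
  also have "\<dots> = (sqrt (qf K v) + sqrt (qf K w))\<^sup>2"
    using nn by (simp add: power2_sum)
  finally show ?thesis using nn by (simp add: real_le_lsqrt)
qed

section \<open>The semi-inner product space of a matrix weight\<close>

locale weight =
  fixes H :: "real \<Rightarrow> complex^'m^'m"
  assumes H_meas: "H \<in> borel_measurable lebesgue" and H_psd: "AE x in lebesgue. psd (H x)"
begin

definition nrm2 :: "(real \<Rightarrow> complex^'m) \<Rightarrow> real" where
  "nrm2 f = (LINT x|lebesgue. qf (H x) (f x))"

lemma sesq_measurable:
  assumes "f \<in> borel_measurable lebesgue" "g \<in> borel_measurable lebesgue"
  shows "(\<lambda>x. cdot (f x) (H x *v g x)) \<in> borel_measurable lebesgue"
  by (rule bilinear_lebesgue_measurable[OF bounded_bilinear_cdot assms(1)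
        bilinear_lebesgue_measurable[OF bounded_bilinear_mult_vec H_meas assms(2)]])

lemma qf_measurable:
  assumes "f \<in> borel_measurable lebesgue"
  shows "(\<lambda>x. qf (H x) (f x)) \<in> borel_measurable lebesgue"
  unfolding qf_def using sesq_measurable[OF assms assms] by simp

lemma cdot_eq_qf_AE: "AE x in lebesgue. cdot (f x) (H x *v f x) = complex_of_real (qf (H x) (f x))"
  using H_psd by eventually_elim (simp add: hermitian_cdot_self psd_def)

lemma qf_nonneg_AE: "AE x in lebesgue. 0 \<le> qf (H x) (f x)"
  using H_psd by eventually_elim (rule psd_qf_nonneg)

lemma integrable_qf_iff:
  assumes "f \<in> borel_measurable lebesgue"
  shows "integrable lebesgue (\<lambda>x. cdot (f x) (H x *v f x)) \<longleftrightarrow> integrable lebesgue (\<lambda>x. qf (H x) (f x))"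
proof
  assume "integrable lebesgue (\<lambda>x. cdot (f x) (H x *v f x))"
  then show "integrable lebesgue (\<lambda>x. qf (H x) (f x))" unfolding qf_def by (rule integrable_Re)
next
  assume "integrable lebesgue (\<lambda>x. qf (H x) (f x))"
  then have "integrable lebesgue (\<lambda>x. complex_of_real (qf (H x) (f x)))" by simp
  then show "integrable lebesgue (\<lambda>x. cdot (f x) (H x *v f x))"
    by (rule integrable_cong_AE_imp[OF _ sesq_measurable[OF assms assms]])
       (use cdot_eq_qf_AE[of f] in eventually_elim, simp)
qed

lemma L2_iff: "f \<in> L2_fun H \<longleftrightarrow> f \<in> borel_measurable borel \<and> integrable lebesgue (\<lambda>x. qf (H x) (f x))"
  using integrable_qf_iff[OF borel_imp_lebesgue_measurable] by (auto simp: L2_fun_def)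

lemma L2_measurable: "f \<in> L2_fun H \<Longrightarrow> f \<in> borel_measurable borel"
  and L2_lebesgue_measurable: "f \<in> L2_fun H \<Longrightarrow> f \<in> borel_measurable lebesgue"
  and L2_qf: "f \<in> L2_fun H \<Longrightarrow> integrable lebesgue (\<lambda>x. qf (H x) (f x))"
  by (auto simp: L2_iff borel_imp_lebesgue_measurable)

text \<open>Stated for arbitrary \<open>f\<close>, because distances are defined through chosen
  representatives of arbitrary sets; when the integrands are not integrable, both sides are
  \<open>0\<close>.\<close>

lemma form_self: "form H f f = complex_of_real (nrm2 f)"
proof -
  have "form H f f = (LINT x|lebesgue. complex_of_real (qf (H x) (f x)))" if "f \<in> borel_measurable lebesgue"
    unfolding form_def
    by (rule integral_cong_AE[OF sesq_measurable[OF that that] _ cdot_eq_qf_AE])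
       (use qf_measurable[OF that] in simp)
  moreover have "form H f f = (LINT x|lebesgue. complex_of_real (qf (H x) (f x)))" if "f \<notin> borel_measurable lebesgue"
  proof (cases "integrable lebesgue (\<lambda>x. cdot (f x) (H x *v f x))")
    case True
    then have 1: "integrable lebesgue (\<lambda>x. qf (H x) (f x))" unfolding qf_def by (rule integrable_Re)
    show ?thesis
      unfolding form_def by (rule integral_cong_AE[OF _ _ cdot_eq_qf_AE]) (use True 1 in auto)
  next
    case False
    have "\<not> integrable lebesgue (\<lambda>x. qf (H x) (f x))"
    proof
      assume "integrable lebesgue (\<lambda>x. qf (H x) (f x))"
      then have i: "integrable lebesgue (\<lambda>x. complex_of_real (qf (H x) (f x)))" by simp
      have "(\<lambda>x. cdot (f x) (H x *v f x)) \<in> borel_measurable lebesgue"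
        by (rule borel_measurable_AE[OF borel_measurable_integrable[OF i]])
           (use cdot_eq_qf_AE[of f] in eventually_elim, simp)
      from integrable_cong_AE_imp[OF i this] have "integrable lebesgue (\<lambda>x. cdot (f x) (H x *v f x))"
        using cdot_eq_qf_AE[of f] by (simp add: eventually_mono)
      with False show False by simp
    qed
    then show ?thesis using False unfolding form_def
      by (simp add: not_integrable_integral_eq complex_of_real_integrable_eq)
  qed
  ultimately show ?thesis unfolding nrm2_def by (cases "f \<in> borel_measurable lebesgue") auto
qed

lemma nrm2_nonneg: "0 \<le> nrm2 f"
  unfolding nrm2_def by (rule integral_nonneg_AE) (rule qf_nonneg_AE)

lemma L2_bound:
  assumes "f \<in> borel_measurable borel" "integrable lebesgue G" "AE x in lebesgue. qf (H x) (f x) \<le> G x"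
  shows "f \<in> L2_fun H"
  unfolding L2_iff
proof
  show "integrable lebesgue (\<lambda>x. qf (H x) (f x))"
    by (rule Bochner_Integration.integrable_bound[OF assms(2) qf_measurable[OF borel_imp_lebesgue_measurable[OF assms(1)]]])
       (use assms(3) qf_nonneg_AE[of f] in eventually_elim, simp)
qed fact

lemma L2_add: "f \<in> L2_fun H \<Longrightarrow> g \<in> L2_fun H \<Longrightarrow> (\<lambda>x. f x + g x) \<in> L2_fun H"
proof -
  assume f: "f \<in> L2_fun H" and g: "g \<in> L2_fun H"
  show ?thesis
  proof (rule L2_bound)
    show "integrable lebesgue (\<lambda>x. 2 * qf (H x) (f x) + 2 * qf (H x) (g x))"
      using L2_qf[OF f] L2_qf[OF g] by simp
    show "AE x in lebesgue. qf (H x) (f x + g x) \<le> 2 * qf (H x) (f x) + 2 * qf (H x) (g x)"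
      using qf_nonneg_AE[of "\<lambda>x. f x - g x"]
      by eventually_elim (use qf_parallelogram in smt)
  qed (use L2_measurable[OF f] L2_measurable[OF g] in measurable)
qed

lemma L2_smult: "f \<in> L2_fun H \<Longrightarrow> (\<lambda>x. c *s f x) \<in> L2_fun H"
proof -
  assume f: "f \<in> L2_fun H"
  show ?thesis
  proof (rule L2_bound)
    show "integrable lebesgue (\<lambda>x. (cmod c)\<^sup>2 * qf (H x) (f x))" using L2_qf[OF f] by simp
    have "continuous_on UNIV (\<lambda>v :: complex^'m. c *s v)"
      unfolding vector_scalar_mult_def by (intro continuous_intros)
    then show "(\<lambda>x. c *s f x) \<in> borel_measurable borel"
      using L2_measurable[OF f] by (metis borel_measurable_continuous_onI measurable_compose)
  qed (simp add: qf_smult)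
qed

lemma L2_scaleR: "f \<in> L2_fun H \<Longrightarrow> (\<lambda>x. r *\<^sub>R f x) \<in> L2_fun H"
  unfolding scaleR_eq_smult by (rule L2_smult)

lemma L2_minus: "f \<in> L2_fun H \<Longrightarrow> (\<lambda>x. - f x) \<in> L2_fun H"
  using L2_scaleR[of f "-1"] by simp

lemma L2_diff: "f \<in> L2_fun H \<Longrightarrow> g \<in> L2_fun H \<Longrightarrow> (\<lambda>x. f x - g x) \<in> L2_fun H"
  using L2_add[OF _ L2_minus, of f g] by simp

lemma L2_zero: "(\<lambda>x. 0) \<in> L2_fun H"
  by (simp add: L2_iff)

lemma L2_sesq_integrable:
  assumes f: "f \<in> L2_fun H" and g: "g \<in> L2_fun H"
  shows "integrable lebesgue (\<lambda>x. cdot (f x) (H x *v g x))"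
proof (rule Bochner_Integration.integrable_bound)
  show "integrable lebesgue (\<lambda>x. qf (H x) (f x) + qf (H x) (g x))"
    using L2_qf[OF f] L2_qf[OF g] by simp
  show "(\<lambda>x. cdot (f x) (H x *v g x)) \<in> borel_measurable lebesgue"
    by (rule sesq_measurable[OF L2_lebesgue_measurable[OF f] L2_lebesgue_measurable[OF g]])
  show "AE x in lebesgue. norm (cdot (f x) (H x *v g x)) \<le> norm (qf (H x) (f x) + qf (H x) (g x))"
    using H_psd
  proof eventually_elim
    case (elim x)
    have "cmod (cdot (f x) (H x *v g x)) \<le> sqrt (qf (H x) (f x)) * sqrt (qf (H x) (g x))"
      by (rule psd_cauchy_schwarz_sqrt[OF elim])
    also have "\<dots> \<le> (qf (H x) (f x) + qf (H x) (g x)) / 2"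
      using arith_geo_mean_sqrt[of "qf (H x) (f x)" "qf (H x) (g x)"] psd_qf_nonneg[OF elim]
      by (simp add: real_sqrt_mult)
    also have "\<dots> \<le> norm (qf (H x) (f x) + qf (H x) (g x))"
      using psd_qf_nonneg[OF elim] by simp
    finally show ?case .
  qed
qed

lemma form_add_left: "f \<in> L2_fun H \<Longrightarrow> g \<in> L2_fun H \<Longrightarrow> h \<in> L2_fun H \<Longrightarrow>
    form H (\<lambda>x. f x + g x) h = form H f h + form H g h"
  unfolding form_def by (simp add: cdot_add_left L2_sesq_integrable)

lemma form_diff_left: "f \<in> L2_fun H \<Longrightarrow> g \<in> L2_fun H \<Longrightarrow> h \<in> L2_fun H \<Longrightarrow>
    form H (\<lambda>x. f x - g x) h = form H f h - form H g h"
  unfolding form_def by (simp add: cdot_diff_left L2_sesq_integrable)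

lemma form_cnj: "f \<in> L2_fun H \<Longrightarrow> g \<in> L2_fun H \<Longrightarrow> form H g f = cnj (form H f g)"
proof -
  assume f: "f \<in> L2_fun H" and g: "g \<in> L2_fun H"
  have "AE x in lebesgue. cdot (g x) (H x *v f x) = cnj (cdot (f x) (H x *v g x))"
    using H_psd by eventually_elim (metis cnj_cdot hermitian_cdot psd_def)
  moreover have "(\<lambda>x. cnj (cdot (f x) (H x *v g x))) \<in> borel_measurable lebesgue"
    by (rule borel_measurable_integrable) (simp add: L2_sesq_integrable f g)
  ultimately have "form H g f = (LINT x|lebesgue. cnj (cdot (f x) (H x *v g x)))"
    unfolding form_def
    by (intro integral_cong_AE borel_measurable_integrable[OF L2_sesq_integrable[OF g f]])
  then show ?thesis unfolding form_def by simp
qed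

lemma form_add_right: "f \<in> L2_fun H \<Longrightarrow> g \<in> L2_fun H \<Longrightarrow> h \<in> L2_fun H \<Longrightarrow>
    form H h (\<lambda>x. f x + g x) = form H h f + form H h g"
  unfolding form_def by (simp add: cdot_add_right mult_vec_simps L2_sesq_integrable)

lemma form_diff_right: "f \<in> L2_fun H \<Longrightarrow> g \<in> L2_fun H \<Longrightarrow> h \<in> L2_fun H \<Longrightarrow>
    form H h (\<lambda>x. f x - g x) = form H h f - form H h g"
  unfolding form_def by (simp add: cdot_diff_right mult_vec_simps L2_sesq_integrable)

lemma form_smult_left: "form H (\<lambda>x. c *s f x) h = cnj c * form H f h"
  and form_smult_right: "form H h (\<lambda>x. c *s f x) = c * form H h f"
  unfolding form_def by (simp_all add: cdot_smult_left cdot_smult_right vector_scalar_commute)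

lemma nrm2_smult: "nrm2 (\<lambda>x. c *s f x) = (cmod c)\<^sup>2 * nrm2 f"
  unfolding nrm2_def by (simp add: qf_smult)

lemma nrm2_minus: "nrm2 (\<lambda>x. f x - g x) = nrm2 (\<lambda>x. g x - f x)"
  unfolding nrm2_def using qf_minus[of _ "f _ - g _"] by simp

lemma nrm2_add: "f \<in> L2_fun H \<Longrightarrow> g \<in> L2_fun H \<Longrightarrow>
    nrm2 (\<lambda>x. f x + g x) = nrm2 f + 2 * Re (form H f g) + nrm2 g"
proof -
  assume f: "f \<in> L2_fun H" and g: "g \<in> L2_fun H"
  have "form H (\<lambda>x. f x + g x) (\<lambda>x. f x + g x) = form H f f + form H f g + (cnj (form H f g) + form H g g)"
    using f g L2_add[OF f g] form_cnj[OF f g] by (simp add: form_add_left form_add_right)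
  then have "Re (form H (\<lambda>x. f x + g x) (\<lambda>x. f x + g x)) = Re (form H f f) + 2 * Re (form H f g) + Re (form H g g)"
    by simp
  then show ?thesis by (simp add: form_self)
qed

lemma form_cauchy_schwarz:
  assumes f: "f \<in> L2_fun H" and g: "g \<in> L2_fun H"
  shows "(cmod (form H f g))\<^sup>2 \<le> nrm2 f * nrm2 g"
proof -
  define z where "z = form H f g"
  define e where "e = (if z = 0 then 1 else cnj z / cmod z)"
  have e: "cmod e = 1" "e * z = cmod z"
    by (auto simp: e_def norm_divide complex_norm_square[symmetric] mult.commute power2_eq_square divide_simps)
  have "0 \<le> nrm2 f + 2 * t * cmod z + t\<^sup>2 * nrm2 g" for t
  proof -
    have "0 \<le> nrm2 (\<lambda>x. f x + (complex_of_real t * e) *s g x)" by (rule nrm2_nonneg)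
    also have "\<dots> = nrm2 f + 2 * Re (t * (e * z)) + t\<^sup>2 * nrm2 g"
      by (simp only: nrm2_add[OF f L2_smult[OF g]] form_smult_right nrm2_smult)
         (simp add: z_def mult.assoc norm_mult e(1) power_mult_distrib)
    also have "\<dots> = nrm2 f + 2 * t * cmod z + t\<^sup>2 * nrm2 g" by (simp only: e(2)) simp
    finally show ?thesis .
  qed
  from quadratic_nonneg_discriminant[OF this nrm2_nonneg] show ?thesis by (simp add: z_def)
qed

lemma form_cauchy_schwarz_sqrt:
  "f \<in> L2_fun H \<Longrightarrow> g \<in> L2_fun H \<Longrightarrow> cmod (form H f g) \<le> sqrt (nrm2 f) * sqrt (nrm2 g)"
  using form_cauchy_schwarz by (simp add: real_le_rsqrt flip: real_sqrt_mult)

lemma sqrt_nrm2_triangle: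
  assumes f: "f \<in> L2_fun H" and g: "g \<in> L2_fun H"
  shows "sqrt (nrm2 (\<lambda>x. f x + g x)) \<le> sqrt (nrm2 f) + sqrt (nrm2 g)"
proof -
  have "nrm2 (\<lambda>x. f x + g x) \<le> nrm2 f + 2 * (sqrt (nrm2 f) * sqrt (nrm2 g)) + nrm2 g"
    unfolding nrm2_add[OF f g]
    using form_cauchy_schwarz_sqrt[OF f g] complex_Re_le_cmod[of "form H f g"] by linarith
  also have "\<dots> = (sqrt (nrm2 f) + sqrt (nrm2 g))\<^sup>2"
    using nrm2_nonneg by (simp add: power2_sum)
  finally show ?thesis using nrm2_nonneg by (simp add: real_le_lsqrt)
qed

lemma nrm2_parallelogram:
  assumes f: "f \<in> L2_fun H" and g: "g \<in> L2_fun H"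
  shows "nrm2 (\<lambda>x. f x + g x) + nrm2 (\<lambda>x. f x - g x) = 2 * nrm2 f + 2 * nrm2 g"
proof -
  have "nrm2 (\<lambda>x. f x - g x) = nrm2 f - 2 * Re (form H f g) + nrm2 g"
    using nrm2_add[OF f L2_smult[OF g, of "-1"]] nrm2_smult[of "-1" g] form_smult_right[of f "-1" g]
    by simp
  then show ?thesis using nrm2_add[OF f g] by simp
qed

section \<open>The quotient metric space\<close>

lemma L2_rel_iff: "(f, g) \<in> L2_rel H \<longleftrightarrow> f \<in> L2_fun H \<and> g \<in> L2_fun H \<and> nrm2 (\<lambda>x. f x - g x) = 0"
  by (simp add: L2_rel_def form_self)

lemma nrm2_diff_trans:
  assumes "f \<in> L2_fun H" "g \<in> L2_fun H" "h \<in> L2_fun H"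
  shows "sqrt (nrm2 (\<lambda>x. f x - h x)) \<le> sqrt (nrm2 (\<lambda>x. f x - g x)) + sqrt (nrm2 (\<lambda>x. g x - h x))"
  using sqrt_nrm2_triangle[OF L2_diff[OF assms(1,2)] L2_diff[OF assms(2,3)]] by simp

lemma equiv_L2_rel: "equiv (L2_fun H) (L2_rel H)"
proof (rule equivI)
  show "L2_rel H \<subseteq> L2_fun H \<times> L2_fun H" by (auto simp: L2_rel_iff)
  show "refl_on (L2_fun H) (L2_rel H)" by (auto simp: refl_on_def L2_rel_iff nrm2_def)
  show "sym (L2_rel H)" by (auto simp: sym_def L2_rel_iff) (metis nrm2_minus)
  show "trans (L2_rel H)"
  proof (rule transI)
    fix f g h assume "(f, g) \<in> L2_rel H" "(g, h) \<in> L2_rel H"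
    then show "(f, h) \<in> L2_rel H"
      using nrm2_diff_trans[of f g h] nrm2_nonneg[of "\<lambda>x. f x - h x"] by (auto simp: L2_rel_iff)
  qed
qed

lemma L2_class_eq_iff:
  "f \<in> L2_fun H \<Longrightarrow> g \<in> L2_fun H \<Longrightarrow> L2_class H f = L2_class H g \<longleftrightarrow> nrm2 (\<lambda>x. f x - g x) = 0"
  unfolding L2_class_def using eq_equiv_class_iff[OF equiv_L2_rel, of f g] by (simp add: L2_rel_iff)

lemma L2_class_in_space: "f \<in> L2_fun H \<Longrightarrow> L2_class H f \<in> L2_space H"
  unfolding L2_class_def L2_space_def by (rule quotientI)

lemma L2_space_cases:
  assumes "u \<in> L2_space H"
  obtains f where "f \<in> L2_fun H" "u = L2_class H f"
  using assms unfolding L2_class_def L2_space_def by (rule quotientE)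

lemma L2_rep:
  assumes f: "f \<in> L2_fun H"
  defines "r \<equiv> SOME g. g \<in> L2_class H f"
  shows "r \<in> L2_fun H" "nrm2 (\<lambda>x. f x - r x) = 0"
proof -
  have "f \<in> L2_class H f" unfolding L2_class_def by (rule equiv_class_self[OF equiv_L2_rel f])
  then have "r \<in> L2_class H f" unfolding r_def by (rule someI[where P = "\<lambda>g. g \<in> L2_class H f"])
  then show "r \<in> L2_fun H" "nrm2 (\<lambda>x. f x - r x) = 0" by (simp_all add: L2_class_def L2_rel_iff)
qed

lemma form_cong_nrm2:
  assumes "f \<in> L2_fun H" "f' \<in> L2_fun H" "g \<in> L2_fun H" "g' \<in> L2_fun H"
    "nrm2 (\<lambda>x. f x - f' x) = 0" "nrm2 (\<lambda>x. g x - g' x) = 0"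
  shows "form H f g = form H f' g'"
proof -
  have "form H (\<lambda>x. f x - f' x) g = 0"
    using form_cauchy_schwarz[OF L2_diff[OF assms(1,2)] assms(3)] assms(5) by simp
  moreover have "form H f' (\<lambda>x. g x - g' x) = 0"
    using form_cauchy_schwarz[OF assms(2) L2_diff[OF assms(3,4)]] assms(6) by simp
  ultimately show ?thesis using assms(1-4) by (simp add: form_diff_left form_diff_right)
qed

lemma L2_inner_class:
  assumes "f \<in> L2_fun H" "g \<in> L2_fun H"
  shows "L2_inner H (L2_class H f) (L2_class H g) = form H f g"
  unfolding L2_inner_def by (rule form_cong_nrm2[symmetric]) (simp_all add: L2_rep assms)

lemma L2_dist_class:
  assumes f: "f \<in> L2_fun H" and g: "g \<in> L2_fun H"
  shows "L2_dist H (L2_class H f) (L2_class H g) = sqrt (nrm2 (\<lambda>x. f x - g x))"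
proof -
  let ?f = "SOME h. h \<in> L2_class H f" and ?g = "SOME h. h \<in> L2_class H g"
  note rf = L2_rep[OF f] and rg = L2_rep[OF g]
  have "sqrt (nrm2 (\<lambda>x. f x - g x)) \<le> sqrt (nrm2 (\<lambda>x. ?f x - ?g x))"
    using nrm2_diff_trans[OF f rf(1) g] nrm2_diff_trans[OF rf(1) rg(1) g] rf(2) rg(2) nrm2_minus[of ?g g] by simp
  moreover have "sqrt (nrm2 (\<lambda>x. ?f x - ?g x)) \<le> sqrt (nrm2 (\<lambda>x. f x - g x))"
    using nrm2_diff_trans[OF rf(1) f rg(1)] nrm2_diff_trans[OF f g rg(1)] rf(2) rg(2) nrm2_minus[of ?f f] by simp
  ultimately show ?thesis unfolding L2_dist_def Let_def form_self by simp
qed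

lemma Metric_space_L2: "Metric_space (L2_space H) (L2_dist H)"
proof
  show "0 \<le> L2_dist H u v" for u v by (simp add: L2_dist_def Let_def form_self nrm2_nonneg)
  show "L2_dist H u v = L2_dist H v u" for u v
    unfolding L2_dist_def Let_def form_self
    using nrm2_minus[of "SOME f. f \<in> u" "SOME g. g \<in> v"] by simp
  show "L2_dist H u v = 0 \<longleftrightarrow> u = v" if "u \<in> L2_space H" "v \<in> L2_space H" for u v
    using that by (elim L2_space_cases) (simp add: L2_dist_class L2_class_eq_iff)
  show "L2_dist H u w \<le> L2_dist H u v + L2_dist H v w"
    if "u \<in> L2_space H" "v \<in> L2_space H" "w \<in> L2_space H" for u v w
    using that by (elim L2_space_cases) (simp add: L2_dist_class nrm2_diff_trans)
qed

text \<open>The product topology comes from the Euclidean combination of the two distances, whose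
  square is this sum of squared seminorms; closures can thus be tested on representatives.\<close>

lemma closure_of_L2_prod:
  assumes "f \<in> L2_fun H" "g \<in> L2_fun H" "S \<subseteq> L2_space H \<times> L2_space H"
  shows "(L2_class H f, L2_class H g) \<in> prod_topology (L2_topology H) (L2_topology H) closure_of S \<longleftrightarrow>
    (\<forall>e>0. \<exists>f' g'. f' \<in> L2_fun H \<and> g' \<in> L2_fun H \<and> (L2_class H f', L2_class H g') \<in> S \<and>
       nrm2 (\<lambda>x. f x - f' x) + nrm2 (\<lambda>x. g x - g' x) < e)"
proof -
  interpret Metric_space "L2_space H" "L2_dist H" by (rule Metric_space_L2)
  interpret M12: Metric_space12 "L2_space H" "L2_dist H" "L2_space H" "L2_dist H" ..
  have top: "prod_topology (L2_topology H) (L2_topology H) = M12.Prod_metric.mtopology"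
    unfolding L2_topology_def by (rule M12.mtopology_prod_metric[symmetric])
  show ?thesis
    unfolding top M12.Prod_metric.metric_closure_of mem_Collect_eq
  proof (intro iffI conjI allI impI; (elim conjE)?)
    fix e :: real assume e: "e > 0"
      and "\<forall>r>0. \<exists>y\<in>S. y \<in> M12.Prod_metric.mball (L2_class H f, L2_class H g) r"
    then obtain y where y: "y \<in> S" "y \<in> M12.Prod_metric.mball (L2_class H f, L2_class H g) (sqrt e)"
      by (metis real_sqrt_gt_zero)
    obtain f' g' where fg: "f' \<in> L2_fun H" "g' \<in> L2_fun H" "y = (L2_class H f', L2_class H g')"
    proof -
      obtain u v where uv: "y = (u, v)" by (cases y)
      then have "u \<in> L2_space H" "v \<in> L2_space H" using y(1) assms(3) by auto
      then show ?thesis using uv that by (metis L2_space_cases)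
    qed
    have "prod_dist (L2_dist H) (L2_dist H) (L2_class H f, L2_class H g) y < sqrt e"
      using y(2) by simp
    then have "nrm2 (\<lambda>x. f x - f' x) + nrm2 (\<lambda>x. g x - g' x) < e"
      by (simp add: fg prod_dist_def L2_dist_class assms nrm2_nonneg)
    then show "\<exists>f' g'. f' \<in> L2_fun H \<and> g' \<in> L2_fun H \<and> (L2_class H f', L2_class H g') \<in> S \<and>
       nrm2 (\<lambda>x. f x - f' x) + nrm2 (\<lambda>x. g x - g' x) < e" using fg y(1) by blast
  next
    show "(L2_class H f, L2_class H g) \<in> L2_space H \<times> L2_space H"
      using assms L2_class_in_space by blast
  next
    fix r :: real assume r: "r > 0"
      and *: "\<forall>e>0. \<exists>f' g'. f' \<in> L2_fun H \<and> g' \<in> L2_fun H \<and> (L2_class H f', L2_class H g') \<in> S \<and>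
       nrm2 (\<lambda>x. f x - f' x) + nrm2 (\<lambda>x. g x - g' x) < e"
    from *[rule_format, of "r\<^sup>2"] r obtain f' g' where fg: "f' \<in> L2_fun H" "g' \<in> L2_fun H"
      "(L2_class H f', L2_class H g') \<in> S" "nrm2 (\<lambda>x. f x - f' x) + nrm2 (\<lambda>x. g x - g' x) < r\<^sup>2" by auto
    have "prod_dist (L2_dist H) (L2_dist H) (L2_class H f, L2_class H g) (L2_class H f', L2_class H g') < r"
      using fg r by (simp add: prod_dist_def L2_dist_class assms nrm2_nonneg real_less_lsqrt)
    then show "\<exists>y\<in>S. y \<in> M12.Prod_metric.mball (L2_class H f, L2_class H g) r"
      using fg assms L2_class_in_space by (intro bexI[of _ "(L2_class H f', L2_class H g')"]) auto
  qed
qed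

end

text \<open>The form controls \<open>v k\<close> only modulo the kernel of \<open>K\<close>, so
  \<open>v k\<close> itself need not converge, but \<open>K *v v k\<close> does, and its limit stays
  in the range because finite-dimensional subspaces are closed. Any preimage \<open>w\<close> of the
  limit then serves as a limit of \<open>v\<close> in the seminorm.\<close>

lemma psd_fast_cauchy:
  fixes K :: "complex^'n^'n" and v :: "nat \<Rightarrow> complex^'n"
  assumes K: "psd K" and G: "G \<ge> 0" and step: "\<And>k. qf K (v (Suc k) - v k) \<le> G * (1/4)^k"
  shows "(\<lambda>k. K *v v k) \<longlonglongrightarrow> lim (\<lambda>k. K *v v k)" "lim (\<lambda>k. K *v v k) \<in> range ((*v) K)"
    and "K *v w = lim (\<lambda>k. K *v v k) \<Longrightarrow> qf K (v k - w) \<le> 4 * G * (1/4)^k"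
proof -
  define N where "N u = sqrt (qf K u)" for u
  define s where "s = sqrt G"
  have s: "s \<ge> 0" "s\<^sup>2 = G" using G by (auto simp: s_def)
  have step': "N (v (Suc k) - v k) \<le> s * (1/2)^k" for k
  proof -
    have "sqrt (G * (1/4)^k) = s * (1/2)^k"
      by (simp add: s_def real_sqrt_mult real_sqrt_power real_sqrt_divide)
    then show ?thesis using real_sqrt_le_mono[OF step[of k]] by (simp add: N_def)
  qed
  have tail: "N (v (k + j) - v k) \<le> 2 * s * (1/2)^k * (1 - (1/2)^j)" for k j
  proof (induction j)
    case (Suc j)
    have "N (v (k + Suc j) - v k) \<le> N (v (k + j) - v k) + N (v (Suc (k + j)) - v (k + j))"
      using psd_sqrt_qf_triangle[OF K, of "v (k + j) - v k" "v (Suc (k + j)) - v (k + j)"] by (simp add: N_def)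
    also have "\<dots> \<le> 2 * s * (1/2)^k * (1 - (1/2)^j) + s * (1/2)^(k + j)"
      using Suc step'[of "k + j"] by linarith
    also have "\<dots> = 2 * s * (1/2)^k * (1 - (1/2)^Suc j)"
      by (simp add: power_add algebra_simps)
    finally show ?case .
  qed (simp add: N_def)
  obtain L where L: "L > 0" "\<forall>(K::complex^'n^'n) v. norm (K *v v) \<le> norm K * L * norm v"
    using qf_norm_bound by blast
  define C where "C = sqrt (norm K * L)"
  have KN: "norm (K *v u) \<le> C * N u" for u
  proof -
    have "(norm (K *v u))\<^sup>2 \<le> (norm K * L) * qf K u"
      by (rule psd_norm_mult_le[OF K qf_le_norm]) (use L in auto)
    then show ?thesis by (simp add: C_def N_def real_le_rsqrt flip: real_sqrt_mult)
  qed
  have C0: "C \<ge> 0" using L by (simp add: C_def)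
  have "summable (\<lambda>k. K *v v (Suc k) - K *v v k)"
  proof (rule summable_comparison_test')
    show "summable (\<lambda>k. C * (s * (1/2)^k))" by (intro summable_mult summable_geometric) simp
    show "norm (K *v v (Suc k) - K *v v k) \<le> C * (s * (1/2)^k)" for k
    proof -
      have "norm (K *v (v (Suc k) - v k)) \<le> C * N (v (Suc k) - v k)" by (rule KN)
      also have "\<dots> \<le> C * (s * (1/2)^k)" by (rule mult_left_mono[OF step' C0])
      finally show ?thesis by (simp add: mult_vec_simps)
    qed
  qed
  then have "(\<lambda>n. (\<Sum>k<n. K *v v (Suc k) - K *v v k) + K *v v 0) \<longlonglongrightarrow> suminf (\<lambda>k. K *v v (Suc k) - K *v v k) + K *v v 0"
    by (intro tendsto_add tendsto_const summable_LIMSEQ)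
  then have "convergent (\<lambda>n. K *v v n)"
    unfolding sum_lessThan_telescope[of "\<lambda>k. K *v v k"] by (auto simp: convergent_def)
  then show lim: "(\<lambda>k. K *v v k) \<longlonglongrightarrow> lim (\<lambda>k. K *v v k)" by (simp add: convergent_LIMSEQ_iff)
  have "linear ((*v) K)"
    by (rule bounded_linear.linear[OF bounded_bilinear.bounded_linear_right[OF bounded_bilinear_mult_vec]])
  then have "closed (range ((*v) K))" by (intro closed_subspace linear_subspace_image subspace_UNIV)
  then show "lim (\<lambda>k. K *v v k) \<in> range ((*v) K)"
    by (rule closed_sequentially[OF _ _ lim]) auto
  assume w: "K *v w = lim (\<lambda>k. K *v v k)"
  \<comment> \<open>A bound for the whole tail after \<open>k\<close>: the steps of
    \<open>N\<close>, the root of the form, are at most \<open>s * (1/2)^j\<close> and sum to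
    this.\<close>
  define e where "e = 2 * s * (1/2)^k"
  have e0: "e \<ge> 0" using s by (simp add: e_def)
  have "(\<lambda>l. K *v v l - K *v w) \<longlonglongrightarrow> 0" using tendsto_diff[OF lim tendsto_const[of "K *v w"]] w by simp
  then have "(\<lambda>l. N (v k - w) * e + norm (v k - w) * norm (K *v v l - K *v w)) \<longlonglongrightarrow> N (v k - w) * e + norm (v k - w) * 0"
    by (intro tendsto_intros tendsto_norm_zero)
  \<comment> \<open>One part of \<open>K *v (v k - w)\<close> is estimated in the seminorm, the
    other in the Euclidean norm. The second disappears as \<open>l\<close> tends to infinity, and
    then one factor \<open>N (v k - w)\<close> cancels.\<close>
  moreover have "qf K (v k - w) \<le> N (v k - w) * e + norm (v k - w) * norm (K *v v l - K *v w)" if "l \<ge> k" for l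
  proof -
    have "N (v k - v l) = N (v l - v k)" using qf_minus[of K "v k - v l"] by (simp add: N_def)
    also have "\<dots> \<le> 2 * s * (1/2)^k * (1 - (1/2)^(l - k))" using tail[of k "l - k"] that by simp
    also have "\<dots> \<le> e * 1" unfolding e_def using s by (intro mult_left_mono) auto
    finally have Ne: "N (v k - v l) \<le> e" by simp
    have "K *v (v k - w) = K *v (v k - v l) + (K *v v l - K *v w)" by (simp add: mult_vec_simps)
    then have "qf K (v k - w) = Re (cdot (v k - w) (K *v (v k - v l))) + Re (cdot (v k - w) (K *v v l - K *v w))"
      unfolding qf_def by (simp add: cdot_add_right)
    also have "\<dots> \<le> cmod (cdot (v k - w) (K *v (v k - v l))) + cmod (cdot (v k - w) (K *v v l - K *v w))"
      by (intro add_mono complex_Re_le_cmod)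
    also have "\<dots> \<le> N (v k - w) * N (v k - v l) + norm (v k - w) * norm (K *v v l - K *v w)"
      unfolding N_def by (intro add_mono psd_cauchy_schwarz_sqrt[OF K] norm_cdot_le)
    also have "\<dots> \<le> N (v k - w) * e + norm (v k - w) * norm (K *v v l - K *v w)"
      using Ne psd_qf_nonneg[OF K] by (intro add_mono mult_left_mono) (auto simp: N_def)
    finally show ?thesis .
  qed
  ultimately have "qf K (v k - w) \<le> N (v k - w) * e"
    by (intro LIMSEQ_le_const[where a = "qf K (v k - w)"]) auto
  moreover have NN: "qf K (v k - w) = N (v k - w) * N (v k - w)" "N (v k - w) \<ge> 0"
    using psd_qf_nonneg[OF K] by (auto simp: N_def)
  ultimately have "N (v k - w) \<le> e" using e0 by (cases "N (v k - w) = 0") auto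
  then have "N (v k - w) * N (v k - w) \<le> e * e" using NN(2) e0 by (intro mult_mono)
  also have "e * e = 4 * G * (1/4)^k"
    unfolding e_def s(2)[symmetric] by (simp add: power2_eq_square power_mult_distrib[symmetric] mult_ac)
  finally show "qf K (v k - w) \<le> 4 * G * (1/4)^k" using NN by simp
qed

section \<open>Completeness and orthogonal projection\<close>

context weight
begin

lemma richardson_measurable:
  assumes "t \<in> borel_measurable lebesgue" "h \<in> borel_measurable lebesgue"
  shows "(\<lambda>x. richardson (t x) (H x) (h x) j) \<in> borel_measurable lebesgue"
proof (induction j)
  case (Suc j)
  have "(\<lambda>x. H x *v richardson (t x) (H x) (h x) j) \<in> borel_measurable lebesgue"
    by (rule bilinear_lebesgue_measurable[OF bounded_bilinear_mult_vec H_meas Suc])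
  then show ?case using Suc assms by simp
qed simp

text \<open>The rate \<open>(1/16)^k\<close> leaves a factor \<open>(1/4)^k\<close> after weighting
  the differences by \<open>4^k\<close>, so the weighted series has an integrable sum
  \<open>G\<close>, and pointwise \<open>psd_fast_cauchy\<close> applies with the bound
  \<open>G x * (1/4)^k\<close>. Any measurable \<open>g\<close> with \<open>H x *v g x = h x\<close>
  is then a limit; Richardson iteration selects one.\<close>

theorem L2_complete:
  assumes f: "\<And>k. f k \<in> L2_fun H" and fast: "\<And>k. nrm2 (\<lambda>x. f (Suc k) x - f k x) \<le> (1/16)^k"
  shows "\<exists>g\<in>L2_fun H. (\<lambda>k. nrm2 (\<lambda>x. f k x - g x)) \<longlonglongrightarrow> 0"
proof -
  define a where "a k x = 4^k * qf (H x) (f (Suc k) x - f k x)" for k x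
  have ai: "integrable lebesgue (a k)" for k
    unfolding a_def using L2_qf[OF L2_diff[OF f f]] by simp
  have an: "AE x in lebesgue. \<forall>k. 0 \<le> a k x"
    using H_psd by eventually_elim (simp add: a_def psd_qf_nonneg)
  have aint: "integral\<^sup>L lebesgue (a k) \<le> (1/4)^k" for k
  proof -
    have "integral\<^sup>L lebesgue (a k) = 4^k * nrm2 (\<lambda>x. f (Suc k) x - f k x)"
      unfolding a_def nrm2_def by simp
    also have "\<dots> \<le> 4^k * (1/16)^k" by (rule mult_left_mono[OF fast]) simp
    also have "\<dots> = (1/4)^k" by (simp flip: power_mult_distrib)
    finally show ?thesis .
  qed
  have ann: "(\<integral>\<^sup>+x. ennreal (a k x) \<partial>lebesgue) \<le> ennreal ((1/4)^k)" for k
  proof -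
    have "(\<integral>\<^sup>+x. ennreal (a k x) \<partial>lebesgue) = ennreal (integral\<^sup>L lebesgue (a k))"
      by (rule nn_integral_eq_integral[OF ai]) (use an in eventually_elim, simp)
    then show ?thesis using aint by (simp add: ennreal_leI)
  qed
  have "(\<integral>\<^sup>+x. (\<Sum>k. ennreal (a k x)) \<partial>lebesgue) = (\<Sum>k. \<integral>\<^sup>+x. ennreal (a k x) \<partial>lebesgue)"
    by (rule nn_integral_suminf) (use borel_measurable_integrable[OF ai] in measurable)
  also have "\<dots> \<le> (\<Sum>k. ennreal ((1/4)^k))" by (intro suminf_le ann summableI)
  also have "\<dots> = ennreal (\<Sum>k. (1/4)^k)" by (rule suminf_ennreal2) (auto intro!: summable_geometric)
  finally have fin: "(\<integral>\<^sup>+x. (\<Sum>k. ennreal (a k x)) \<partial>lebesgue) \<noteq> \<infinity>"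
    by (metis ennreal_neq_top infinity_ennreal_def neq_top_trans)
  have "AE x in lebesgue. (\<Sum>k. ennreal (a k x)) \<noteq> \<infinity>"
    by (rule nn_integral_PInf_AE[OF _ fin]) (use borel_measurable_integrable[OF ai] in measurable)
  then have asum: "AE x in lebesgue. summable (\<lambda>k. a k x)"
    using an by eventually_elim (auto intro!: summable_suminf_not_top)
  define G where "G x = (\<Sum>k. a k x)" for x
  have Gi: "integrable lebesgue G"
    unfolding G_def
  proof (rule integrable_suminf[OF ai])
    show "AE x in lebesgue. summable (\<lambda>i. norm (a i x))"
      using asum an by eventually_elim simp
    show "summable (\<lambda>i. LINT x|lebesgue. norm (a i x))"
    proof (rule summable_comparison_test')
      show "summable (\<lambda>k. (1/4 :: real)^k)" by (rule summable_geometric) simp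
      fix k
      have "(LINT x|lebesgue. norm (a k x)) = integral\<^sup>L lebesgue (a k)"
        by (rule integral_cong_AE) (use an borel_measurable_integrable[OF ai] in \<open>auto elim!: eventually_mono\<close>)
      moreover have "0 \<le> (LINT x|lebesgue. norm (a k x))" by simp
      ultimately show "norm (LINT x|lebesgue. norm (a k x)) \<le> (1/4)^k" using aint[of k] by simp
    qed
  qed
  obtain L where L: "L > 0" "\<forall>(K::complex^'m^'m) v. norm (K *v v) \<le> norm K * L * norm v"
    using qf_norm_bound by blast
  \<comment> \<open>The step size is the reciprocal of a bound for the norm of \<open>H x\<close>,
    increased by \<open>1\<close> so that it stays meaningful where \<open>H x = 0\<close>.\<close>
  define t where "t x = 1 / (1 + norm (H x) * L)" for x
  define h where "h x = lim (\<lambda>k. H x *v f k x)" for x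
  have hm: "h \<in> borel_measurable lebesgue"
    unfolding h_def
    by (intro borel_measurable_lim_metric bilinear_lebesgue_measurable[OF bounded_bilinear_mult_vec H_meas] L2_lebesgue_measurable f)
  have tm: "t \<in> borel_measurable lebesgue" unfolding t_def using H_meas by measurable
  have "(\<lambda>x. lim (richardson (t x) (H x) (h x))) \<in> borel_measurable lebesgue"
    by (rule borel_measurable_lim_metric[OF richardson_measurable[OF tm hm]])
  then obtain g where g: "g \<in> borel_measurable borel" "AE x in lebesgue. lim (richardson (t x) (H x) (h x)) = g x"
    using lebesgue_measurable_ex_borel by blast
  have main: "AE x in lebesgue. \<forall>k. qf (H x) (f k x - g x) \<le> 4 * G x * (1/4)^k"
    using H_psd asum an g(2)
  proof eventually_elim
    case (elim x)
    have G0: "G x \<ge> 0" unfolding G_def using elim by (intro suminf_nonneg) auto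
    have step: "qf (H x) (f (Suc k) x - f k x) \<le> G x * (1/4)^k" for k
    proof -
      have "a k x \<le> G x" unfolding G_def using sum_le_suminf[OF elim(2), of "{k}"] elim(3) by simp
      then show ?thesis by (simp add: a_def field_simps power_divide)
    qed
    note fc = psd_fast_cauchy[OF elim(1) G0, where v = "\<lambda>k. f k x", OF step, folded h_def]
    have "norm (H x) * L \<ge> 0" using L by simp
    then have t: "t x > 0" "t x * (norm (H x) * L) \<le> 1" by (auto simp: t_def divide_simps)
    obtain w where w: "richardson (t x) (H x) (h x) \<longlonglongrightarrow> w" "H x *v w = h x"
      using richardson_convergent[OF elim(1) _ t fc(2)] L(2) by blast
    have "g x = w" using limI[OF w(1)] elim(4) by simp
    then show ?case using fc(3)[OF w(2)] by simp
  qed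
  have gm: "(\<lambda>x. f k x - g x) \<in> borel_measurable borel" for k
    using g(1) L2_measurable[OF f] by measurable
  have fg: "(\<lambda>x. f k x - g x) \<in> L2_fun H" for k
    by (rule L2_bound[OF gm, of "\<lambda>x. 4 * G x * (1/4)^k"]) (use Gi main in \<open>auto elim!: eventually_mono\<close>)
  have "g \<in> L2_fun H" using L2_diff[OF f[of 0] fg[of 0]] by simp
  moreover have "(\<lambda>k. nrm2 (\<lambda>x. f k x - g x)) \<longlonglongrightarrow> 0"
  proof (rule real_tendsto_sandwich)
    show "\<forall>\<^sub>F k in sequentially. 0 \<le> nrm2 (\<lambda>x. f k x - g x)" by (simp add: nrm2_nonneg)
    show "\<forall>\<^sub>F k in sequentially. nrm2 (\<lambda>x. f k x - g x) \<le> 4 * integral\<^sup>L lebesgue G * (1/4)^k"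
    proof (intro always_eventually allI)
      fix k
      have "nrm2 (\<lambda>x. f k x - g x) \<le> (LINT x|lebesgue. 4 * G x * (1/4)^k)"
        unfolding nrm2_def
        by (rule integral_mono_AE[OF L2_qf[OF fg]]) (use Gi main in \<open>auto elim!: eventually_mono\<close>)
      then show "nrm2 (\<lambda>x. f k x - g x) \<le> 4 * integral\<^sup>L lebesgue G * (1/4)^k" by simp
    qed
    have "(\<lambda>k. 4 * integral\<^sup>L lebesgue G * (1/4)^k) \<longlonglongrightarrow> 4 * integral\<^sup>L lebesgue G * 0"
      by (intro tendsto_mult tendsto_const LIMSEQ_realpow_zero) auto
    then show "(\<lambda>k. 4 * integral\<^sup>L lebesgue G * (1/4)^k) \<longlonglongrightarrow> 0" by simp
  qed simp
  ultimately show ?thesis by blast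
qed

lemma nrm2_limit:
  assumes f: "\<And>n. f n \<in> L2_fun H" and w: "w \<in> L2_fun H"
    and lim: "(\<lambda>n. nrm2 (\<lambda>x. f n x - w x)) \<longlonglongrightarrow> 0" and y: "y \<in> L2_fun H"
  shows "(\<lambda>n. form H (f n) y) \<longlonglongrightarrow> form H w y"
proof -
  have "(\<lambda>n. sqrt (nrm2 (\<lambda>x. f n x - w x)) * sqrt (nrm2 y)) \<longlonglongrightarrow> sqrt 0 * sqrt (nrm2 y)"
    by (intro tendsto_mult tendsto_const tendsto_real_sqrt lim)
  then have "(\<lambda>n. sqrt (nrm2 (\<lambda>x. f n x - w x)) * sqrt (nrm2 y)) \<longlonglongrightarrow> 0" by simp
  then have "(\<lambda>n. form H (f n) y - form H w y) \<longlonglongrightarrow> 0"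
  proof (rule Lim_null_comparison[rotated])
    show "\<forall>\<^sub>F n in sequentially. norm (form H (f n) y - form H w y) \<le> sqrt (nrm2 (\<lambda>x. f n x - w x)) * sqrt (nrm2 y)"
      using form_cauchy_schwarz_sqrt[OF L2_diff[OF f w] y] by (simp add: form_diff_left f w y)
  qed
  then show ?thesis by (simp add: LIM_zero_iff)
qed

text \<open>The residuals of a minimising sequence converge by the parallelogram law and
  completeness. The statement speaks of the limit residual \<open>w\<close> and the approximants
  \<open>s n\<close>, so that \<open>S\<close> itself need not be closed; with real scalars,
  orthogonality is that of real parts.\<close>

theorem L2_projection:
  assumes S: "S \<subseteq> L2_fun H" and S0: "(\<lambda>x. 0) \<in> S"
    and Sadd: "\<And>f g. f \<in> S \<Longrightarrow> g \<in> S \<Longrightarrow> (\<lambda>x. f x + g x) \<in> S"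
    and Sscale: "\<And>f r. f \<in> S \<Longrightarrow> (\<lambda>x. r *\<^sub>R f x) \<in> S"
    and f: "f \<in> L2_fun H"
  shows "\<exists>w s. w \<in> L2_fun H \<and> (\<forall>n. s n \<in> S) \<and> (\<lambda>n. nrm2 (\<lambda>x. f x - s n x - w x)) \<longlonglongrightarrow> 0
     \<and> (\<forall>y\<in>S. Re (form H w y) = 0)"
proof -
  define D where "D = (\<lambda>s. nrm2 (\<lambda>x. f x - s x)) ` S"
  define m where "m = Inf D"
  have D: "D \<noteq> {}" "bdd_below D" using S0 nrm2_nonneg by (auto simp: D_def bdd_below_def)
  have mle: "m \<le> nrm2 (\<lambda>x. f x - s x)" if "s \<in> S" for s
    unfolding m_def using D that by (intro cInf_lower) (auto simp: D_def)
  \<comment> \<open>The parallelogram law turns two excesses of \<open>(1/16)^n / 4\<close> over the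
    infimum into a difference of at most \<open>(1/16)^n\<close>, the rate that completeness asks
    for.\<close>
  have "\<exists>s\<in>S. nrm2 (\<lambda>x. f x - s x) < m + (1/16)^n / 4" for n
    using cInf_lessD[OF D(1), of "m + (1/16)^n / 4"] by (auto simp: m_def D_def)
  then obtain s where s: "\<And>n. s n \<in> S" "\<And>n. nrm2 (\<lambda>x. f x - s n x) < m + (1/16)^n / 4" by metis
  have sL: "s n \<in> L2_fun H" for n using s(1) S by blast
  define g where "g n = (\<lambda>x. f x - s n x)" for n
  have gL: "g n \<in> L2_fun H" for n unfolding g_def by (rule L2_diff[OF f sL])
  have "nrm2 (\<lambda>x. g (Suc n) x - g n x) \<le> (1/16)^n" for n
  proof -
    let ?mid = "\<lambda>x. (1/2) *\<^sub>R (s (Suc n) x + s n x)"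
    have "nrm2 (\<lambda>x. g (Suc n) x + g n x) = nrm2 (\<lambda>x. 2 *s (f x - ?mid x))"
    proof -
      have two: "(2::complex) *s v = v + v" for v :: "complex^'m"
        by (simp add: vec_eq_iff)
      have "g (Suc n) x + g n x = 2 *s (f x - ?mid x)" for x
      proof -
        have "?mid x + ?mid x = s (Suc n) x + s n x" by (simp flip: scaleR_2)
        then show ?thesis unfolding two g_def by (simp add: algebra_simps)
      qed
      then show ?thesis by simp
    qed
    also have "\<dots> = 4 * nrm2 (\<lambda>x. f x - ?mid x)" by (simp only: nrm2_smult) simp
    finally have "4 * m \<le> nrm2 (\<lambda>x. g (Suc n) x + g n x)"
      using mle[OF Sscale[OF Sadd[OF s(1)[of "Suc n"] s(1)[of n]], of "1/2"]] by simp
    moreover have "nrm2 (g (Suc n)) \<le> m + (1/16)^n / 4"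
      using s(2)[of "Suc n"] by (simp add: g_def) (use zero_le_power[of "1/16::real" n] in linarith)
    moreover have "nrm2 (g n) \<le> m + (1/16)^n / 4"
      using s(2)[of n] by (simp add: g_def)
    ultimately show ?thesis
      using nrm2_parallelogram[OF gL[of "Suc n"] gL[of n]] by linarith
  qed
  from L2_complete[OF gL this] obtain w where w: "w \<in> L2_fun H" "(\<lambda>n. nrm2 (\<lambda>x. g n x - w x)) \<longlonglongrightarrow> 0"
    by blast
  have "Re (form H w y) = 0" if y: "y \<in> S" for y
  proof -
    have yL: "y \<in> L2_fun H" using y S by blast
    have lim: "(\<lambda>n. Re (form H (g n) y)) \<longlonglongrightarrow> Re (form H w y)"
      by (intro tendsto_Re nrm2_limit[OF gL w yL])
    \<comment> \<open>Minimality under the variations \<open>t y\<close>, in the limit. The constant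
      term is \<open>0\<close>, so the discriminant inequality forces the linear coefficient to
      vanish.\<close>
    have "0 \<le> 0 + 2 * t * Re (form H w y) + t\<^sup>2 * nrm2 y" for t
    proof -
      have "m \<le> m + (1/16)^n / 4 + 2 * t * Re (form H (g n) y) + t\<^sup>2 * nrm2 y" for n
      proof -
        have "m \<le> nrm2 (\<lambda>x. f x - (s n x + (- t) *\<^sub>R y x))"
          by (rule mle[OF Sadd[OF s(1) Sscale[OF y]]])
        also have "\<dots> = nrm2 (\<lambda>x. g n x + complex_of_real t *s y x)"
          by (simp add: g_def scaleR_eq_smult[symmetric] algebra_simps)
        also have "\<dots> = nrm2 (g n) + 2 * t * Re (form H (g n) y) + t\<^sup>2 * nrm2 y"
          by (simp add: nrm2_add[OF gL L2_smult[OF yL]] form_smult_right nrm2_smult)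
        also have "nrm2 (g n) \<le> m + (1/16)^n / 4" using s(2)[of n] by (simp add: g_def)
        finally show ?thesis by simp
      qed
      moreover have "(\<lambda>n. m + (1/16)^n / 4 + 2 * t * Re (form H (g n) y) + t\<^sup>2 * nrm2 y)
        \<longlonglongrightarrow> m + 0 / 4 + 2 * t * Re (form H w y) + t\<^sup>2 * nrm2 y"
        by (intro tendsto_intros lim LIMSEQ_realpow_zero) auto
      ultimately have "m \<le> m + 0 / 4 + 2 * t * Re (form H w y) + t\<^sup>2 * nrm2 y"
        by (intro LIMSEQ_le_const) auto
      then show ?thesis by simp
    qed
    from quadratic_nonneg_discriminant[OF this nrm2_nonneg] show ?thesis by simp
  qed
  then show ?thesis using w s(1) by (intro exI[of _ w] exI[of _ s]) (auto simp: g_def)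
qed

end

section \<open>Pairs of vectors and block matrices\<close>

definition join :: "complex^'m \<Rightarrow> complex^'m \<Rightarrow> complex^('m + 'm)" where
  "join a b = (\<chi> i. case i of Inl k \<Rightarrow> a $ k | Inr k \<Rightarrow> b $ k)"

definition upper :: "complex^('m + 'm) \<Rightarrow> complex^'m" where "upper v = (\<chi> k. v $ Inl k)"

definition lower :: "complex^('m + 'm) \<Rightarrow> complex^'m" where "lower v = (\<chi> k. v $ Inr k)"

lemma upper_join [simp]: "upper (join a b) = a" and lower_join [simp]: "lower (join a b) = b"
  by (simp_all add: upper_def lower_def join_def vec_eq_iff)

lemma join_upper_lower [simp]: "join (upper v) (lower v) = v"
  by (auto simp: upper_def lower_def join_def vec_eq_iff split: sum.splits)

lemma sum_UNIV_Plus: "(\<Sum>i\<in>UNIV. F i) = (\<Sum>k\<in>UNIV. F (Inl k)) + (\<Sum>k\<in>UNIV. F (Inr k))"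
  for F :: "'a::finite + 'b::finite \<Rightarrow> 'c::comm_monoid_add"
  using sum.Plus[of "UNIV :: 'a set" "UNIV :: 'b set" F] by (simp add: o_def)

lemma block_mult_join:
  "block P Q R S *v join a b = join (P *v a + Q *v b) (R *v a + S *v b)"
  by (auto simp: vec_eq_iff matrix_vector_mult_def sum_UNIV_Plus join_def block_def split: sum.splits)

lemma cdot_join: "cdot (join a b) (join c d) = cdot a c + cdot b d"
  by (simp add: cdot_def sum_UNIV_Plus join_def)

lemma join_add: "join a b + join c d = join (a + c) (b + d)"
  and join_diff: "join a b - join c d = join (a - c) (b - d)"
  and join_scaleR: "r *\<^sub>R join a b = join (r *\<^sub>R a) (r *\<^sub>R b)"
  and join_0: "join 0 0 = 0"
  by (auto simp: join_def vec_eq_iff split: sum.splits)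

lemma bounded_linear_upper: "bounded_linear upper" and bounded_linear_lower: "bounded_linear lower"
  unfolding linear_conv_bounded_linear[symmetric]
  by (auto intro!: linearI simp: upper_def lower_def vec_eq_iff)

lemma bounded_linear_join1: "bounded_linear (\<lambda>a. join a 0)" and bounded_linear_join2: "bounded_linear (join 0)"
  unfolding linear_conv_bounded_linear[symmetric]
  by (auto intro!: linearI simp: join_add join_scaleR)

lemma join_measurable:
  assumes "f \<in> borel_measurable M" "g \<in> borel_measurable M"
  shows "(\<lambda>x. join (f x) (g x)) \<in> borel_measurable M"
proof -
  have "(\<lambda>x. join (f x) 0 + join 0 (g x)) \<in> borel_measurable M"
    by (intro borel_measurable_add assms
        borel_measurable_continuous_on[OF linear_continuous_on[OF bounded_linear_join1]]
        borel_measurable_continuous_on[OF linear_continuous_on[OF bounded_linear_join2]])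
  then show ?thesis by (simp add: join_add)
qed

lemma adj_block: "adj (block P Q R S) = block (adj P) (adj R) (adj Q) (adj S)"
  by (auto simp: adj_def block_def vec_eq_iff split: sum.splits)

lemma psd_block_diag: "psd P \<Longrightarrow> psd S \<Longrightarrow> psd (block P 0 0 S)"
proof -
  assume P: "psd P" and S: "psd S"
  have "0 \<le> Re (cdot (join a b) (block P 0 0 S *v join a b))" for a b
    using P S by (simp add: block_mult_join cdot_join psd_def)
  from this[of "upper v" "lower v" for v] have "0 \<le> Re (cdot v (block P 0 0 S *v v))" for v by simp
  then show ?thesis using P S by (simp add: psd_def hermitian_def adj_block)
qed

lemma bounded_linear_block_diag:
  "bounded_linear (\<lambda>P :: complex^'n^'n. block P 0 0 P)" "bounded_linear (\<lambda>P :: complex^'n^'n. block P 0 0 0)"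
  unfolding linear_conv_bounded_linear[symmetric]
  by (auto intro!: linearI simp: block_def vec_eq_iff split: sum.splits)

lemma psd_0: "psd 0" by (simp add: psd_def hermitian_def)

context weight
begin

text \<open>A pair of functions is a single function with twice as many components and the weight
  \<open>block (H x) 0 0 (H x)\<close>, so the projection theorem for functions applies to
  relations.\<close>

theorem pair_projection:
  assumes S: "S \<subseteq> L2_fun H \<times> L2_fun H" and S0: "(\<lambda>x. 0, \<lambda>x. 0) \<in> S"
    and Sadd: "\<And>f g f' g'. (f, g) \<in> S \<Longrightarrow> (f', g') \<in> S \<Longrightarrow> (\<lambda>x. f x + f' x, \<lambda>x. g x + g' x) \<in> S"
    and Sscale: "\<And>f g c. (f, g) \<in> S \<Longrightarrow> (\<lambda>x. c *s f x, \<lambda>x. c *s g x) \<in> S"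
    and f: "f \<in> L2_fun H" and g: "g \<in> L2_fun H"
  shows "\<exists>w1 w2 s1 s2. w1 \<in> L2_fun H \<and> w2 \<in> L2_fun H \<and> (\<forall>n. (s1 n, s2 n) \<in> S)
    \<and> (\<lambda>n. nrm2 (\<lambda>x. f x - s1 n x - w1 x) + nrm2 (\<lambda>x. g x - s2 n x - w2 x)) \<longlonglongrightarrow> 0
    \<and> (\<forall>(y, z)\<in>S. form H w1 y + form H w2 z = 0)"
proof -
  let ?HH = "\<lambda>x. block (H x) 0 0 (H x)"
  interpret W: weight ?HH
  proof
    show "?HH \<in> borel_measurable lebesgue"
      using H_meas linear_continuous_on[OF bounded_linear_block_diag(1)]
      by (rule borel_measurable_continuous_on[rotated])
    show "AE x in lebesgue. psd (?HH x)" using H_psd by eventually_elim (simp add: psd_block_diag)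
  qed
  have qfj: "qf (?HH x) (join a b) = qf (H x) a + qf (H x) b" for x a b
    by (simp add: qf_def block_mult_join cdot_join)
  have jL: "(\<lambda>x. join (u x) (v x)) \<in> L2_fun ?HH" if "u \<in> L2_fun H" "v \<in> L2_fun H" for u v
    using that unfolding L2_iff W.L2_iff by (simp add: qfj join_measurable)
  have uL: "(\<lambda>x. upper (v x)) \<in> L2_fun H \<and> (\<lambda>x. lower (v x)) \<in> L2_fun H" if v: "v \<in> L2_fun ?HH" for v
  proof -
    have q: "qf (?HH x) (v x) = qf (H x) (upper (v x)) + qf (H x) (lower (v x))" for x
      using qfj[of x "upper (v x)" "lower (v x)"] by simp
    have m: "(\<lambda>x. upper (v x)) \<in> borel_measurable borel" "(\<lambda>x. lower (v x)) \<in> borel_measurable borel"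
      by (rule borel_measurable_continuous_on[OF linear_continuous_on W.L2_measurable[OF v]],
          rule bounded_linear_upper bounded_linear_lower)+
    have "AE x in lebesgue. qf (H x) (upper (v x)) \<le> qf (?HH x) (v x)"
      "AE x in lebesgue. qf (H x) (lower (v x)) \<le> qf (?HH x) (v x)"
      unfolding q using H_psd by (auto elim!: eventually_mono simp: psd_qf_nonneg)
    then show ?thesis using L2_bound[OF m(1) W.L2_qf[OF v]] L2_bound[OF m(2) W.L2_qf[OF v]] by blast
  qed
  have nrmj: "W.nrm2 (\<lambda>x. join (u x) (v x)) = nrm2 u + nrm2 v" if "u \<in> L2_fun H" "v \<in> L2_fun H" for u v
    using that unfolding nrm2_def W.nrm2_def by (simp add: qfj L2_qf)
  have formj: "form ?HH (\<lambda>x. join (u x) (v x)) (\<lambda>x. join (y x) (z x)) = form H u y + form H v z"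
    if "u \<in> L2_fun H" "v \<in> L2_fun H" "y \<in> L2_fun H" "z \<in> L2_fun H" for u v y z
    using that unfolding form_def by (simp add: block_mult_join cdot_join L2_sesq_integrable)
  define T where "T = (\<lambda>(y, z). \<lambda>x. join (y x) (z x)) ` S"
  have T: "(\<lambda>x. join (y x) (z x)) \<in> T" if "(y, z) \<in> S" for y z
    using that by (force simp: T_def)
  have TE: "\<exists>y z. (y, z) \<in> S \<and> h = (\<lambda>x. join (y x) (z x))" if "h \<in> T" for h
    using that by (auto simp: T_def)
  have "\<exists>w s. w \<in> L2_fun ?HH \<and> (\<forall>n. s n \<in> T) \<and> (\<lambda>n. W.nrm2 (\<lambda>x. join (f x) (g x) - s n x - w x)) \<longlonglongrightarrow> 0
     \<and> (\<forall>y\<in>T. Re (form ?HH w y) = 0)"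
  proof (rule W.L2_projection)
    show "T \<subseteq> L2_fun ?HH" using S jL by (auto simp: T_def)
    show "(\<lambda>x. 0) \<in> T" using T[OF S0] by (simp add: join_0)
    show "(\<lambda>x. u x + v x) \<in> T" if uv: "u \<in> T" "v \<in> T" for u v
    proof -
      obtain y z y' z' where yz: "(y, z) \<in> S" "(y', z') \<in> S" "u = (\<lambda>x. join (y x) (z x))" "v = (\<lambda>x. join (y' x) (z' x))"
        using TE[OF uv(1)] TE[OF uv(2)] by blast
      show ?thesis using T[OF Sadd[OF yz(1,2)]] by (simp add: yz(3,4) join_add)
    qed
    show "(\<lambda>x. r *\<^sub>R u x) \<in> T" if u: "u \<in> T" for u r
    proof -
      obtain y z where yz: "(y, z) \<in> S" "u = (\<lambda>x. join (y x) (z x))" using TE[OF u] by blast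
      show ?thesis using T[OF Sscale[OF yz(1), of "complex_of_real r"]]
        by (simp add: yz(2) join_scaleR flip: scaleR_eq_smult)
    qed
    show "(\<lambda>x. join (f x) (g x)) \<in> L2_fun ?HH" by (rule jL[OF f g])
  qed
  then obtain w s where w: "w \<in> L2_fun ?HH" and s: "\<And>n. s n \<in> T"
    and lim: "(\<lambda>n. W.nrm2 (\<lambda>x. join (f x) (g x) - s n x - w x)) \<longlonglongrightarrow> 0"
    and orth: "\<And>y. y \<in> T \<Longrightarrow> Re (form ?HH w y) = 0" by blast
  define w1 w2 where "w1 = (\<lambda>x. upper (w x))" and "w2 = (\<lambda>x. lower (w x))"
  have wL: "w1 \<in> L2_fun H" "w2 \<in> L2_fun H" using uL[OF w] by (auto simp: w1_def w2_def)
  have wj: "w = (\<lambda>x. join (w1 x) (w2 x))" by (simp add: w1_def w2_def)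
  obtain s1 s2 where s12: "\<And>n. (s1 n, s2 n) \<in> S" "\<And>n. s n = (\<lambda>x. join (s1 n x) (s2 n x))"
    using TE[OF s] by metis
  have sL: "s1 n \<in> L2_fun H" "s2 n \<in> L2_fun H" for n using s12(1)[of n] S by auto
  have "W.nrm2 (\<lambda>x. join (f x) (g x) - s n x - w x) = nrm2 (\<lambda>x. f x - s1 n x - w1 x) + nrm2 (\<lambda>x. g x - s2 n x - w2 x)" for n
    unfolding wj s12(2) join_diff
    by (rule nrmj[OF L2_diff[OF L2_diff[OF f sL(1)] wL(1)] L2_diff[OF L2_diff[OF g sL(2)] wL(2)]])
  moreover have "form H w1 y + form H w2 z = 0" if yz: "(y, z) \<in> S" for y z
  proof -
    have yzL: "y \<in> L2_fun H" "z \<in> L2_fun H" using yz S by auto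
    have "Re (form H w1 y + form H w2 z) = 0"
      using orth[OF T[OF yz]] by (simp add: wj formj[OF wL yzL])
    \<comment> \<open>Only real parts are known to vanish; testing with \<open>\<i>\<close> times
      the pair, which again lies in \<open>S\<close>, gives the imaginary part.\<close>
    moreover have "Re (\<i> * (form H w1 y + form H w2 z)) = 0"
      using orth[OF T[OF Sscale[OF yz, of \<i>]]]
      by (simp add: wj formj[OF wL L2_smult[OF yzL(1)] L2_smult[OF yzL(2)]] form_smult_right algebra_simps)
    ultimately show ?thesis by (simp add: complex_eq_iff)
  qed
  ultimately show ?thesis using wL s12(1) lim
    by (intro exI[of _ w1] exI[of _ w2] exI[of _ s1] exI[of _ s2]) auto
qed

end

section \<open>The adjoint of the minimal relation\<close>

lemma primitive_exists:
  fixes g :: "real \<Rightarrow> 'a::euclidean_space"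
  assumes g: "loc_integrable g"
  shows "\<exists>P. has_density P g"
proof -
  define P where "P x = (if 0 \<le> x then integral {0..x} g else - integral {x..0} g)" for x
  note gi = loc_integrable_integrable_on[OF g]
  have "P b - P a = integral {a..b} g" if "a \<le> b" for a b
  proof -
    consider "0 \<le> a" | "a < 0" "0 \<le> b" | "b < 0" by linarith
    then show ?thesis
    proof cases
      case 1
      then show ?thesis using Henstock_Kurzweil_Integration.integral_combine[OF 1 that gi] that
        by (simp add: P_def algebra_simps)
    next
      case 2
      then show ?thesis using Henstock_Kurzweil_Integration.integral_combine[of a 0 b g] gi by (simp add: P_def add.commute)
    next
      case 3
      then show ?thesis using Henstock_Kurzweil_Integration.integral_combine[of a b 0 g] gi that
        by (simp add: P_def algebra_simps)
    qed
  qed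
  then show ?thesis using g by (auto simp: has_density_def)
qed

lemma has_density_continuous: "has_density f g \<Longrightarrow> continuous_on S f"
  using has_density_imp_loc_abs_cont loc_abs_cont_continuous by blast

lemma has_density_zero_const:
  assumes "has_density f (\<lambda>_. 0)"
  shows "f x = f y"
  using has_densityD[OF assms, of x y] has_densityD[OF assms, of y x] by (cases "x \<le> y") auto

lemma has_density_const: "has_density (\<lambda>_. c) (\<lambda>_. 0 :: 'a::euclidean_space)"
  by (simp add: has_density_def loc_integrable_def)

text \<open>Cramer's rule writes the entries of the inverse as quotients of determinants, which are
  polynomials in the continuous entries of \<open>J\<close>.\<close>

lemma continuous_inverse_matrix:
  fixes J :: "real \<Rightarrow> complex^'n^'n"
  assumes J: "continuous_on UNIV J" and det: "\<And>x. det (J x) \<noteq> 0"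
  shows "\<exists>K. continuous_on UNIV K \<and> (\<forall>x. J x ** K x = mat 1 \<and> K x ** J x = mat 1)"
proof -
  have cdet: "continuous_on UNIV (\<lambda>x. det (A x))" if "\<And>i j. continuous_on UNIV (\<lambda>x. A x $ i $ j)" for A :: "real \<Rightarrow> complex^'n^'n"
    unfolding det_def by (intro continuous_intros that)
  have cJ: "continuous_on UNIV (\<lambda>x. J x $ i $ j)" for i j
    by (rule bounded_linear.continuous_on[OF bounded_linear_vec_nth bounded_linear.continuous_on[OF bounded_linear_vec_nth J]])
  have ci: "continuous_on UNIV (\<lambda>x. if j = k then a else J x $ i $ j)" for i j k a
    by (cases "j = k") (simp_all add: cJ)
  define col where "col x l = (\<chi> k. det (\<chi> i j. if j = k then (axis l 1 :: complex^'n) $ i else J x $ i $ j) / det (J x))" for x l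
  have col: "J x *v col x l = axis l 1" for x l
    unfolding cramer[OF det] col_def ..
  define K where "K x = (\<chi> i l. col x l $ i)" for x
  have "J x ** K x = mat 1" for x
  proof -
    have "(J x ** K x) $ i $ l = (J x *v col x l) $ i" for i l
      by (simp add: matrix_matrix_mult_def matrix_vector_mult_def K_def)
    then show ?thesis unfolding col by (simp add: vec_eq_iff mat_def axis_def)
  qed
  moreover have "continuous_on UNIV K"
    unfolding K_def col_def
    by (intro continuous_on_vec_lambda) (simp, intro continuous_on_divide cdet, simp_all add: ci cJ det)
  ultimately show ?thesis by (metis matrix_left_right_inverse)
qed

lemma mult_le_sum_square: "0 \<le> a \<Longrightarrow> 0 \<le> b \<Longrightarrow> a * b \<le> (a + b)\<^sup>2" for a b :: real
  by (simp add: power2_sum)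

lemma compactly_supported_bound:
  fixes f :: "real \<Rightarrow> 'a::real_normed_vector"
  assumes "compactly_supported f"
  obtains R where "\<And>x. \<bar>x\<bar> > R \<Longrightarrow> f x = 0"
proof -
  have "bounded (closure {x. f x \<noteq> 0})"
    using assms by (simp add: compactly_supported_def compact_imp_bounded)
  then obtain R where R: "\<And>x. x \<in> closure {x. f x \<noteq> 0} \<Longrightarrow> \<bar>x\<bar> \<le> R"
    by (auto simp: bounded_iff)
  have "f x = 0" if "\<bar>x\<bar> > R" for x
  proof (rule ccontr)
    assume "f x \<noteq> 0"
    then have "x \<in> closure {x. f x \<noteq> 0}" using subsetD[OF closure_subset, of x "{x. f x \<noteq> 0}"] by simp
    then show False using R[of x] that by linarith
  qed
  then show thesis using that by blast
qed

lemma compactly_supportedI: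
  fixes f :: "real \<Rightarrow> 'a::real_normed_vector"
  assumes "\<And>x. \<bar>x\<bar> > R \<Longrightarrow> f x = 0"
  shows "compactly_supported f"
proof -
  have "{x. f x \<noteq> 0} \<subseteq> {-R..R}" using assms by (force simp: abs_le_iff not_less[symmetric])
  then have "bounded {x. f x \<noteq> 0}" using bounded_closed_interval bounded_subset by blast
  then show ?thesis by (simp add: compactly_supported_def compact_eq_bounded_closed bounded_closure)
qed

text \<open>\<open>J_skew\<close> and \<open>JB\<close> say that \<open>J f' + B f\<close> equals
  its formal adjoint: integration by parts moves the derivative onto \<open>J\<close> as well, and
  the resulting \<open>J'\<close> has to be compensated by \<open>B - adj B\<close>.\<close>

locale symmetric_system =
  fixes J B H :: "real \<Rightarrow> complex^'m^'m"
  assumes J_ac: "loc_abs_cont J" and J_det: "\<And>x. det (J x) \<noteq> 0" and J_skew: "\<And>x. adj (J x) = - J x"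
    and B_int: "loc_integrable B" and H_int: "loc_integrable H" and Hpsd: "AE x in lebesgue. psd (H x)"
    and JB: "AE x in lebesgue. B x - adj (B x) = vector_derivative J (at x)"

sublocale symmetric_system \<subseteq> weight H
  using loc_integrable_borel_measurable[OF H_int] Hpsd by unfold_locales

context symmetric_system
begin

definition sol :: "(real \<Rightarrow> complex^'m) \<Rightarrow> (real \<Rightarrow> complex^'m) \<Rightarrow> bool" where
  "sol f F \<longleftrightarrow> loc_abs_cont f \<and> (AE x in lebesgue. J x *v vector_derivative f (at x) + B x *v f x = F x)"

lemma solI:
  assumes "has_density f f'" "AE x in lebesgue. J x *v f' x + B x *v f x = F x"
  shows "sol f F"
  unfolding sol_def
proof
  show "loc_abs_cont f" by (rule has_density_imp_loc_abs_cont[OF assms(1)])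
  show "AE x in lebesgue. J x *v vector_derivative f (at x) + B x *v f x = F x"
    using has_density_AE_derivative[OF assms(1)] assms(2)
    by eventually_elim (simp add: vector_derivative_at)
qed

lemma solD:
  assumes "sol f F"
  shows "has_density f (\<lambda>x. vector_derivative f (at x))"
    "AE x in lebesgue. J x *v vector_derivative f (at x) + B x *v f x = F x"
  using assms loc_abs_cont_has_density by (auto simp: sol_def)

lemma sol_continuous: "sol f F \<Longrightarrow> continuous_on S f"
  by (simp add: sol_def loc_abs_cont_continuous)

text \<open>The product rule produces a term with \<open>J'\<close>, which is exactly
  \<open>B - adj B\<close>; with the skewness of \<open>J\<close> all coefficient terms cancel and
  only the right-hand sides remain.\<close>

lemma lagrange:
  assumes f: "sol f F" and h: "sol h G"
  shows "has_density (\<lambda>x. cdot (f x) (J x *v h x)) (\<lambda>x. cdot (f x) (G x) - cdot (F x) (h x))"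
proof -
  let ?D = "\<lambda>u x. vector_derivative u (at x)"
  have Jd: "has_density J (?D J)" by (rule loc_abs_cont_has_density[OF J_ac])
  have "has_density (\<lambda>x. J x *v h x) (\<lambda>x. J x *v ?D h x + ?D J x *v h x)"
    by (rule has_density_bilinear[OF Jd solD(1)[OF h] bounded_bilinear_mult_vec])
  then have "has_density (\<lambda>x. cdot (f x) (J x *v h x))
     (\<lambda>x. cdot (f x) (J x *v ?D h x + ?D J x *v h x) + cdot (?D f x) (J x *v h x))"
    by (rule has_density_bilinear[OF solD(1)[OF f] _ bounded_bilinear_cdot])
  then show ?thesis
  proof (rule has_density_cong_AE)
    show "AE x in lebesgue. cdot (f x) (J x *v ?D h x + ?D J x *v h x) + cdot (?D f x) (J x *v h x)
        = cdot (f x) (G x) - cdot (F x) (h x)"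
      using solD(2)[OF f] solD(2)[OF h] JB
    proof eventually_elim
      case (elim x)
      have 1: "J x *v ?D h x = G x - B x *v h x" using elim(2) by (simp add: algebra_simps)
      have 2: "?D J x *v h x = B x *v h x - adj (B x) *v h x" by (simp add: elim(3)[symmetric] mult_vec_simps)
      have "cdot (?D f x) (J x *v h x) = - cdot (J x *v ?D f x) (h x)"
        by (simp add: cdot_mult_right J_skew mult_vec_simps cdot_minus_left)
      also have "J x *v ?D f x = F x - B x *v f x" using elim(1) by (simp add: algebra_simps)
      finally have 3: "cdot (?D f x) (J x *v h x) = cdot (f x) (adj (B x) *v h x) - cdot (F x) (h x)"
        by (simp add: cdot_diff_left cdot_mult_left)
      show ?case unfolding 1 2 3 by (simp add: cdot_add_right cdot_diff_right)
    qed
  qed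
qed

lemma sol_add: "sol f F \<Longrightarrow> sol h G \<Longrightarrow> sol (\<lambda>x. f x + h x) (\<lambda>x. F x + G x)"
proof -
  assume f: "sol f F" and h: "sol h G"
  show ?thesis
  proof (rule solI[OF has_density_add[OF solD(1)[OF f] solD(1)[OF h]]])
    show "AE x in lebesgue. J x *v (vector_derivative f (at x) + vector_derivative h (at x)) + B x *v (f x + h x) = F x + G x"
      using solD(2)[OF f] solD(2)[OF h]
      by eventually_elim (simp add: mult_vec_simps algebra_simps)
  qed
qed

lemma sol_smult: "sol f F \<Longrightarrow> sol (\<lambda>x. c *s f x) (\<lambda>x. c *s F x)"
proof -
  assume f: "sol f F"
  have bl: "bounded_linear (\<lambda>v :: complex^'m. c *s v)"
    unfolding linear_conv_bounded_linear[symmetric]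
    by (auto intro!: linearI simp: vec_eq_iff algebra_simps)
  show ?thesis
  proof (rule solI[OF has_density_compose_linear[OF solD(1)[OF f] bl]])
    show "AE x in lebesgue. J x *v (c *s vector_derivative f (at x)) + B x *v (c *s f x) = c *s F x"
      using solD(2)[OF f]
      by eventually_elim (simp add: vector_scalar_commute flip: vector_add_ldistrib)
  qed
qed

text \<open>Members of \<open>L2_fun H\<close> need not be locally integrable, but
  \<open>norm (H x *v g x)\<close> is dominated by the geometric mean of a multiple of
  \<open>norm (H x)\<close> and of \<open>qf (H x) (g x)\<close>, both of which are.\<close>

lemma weighted_loc_integrable:
  assumes g: "g \<in> L2_fun H"
  shows "loc_integrable (\<lambda>x. H x *v g x)"
proof (rule loc_integrableI)
  fix a b :: real
  obtain L where L: "L > 0" "\<forall>(K::complex^'m^'m) v. norm (K *v v) \<le> norm K * L * norm v"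
    using qf_norm_bound by blast
  have mm: "(\<lambda>x. H x *v g x) \<in> borel_measurable lebesgue"
    by (rule bilinear_lebesgue_measurable[OF bounded_bilinear_mult_vec H_meas L2_lebesgue_measurable[OF g]])
  have "(\<lambda>x. norm (H x) * L) absolutely_integrable_on {a..b}"
    by (rule loc_integrableD[OF loc_integrable_linear[OF loc_integrable_norm[OF H_int] bounded_linear_mult_left]])
  moreover have "(\<lambda>x. qf (H x) (g x)) absolutely_integrable_on {a..b}"
    by (rule loc_integrableD[OF integrable_imp_loc_integrable[OF L2_qf[OF g]]])
  ultimately have i: "(\<lambda>x. norm (H x) * L + qf (H x) (g x)) absolutely_integrable_on {a..b}"
    by (rule set_integral_add)
  show "(\<lambda>x. H x *v g x) absolutely_integrable_on {a..b}"
  proof (rule set_integrable_bound[OF i])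
    show "set_borel_measurable lebesgue {a..b} (\<lambda>x. H x *v g x)"
      unfolding set_borel_measurable_def
      by (intro borel_measurable_scaleR borel_measurable_indicator mm) simp
    show "AE x in lebesgue. x \<in> {a..b} \<longrightarrow> norm (H x *v g x) \<le> norm (norm (H x) * L + qf (H x) (g x))"
      using Hpsd
    proof eventually_elim
      case (elim x)
      have nn: "norm (H x) * L \<ge> 0" "qf (H x) (g x) \<ge> 0" using L psd_qf_nonneg[OF elim] by auto
      have "(norm (H x *v g x))\<^sup>2 \<le> (norm (H x) * L) * qf (H x) (g x)"
        by (rule psd_norm_mult_le[OF elim qf_le_norm]) (use L in auto)
      also have "\<dots> \<le> (norm (H x) * L + qf (H x) (g x))\<^sup>2"
        by (rule mult_le_sum_square[OF nn])
      finally have "norm (H x *v g x) \<le> norm (H x) * L + qf (H x) (g x)"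
        by (rule power2_le_imp_le) (use nn in simp)
      then show ?case using nn by simp
    qed
  qed
qed

lemma L2_continuous_compact:
  assumes f: "continuous_on UNIV f" and R: "\<And>x. \<bar>x\<bar> > R \<Longrightarrow> f x = 0"
  shows "f \<in> L2_fun H"
  unfolding L2_iff
proof
  show "f \<in> borel_measurable borel" by (rule borel_measurable_continuous_onI[OF f])
  have "loc_integrable (\<lambda>x. cdot (f x) (H x *v f x))"
    by (intro loc_integrable_bilinear[OF f _ bounded_bilinear_cdot] loc_integrable_bilinear'[OF f H_int bounded_bilinear_mult_vec])
  then have "integrable lebesgue (\<lambda>x. cdot (f x) (H x *v f x))"
    by (rule loc_integrable_bounded_support(1)[where a = "-R" and b = R])
       (use R in \<open>auto intro!: always_eventually\<close>)
  then show "integrable lebesgue (\<lambda>x. qf (H x) (f x))" unfolding qf_def by (rule integrable_Re)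
qed

lemma L2_cutoff_continuous:
  assumes f: "continuous_on UNIV f"
  shows "(\<lambda>x. if x \<in> {a..b} then f x else 0) \<in> L2_fun H"
  unfolding L2_iff
proof
  have fm: "f \<in> borel_measurable borel" by (rule borel_measurable_continuous_onI[OF f])
  then show "(\<lambda>x. if x \<in> {a..b} then f x else 0) \<in> borel_measurable borel" by measurable
  have "loc_integrable (\<lambda>x. cdot (f x) (H x *v f x))"
    by (intro loc_integrable_bilinear[OF f _ bounded_bilinear_cdot] loc_integrable_bilinear'[OF f H_int bounded_bilinear_mult_vec])
  then have "integrable lebesgue (\<lambda>x. indicator {a..b} x *\<^sub>R cdot (f x) (H x *v f x))"
    using loc_integrableD[of _ a b] by (simp add: set_integrable_def)
  then have "integrable lebesgue (\<lambda>x. Re (indicator {a..b} x *\<^sub>R cdot (f x) (H x *v f x)))" by (rule integrable_Re)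
  moreover have "(\<lambda>x. Re (indicator {a..b} x *\<^sub>R cdot (f x) (H x *v f x))) = (\<lambda>x. qf (H x) (if x \<in> {a..b} then f x else 0))"
    by (auto simp: qf_def indicator_def)
  ultimately show "integrable lebesgue (\<lambda>x. qf (H x) (if x \<in> {a..b} then f x else 0))" by simp
qed

lemma L2_cutoff:
  assumes f: "f \<in> L2_fun H"
  shows "(\<lambda>x. if x \<in> {a..b} then f x else 0) \<in> L2_fun H"
proof (rule L2_bound[OF _ L2_qf[OF f]])
  show "(\<lambda>x. if x \<in> {a..b} then f x else 0) \<in> borel_measurable borel"
    using L2_measurable[OF f] by measurable
  show "AE x in lebesgue. qf (H x) (if x \<in> {a..b} then f x else 0) \<le> qf (H x) (f x)"
    using Hpsd by eventually_elim (simp add: psd_qf_nonneg)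
qed

section \<open>Minimal and maximal relation of functions\<close>

lemma compact_green:
  assumes f: "sol f (\<lambda>x. H x *v g x)" and h: "sol h (\<lambda>x. H x *v k x)"
    and R: "\<And>x. \<bar>x\<bar> > R \<Longrightarrow> h x = 0"
  shows "integrable lebesgue (\<lambda>x. cdot (f x) (H x *v k x) - cdot (H x *v g x) (h x))"
    "(LINT x|lebesgue. cdot (f x) (H x *v k x) - cdot (H x *v g x) (h x)) = 0"
  using has_density_integral_zero[OF lagrange[OF f h], of R] R by auto

lemma hermitian_swap_AE: "AE x in lebesgue. \<forall>v w. cdot (H x *v v) w = cdot v (H x *v w)"
  using Hpsd by eventually_elim (simp add: psd_def hermitian_cdot)

text \<open>A relation between functions rather than classes: the absolutely continuous
  representative, which the boundary terms require, is lost in the quotient. Square integrability of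
  \<open>f\<close> follows from its compact support.\<close>

definition T_min :: "((real \<Rightarrow> complex^'m) \<times> (real \<Rightarrow> complex^'m)) set" where
  "T_min = {(f, g). sol f (\<lambda>x. H x *v g x) \<and> g \<in> L2_fun H \<and> compactly_supported f \<and> compactly_supported g}"

definition T_max :: "((real \<Rightarrow> complex^'m) \<times> (real \<Rightarrow> complex^'m)) set" where
  "T_max = {(f, g). sol f (\<lambda>x. H x *v g x) \<and> f \<in> L2_fun H \<and> g \<in> L2_fun H}"

lemma T_min_subset: "T_min \<subseteq> T_max"
proof clarify
  fix f g assume fg: "(f, g) \<in> T_min"
  then obtain R where "\<And>x. \<bar>x\<bar> > R \<Longrightarrow> f x = 0"
    using compactly_supported_bound[of f] by (auto simp: T_min_def)
  then have "f \<in> L2_fun H"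
    using fg L2_continuous_compact[of f R] sol_continuous by (auto simp: T_min_def)
  then show "(f, g) \<in> T_max" using fg by (simp add: T_min_def T_max_def)
qed

lemma S_min_eq: "S_min J B H = (\<lambda>(f, g). (L2_class H f, L2_class H g)) ` T_min"
  unfolding S_min_def T_min_def sol_def by (auto simp: image_iff)

lemma symmetric_T_max_T_min:
  assumes "(f, g) \<in> T_max" "(h, k) \<in> T_min"
  shows "form H f k = form H g h"
proof -
  have f: "sol f (\<lambda>x. H x *v g x)" "f \<in> L2_fun H" "g \<in> L2_fun H" using assms by (auto simp: T_max_def)
  have h: "sol h (\<lambda>x. H x *v k x)" "h \<in> L2_fun H" "k \<in> L2_fun H"
    using assms T_min_subset by (auto simp: T_max_def)
  obtain R where R: "\<And>x. \<bar>x\<bar> > R \<Longrightarrow> h x = 0"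
    using compactly_supported_bound[of h] assms by (auto simp: T_min_def)
  note i1 = L2_sesq_integrable[OF f(2) h(3)] and i2 = L2_sesq_integrable[OF f(3) h(2)]
  have "form H f k - form H g h = (LINT x|lebesgue. cdot (f x) (H x *v k x) - cdot (g x) (H x *v h x))"
    unfolding form_def by (simp add: i1 i2)
  also have "\<dots> = (LINT x|lebesgue. cdot (f x) (H x *v k x) - cdot (H x *v g x) (h x))"
  proof (rule integral_cong_AE)
    show "(\<lambda>x. cdot (f x) (H x *v k x) - cdot (g x) (H x *v h x)) \<in> borel_measurable lebesgue"
      using i1 i2 by (intro borel_measurable_diff borel_measurable_integrable)
    show "(\<lambda>x. cdot (f x) (H x *v k x) - cdot (H x *v g x) (h x)) \<in> borel_measurable lebesgue"
      by (rule borel_measurable_integrable[OF compact_green(1)[OF f(1) h(1) R]])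
    show "AE x in lebesgue. cdot (f x) (H x *v k x) - cdot (g x) (H x *v h x) = cdot (f x) (H x *v k x) - cdot (H x *v g x) (h x)"
      using hermitian_swap_AE by eventually_elim simp
  qed
  also have "\<dots> = 0" by (rule compact_green(2)[OF f(1) h(1) R])
  finally show ?thesis by simp
qed

text \<open>The Lagrange identity for homogeneous solutions makes
  \<open>adj (Z x) ** J x ** Z x\<close> constant, equal to \<open>J 0\<close>. This gives the
  inverse of \<open>J x ** Z x\<close> as \<open>N ** adj (Z x)\<close> with \<open>N\<close> the
  inverse of \<open>J 0\<close>, hence variation of constants in a form that involves only integrals
  against \<open>adj (Z x)\<close>.\<close>

lemma fundamental_system:
  "\<exists>(Z :: real \<Rightarrow> complex^'m^'m) N. (\<forall>c. sol (\<lambda>x. Z x *v c) (\<lambda>x. 0)) \<and> continuous_on UNIV Z \<and> (\<forall>x. J x ** (Z x ** (N ** adj (Z x))) = mat 1)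
    \<and> (\<exists>M. has_density Z (\<lambda>x. M x ** Z x) \<and> (\<forall>x. J x ** M x = - B x))"
proof -
  obtain K where K: "continuous_on UNIV K" "\<And>x. J x ** K x = mat 1" "\<And>x. K x ** J x = mat 1"
    using continuous_inverse_matrix[OF loc_abs_cont_continuous[OF J_ac] J_det] by blast
  define M where "M x = - (K x ** B x)" for x
  have "loc_integrable (\<lambda>x. K x ** B x)"
    by (rule loc_integrable_bilinear[OF K(1) B_int bounded_bilinear_matrix_mult])
  then have "loc_integrable M"
    unfolding M_def by (rule loc_integrable_linear[OF _ bounded_linear_minus[OF bounded_linear_ident]])
  then obtain Z where Z: "has_density Z (\<lambda>x. M x ** Z x)" "Z 0 = mat 1"
    using fundamental_matrix_exists by blast
  have JM: "J x ** M x = - B x" for x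
    by (simp add: M_def mat_mult_simps matrix_mul_assoc K(2))
  have sZ: "sol (\<lambda>x. Z x *v c) (\<lambda>x. 0)" for c
  proof (rule solI)
    show "has_density (\<lambda>x. Z x *v c) (\<lambda>x. (M x ** Z x) *v c)"
      by (rule has_density_compose_linear[OF Z(1) bounded_bilinear.bounded_linear_left[OF bounded_bilinear_mult_vec]])
    show "AE x in lebesgue. J x *v ((M x ** Z x) *v c) + B x *v (Z x *v c) = 0"
      by (simp add: matrix_vector_mul_assoc matrix_mul_assoc JM mat_mult_simps mult_vec_simps)
  qed
  have const: "cdot c ((adj (Z x) ** J x ** Z x) *v d) = cdot c (J 0 *v d)" for x c d
  proof -
    have "has_density (\<lambda>x. cdot (Z x *v c) (J x *v (Z x *v d))) (\<lambda>x. 0)"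
      using lagrange[OF sZ[of c] sZ[of d]] by simp
    from has_density_zero_const[OF this, of x 0] show ?thesis
      by (simp add: Z(2) cdot_mult_left[of "Z x"] matrix_vector_mul_assoc matrix_mul_assoc)
  qed
  have ZJZ: "adj (Z x) ** J x ** Z x = J 0" for x
  proof -
    have "(adj (Z x) ** J x ** Z x) *v d = J 0 *v d" for d
    proof -
      let ?w = "(adj (Z x) ** J x ** Z x) *v d - J 0 *v d"
      have "cdot ?w ?w = 0" using const[of ?w x d] by (simp add: cdot_diff_right)
      then show ?thesis by (simp add: cdot_self)
    qed
    then show ?thesis by (simp add: matrix_eq)
  qed
  have JZ: "J x ** (Z x ** (K 0 ** adj (Z x))) = mat 1" for x
  proof -
    have "(K 0 ** adj (Z x) ** J x) ** Z x = mat 1"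
      using ZJZ[of x] K(3)[of 0] by (simp add: matrix_mul_assoc[symmetric])
    then have "Z x ** (K 0 ** adj (Z x) ** J x) = mat 1" by (simp add: matrix_left_right_inverse)
    then have "(Z x ** (K 0 ** adj (Z x))) ** J x = mat 1" by (simp add: matrix_mul_assoc)
    then show ?thesis by (simp add: matrix_left_right_inverse)
  qed
  show ?thesis
    by (rule exI[of _ Z], rule exI[of _ "K 0"], intro conjI allI exI[of _ M])
       (rule sZ Z(1) JM JZ has_density_continuous[OF Z(1)])+
qed

end

text \<open>The range of a Hermitian matrix is the orthogonal complement of its kernel; this serves
  to solve a Gram system that may be singular.\<close>

lemma hermitian_range_decomp:
  fixes G :: "complex^'n^'n"
  assumes G: "hermitian G" and b: "\<And>z. G *v z = 0 \<Longrightarrow> cdot z b = 0"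
  shows "b \<in> range ((*v) G)"
proof -
  let ?S = "range ((*v) G)"
  have lin: "linear ((*v) G)"
    by (rule bounded_linear.linear[OF bounded_bilinear.bounded_linear_right[OF bounded_bilinear_mult_vec]])
  then have sub: "subspace ?S" by (metis linear_subspace_image subspace_UNIV)
  obtain y z where yz: "y \<in> span ?S" "\<And>w. w \<in> span ?S \<Longrightarrow> orthogonal z w" "b = y + z"
    using orthogonal_subspace_decomp_exists by metis
  have y: "y \<in> ?S" using yz(1) sub by (metis span_eq_iff)
  have "orthogonal z (G *v (G *v z))" by (rule yz(2)) (simp add: span_base)
  then have "Re (cdot z (G *v (G *v z))) = 0" by (simp add: orthogonal_def Re_cdot)
  then have "G *v z = 0" by (simp add: hermitian_cdot[OF G, of z] cdot_self)
  then have "Re (cdot z b) = 0" using b by simp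
  moreover have "Re (cdot z y) = 0" using yz(2)[OF yz(1)] by (simp add: orthogonal_def Re_cdot)
  ultimately have "z = 0" by (simp add: yz(3) cdot_add_right cdot_self)
  then show ?thesis using y yz(3) by simp
qed

lemma has_density_primitive_from:
  fixes g :: "real \<Rightarrow> 'a::euclidean_space"
  assumes g: "loc_integrable g" and g0: "\<And>x. x < a \<Longrightarrow> g x = 0"
  shows "has_density (\<lambda>x. integral {a..x} g) g"
proof -
  obtain P where P: "has_density P g" using primitive_exists[OF g] by blast
  have "integral {a..x} g = P x - P a" for x
  proof (cases "a \<le> x")
    case True
    then show ?thesis using has_densityD[OF P True] by simp
  next
    case False
    have "P a - P x = integral {x..a} g" by (rule has_densityD[OF P]) (use False in simp)
    also have "\<dots> = integral {x..a} (\<lambda>_. 0)"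
      by (rule integral_spike[of "{a}"]) (use g0 in auto)
    finally show ?thesis using False by simp
  qed
  moreover have "has_density (\<lambda>x. P x - P a) g"
    using has_density_diff[OF P has_density_const[of "P a"]] by simp
  ultimately show ?thesis by simp
qed

section \<open>Representing pairs in the adjoint by solutions\<close>

context symmetric_system
begin

lemma sol_particular:
  fixes Z :: "real \<Rightarrow> complex^'m^'m"
  assumes J: "\<And>x. J x ** (Z x ** (N ** adj (Z x))) = mat 1"
    and Z: "has_density Z (\<lambda>x. M x ** Z x)" "\<And>x. J x ** M x = - B x"
    and P: "has_density P (\<lambda>x. adj (Z x) *v F x)"
  shows "sol (\<lambda>x. Z x *v (N *v P x)) F"
proof (rule solI)
  have "has_density (\<lambda>x. N *v P x) (\<lambda>x. N *v (adj (Z x) *v F x))"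
    by (rule has_density_compose_linear[OF P bounded_bilinear.bounded_linear_right[OF bounded_bilinear_mult_vec]])
  then show "has_density (\<lambda>x. Z x *v (N *v P x)) (\<lambda>x. Z x *v (N *v (adj (Z x) *v F x)) + (M x ** Z x) *v (N *v P x))"
    by (rule has_density_bilinear[OF Z(1) _ bounded_bilinear_mult_vec])
  have "J x *v (Z x *v (N *v (adj (Z x) *v F x)) + (M x ** Z x) *v (N *v P x)) + B x *v (Z x *v (N *v P x)) = F x" for x
  proof -
    have "J x *v (Z x *v (N *v (adj (Z x) *v F x))) = F x"
      using J[of x] by (simp add: matrix_vector_mul_assoc matrix_mul_assoc)
    moreover have "J x *v ((M x ** Z x) *v (N *v P x)) = - (B x *v (Z x *v (N *v P x)))"
      by (simp add: matrix_vector_mul_assoc matrix_mul_assoc Z(2) mat_mult_simps mult_vec_simps)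
    ultimately show ?thesis by (simp add: mult_vec_simps)
  qed
  then show "AE x in lebesgue. J x *v (Z x *v (N *v (adj (Z x) *v F x)) + (M x ** Z x) *v (N *v P x)) + B x *v (Z x *v (N *v P x)) = F x"
    by simp
qed

lemma integrable_qf_zero_AE:
  assumes "r \<in> L2_fun H" "nrm2 r = 0"
  shows "AE x in lebesgue. H x *v r x = 0"
proof -
  have "AE x in lebesgue. qf (H x) (r x) = 0"
    using integral_nonneg_eq_0_iff_AE[OF L2_qf[OF assms(1)] qf_nonneg_AE] assms(2) by (simp add: nrm2_def)
  then show ?thesis using Hpsd by eventually_elim (rule psd_qf_zero)
qed

text \<open>On \<open>{a..b}\<close> the defect \<open>f - w\<close> is split into its projection onto the homogeneous
  solutions \<open>Z c\<close> and a remainder \<open>r\<close>. Since \<open>r\<close> is orthogonal to these, the solution of the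
  system with right-hand side \<open>r\<close> that starts at \<open>0\<close> in \<open>a\<close> vanishes again after \<open>b\<close>, hence is an
  admissible test function, and testing with it gives \<open>r = 0\<close> almost everywhere in the weighted sense.\<close>
theorem adjoint_local_solution:
  fixes Z :: "real \<Rightarrow> complex^'m^'m"
  assumes Z: "\<And>c. sol (\<lambda>x. Z x *v c) (\<lambda>x. 0)" "continuous_on UNIV Z"
      "\<And>x. J x ** (Z x ** (N ** adj (Z x))) = mat 1"
      "has_density Z (\<lambda>x. M x ** Z x)" "\<And>x. J x ** M x = - B x"
    and f: "f \<in> L2_fun H" and g: "g \<in> L2_fun H"
    and adj: "\<And>h k. (h, k) \<in> T_min \<Longrightarrow> form H f k = form H g h"
    and w: "sol w (\<lambda>x. H x *v g x)" and ab: "a \<le> b"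
  shows "\<exists>c. AE x in lebesgue. x \<in> {a..b} \<longrightarrow> H x *v (f x - w x - Z x *v c) = 0"
proof -
  note wc = sol_continuous[OF w, of UNIV]
  have adjZc: "continuous_on UNIV (\<lambda>x. adj (Z x))"
    by (rule bounded_linear.continuous_on[OF bounded_linear_adj Z(2)])
  define I where "I = {a..b}"
  define v where "v = (\<lambda>x. (if x \<in> I then f x else 0) - (if x \<in> I then w x else 0))"
  have vL: "v \<in> L2_fun H"
    unfolding v_def I_def by (rule L2_diff[OF L2_cutoff[OF f] L2_cutoff_continuous[OF wc]])
  have zcL: "(\<lambda>x. if x \<in> I then Z x *v c else 0) \<in> L2_fun H" for c
    unfolding I_def by (rule L2_cutoff_continuous[OF sol_continuous[OF Z(1)]])
  define r where "r c = (\<lambda>x. v x - (if x \<in> I then Z x *v c else 0))" for c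
  have rL: "r c \<in> L2_fun H" for c unfolding r_def by (rule L2_diff[OF vL zcL])
  have r_out: "r c x = 0" if "x \<notin> I" for c x using that by (simp add: r_def v_def)
  \<comment> \<open>\<open>G\<close> is the Gram matrix of the columns of \<open>Z\<close> on
    \<open>I\<close>, and \<open>d\<close> the vector of their products with \<open>v\<close>.
    \<open>G\<close> may be singular, but a kernel vector gives a homogeneous solution of seminorm
    \<open>0\<close> on \<open>I\<close>, so \<open>d\<close> is orthogonal to it by the
    Cauchy-Schwarz inequality, and \<open>G *v c = d\<close> is solvable.\<close>
  define G where "G = integral I (\<lambda>x. adj (Z x) ** (H x ** Z x))"
  define d where "d = integral I (\<lambda>x. adj (Z x) *v (H x *v v x))"
  have Gi: "loc_integrable (\<lambda>x. adj (Z x) ** (H x ** Z x))"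
    by (intro loc_integrable_bilinear[OF adjZc _ bounded_bilinear_matrix_mult]
        loc_integrable_bilinear'[OF Z(2) H_int bounded_bilinear_matrix_mult])
  have ui: "loc_integrable (\<lambda>x. adj (Z x) *v (H x *v u x))" if "u \<in> L2_fun H" for u
    by (rule loc_integrable_bilinear[OF adjZc weighted_loc_integrable[OF that] bounded_bilinear_mult_vec])
  have Gv: "G *v c = integral I (\<lambda>x. adj (Z x) *v (H x *v (Z x *v c)))" for c
  proof -
    have "integral I (\<lambda>x. (adj (Z x) ** (H x ** Z x)) *v c) = G *v c"
      unfolding G_def I_def
      by (rule integral_linear[OF loc_integrable_integrable_on[OF Gi]
            bounded_bilinear.bounded_linear_left[OF bounded_bilinear_mult_vec], unfolded o_def])
    then show ?thesis by (simp add: matrix_vector_mul_assoc)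
  qed
  have cdot_int: "cdot c (integral I (\<lambda>x. adj (Z x) *v (H x *v u x))) = form H (\<lambda>x. if x \<in> I then Z x *v c else 0) u"
    if u: "u \<in> L2_fun H" for c u
  proof -
    have "cdot c (integral I (\<lambda>x. adj (Z x) *v (H x *v u x))) = integral I (\<lambda>x. cdot c (adj (Z x) *v (H x *v u x)))"
      unfolding I_def
      by (rule integral_linear[OF loc_integrable_integrable_on[OF ui[OF u]]
            bounded_bilinear.bounded_linear_right[OF bounded_bilinear_cdot], unfolded o_def, symmetric])
    also have "\<dots> = integral I (\<lambda>x. cdot (if x \<in> I then Z x *v c else 0) (H x *v u x))"
      by (rule Henstock_Kurzweil_Integration.integral_cong) (simp add: cdot_mult_left)
    also have "\<dots> = (LINT x|lebesgue. cdot (if x \<in> I then Z x *v c else 0) (H x *v u x))"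
      unfolding I_def
      by (rule loc_integrable_bounded_support(2)[symmetric])
         (use integrable_imp_loc_integrable[OF L2_sesq_integrable[OF zcL u]] in \<open>auto simp: I_def\<close>)
    finally show ?thesis by (simp add: form_def)
  qed
  have Gzc: "integral I (\<lambda>x. adj (Z x) *v (H x *v (if x \<in> I then Z x *v c else 0))) = G *v c" for c
    unfolding Gv by (rule Henstock_Kurzweil_Integration.integral_cong) simp
  have herm: "hermitian G"
  proof -
    have "adj G *v c = G *v c" for c
    proof -
      have sym: "cdot e (G *v c) = cdot (G *v e) c" for e
      proof -
        have "cdot e (G *v c) = form H (\<lambda>x. if x \<in> I then Z x *v e else 0) (\<lambda>x. if x \<in> I then Z x *v c else 0)"
          unfolding Gzc[of c, symmetric] by (rule cdot_int[OF zcL])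
        also have "\<dots> = cnj (form H (\<lambda>x. if x \<in> I then Z x *v c else 0) (\<lambda>x. if x \<in> I then Z x *v e else 0))"
          by (rule form_cnj[OF zcL zcL])
        also have "\<dots> = cnj (cdot c (G *v e))"
          unfolding Gzc[of e, symmetric] by (subst cdot_int[OF zcL]) simp
        finally show ?thesis by (simp add: cnj_cdot)
      qed
      let ?u = "G *v c - adj G *v c"
      have "cdot ?u ?u = 0" using sym[of ?u] by (simp add: cdot_diff_right cdot_mult_left)
      then show ?thesis by (simp add: cdot_self)
    qed
    then show ?thesis by (simp add: hermitian_def matrix_eq)
  qed
  have "d \<in> range ((*v) G)"
  proof (rule hermitian_range_decomp[OF herm])
    fix z assume z: "G *v z = 0"
    have "complex_of_real (nrm2 (\<lambda>x. if x \<in> I then Z x *v z else 0)) = cdot z (G *v z)"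
      unfolding Gzc[of z, symmetric] cdot_int[OF zcL] by (simp add: form_self)
    then have "nrm2 (\<lambda>x. if x \<in> I then Z x *v z else 0) = 0" using z by simp
    then have "form H (\<lambda>x. if x \<in> I then Z x *v z else 0) v = 0"
      using form_cauchy_schwarz[OF zcL vL, of z] by simp
    then show "cdot z d = 0" unfolding d_def cdot_int[OF vL] .
  qed
  then obtain c where c: "d = G *v c" by blast
  have intr: "integral I (\<lambda>x. adj (Z x) *v (H x *v r c x)) = 0"
  proof -
    have ii: "F integrable_on I" if "loc_integrable F" for F :: "real \<Rightarrow> complex^'m"
      using loc_integrable_integrable_on[OF that] by (simp add: I_def)
    have "integral I (\<lambda>x. adj (Z x) *v (H x *v r c x)) =
      integral I (\<lambda>x. adj (Z x) *v (H x *v v x) - adj (Z x) *v (H x *v (if x \<in> I then Z x *v c else 0)))"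
      by (rule Henstock_Kurzweil_Integration.integral_cong) (simp add: r_def mult_vec_simps)
    also have "\<dots> = d - G *v c"
      unfolding d_def Gzc[of c, symmetric]
      by (rule Henstock_Kurzweil_Integration.integral_diff[OF ii[OF ui[OF vL]] ii[OF ui[OF zcL]]])
    finally have "integral I (\<lambda>x. adj (Z x) *v (H x *v r c x)) = d - G *v c" .
    then show ?thesis by (simp add: c)
  qed
  \<comment> \<open>The primitive in variation of constants. It is \<open>0\<close> before
    \<open>a\<close> because the interval is empty, and \<open>0\<close> after \<open>b\<close> by
    \<open>intr\<close>, so that \<open>h\<close> vanishes outside \<open>I\<close>.\<close>
  define P where "P x = integral {a..x} (\<lambda>x. adj (Z x) *v (H x *v r c x))" for x
  have Pd: "has_density P (\<lambda>x. adj (Z x) *v (H x *v r c x))"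
    unfolding P_def by (rule has_density_primitive_from[OF ui[OF rL]]) (simp add: r_out I_def)
  have P0: "P x = 0" if "x \<notin> I" for x
  proof (cases "x < a")
    case False
    then have x: "b < x" using that by (auto simp: I_def)
    have "P x - P b = integral {b..x} (\<lambda>x. adj (Z x) *v (H x *v r c x))"
      by (rule has_densityD[OF Pd]) (use x in simp)
    also have "\<dots> = integral {b..x} (\<lambda>_. 0)"
      by (rule integral_spike[of "{b}"]) (auto simp: r_out I_def)
    also have "P b = 0" using intr by (simp add: P_def I_def)
    finally show ?thesis by simp
  qed (simp add: P_def)
  define h where "h x = Z x *v (N *v P x)" for x
  have hs: "sol h (\<lambda>x. H x *v r c x)"
    unfolding h_def by (rule sol_particular[OF Z(3,4,5) Pd])
  define R where "R = max \<bar>a\<bar> \<bar>b\<bar>"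
  have outI: "x \<notin> I" if "\<bar>x\<bar> > R" for x using that by (auto simp: R_def I_def)
  have hR: "h x = 0" if "\<bar>x\<bar> > R" for x using P0[OF outI[OF that]] by (simp add: h_def)
  have hT: "(h, r c) \<in> T_min"
    unfolding T_min_def using hs rL compactly_supportedI[of R h] compactly_supportedI[of R "r c"] hR r_out[OF outI]
    by auto
  then have hL: "h \<in> L2_fun H" using T_min_subset by (auto simp: T_max_def)
  let ?cut = "\<lambda>u x. if x \<in> I then u x else 0"
  have fcL: "?cut f \<in> L2_fun H" unfolding I_def by (rule L2_cutoff[OF f])
  have wcL: "?cut w \<in> L2_fun H" unfolding I_def by (rule L2_cutoff_continuous[OF wc])
  have f_r: "form H (?cut f) (r c) = form H f (r c)"
    unfolding form_def by (rule Bochner_Integration.integral_cong) (auto simp: r_out)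
  have w_r: "form H (?cut w) (r c) = form H g h"
  proof -
    have "form H (?cut w) (r c) - form H g h = (LINT x|lebesgue. cdot (?cut w x) (H x *v r c x) - cdot (g x) (H x *v h x))"
      unfolding form_def by (simp add: L2_sesq_integrable[OF wcL rL] L2_sesq_integrable[OF g hL])
    also have "\<dots> = (LINT x|lebesgue. cdot (w x) (H x *v r c x) - cdot (H x *v g x) (h x))"
    proof (rule integral_cong_AE)
      show "(\<lambda>x. cdot (?cut w x) (H x *v r c x) - cdot (g x) (H x *v h x)) \<in> borel_measurable lebesgue"
        using L2_sesq_integrable[OF wcL rL] L2_sesq_integrable[OF g hL]
        by (intro borel_measurable_diff borel_measurable_integrable)
      show "(\<lambda>x. cdot (w x) (H x *v r c x) - cdot (H x *v g x) (h x)) \<in> borel_measurable lebesgue"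
        by (rule borel_measurable_integrable[OF compact_green(1)[OF w hs hR]])
      show "AE x in lebesgue. cdot (?cut w x) (H x *v r c x) - cdot (g x) (H x *v h x) = cdot (w x) (H x *v r c x) - cdot (H x *v g x) (h x)"
        using hermitian_swap_AE by eventually_elim (auto simp: r_out)
    qed
    also have "\<dots> = 0" by (rule compact_green(2)[OF w hs hR])
    finally show ?thesis by simp
  qed
  \<comment> \<open>Both \<open>f\<close> and the particular solution \<open>w\<close> pair with
    \<open>r c\<close> to \<open>form H g h\<close>: the first because of the adjoint relation, the
    second by Green's formula.\<close>
  have "form H v (r c) = 0"
    unfolding v_def form_diff_left[OF fcL wcL rL] f_r w_r using adj[OF hT] by simp
  moreover have "form H (\<lambda>x. if x \<in> I then Z x *v c else 0) (r c) = 0"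
    using cdot_int[OF rL, of c c] intr by simp
  ultimately have "form H (r c) (r c) = 0"
    using form_diff_left[OF vL zcL rL, of c c] by (simp add: r_def)
  then have "nrm2 (r c) = 0" by (simp add: form_self)
  from integrable_qf_zero_AE[OF rL this]
  have "AE x in lebesgue. x \<in> {a..b} \<longrightarrow> H x *v (f x - w x - Z x *v c) = 0"
    by eventually_elim (auto simp: r_def v_def I_def)
  then show ?thesis by blast
qed

text \<open>On each bounded interval a homogeneous correction \<open>c\<close> exists, but it need
  not be unique, since homogeneous solutions may be invisible to \<open>H\<close> there. The
  ambiguities \<open>K n\<close> are decreasing subspaces of a finite-dimensional space, so they are
  constant from some \<open>n0\<close> on, and then every \<open>c\<close> that works for
  \<open>n0\<close> works for all \<open>n\<close>.\<close>

theorem adjoint_solution: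
  assumes f: "f \<in> L2_fun H" and g: "g \<in> L2_fun H"
    and adj: "\<And>h k. (h, k) \<in> T_min \<Longrightarrow> form H f k = form H g h"
  shows "\<exists>f'. (f', g) \<in> T_max \<and> nrm2 (\<lambda>x. f x - f' x) = 0"
proof -
  obtain Z :: "real \<Rightarrow> complex^'m^'m" and N M where Z: "\<And>c. sol (\<lambda>x. Z x *v c) (\<lambda>x. 0)" "continuous_on UNIV Z"
      "\<And>x. J x ** (Z x ** (N ** adj (Z x))) = mat 1"
      "has_density Z (\<lambda>x. M x ** Z x)" "\<And>x. J x ** M x = - B x"
    using fundamental_system by blast
  have "loc_integrable (\<lambda>x. adj (Z x) *v (H x *v g x))"
    by (rule loc_integrable_bilinear[OF bounded_linear.continuous_on[OF bounded_linear_adj Z(2)]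
          weighted_loc_integrable[OF g] bounded_bilinear_mult_vec])
  then obtain P where "has_density P (\<lambda>x. adj (Z x) *v (H x *v g x))" using primitive_exists by blast
  from sol_particular[OF Z(3,4,5) this] obtain w where w: "sol w (\<lambda>x. H x *v g x)" by blast
  define C where "C n = {c. AE x in lebesgue. x \<in> {- real n..real n} \<longrightarrow> H x *v (f x - w x - Z x *v c) = 0}" for n
  define K where "K n = {c. AE x in lebesgue. x \<in> {- real n..real n} \<longrightarrow> H x *v (Z x *v c) = 0}" for n
  have C_ne: "C n \<noteq> {}" for n
    using adjoint_local_solution[OF Z f g adj w, of "- real n" "real n"] by (auto simp: C_def)
  have K_sub: "subspace (K n)" for n
  proof (rule subspaceI)
    show "0 \<in> K n" by (simp add: K_def)
    show "x + y \<in> K n" if "x \<in> K n" "y \<in> K n" for x y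
    proof -
      have "AE t in lebesgue. t \<in> {- real n..real n} \<longrightarrow> H t *v (Z t *v x) = 0"
        "AE t in lebesgue. t \<in> {- real n..real n} \<longrightarrow> H t *v (Z t *v y) = 0" using that by (auto simp: K_def)
      then have "AE t in lebesgue. t \<in> {- real n..real n} \<longrightarrow> H t *v (Z t *v (x + y)) = 0"
        by eventually_elim (simp add: mult_vec_simps)
      then show ?thesis by (simp add: K_def)
    qed
    show "c *\<^sub>R x \<in> K n" if "x \<in> K n" for c x
    proof -
      have "AE t in lebesgue. t \<in> {- real n..real n} \<longrightarrow> H t *v (Z t *v x) = 0" using that by (auto simp: K_def)
      then have "AE t in lebesgue. t \<in> {- real n..real n} \<longrightarrow> H t *v (Z t *v (c *\<^sub>R x)) = 0"
        by eventually_elim (simp add: mult_vec_simps)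
      then show ?thesis by (simp add: K_def)
    qed
  qed
  have mono: "K m \<subseteq> K n" "C m \<subseteq> C n" if "n \<le> m" for n m
    using that unfolding K_def C_def by (auto elim!: eventually_mono)
  define n0 where "n0 = (ARG_MIN (\<lambda>n. dim (K n)) n. True)"
  have n0: "dim (K n0) \<le> dim (K n)" for n unfolding n0_def by (rule arg_min_nat_le) simp
  have K_eq: "K n = K n0" if "n \<ge> n0" for n
    by (rule subspace_dim_equal[OF K_sub K_sub mono(1)[OF that] n0])
  obtain c where c: "c \<in> C n0" using C_ne by blast
  have c_all: "c \<in> C n" for n
  proof -
    have "c \<in> C m" if m: "m \<ge> n0" for m
    proof -
      obtain c' where c': "c' \<in> C m" using C_ne by blast
      then have "c' \<in> C n0" using mono(2)[OF m] by blast
      with c have "AE x in lebesgue. x \<in> {- real n0..real n0} \<longrightarrow> H x *v (f x - w x - Z x *v c) = 0"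
        "AE x in lebesgue. x \<in> {- real n0..real n0} \<longrightarrow> H x *v (f x - w x - Z x *v c') = 0" by (auto simp: C_def)
      then have "AE x in lebesgue. x \<in> {- real n0..real n0} \<longrightarrow> H x *v (Z x *v (c' - c)) = 0"
        by eventually_elim (simp add: mult_vec_simps)
      then have "c' - c \<in> K m" using K_eq[OF m] by (simp add: K_def)
      then have "AE x in lebesgue. x \<in> {- real m..real m} \<longrightarrow> H x *v (Z x *v (c' - c)) = 0" by (simp add: K_def)
      moreover have "AE x in lebesgue. x \<in> {- real m..real m} \<longrightarrow> H x *v (f x - w x - Z x *v c') = 0"
        using c' by (simp add: C_def)
      ultimately have "AE x in lebesgue. x \<in> {- real m..real m} \<longrightarrow> H x *v (f x - w x - Z x *v c) = 0"
        by eventually_elim (simp add: mult_vec_simps)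
      then show ?thesis by (simp add: C_def)
    qed
    then have "c \<in> C (max n n0)" by simp
    then show ?thesis using mono(2)[of n "max n n0"] by auto
  qed
  define f' where "f' x = w x + Z x *v c" for x
  have sf: "sol f' (\<lambda>x. H x *v g x)"
    unfolding f'_def using sol_add[OF w Z(1)[of c]] by simp
  have "AE x in lebesgue. \<forall>n. x \<in> {- real n..real n} \<longrightarrow> H x *v (f x - w x - Z x *v c) = 0"
    unfolding AE_all_countable using c_all by (simp add: C_def)
  then have ae: "AE x in lebesgue. qf (H x) (f x - f' x) = 0"
  proof eventually_elim
    case (elim x)
    obtain n where "\<bar>x\<bar> \<le> real n" using real_arch_simple by blast
    then have "x \<in> {- real n..real n}" by auto
    then have "H x *v (f x - w x - Z x *v c) = 0" using elim by blast
    then show ?case by (simp add: qf_def f'_def diff_diff_eq)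
  qed
  have "f' \<in> borel_measurable borel" by (rule borel_measurable_continuous_onI[OF sol_continuous[OF sf]])
  then have "(\<lambda>x. f x - f' x) \<in> borel_measurable borel" using L2_measurable[OF f] by measurable
  then have d: "(\<lambda>x. f x - f' x) \<in> L2_fun H"
    by (rule L2_bound[of _ "\<lambda>_. 0"]) (use ae in \<open>auto elim!: eventually_mono\<close>)
  have "f' \<in> L2_fun H" using L2_diff[OF f d] by simp
  moreover have "nrm2 (\<lambda>x. f x - f' x) = 0"
    unfolding nrm2_def using ae by (intro integral_eq_zero_AE)
  ultimately show ?thesis using sf g by (auto simp: T_max_def)
qed

text \<open>For the harder inclusion \<open>(f, g)\<close> is projected onto the minimal relation.
  The residual \<open>(w1, w2)\<close> is orthogonal to it, which says that
  \<open>(w2, - w1)\<close> belongs to the adjoint and so is represented in \<open>T_max\<close>.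
  Symmetry of \<open>T_max\<close> then makes the residual orthogonal to \<open>(f, g)\<close>,
  hence to itself.\<close>

theorem ess_self_adjointI:
  assumes sym: "\<And>f g h k. (f, g) \<in> T_max \<Longrightarrow> (h, k) \<in> T_max \<Longrightarrow> form H f k = form H g h"
  shows "ess_self_adjoint H (S_min J B H)"
proof -
  let ?S = "S_min J B H" and ?T = "prod_topology (L2_topology H) (L2_topology H)"
  have TL: "T_min \<subseteq> L2_fun H \<times> L2_fun H" using T_min_subset by (auto simp: T_max_def)
  have SL: "?S \<subseteq> L2_space H \<times> L2_space H"
    unfolding S_min_eq using TL L2_class_in_space by auto
  have top: "topspace ?T = L2_space H \<times> L2_space H"
    unfolding L2_topology_def by (simp add: Metric_space.topspace_mtopology[OF Metric_space_L2])
  have adj_iff: "(L2_class H f, L2_class H g) \<in> rel_adjoint H ?S \<longleftrightarrow> (\<forall>(h, k)\<in>T_min. form H f k = form H g h)"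
    if fg: "f \<in> L2_fun H" "g \<in> L2_fun H" for f g
  proof -
    have hk: "h \<in> L2_fun H" "k \<in> L2_fun H" if "(h, k) \<in> T_min" for h k using that TL by auto
    have "(L2_class H f, L2_class H g) \<in> rel_adjoint H ?S \<longleftrightarrow>
      (\<forall>(h, k)\<in>T_min. L2_inner H (L2_class H f) (L2_class H k) = L2_inner H (L2_class H g) (L2_class H h))"
      unfolding rel_adjoint_def S_min_eq using fg L2_class_in_space by auto
    also have "\<dots> \<longleftrightarrow> (\<forall>(h, k)\<in>T_min. form H f k = form H g h)"
      using hk fg by (auto simp: L2_inner_class)
    finally show ?thesis .
  qed
  have sub1: "(L2_class H f, L2_class H g) \<in> rel_adjoint H ?S"
    if fg: "f \<in> L2_fun H" "g \<in> L2_fun H" and cl: "(L2_class H f, L2_class H g) \<in> ?T closure_of ?S" for f g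
    unfolding adj_iff[OF fg]
  proof clarify
    fix h k assume hk: "(h, k) \<in> T_min"
    have hkL: "h \<in> L2_fun H" "k \<in> L2_fun H" using hk TL by auto
    define Q where "Q e p \<longleftrightarrow> p \<in> T_min \<and> nrm2 (\<lambda>x. f x - fst p x) + nrm2 (\<lambda>x. g x - snd p x) < e" for e p
    have approx: "\<exists>p. Q e p" if "e > 0" for e
    proof -
      obtain p q where pq: "p \<in> L2_fun H" "q \<in> L2_fun H" "(L2_class H p, L2_class H q) \<in> ?S"
         "nrm2 (\<lambda>x. f x - p x) + nrm2 (\<lambda>x. g x - q x) < e"
        using cl[unfolded closure_of_L2_prod[OF fg SL]] \<open>e > 0\<close> by blast
      \<comment> \<open>The approximants are known to belong to \<open>?S\<close> only as classes;
        they are exchanged for representatives in \<open>T_min\<close>, which costs nothing in the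
        seminorm.\<close>
      from pq(3) obtain f' g' where fg': "(f', g') \<in> T_min" "L2_class H p = L2_class H f'" "L2_class H q = L2_class H g'"
        unfolding S_min_eq by auto
      have L': "f' \<in> L2_fun H" "g' \<in> L2_fun H" using fg' TL by auto
      have z: "nrm2 (\<lambda>x. p x - f' x) = 0" "nrm2 (\<lambda>x. q x - g' x) = 0"
        using fg' pq(1,2) L' by (auto simp: L2_class_eq_iff)
      have "sqrt (nrm2 (\<lambda>x. f x - f' x)) \<le> sqrt (nrm2 (\<lambda>x. f x - p x))"
        using nrm2_diff_trans[OF fg(1) pq(1) L'(1)] z by simp
      moreover have "sqrt (nrm2 (\<lambda>x. g x - g' x)) \<le> sqrt (nrm2 (\<lambda>x. g x - q x))"
        using nrm2_diff_trans[OF fg(2) pq(2) L'(2)] z by simp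
      ultimately show ?thesis using fg'(1) pq(4) by (intro exI[of _ "(f', g')"]) (auto simp: Q_def)
    qed
    have "\<exists>p. Q (inverse (real (Suc n))) p" for n
      by (rule approx) simp
    then obtain p where p: "\<And>n. Q (inverse (real (Suc n))) (p n)" by metis
    define F G where "F n = fst (p n)" and "G n = snd (p n)" for n
    have FG: "(F n, G n) \<in> T_min"
      "nrm2 (\<lambda>x. f x - F n x) + nrm2 (\<lambda>x. g x - G n x) < inverse (real (Suc n))" for n
      using p[of n] by (simp_all add: Q_def F_def G_def)
    have FL: "F n \<in> L2_fun H" "G n \<in> L2_fun H" for n using FG(1)[of n] TL by auto
    have bd: "nrm2 (\<lambda>x. F n x - f x) \<le> inverse (real (Suc n))" "nrm2 (\<lambda>x. G n x - g x) \<le> inverse (real (Suc n))" for n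
      using FG(2)[of n] nrm2_minus[of "F n" f] nrm2_minus[of "G n" g]
        nrm2_nonneg[of "\<lambda>x. f x - F n x"] nrm2_nonneg[of "\<lambda>x. g x - G n x"] by linarith+
    have "(\<lambda>n. nrm2 (\<lambda>x. F n x - f x)) \<longlonglongrightarrow> 0"
      by (rule real_tendsto_sandwich[OF always_eventually always_eventually tendsto_const LIMSEQ_inverse_real_of_nat])
         (intro allI nrm2_nonneg bd)+
    from nrm2_limit[OF FL(1) fg(1) this hkL(2)] have 1: "(\<lambda>n. form H (F n) k) \<longlonglongrightarrow> form H f k" .
    have "(\<lambda>n. nrm2 (\<lambda>x. G n x - g x)) \<longlonglongrightarrow> 0"
      by (rule real_tendsto_sandwich[OF always_eventually always_eventually tendsto_const LIMSEQ_inverse_real_of_nat])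
         (intro allI nrm2_nonneg bd)+
    from nrm2_limit[OF FL(2) fg(2) this hkL(1)] have 2: "(\<lambda>n. form H (G n) h) \<longlonglongrightarrow> form H g h" .
    have "form H (F n) k = form H (G n) h" for n
      using symmetric_T_max_T_min[OF _ hk] FG(1) T_min_subset by blast
    then show "form H f k = form H g h" using 1 2 LIMSEQ_unique by simp
  qed
  have sub2: "(L2_class H f, L2_class H g) \<in> ?T closure_of ?S"
    if fg: "(f, g) \<in> T_max" for f g
  proof -
    have L: "f \<in> L2_fun H" "g \<in> L2_fun H" using fg by (auto simp: T_max_def)
    have zero: "(\<lambda>x. 0, \<lambda>x. 0) \<in> T_min"
      using solI[OF has_density_const[of 0], of "\<lambda>_. 0"] L2_zero compactly_supportedI[of 0 "\<lambda>_. 0 :: complex^'m"]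
      by (simp add: T_min_def)
    have cs_add: "compactly_supported (\<lambda>x. u x + v x)" if uv: "compactly_supported u" "compactly_supported v"
      for u v :: "real \<Rightarrow> complex^'m"
    proof -
      obtain R1 where R1: "\<And>x. \<bar>x\<bar> > R1 \<Longrightarrow> u x = 0" using compactly_supported_bound[OF uv(1)] by blast
      obtain R2 where R2: "\<And>x. \<bar>x\<bar> > R2 \<Longrightarrow> v x = 0" using compactly_supported_bound[OF uv(2)] by blast
      show ?thesis by (rule compactly_supportedI[of "max R1 R2"]) (simp add: R1 R2)
    qed
    have cs_smult: "compactly_supported (\<lambda>x. c *s u x)" if u: "compactly_supported u"
      for u :: "real \<Rightarrow> complex^'m" and c
    proof -
      obtain R1 where R1: "\<And>x. \<bar>x\<bar> > R1 \<Longrightarrow> u x = 0" using compactly_supported_bound[OF u] by blast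
      show ?thesis by (rule compactly_supportedI[of R1]) (simp add: R1)
    qed
    have "\<exists>w1 w2 s1 s2. w1 \<in> L2_fun H \<and> w2 \<in> L2_fun H \<and> (\<forall>n. (s1 n, s2 n) \<in> T_min)
      \<and> (\<lambda>n. nrm2 (\<lambda>x. f x - s1 n x - w1 x) + nrm2 (\<lambda>x. g x - s2 n x - w2 x)) \<longlonglongrightarrow> 0
      \<and> (\<forall>(y, z)\<in>T_min. form H w1 y + form H w2 z = 0)"
    proof (rule pair_projection[OF TL zero _ _ L])
      show "(\<lambda>x. f x + f' x, \<lambda>x. g x + g' x) \<in> T_min" if "(f, g) \<in> T_min" "(f', g') \<in> T_min" for f g f' g'
        using that sol_add[of f "\<lambda>x. H x *v g x" f' "\<lambda>x. H x *v g' x"]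
        by (simp add: T_min_def L2_add cs_add mult_vec_simps)
      show "(\<lambda>x. c *s f x, \<lambda>x. c *s g x) \<in> T_min" if "(f, g) \<in> T_min" for f g c
        using that sol_smult[of f "\<lambda>x. H x *v g x" c]
        by (simp add: T_min_def L2_smult cs_smult vector_scalar_commute)
    qed
    then obtain w1 w2 s1 s2 where w: "w1 \<in> L2_fun H" "w2 \<in> L2_fun H" and s: "\<And>n. (s1 n, s2 n) \<in> T_min"
      and lim: "(\<lambda>n. nrm2 (\<lambda>x. f x - s1 n x - w1 x) + nrm2 (\<lambda>x. g x - s2 n x - w2 x)) \<longlonglongrightarrow> 0"
      and orth: "\<And>y z. (y, z) \<in> T_min \<Longrightarrow> form H w1 y + form H w2 z = 0" by blast
    have sL: "s1 n \<in> L2_fun H" "s2 n \<in> L2_fun H" for n using s[of n] TL by auto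
    have mw: "(\<lambda>x. - w1 x) \<in> L2_fun H" by (rule L2_minus[OF w(1)])
    have fm: "form H (\<lambda>x. - w1 x) y = - form H w1 y" "form H y (\<lambda>x. - w1 x) = - form H y w1" for y
      using form_smult_left[of "-1" w1 y] form_smult_right[of y "-1" w1] by simp_all
    have "form H w2 z = form H (\<lambda>x. - w1 x) y" if "(y, z) \<in> T_min" for y z
      using orth[OF that] fm by (simp add: add_eq_0_iff)
    then obtain p where p: "(p, \<lambda>x. - w1 x) \<in> T_max" "nrm2 (\<lambda>x. w2 x - p x) = 0"
      using adjoint_solution[OF w(2) mw] by blast
    have pL: "p \<in> L2_fun H" using p(1) by (simp add: T_max_def)
    have "form H f (\<lambda>x. - w1 x) = form H g p" by (rule sym[OF fg p(1)])
    also have "form H g p = form H g w2"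
      by (rule form_cong_nrm2[OF L(2) L(2) pL w(2)]) (use p(2) nrm2_minus[of w2 p] in \<open>simp_all add: nrm2_def\<close>)
    finally have fw: "form H f w1 + form H g w2 = 0" using fm by (simp add: add_eq_0_iff)
    have d1: "(\<lambda>x. f x - s1 n x) \<in> L2_fun H" and d2: "(\<lambda>x. g x - s2 n x) \<in> L2_fun H" for n
      by (intro L2_diff L sL)+
    have l1: "(\<lambda>n. nrm2 (\<lambda>x. f x - s1 n x - w1 x)) \<longlonglongrightarrow> 0"
      by (rule real_tendsto_sandwich[OF _ _ tendsto_const lim]) (auto intro!: always_eventually simp: nrm2_nonneg)
    have l2: "(\<lambda>n. nrm2 (\<lambda>x. g x - s2 n x - w2 x)) \<longlonglongrightarrow> 0"
      by (rule real_tendsto_sandwich[OF _ _ tendsto_const lim]) (auto intro!: always_eventually simp: nrm2_nonneg)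
    have "(\<lambda>n. form H (\<lambda>x. f x - s1 n x) w1 + form H (\<lambda>x. g x - s2 n x) w2) \<longlonglongrightarrow> form H w1 w1 + form H w2 w2"
      by (intro tendsto_add nrm2_limit[OF d1 w(1) l1 w(1)] nrm2_limit[OF d2 w(2) l2 w(2)])
    moreover have "form H (\<lambda>x. f x - s1 n x) w1 + form H (\<lambda>x. g x - s2 n x) w2 = 0" for n
    proof -
      have "form H (s1 n) w1 + form H (s2 n) w2 = cnj (form H w1 (s1 n) + form H w2 (s2 n))"
        using form_cnj[OF w(1) sL(1)] form_cnj[OF w(2) sL(2)] by simp
      also have "\<dots> = 0" using orth[OF s] by simp
      finally have sw: "form H (s1 n) w1 + form H (s2 n) w2 = 0" .
      have "form H (\<lambda>x. f x - s1 n x) w1 + form H (\<lambda>x. g x - s2 n x) w2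
        = (form H f w1 + form H g w2) - (form H (s1 n) w1 + form H (s2 n) w2)"
        unfolding form_diff_left[OF L(1) sL(1) w(1)] form_diff_left[OF L(2) sL(2) w(2)] by simp
      then show ?thesis unfolding fw sw by simp
    qed
    ultimately have "(\<lambda>n::nat. 0) \<longlonglongrightarrow> form H w1 w1 + form H w2 w2" by simp
    then have "form H w1 w1 + form H w2 w2 = 0" by (simp add: LIMSEQ_const_iff)
    then have "complex_of_real (nrm2 w1 + nrm2 w2) = 0" by (simp add: form_self)
    then have "nrm2 w1 + nrm2 w2 = 0" by (simp only: of_real_eq_0_iff)
    then have wz: "nrm2 w1 = 0" "nrm2 w2 = 0" using nrm2_nonneg[of w1] nrm2_nonneg[of w2] by linarith+
    show ?thesis
      unfolding closure_of_L2_prod[OF L SL]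
    proof (intro allI impI)
      fix e :: real assume "e > 0"
      have "\<forall>\<^sub>F n in sequentially. nrm2 (\<lambda>x. f x - s1 n x - w1 x) + nrm2 (\<lambda>x. g x - s2 n x - w2 x) < e"
        by (rule order_tendstoD(2)[OF lim \<open>e > 0\<close>])
      then obtain n where n: "nrm2 (\<lambda>x. f x - s1 n x - w1 x) + nrm2 (\<lambda>x. g x - s2 n x - w2 x) < e"
        by (auto simp: eventually_sequentially)
      have "sqrt (nrm2 (\<lambda>x. f x - s1 n x)) \<le> sqrt (nrm2 (\<lambda>x. f x - s1 n x - w1 x))"
        using sqrt_nrm2_triangle[OF L2_diff[OF d1[of n] w(1)] w(1)] wz by simp
      moreover have "sqrt (nrm2 (\<lambda>x. g x - s2 n x)) \<le> sqrt (nrm2 (\<lambda>x. g x - s2 n x - w2 x))"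
        using sqrt_nrm2_triangle[OF L2_diff[OF d2[of n] w(2)] w(2)] wz by simp
      ultimately have "nrm2 (\<lambda>x. f x - s1 n x) + nrm2 (\<lambda>x. g x - s2 n x) < e" using n by simp
      moreover have "(L2_class H (s1 n), L2_class H (s2 n)) \<in> ?S"
        unfolding S_min_eq using s[of n] by (force simp: image_iff)
      ultimately show "\<exists>f' g'. f' \<in> L2_fun H \<and> g' \<in> L2_fun H \<and> (L2_class H f', L2_class H g') \<in> ?S \<and>
         nrm2 (\<lambda>x. f x - f' x) + nrm2 (\<lambda>x. g x - g' x) < e"
        using sL by blast
    qed
  qed
  show ?thesis
    unfolding ess_self_adjoint_def
  proof (intro set_eqI iffI)
    fix uv assume uv: "uv \<in> ?T closure_of ?S"
    then have "uv \<in> L2_space H \<times> L2_space H" using closure_of_subset_topspace[of ?T ?S] top by blast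
    then obtain f g where "f \<in> L2_fun H" "g \<in> L2_fun H" "uv = (L2_class H f, L2_class H g)"
      by (metis L2_space_cases SigmaE)
    then show "uv \<in> rel_adjoint H ?S" using sub1 uv by blast
  next
    fix uv assume uv: "uv \<in> rel_adjoint H ?S"
    then have "uv \<in> L2_space H \<times> L2_space H" by (auto simp: rel_adjoint_def)
    then obtain f g where fg: "f \<in> L2_fun H" "g \<in> L2_fun H" "uv = (L2_class H f, L2_class H g)"
      by (metis L2_space_cases SigmaE)
    have "form H f k = form H g h" if "(h, k) \<in> T_min" for h k
      using uv that unfolding fg(3) adj_iff[OF fg(1,2)] by blast
    then obtain f' where f': "(f', g) \<in> T_max" "nrm2 (\<lambda>x. f x - f' x) = 0"
      using adjoint_solution[OF fg(1,2)] by blast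
    have "L2_class H f = L2_class H f'"
      using f' fg(1) by (subst L2_class_eq_iff) (auto simp: T_max_def)
    then show "uv \<in> ?T closure_of ?S" using sub2[OF f'(1)] fg(3) by simp
  qed
qed

end

section \<open>The cut-off weight\<close>

text \<open>\<open>nn_integral\<close> is a supremum over simple minorants even when the integrand
  is not measurable; the supremum of countably many of them, with integrals exceeding every
  \<open>n\<close>, is a measurable minorant of infinite integral.\<close>

lemma nn_integral_infinite_minorant:
  assumes "(\<integral>\<^sup>+x. f x \<partial>M) = \<infinity>"
  obtains h where "h \<in> borel_measurable M" "\<And>x. h x \<le> f x" "(\<integral>\<^sup>+x. h x \<partial>M) = \<infinity>"
proof -
  have "\<exists>g. simple_function M g \<and> g \<le> f \<and> of_nat n < integral\<^sup>S M g" for n :: nat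
  proof -
    have "(of_nat n :: ennreal) < (SUP g\<in>{g. simple_function M g \<and> g \<le> f}. integral\<^sup>S M g)"
      using assms of_nat_less_top[of n] unfolding nn_integral_def by (metis infinity_ennreal_def)
    then show ?thesis unfolding less_SUP_iff by auto
  qed
  then obtain g where g: "\<And>n::nat. simple_function M (g n)" "\<And>n. g n \<le> f" "\<And>n. of_nat n < integral\<^sup>S M (g n)"
    by metis
  show thesis
  proof (rule that)
    show "(\<lambda>x. SUP n. g n x) \<in> borel_measurable M"
      by (rule borel_measurable_SUP) (auto intro: borel_measurable_simple_function g)
    show "(SUP n. g n x) \<le> f x" for x by (rule SUP_least) (use g(2) in \<open>auto simp: le_fun_def\<close>)
    have "of_nat n \<le> (\<integral>\<^sup>+x. (SUP n. g n x) \<partial>M)" for n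
    proof -
      have "of_nat n \<le> (\<integral>\<^sup>+x. g n x \<partial>M)"
        using g(3)[of n] nn_integral_eq_simple_integral[OF g(1)[of n]] by simp
      also have "\<dots> \<le> (\<integral>\<^sup>+x. (SUP n. g n x) \<partial>M)" by (rule nn_integral_mono) (rule SUP_upper, simp)
      finally show ?thesis .
    qed
    then show "(\<integral>\<^sup>+x. (SUP n. g n x) \<partial>M) = \<infinity>"
      using ennreal_Ex_less_of_nat[of "\<integral>\<^sup>+x. (SUP n. g n x) \<partial>M"] by (metis infinity_ennreal_def leD top.not_eq_extremum)
  qed
qed

section \<open>Divergent integrals and their primitives\<close>

lemma has_density_le:
  fixes f g :: "real \<Rightarrow> real"
  assumes "has_density f f'" "has_density g g'" "a \<le> b" "\<And>x. a \<le> x \<Longrightarrow> x \<le> b \<Longrightarrow> f' x \<le> g' x"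
  shows "f b - f a \<le> g b - g a"
  unfolding has_densityD[OF assms(1,3)] has_densityD[OF assms(2,3)]
  using assms(4) by (intro integral_le loc_integrable_integrable_on has_density_loc_integrable[OF assms(1)]
    has_density_loc_integrable[OF assms(2)]) auto

lemma has_density_mono:
  fixes f :: "real \<Rightarrow> real"
  assumes "has_density f f'" "a \<le> b" "\<And>x. 0 \<le> f' x"
  shows "f a \<le> f b"
  using has_density_le[OF has_density_const[of 0] assms(1,2)] assms(3) by simp

lemma nn_integral_density_le:
  fixes T :: "real \<Rightarrow> real"
  assumes T: "has_density T \<kappa>" and nn: "\<And>x. 0 \<le> \<kappa> x"
    and ab: "\<And>n::nat. a n \<le> b n" "decseq a" "incseq b" and Z: "\<And>n. T (b n) - T (a n) \<le> Z"
  shows "(\<integral>\<^sup>+x\<in>(\<Union>n. {a n..b n}). ennreal (\<kappa> x) \<partial>lebesgue) \<le> ennreal Z"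
proof -
  have meas: "\<kappa> \<in> borel_measurable lebesgue"
    using loc_integrable_borel_measurable[OF has_density_loc_integrable[OF T]] .
  have inc: "incseq (\<lambda>n. {a n..b n})"
    using ab(2,3) unfolding incseq_def decseq_def by (meson atLeastatMost_subset_iff)
  have pw: "ennreal (\<kappa> x) * indicator (\<Union>n. {a n..b n}) x = (SUP n. ennreal (\<kappa> x) * indicator {a n..b n} x)" for x
  proof -
    have "indicator (\<Union>n. {a n..b n}) x = (SUP n. indicator {a n..b n} x :: ennreal)"
    proof (cases "x \<in> (\<Union>n. {a n..b n})")
      case True
      then obtain n where n: "x \<in> {a n..b n}" by blast
      have "(SUP n. indicator {a n..b n} x :: ennreal) = 1"
      proof (rule antisym)
        show "(SUP n. indicator {a n..b n} x :: ennreal) \<le> 1"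
          by (rule SUP_least) (simp add: indicator_def)
        show "1 \<le> (SUP n. indicator {a n..b n} x :: ennreal)"
          by (rule SUP_upper2[of n]) (use n in auto)
      qed
      then show ?thesis using True by simp
    next
      case False
      then have "(indicator {a n..b n} x :: ennreal) = 0" for n by (auto simp: indicator_def)
      then show ?thesis using False by simp
    qed
    then show ?thesis by (simp add: SUP_mult_left_ennreal)
  qed
  have "(\<integral>\<^sup>+x\<in>(\<Union>n. {a n..b n}). ennreal (\<kappa> x) \<partial>lebesgue)
      = (SUP n. \<integral>\<^sup>+x\<in>{a n..b n}. ennreal (\<kappa> x) \<partial>lebesgue)"
    unfolding pw
  proof (rule nn_integral_monotone_convergence_SUP)
    show "incseq (\<lambda>n x. ennreal (\<kappa> x) * indicator {a n..b n} x)"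
      by (intro incseq_SucI le_funI mult_left_mono indicator_leI) (rule subsetD[OF incseq_SucD[OF inc]], auto)
    show "(\<lambda>x. ennreal (\<kappa> x) * indicator {a n..b n} x) \<in> borel_measurable lebesgue" for n
      by (intro borel_measurable_times_ennreal borel_measurable_indicator measurable_compose[OF meas measurable_ennreal]) auto
  qed
  also have "\<dots> \<le> ennreal Z"
  proof (rule SUP_least)
    fix n :: nat
    have "(\<kappa> has_integral (T (b n) - T (a n))) {a n..b n}"
      unfolding has_densityD[OF T ab(1)]
      by (rule integrable_integral loc_integrable_integrable_on has_density_loc_integrable[OF T])+
    then have "(\<integral>\<^sup>+x\<in>{a n..b n}. ennreal (\<kappa> x) \<partial>lebesgue) = ennreal (T (b n) - T (a n))"
      using nn_integral_has_integral_lebesgue'[of "{a n..b n}" \<kappa>] nn by (simp add: nn_integral_completion)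
    then show "(\<integral>\<^sup>+x\<in>{a n..b n}. ennreal (\<kappa> x) \<partial>lebesgue) \<le> ennreal Z"
      using Z by (simp add: ennreal_leI)
  qed
  finally show ?thesis .
qed

lemma density_unbounded:
  fixes T :: "real \<Rightarrow> real"
  assumes T: "has_density T \<kappa>" and nn: "\<And>x. 0 \<le> \<kappa> x"
  shows "(\<integral>\<^sup>+x\<in>{0..}. ennreal (\<kappa> x) \<partial>lebesgue) = \<infinity> \<Longrightarrow> filterlim T at_top at_top"
    and "(\<integral>\<^sup>+x\<in>{..0}. ennreal (\<kappa> x) \<partial>lebesgue) = \<infinity> \<Longrightarrow> filterlim T at_bot at_bot"
proof -
  note mono = has_density_mono[OF T _ nn]
  show "filterlim T at_top at_top" if inf: "(\<integral>\<^sup>+x\<in>{0..}. ennreal (\<kappa> x) \<partial>lebesgue) = \<infinity>"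
    unfolding filterlim_at_top
  proof
    fix Z
    have "\<exists>n. Z \<le> T (real n)"
    proof (rule ccontr)
      assume "\<nexists>n. Z \<le> T (real n)"
      then have "T (real n) - T 0 \<le> Z - T 0" for n by (simp add: not_le less_imp_le)
      then have "(\<integral>\<^sup>+x\<in>(\<Union>n. {0..real n}). ennreal (\<kappa> x) \<partial>lebesgue) \<le> ennreal (Z - T 0)"
        by (intro nn_integral_density_le[OF T nn]) (auto simp: decseq_def incseq_def)
      moreover have "(\<Union>n. {0..real n}) = {0..}" using real_arch_simple by auto
      ultimately show False using inf by (simp add: top_unique)
    qed
    then obtain n where "Z \<le> T (real n)" ..
    then have "Z \<le> T x" if "real n \<le> x" for x using mono[OF that] by linarith
    then show "\<forall>\<^sub>F x in at_top. Z \<le> T x" by (auto simp: eventually_at_top_linorder)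
  qed
  show "filterlim T at_bot at_bot" if inf: "(\<integral>\<^sup>+x\<in>{..0}. ennreal (\<kappa> x) \<partial>lebesgue) = \<infinity>"
    unfolding filterlim_at_bot
  proof
    fix Z
    have "\<exists>n. T (- real n) \<le> Z"
    proof (rule ccontr)
      assume "\<nexists>n. T (- real n) \<le> Z"
      then have "T 0 - T (- real n) \<le> T 0 - Z" for n by (simp add: not_le less_imp_le)
      then have "(\<integral>\<^sup>+x\<in>(\<Union>n. {- real n..0}). ennreal (\<kappa> x) \<partial>lebesgue) \<le> ennreal (T 0 - Z)"
        by (intro nn_integral_density_le[OF T nn]) (auto simp: decseq_def incseq_def)
      moreover have "(\<Union>n. {- real n..0}) = {..0}" using real_arch_simple by (auto simp: minus_le_iff)
      ultimately show False using inf by (simp add: top_unique)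
    qed
    then obtain n where "T (- real n) \<le> Z" ..
    then have "T x \<le> Z" if "x \<le> - real n" for x using mono[OF that] by linarith
    then show "\<forall>\<^sub>F x in at_bot. T x \<le> Z" by (auto simp: eventually_at_bot_linorder)
  qed
qed

text \<open>The function \<open>c\<close> is not assumed measurable, so that the nonnegative integrals are lower
  integrals; they are replaced by the integrals of a measurable minorant.\<close>
lemma divergent_weight:
  fixes c :: "real \<Rightarrow> ennreal" and q :: "real \<Rightarrow> real"
  assumes c: "\<And>x. 1 \<le> c x" and \<delta>: "\<delta> > 0" and q: "\<And>x. \<delta> \<le> q x"
    and q_meas: "q \<in> borel_measurable lebesgue"
    and int_pos: "(\<integral>\<^sup>+x\<in>{0..}. 1 / (c x * ennreal (q x powr (1/2))) \<partial>lebesgue) = \<infinity>"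
    and int_neg: "(\<integral>\<^sup>+x\<in>{..0}. 1 / (c x * ennreal (q x powr (1/2))) \<partial>lebesgue) = \<infinity>"
  obtains k where "k \<in> borel_measurable lebesgue" "\<And>x. 0 \<le> k x" "\<And>x. k x \<le> 1" "\<And>x. ennreal (k x) * c x \<le> 1"
    "(\<integral>\<^sup>+x\<in>{0..}. ennreal (1 / sqrt (q x) * k x) \<partial>lebesgue) = \<infinity>"
    "(\<integral>\<^sup>+x\<in>{..0}. ennreal (1 / sqrt (q x) * k x) \<partial>lebesgue) = \<infinity>"
proof -
  define F where "F x = 1 / (c x * ennreal (sqrt (q x)))" for x
  have q0: "0 < q x" for x using \<delta> q[of x] by linarith
  have powr: "q x powr (1/2) = sqrt (q x)" for x using q0[of x] by (simp add: powr_half_sqrt)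
  obtain h1 where h1: "h1 \<in> borel_measurable lebesgue" "\<And>x. h1 x \<le> F x * indicator {0..} x"
    "(\<integral>\<^sup>+x. h1 x \<partial>lebesgue) = \<infinity>"
    by (rule nn_integral_infinite_minorant[OF int_pos[unfolded powr, folded F_def]]) blast
  obtain h2 where h2: "h2 \<in> borel_measurable lebesgue" "\<And>x. h2 x \<le> F x * indicator {..0} x"
    "(\<integral>\<^sup>+x. h2 x \<partial>lebesgue) = \<infinity>"
    by (rule nn_integral_infinite_minorant[OF int_neg[unfolded powr, folded F_def]]) blast
  define h where "h x = max (h1 x) (h2 x)" for x
  have ind: "F x * indicator A x \<le> F x" for x and A :: "real set" by (simp add: indicator_def)
  have hF: "h x \<le> F x" for x
    unfolding h_def using order_trans[OF h1(2) ind] order_trans[OF h2(2) ind] by simp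
  have sq: "0 < sqrt (q x)" for x using q0 by simp
  \<comment> \<open>Only an inequality: where \<open>c x\<close> is infinite, the convention
    \<open>0 * \<infinity> = 0\<close> makes the product \<open>0\<close>.\<close>
  have Fc: "F x * ennreal (sqrt (q x)) * c x \<le> 1" for x
  proof -
    have "(1 / z) * z \<le> 1" for z :: ennreal
      by (cases "z = 0 \<or> z = \<infinity>") (auto simp: ennreal_divide_times ennreal_divide_self top.not_eq_extremum zero_less_iff_neq_zero)
    from this[of "c x * ennreal (sqrt (q x))"] show ?thesis unfolding F_def by (simp add: ac_simps)
  qed
  have hfin: "h x < \<infinity>" for x
  proof -
    have "F x * ennreal (sqrt (q x)) \<le> F x * ennreal (sqrt (q x)) * c x"
      using mult_left_mono[OF c[of x], of "F x * ennreal (sqrt (q x))"] by simp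
    also have "\<dots> \<le> 1" by (rule Fc)
    finally have "F x * ennreal (sqrt (q x)) \<noteq> \<infinity>" by (auto simp: top_unique)
    then have "F x \<noteq> \<infinity>" using sq[of x] by (auto simp: ennreal_mult_eq_top_iff)
    then show ?thesis using hF[of x] by (auto simp: top.not_eq_extremum intro: le_less_trans)
  qed
  \<comment> \<open>Chosen so that \<open>k\<close> divided by \<open>sqrt (q x)\<close> is the
    minorant \<open>h\<close>, whose integral diverges on both half-lines.\<close>
  define k where "k x = enn2real (h x) * sqrt (q x)" for x
  have hk: "ennreal (1 / sqrt (q x) * k x) = h x" for x
    using sq[of x] hfin[of x] unfolding k_def by (simp add: less_top)
  have ek: "ennreal (k x) = h x * ennreal (sqrt (q x))" for x
    using hfin[of x] sq[of x] unfolding k_def by (simp add: ennreal_mult less_top)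
  have kc: "ennreal (k x) * c x \<le> 1" for x
    using order_trans[OF mult_right_mono[OF mult_right_mono[OF hF]] Fc] unfolding ek by simp
  show thesis
  proof (rule that)
    show "k \<in> borel_measurable lebesgue"
      unfolding k_def h_def using h1(1) h2(1) q_meas by measurable
    show "0 \<le> k x" for x using sq[of x] by (simp add: k_def)
    have "ennreal (k x) \<le> 1" for x
      using order_trans[OF mult_left_mono[OF c[of x], of "ennreal (k x)"] kc] by simp
    then show "k x \<le> 1" for x by (metis ennreal_le_1)
    show "ennreal (k x) * c x \<le> 1" for x by (rule kc)
    have "h1 x \<le> h x * indicator {0..} x" for x
      using h1(2)[of x] by (auto simp: h_def indicator_def)
    then show "(\<integral>\<^sup>+x\<in>{0..}. ennreal (1 / sqrt (q x) * k x) \<partial>lebesgue) = \<infinity>"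
      unfolding hk using nn_integral_mono[of lebesgue h1] h1(3) by (metis infinity_ennreal_def top_unique)
    have "h2 x \<le> h x * indicator {..0} x" for x
      using h2(2)[of x] by (auto simp: h_def indicator_def)
    then show "(\<integral>\<^sup>+x\<in>{..0}. ennreal (1 / sqrt (q x) * k x) \<partial>lebesgue) = \<infinity>"
      unfolding hk using nn_integral_mono[of lebesgue h2] h2(3) by (metis infinity_ennreal_def top_unique)
  qed
qed

text \<open>The points where \<open>S\<close> takes the values \<open>j\<close> cut the half-line into pieces of equal
  \<open>k\<close>-measure; on each of them \<open>\<rho>\<close> is, up to a constant, at least the
  largest value of \<open>r\<close> two pieces further on.\<close>
lemma infimal_convolution_divergent:
  fixes r k S \<rho> R G :: "real \<Rightarrow> real"
  assumes S: "has_density S k" "S 0 = 0" and k: "\<And>x. 0 \<le> k x"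
    and R: "has_density R (\<lambda>x. r x * k x)" "filterlim R at_top at_top"
    and G: "has_density G (\<lambda>x. \<rho> x * k x)" and \<rho>: "\<And>x. 0 \<le> \<rho> x"
    and r: "\<And>x y. 0 \<le> x \<Longrightarrow> x \<le> y \<Longrightarrow> r y \<le> r x" "\<And>x. 0 \<le> r x" "\<And>x. r x \<le> M"
    and glb: "\<And>x m. (\<And>y. m \<le> r y + \<bar>S x - S y\<bar>) \<Longrightarrow> m \<le> \<rho> x"
  shows "filterlim G at_top at_top"
proof -
  \<comment> \<open>Dividing by \<open>N\<close> brings the values of \<open>r\<close> below
    \<open>1\<close>, the \<open>S\<close>-length of a piece, and keeps them below \<open>r\<close>
    itself; \<open>lower\<close> uses both.\<close>
  define N where "N = max 1 M"
  have N: "1 \<le> N" "M \<le> N" by (auto simp: N_def)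
  note S_mono = has_density_mono[OF S(1) _ k]
  have G_mono: "a \<le> b \<Longrightarrow> G a \<le> G b" for a b by (rule has_density_mono[OF G]) (simp_all add: k \<rho>)
  have scale: "has_density (\<lambda>x. m * S x) (\<lambda>x. m * k x)" for m
    by (rule has_density_compose_linear[OF S(1) bounded_linear_mult_right])
  have R_le: "R b - R a \<le> m * (S b - S a)" if "a \<le> b" "\<And>x. a \<le> x \<Longrightarrow> x \<le> b \<Longrightarrow> r x \<le> m" for a b m
    using has_density_le[OF R(1) scale[of m] that(1) mult_right_mono[OF that(2) k]] by (simp add: algebra_simps)
  \<comment> \<open>Since \<open>r \<le> N\<close>, the divergence of \<open>R\<close> forces that
    of \<open>S\<close>, so that every value \<open>j\<close> is attained.\<close>
  have S_large: "\<exists>y\<ge>0. S y \<ge> j" for j :: real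
  proof -
    obtain y0 where y0: "\<And>y. y0 \<le> y \<Longrightarrow> N * \<bar>j\<bar> + R 0 \<le> R y"
      using R(2) unfolding filterlim_at_top eventually_at_top_linorder by meson
    define y where "y = max 0 y0"
    have "N * \<bar>j\<bar> \<le> R y - R 0" using y0[of y] by (simp add: y_def)
    also have "\<dots> \<le> N * (S y - S 0)" by (rule R_le) (use r(3) N in \<open>auto simp: y_def intro: order_trans\<close>)
    finally have "\<bar>j\<bar> \<le> S y" using N(1) S(2) by simp
    then show ?thesis by (intro exI[of _ y]) (auto simp: y_def)
  qed
  have "\<exists>y\<ge>0. S y = real j" for j :: nat
  proof -
    obtain y where "0 \<le> y" "real j \<le> S y" using S_large by blast
    then show ?thesis
      using IVT'[of S 0 "real j" y] S(2) has_density_continuous[OF S(1)] by auto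
  qed
  then obtain x where x: "\<And>j::nat. 0 \<le> x j" "\<And>j. S (x j) = real j" by metis
  have S_lt: "y < z" if "S y < S z" for y z using S_mono[of z y] that by linarith
  have x_le: "x i \<le> x j" if "i \<le> j" for i j
    using S_lt[of "x i" "x j"] that x(2) by (cases "i = j") auto
  \<comment> \<open>A competitor \<open>z\<close> at \<open>S\<close>-distance at least
    \<open>1\<close> costs at least \<open>1\<close>. A nearer one lies before
    \<open>x (j + 2)\<close>, where \<open>r\<close> is at least \<open>r (x (j + 2))\<close>. The
    condition \<open>1 \<le> j\<close> keeps \<open>z\<close> in the half-line on which
    \<open>r\<close> is monotone.\<close>
  have lower: "r (x (j + 2)) / N \<le> \<rho> y" if y: "x j \<le> y" "y \<le> x (j + 1)" and j: "1 \<le> j" for j y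
  proof (rule glb)
    fix z
    have Sy: "real j \<le> S y" "S y \<le> real j + 1" using S_mono[OF y(1)] S_mono[OF y(2)] x(2) by auto
    have rN: "r (x (j + 2)) / N \<le> 1" "r (x (j + 2)) / N \<le> r (x (j + 2))"
      using r(3)[of "x (j + 2)"] r(2)[of "x (j + 2)"] N mult_left_mono[of 1 N "r (x (j + 2))"]
      by (auto simp: divide_le_eq)
    show "r (x (j + 2)) / N \<le> r z + \<bar>S y - S z\<bar>"
    proof (cases "\<bar>S y - S z\<bar> < 1")
      case False
      then show ?thesis using rN(1) r(2)[of z] by linarith
    next
      case True
      have "z < x (j + 2)" by (rule S_lt) (use True Sy x(2)[of "j + 2"] in auto)
      moreover have "0 < z" by (rule S_lt) (use True Sy S(2) j in auto)
      ultimately have "r (x (j + 2)) \<le> r z" by (intro r(1)) auto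
      then show ?thesis using rN(2) by linarith
    qed
  qed
  \<comment> \<open>A piece has \<open>S\<close>-length \<open>1\<close>, so \<open>R\<close> grows
    on it by at most the value of \<open>r\<close> at its left end; the shift by two pieces matches
    \<open>lower\<close>.\<close>
  have step: "(R (x (j + 3)) - R (x (j + 2))) / N \<le> G (x (j + 1)) - G (x j)" if "1 \<le> j" for j
  proof -
    have "R (x (j + 3)) - R (x (j + 2)) \<le> r (x (j + 2)) * (S (x (j + 3)) - S (x (j + 2)))"
      by (rule R_le[OF x_le]) (auto intro: r(1)[OF x(1)])
    then have "R (x (j + 3)) - R (x (j + 2)) \<le> r (x (j + 2))" unfolding x(2) by simp
    moreover have "r (x (j + 2)) / N * S (x (j + 1)) - r (x (j + 2)) / N * S (x j) \<le> G (x (j + 1)) - G (x j)"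
      by (rule has_density_le[OF scale G x_le mult_right_mono[OF lower k]]) (use that in auto)
    then have "r (x (j + 2)) / N \<le> G (x (j + 1)) - G (x j)" unfolding x(2) by (simp add: algebra_simps add_divide_distrib)
    ultimately show ?thesis using N(1) divide_right_mono[of _ "r (x (j + 2))" N] by fastforce
  qed
  have sum: "(R (x (j + 3)) - R (x 3)) / N \<le> G (x (j + 1)) - G (x 1)" for j
  proof (induction j)
    case (Suc j)
    have "(R (x (Suc j + 3)) - R (x 3)) / N
        = (R (x (Suc j + 3)) - R (x (Suc j + 2))) / N + (R (x (j + 3)) - R (x 3)) / N"
      by (simp add: diff_divide_distrib eval_nat_numeral)
    then show ?case using Suc step[of "Suc j"] by simp
  qed simp
  have R_mono: "a \<le> b \<Longrightarrow> R a \<le> R b" for a b by (rule has_density_mono[OF R(1)]) (simp_all add: k r)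
  show ?thesis
    unfolding filterlim_at_top
  proof
    fix Z
    obtain y where y: "N * (Z - G (x 1)) + R (x 3) \<le> R y"
      using R(2) unfolding filterlim_at_top eventually_at_top_linorder by blast
    obtain j where "S y < real j" using reals_Archimedean2 by blast
    then have "y \<le> x (j + 3)" using S_lt[of y "x (j + 3)"] x(2)[of "j + 3"] by simp
    then have "N * (Z - G (x 1)) \<le> R (x (j + 3)) - R (x 3)" using R_mono[of y "x (j + 3)"] y by linarith
    then have "Z - G (x 1) \<le> (R (x (j + 3)) - R (x 3)) / N" using N(1) by (simp add: le_divide_eq mult.commute)
    then have "Z \<le> G (x (j + 1))" using sum[of j] by linarith
    then have "Z \<le> G z" if "x (j + 1) \<le> z" for z using G_mono[OF that] by linarith
    then show "\<forall>\<^sub>F z in at_top. Z \<le> G z" by (auto simp: eventually_at_top_linorder)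
  qed
qed

section \<open>Existence of the multiplier\<close>

lemma derivative_le_of_dominated:
  fixes f g :: "real \<Rightarrow> real"
  assumes "(f has_vector_derivative f') (at x)" "(g has_vector_derivative g') (at x)"
    and le: "\<And>y. \<bar>f y - f x\<bar> \<le> \<bar>g y - g x\<bar>"
  shows "\<bar>f'\<bar> \<le> \<bar>g'\<bar>"
proof -
  have lim: "((\<lambda>y. \<bar>(h y - h x) / (y - x)\<bar>) \<longlongrightarrow> \<bar>h'\<bar>) (at x)"
    if "(h has_vector_derivative h') (at x)" for h h'
    using that unfolding has_real_derivative_iff_has_vector_derivative[symmetric] has_field_derivative_iff
    by (rule tendsto_rabs)
  show ?thesis
    by (rule tendsto_le[OF _ lim[OF assms(2)] lim[OF assms(1)]])
      (auto simp: abs_divide intro!: always_eventually divide_right_mono le)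
qed

lemma piecewise_monotone_measurable:
  fixes q :: "real \<Rightarrow> real"
  assumes "antimono_on {..0} q" "mono_on {0..} q"
  shows "q \<in> borel_measurable borel"
proof -
  have "mono_on {..0} (\<lambda>x. - q x)" using assms(1) by (auto simp: monotone_on_def)
  then have "(\<lambda>x. - (- q x)) \<in> borel_measurable (restrict_space borel {..0})"
    by (intro borel_measurable_uminus borel_measurable_mono_on_fnc)
  moreover have "q \<in> borel_measurable (restrict_space borel {0..})"
    by (rule borel_measurable_mono_on_fnc[OF assms(2)])
  ultimately show ?thesis
    by (intro measurable_piecewise_restrict[of "{{..0}, {0..}}" borel q])
       (auto)
qed

lemma loc_integrable_bounded:
  fixes f :: "real \<Rightarrow> real"
  assumes "f \<in> borel_measurable lebesgue" "\<And>x. \<bar>f x\<bar> \<le> M"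
  shows "loc_integrable f"
proof (rule loc_integrableI)
  fix a b :: real
  show "f absolutely_integrable_on {a..b}"
    by (rule measurable_bounded_by_integrable_imp_absolutely_integrable[of f "{a..b}" "\<lambda>_. M"])
      (use assms in \<open>auto simp: measurable_restrict_space1\<close>)
qed

lemma inverse_sqrt_lipschitz:
  fixes a b \<delta> :: real
  assumes "0 < \<delta>" "\<delta> \<le> a" "\<delta> \<le> b"
  shows "\<bar>1 / sqrt b - 1 / sqrt a\<bar> \<le> 1 / (\<delta> * sqrt \<delta>) * \<bar>b - a\<bar>"
proof -
  have pos: "0 < sqrt \<delta>" "sqrt \<delta> \<le> sqrt a" "sqrt \<delta> \<le> sqrt b" using assms by auto
  then have pos2: "0 < sqrt a" "0 < sqrt b" by linarith+
  have "b - a = (sqrt b - sqrt a) * (sqrt b + sqrt a)"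
    using assms by (simp add: algebra_simps)
  then have eq: "\<bar>b - a\<bar> = \<bar>sqrt b - sqrt a\<bar> * (sqrt b + sqrt a)" using pos2 by (simp add: abs_mult)
  have "1 / sqrt b - 1 / sqrt a = (sqrt a - sqrt b) / (sqrt a * sqrt b)" using pos2 by (simp add: field_simps)
  then have lhs: "\<bar>1 / sqrt b - 1 / sqrt a\<bar> = \<bar>sqrt b - sqrt a\<bar> / (sqrt a * sqrt b)"
    using pos2 by (simp add: abs_divide abs_mult abs_minus_commute)
  have "\<delta> = sqrt \<delta> * sqrt \<delta>" using assms(1) by simp
  also have "\<dots> \<le> sqrt a * sqrt b" by (rule mult_mono) (use pos in auto)
  finally have "\<delta> * sqrt \<delta> \<le> (sqrt a * sqrt b) * (sqrt b + sqrt a)"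
    by (rule mult_mono) (use pos pos2 in \<open>auto intro: order_trans add_increasing\<close>)
  then have "\<bar>sqrt b - sqrt a\<bar> * (\<delta> * sqrt \<delta>) \<le> \<bar>sqrt b - sqrt a\<bar> * ((sqrt a * sqrt b) * (sqrt b + sqrt a))"
    by (rule mult_left_mono) simp
  moreover have "0 < \<delta> * sqrt \<delta>" "0 < sqrt a * sqrt b" using pos pos2 assms(1) by simp_all
  ultimately show ?thesis unfolding lhs eq by (simp add: divide_le_eq le_divide_eq ac_simps)
qed

text \<open>For absolutely continuous \<open>q\<close> one takes \<open>\<rho> = q\<^sup>-\<^sup>1\<^sup>/\<^sup>2\<close>. For monotone \<open>q\<close> this function may jump, and
  \<open>\<rho>\<close> is its largest minorant that is Lipschitz with respect to the measure \<open>k dx\<close>.\<close>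
theorem cutoff_weight_exists:
  fixes c :: "real \<Rightarrow> ennreal" and q :: "real \<Rightarrow> real"
  assumes c: "\<And>x. 1 \<le> c x" and \<delta>: "\<delta> > 0" and q: "\<And>x. \<delta> \<le> q x"
    and int_pos: "(\<integral>\<^sup>+x\<in>{0..}. 1 / (c x * ennreal (q x powr (1/2))) \<partial>lebesgue) = \<infinity>"
    and int_neg: "(\<integral>\<^sup>+x\<in>{..0}. 1 / (c x * ennreal (q x powr (1/2))) \<partial>lebesgue) = \<infinity>"
    and cases: "(loc_abs_cont q \<and>
        (\<exists>C1::real. AE x in lebesgue. ennreal \<bar>deriv (\<lambda>t. q t powr (-1/2)) x\<bar> * c x \<le> ennreal C1))
      \<or> (antimono_on {..0} q \<and> mono_on {0..} q)"
  obtains \<rho> \<rho>' k T :: "real \<Rightarrow> real" and K :: real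
  where "has_density \<rho> \<rho>'" "\<And>x. 0 \<le> \<rho> x" "\<And>x. (\<rho> x)\<^sup>2 * q x \<le> 1"
    "\<And>x. 0 \<le> k x" "\<And>x. ennreal (k x) * c x \<le> 1"
    "0 \<le> K" "AE x in lebesgue. ennreal \<bar>\<rho>' x\<bar> * c x \<le> ennreal K"
    "has_density T (\<lambda>x. \<rho> x * k x)" "filterlim T at_top at_top" "filterlim T at_bot at_bot"
proof -
  define r where "r x = 1 / sqrt (q x)" for x
  have q0: "0 < q x" for x using \<delta> q[of x] by linarith
  have r0: "0 < r x" and rq: "(r x)\<^sup>2 * q x = 1" for x
    unfolding r_def using q0[of x] by (simp_all add: power_divide)
  have rM: "r x \<le> 1 / sqrt \<delta>" for x unfolding r_def using q[of x] \<delta> q0[of x] by (simp add: frac_le)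
  have q_meas: "q \<in> borel_measurable lebesgue"
  proof (rule borel_imp_lebesgue_measurable)
    show "q \<in> borel_measurable borel"
      using cases
    proof
      assume "loc_abs_cont q \<and> (\<exists>C1::real. AE x in lebesgue. ennreal \<bar>deriv (\<lambda>t. q t powr (-1/2)) x\<bar> * c x \<le> ennreal C1)"
      then show ?thesis by (intro borel_measurable_continuous_onI loc_abs_cont_continuous) blast
    qed (blast intro: piecewise_monotone_measurable)
  qed
  obtain k where k: "k \<in> borel_measurable lebesgue" "\<And>x. 0 \<le> k x" "\<And>x. k x \<le> 1" "\<And>x. ennreal (k x) * c x \<le> 1"
    and k_inf: "(\<integral>\<^sup>+x\<in>{0..}. ennreal (r x * k x) \<partial>lebesgue) = \<infinity>"
    "(\<integral>\<^sup>+x\<in>{..0}. ennreal (r x * k x) \<partial>lebesgue) = \<infinity>"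
    unfolding r_def by (rule divergent_weight[OF c \<delta> q q_meas int_pos int_neg]) blast
  have rk_int: "loc_integrable (\<lambda>x. r x * k x)"
  proof (rule loc_integrable_bounded)
    show "(\<lambda>x. r x * k x) \<in> borel_measurable lebesgue" unfolding r_def using k(1) q_meas by measurable
    show "\<bar>r x * k x\<bar> \<le> 1 / sqrt \<delta>" for x
      using mult_mono[OF rM[of x] k(3)[of x]] k(2)[of x] r0[of x] \<delta> by (simp add: abs_mult)
  qed
  obtain R where R: "has_density R (\<lambda>x. r x * k x)" using primitive_exists[OF rk_int] ..
  have rk0: "0 \<le> r x * k x" for x using r0[of x] k(2)[of x] by simp
  note R_lim = density_unbounded[OF R rk0]
  show thesis
    using cases
  proof
    assume A: "loc_abs_cont q \<and> (\<exists>C1::real. AE x in lebesgue. ennreal \<bar>deriv (\<lambda>t. q t powr (-1/2)) x\<bar> * c x \<le> ennreal C1)"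
    then obtain C1 where C1: "AE x in lebesgue. ennreal \<bar>deriv (\<lambda>t. q t powr (-1/2)) x\<bar> * c x \<le> ennreal C1" by blast
    have powr: "q x powr (-1/2) = r x" for x
      using q0[of x] powr_minus[of "q x" "1/2"] by (simp add: r_def powr_half_sqrt inverse_eq_divide)
    have r_ac: "loc_abs_cont r"
      by (rule loc_abs_cont_lipschitz[of q])
        (use A inverse_sqrt_lipschitz[OF \<delta> q q] in \<open>auto simp: r_def intro!: exI[of _ "1 / (\<delta> * sqrt \<delta>)"]\<close>)
    have "AE x in lebesgue. (r has_vector_derivative deriv r x) (at x)"
      using loc_abs_cont_AE_derivative[OF r_ac]
      by eventually_elim (metis DERIV_imp_deriv has_real_derivative_iff_has_vector_derivative)
    then have "has_density r (deriv r)" by (rule has_densityI_AE[OF r_ac])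
    \<comment> \<open>The constant in the conclusion must be nonnegative, whereas \<open>C1\<close>
      may be negative, in which case \<open>ennreal C1\<close> is \<open>0\<close>.\<close>
    moreover have "AE x in lebesgue. ennreal \<bar>deriv r x\<bar> * c x \<le> ennreal \<bar>C1\<bar>"
      using C1 unfolding powr by eventually_elim (auto intro: order_trans ennreal_leI)
    ultimately show thesis
      by (intro that[of r "deriv r" k "\<bar>C1\<bar>" R] R R_lim k_inf k) (auto simp: rq r0 less_imp_le)
  next
    assume A: "antimono_on {..0} q \<and> mono_on {0..} q"
    obtain S0 where S0: "has_density S0 k"
      using primitive_exists[OF loc_integrable_bounded[of k 1]] k by auto
    define S where "S x = S0 x - S0 0" for x
    have S: "has_density S k" "S 0 = 0"
      using has_density_diff[OF S0 has_density_const[of "S0 0"]] by (simp_all add: S_def[abs_def])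
    \<comment> \<open>The infimal convolution of \<open>r\<close> with the pseudodistance
      \<open>\<bar>S x - S y\<bar>\<close>. An infimum of functions with Lipschitz constant
      \<open>1\<close> relative to \<open>S\<close> inherits it, so
      \<open>\<bar>\<rho>'\<bar> \<le> k\<close> almost everywhere, and \<open>k c \<le> 1\<close>
      yields the constant \<open>K = 1\<close>.\<close>
    define \<rho> where "\<rho> x = (INF y. r y + \<bar>S x - S y\<bar>)" for x
    have bdd: "bdd_below (range (\<lambda>y. r y + \<bar>S x - S y\<bar>))" for x
      by (rule bdd_belowI2[of _ 0]) (simp add: r0 less_imp_le add_nonneg_nonneg)
    have glb: "m \<le> \<rho> x" if "\<And>y. m \<le> r y + \<bar>S x - S y\<bar>" for x m
      unfolding \<rho>_def by (rule cINF_greatest) (use that in auto)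
    have lb: "\<rho> x \<le> r y + \<bar>S x - S y\<bar>" for x y
      unfolding \<rho>_def by (rule cINF_lower[OF bdd]) simp
    have \<rho>0: "0 \<le> \<rho> x" for x by (rule glb) (simp add: r0 less_imp_le add_nonneg_nonneg)
    have \<rho>r: "\<rho> x \<le> r x" for x using lb[of x x] by simp
    have lip: "\<bar>\<rho> y - \<rho> x\<bar> \<le> \<bar>S y - S x\<bar>" for x y
    proof -
      have "\<rho> a - \<bar>S a - S b\<bar> \<le> \<rho> b" for a b
      proof (rule glb)
        show "\<rho> a - \<bar>S a - S b\<bar> \<le> r y + \<bar>S b - S y\<bar>" for y using lb[of a y] by linarith
      qed
      from this[of x y] this[of y x] show ?thesis by linarith
    qed
    have \<rho>_ac: "loc_abs_cont \<rho>"
      by (rule loc_abs_cont_lipschitz[OF has_density_imp_loc_abs_cont[OF S(1)]])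
        (use lip in \<open>auto intro!: exI[of _ 1]\<close>)
    have k1: "ennreal \<bar>\<rho>'\<bar> * c x \<le> ennreal 1" if "\<bar>\<rho>'\<bar> \<le> \<bar>k x\<bar>" for \<rho>' x
      using order_trans[OF mult_right_mono[OF ennreal_leI[OF that], of "c x"], of 1] k(2,4)[of x] by simp
    have \<rho>'_le: "AE x in lebesgue. ennreal \<bar>vector_derivative \<rho> (at x)\<bar> * c x \<le> ennreal 1"
      using loc_abs_cont_AE_derivative[OF \<rho>_ac] has_density_AE_derivative[OF S(1)]
      by eventually_elim (rule k1, rule derivative_le_of_dominated[OF _ _ lip])
    have \<rho>q: "(\<rho> x)\<^sup>2 * q x \<le> 1" for x
      using mult_right_mono[OF power_mono[OF \<rho>r \<rho>0], of "q x" x 2] rq[of x] q0[of x] by simp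
    have "loc_integrable (\<lambda>x. \<rho> x * k x)"
      by (rule loc_integrable_bilinear[OF loc_abs_cont_continuous[OF \<rho>_ac] has_density_loc_integrable[OF S(1)] bounded_bilinear_mult])
    then obtain G where G: "has_density G (\<lambda>x. \<rho> x * k x)" using primitive_exists by blast
    have r_pos: "r y \<le> r x" if "0 \<le> x" "x \<le> y" for x y
      using A that q0[of x] q0[of y] unfolding r_def by (auto simp: monotone_on_def intro!: divide_left_mono)
    have r_neg: "r (- y) \<le> r (- x)" if "0 \<le> x" "x \<le> y" for x y
      using A that q0[of "-x"] q0[of "-y"] unfolding r_def by (auto simp: monotone_on_def intro!: divide_left_mono)
    have top: "filterlim G at_top at_top"
      by (rule infimal_convolution_divergent[OF S k(2) R R_lim(1)[OF k_inf(1)] G \<rho>0 r_pos less_imp_le[OF r0] rM glb])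
    have refl: "has_density (\<lambda>x. - f (- x)) (\<lambda>x. f' (- x))" if "has_density f f'" for f f' :: "real \<Rightarrow> real"
      using has_density_compose_linear[OF has_density_reflect[OF that] bounded_linear_minus[OF bounded_linear_ident]]
      by simp
    \<comment> \<open>The left half-line is the right one for the reflected data, for which
      \<open>r\<close> is again non-increasing. Odd reflection keeps \<open>S\<close>,
      \<open>R\<close> and \<open>G\<close> increasing.\<close>
    have "filterlim (\<lambda>x. - G (- x)) at_top at_top"
    proof (rule infimal_convolution_divergent[of "\<lambda>x. - S (- x)" "\<lambda>x. k (- x)" "\<lambda>x. - R (- x)" "\<lambda>x. r (- x)" _ "\<lambda>x. \<rho> (- x)" "1 / sqrt \<delta>"])
      show "has_density (\<lambda>x. - R (- x)) (\<lambda>x. r (- x) * k (- x))" by (rule refl[OF R])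
      show "has_density (\<lambda>x. - G (- x)) (\<lambda>x. \<rho> (- x) * k (- x))" by (rule refl[OF G])
      show "filterlim (\<lambda>x. - R (- x)) at_top at_top"
        using R_lim(2)[OF k_inf(2)] by (simp add: filterlim_at_top_mirror filterlim_uminus_at_top)
      show "m \<le> \<rho> (- x)" if le: "\<And>y. m \<le> r (- y) + \<bar>- S (- x) - - S (- y)\<bar>" for x m
      proof (rule glb)
        show "m \<le> r y + \<bar>S (- x) - S y\<bar>" for y using le[of "- y"] by (simp add: abs_minus_commute)
      qed
    qed (use S k r0 rM r_neg \<rho>0 refl[OF S(1)] in \<open>auto simp: less_imp_le\<close>)
    then have bot: "filterlim G at_bot at_bot"
      by (simp add: filterlim_at_top_mirror filterlim_uminus_at_top)
    show thesis
      by (rule that[OF loc_abs_cont_has_density[OF \<rho>_ac] \<rho>0 \<rho>q k(2,4) _ \<rho>'_le G top bot]) simp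
  qed
qed

section \<open>The block system\<close>

lemma block_add: "block P Q R S + block P' Q' R' S' = block (P + P') (Q + Q') (R + R') (S + S')"
  and block_diff: "block P Q R S - block P' Q' R' S' = block (P - P') (Q - Q') (R - R') (S - S')"
  and block_uminus: "- block P Q R S = block (- P) (- Q) (- R) (- S)"
  and block_scaleR: "r *\<^sub>R block P Q R S = block (r *\<^sub>R P) (r *\<^sub>R Q) (r *\<^sub>R R) (r *\<^sub>R S)"
  for P Q R S :: "complex^'n^'n"
  by (auto simp: block_def vec_eq_iff split: sum.split)

lemma bounded_linear_block:
  fixes P Q R S :: "'a::euclidean_space \<Rightarrow> complex^'n^'n"
  assumes "bounded_linear P" "bounded_linear Q" "bounded_linear R" "bounded_linear S"
  shows "bounded_linear (\<lambda>x. block (P x) (Q x) (R x) (S x))"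
  unfolding linear_conv_bounded_linear[symmetric]
  by (rule linearI) (simp_all add: block_add block_scaleR assms[THEN bounded_linear.linear] linear_add linear_scale)

lemma loc_integrable_block:
  fixes P Q R S :: "real \<Rightarrow> complex^'n^'n"
  assumes "loc_integrable P" "loc_integrable Q" "loc_integrable R" "loc_integrable S"
  shows "loc_integrable (\<lambda>x. block (P x) (Q x) (R x) (S x))"
proof -
  note i = bounded_linear_ident bounded_linear_zero
  have "loc_integrable (\<lambda>x. (block (P x) 0 0 0 + block 0 (Q x) 0 0) + (block 0 0 (R x) 0 + block 0 0 0 (S x)))"
    by (intro loc_integrable_add
        loc_integrable_linear[OF assms(1) bounded_linear_block[OF i(1) i(2) i(2) i(2)]]
        loc_integrable_linear[OF assms(2) bounded_linear_block[OF i(2) i(1) i(2) i(2)]]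
        loc_integrable_linear[OF assms(3) bounded_linear_block[OF i(2) i(2) i(1) i(2)]]
        loc_integrable_linear[OF assms(4) bounded_linear_block[OF i(2) i(2) i(2) i(1)]])
  then show ?thesis by (simp add: block_add)
qed

text \<open>A multiplier \<open>t\<close> with \<open>t c \<le> K\<close> turns the matrix estimate
  into one that also covers singular points: where \<open>A x ** H x\<close> is singular,
  \<open>c_fun\<close> is infinite and a finite product forces \<open>t = 0\<close>.\<close>

lemma c_fun_bound:
  fixes J A H :: "real \<Rightarrow> complex^'n^'n"
  assumes "psd (A x)" "psd (H x)" "0 \<le> t" "0 \<le> K" and c: "ennreal t * c_fun J A H x \<le> ennreal K"
  shows "t * cmod (cdot p (J x *v u)) \<le> K * (sqrt (qf (A x) p) * sqrt (qf (H x) u))"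
proof (cases "det (A x ** H x) \<noteq> 0")
  case True
  let ?N = "op_norm (mat_inv_sqrt (A x) ** J x ** mat_inv_sqrt (H x))"
  let ?s = "sqrt (qf (A x) p) * sqrt (qf (H x) u)"
  have s: "0 \<le> ?s" using assms(1,2) by (simp add: psd_qf_nonneg)
  have "ennreal (t * max 1 ?N) \<le> ennreal K"
    using c True assms(3) by (simp add: c_fun_def ennreal_mult)
  then have tK: "t * max 1 ?N \<le> K" using assms(4) by (simp add: ennreal_le_iff)
  have "cmod (cdot p (J x *v u)) \<le> ?N * ?s" by (rule sandwich_cdot_bound[OF assms(1,2) True])
  also have "\<dots> \<le> max 1 ?N * ?s" using s by (intro mult_right_mono) auto
  finally have "t * cmod (cdot p (J x *v u)) \<le> t * (max 1 ?N * ?s)" using assms(3) by (rule mult_left_mono)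
  also have "\<dots> = (t * max 1 ?N) * ?s" by simp
  also have "\<dots> \<le> K * ?s" using tK s by (rule mult_right_mono)
  finally show ?thesis .
next
  case False
  then have "ennreal t * \<infinity> \<le> ennreal K" using c by (simp add: c_fun_def)
  then have "t = 0" using assms(3) by (cases "t = 0") (auto simp: ennreal_mult_top top_unique)
  then show ?thesis using assms by (simp add: psd_qf_nonneg)
qed

text \<open>\<open>Suc n\<close> avoids a division by \<open>0\<close> at \<open>n = 0\<close>. The
  absolute value lets one formula serve both ends, where \<open>T\<close> will have infinite limits
  of opposite signs.\<close>

definition cutoff :: "(real \<Rightarrow> real) \<Rightarrow> nat \<Rightarrow> real \<Rightarrow> real" where
  "cutoff T n x = max 0 (1 - \<bar>T x\<bar> / real (Suc n))"

lemma cutoff_range: "0 \<le> cutoff T n x" "cutoff T n x \<le> 1"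
  by (auto simp: cutoff_def)

lemma cutoff_mono: "m \<le> n \<Longrightarrow> cutoff T m x \<le> cutoff T n x"
  unfolding cutoff_def by (intro max.mono diff_mono divide_left_mono) auto

lemma cutoff_tendsto: "(\<lambda>n. cutoff T n x) \<longlonglongrightarrow> 1"
proof -
  have "(\<lambda>n. max 0 (1 - \<bar>T x\<bar> * inverse (real (Suc n)))) \<longlonglongrightarrow> max 0 (1 - \<bar>T x\<bar> * 0)"
    by (intro tendsto_intros LIMSEQ_inverse_real_of_nat)
  then show ?thesis unfolding cutoff_def by (simp add: divide_inverse)
qed

text \<open>The cut-off is Lipschitz with constant \<open>1\<close> relative to
  \<open>T x / Suc n\<close>, so wherever both are differentiable the derivative of the latter
  dominates; this also settles the kinks of the absolute value and of the maximum.\<close>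

lemma cutoff_density:
  assumes T: "has_density T \<kappa>" and \<kappa>: "\<And>x. 0 \<le> \<kappa> x"
  shows "has_density (cutoff T n) (\<lambda>x. vector_derivative (cutoff T n) (at x))"
    and "AE x in lebesgue. \<bar>vector_derivative (cutoff T n) (at x)\<bar> \<le> \<kappa> x / real (Suc n)"
proof -
  have sc: "has_density (\<lambda>x. T x / real (Suc n)) (\<lambda>x. \<kappa> x / real (Suc n))"
    by (rule has_density_compose_linear[OF T bounded_linear_divide])
  have lip: "\<bar>cutoff T n y - cutoff T n x\<bar> \<le> \<bar>T y / real (Suc n) - T x / real (Suc n)\<bar>" for x y
  proof -
    have "\<bar>\<bar>T y\<bar> / real (Suc n) - \<bar>T x\<bar> / real (Suc n)\<bar> \<le> \<bar>T y / real (Suc n) - T x / real (Suc n)\<bar>"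
      unfolding diff_divide_distrib[symmetric] abs_divide by (intro divide_right_mono) auto
    then show ?thesis unfolding cutoff_def by linarith
  qed
  have ac: "loc_abs_cont (cutoff T n)"
    by (rule loc_abs_cont_lipschitz[OF has_density_imp_loc_abs_cont[OF sc]])
      (use lip in \<open>auto intro!: exI[of _ 1]\<close>)
  show "has_density (cutoff T n) (\<lambda>x. vector_derivative (cutoff T n) (at x))"
    by (rule loc_abs_cont_has_density[OF ac])
  show "AE x in lebesgue. \<bar>vector_derivative (cutoff T n) (at x)\<bar> \<le> \<kappa> x / real (Suc n)"
    using loc_abs_cont_AE_derivative[OF ac] has_density_AE_derivative[OF sc]
  proof eventually_elim
    case (elim x)
    show ?case using derivative_le_of_dominated[OF elim lip] \<kappa>[of x] by simp
  qed
qed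

lemma cutoff_support:
  assumes "filterlim T at_top at_top" "filterlim T at_bot at_bot"
  shows "\<exists>R. \<forall>x. R < \<bar>x\<bar> \<longrightarrow> cutoff T n x = 0"
proof -
  obtain a where a: "\<And>x. a \<le> x \<Longrightarrow> real (Suc n) \<le> T x"
    using assms(1) unfolding filterlim_at_top eventually_at_top_linorder by meson
  obtain b where b: "\<And>x. x \<le> b \<Longrightarrow> T x \<le> - real (Suc n)"
    using assms(2) unfolding filterlim_at_bot eventually_at_bot_linorder by meson
  show ?thesis
  proof (intro exI allI impI)
    fix x assume x: "max \<bar>a\<bar> \<bar>b\<bar> < \<bar>x\<bar>"
    have "real (Suc n) \<le> \<bar>T x\<bar>"
    proof (cases "0 \<le> x")
      case True then show ?thesis using a[of x] x by linarith
    next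
      case False then show ?thesis using b[of x] x by linarith
    qed
    then show "cutoff T n x = 0" by (simp add: cutoff_def)
  qed
qed

section \<open>The block system as a symmetric system\<close>

locale block_coefficients =
  fixes J V B A H :: "real \<Rightarrow> complex^'n^'n"
  assumes J_ac: "loc_abs_cont J" and J_det: "\<And>x. det (J x) \<noteq> 0"
    and V_int: "loc_integrable V" and B_int: "loc_integrable B"
    and A_int: "loc_integrable A" and H_int: "loc_integrable H"
    and V_herm: "AE x in lebesgue. hermitian (V x)"
    and A_psd: "AE x in lebesgue. psd (A x)"
    and H_psd: "AE x in lebesgue. psd (H x)"

text \<open>The entry \<open>adj B - J'\<close> of \<open>B_tilde\<close> is what gives formal
  symmetry: in \<open>B_tilde - adj B_tilde\<close> the terms with \<open>B\<close> cancel, and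
  \<open>adj J'\<close> and \<open>- J'\<close> remain off the diagonal, which is the derivative of
  \<open>J_tilde\<close>.\<close>

sublocale block_coefficients \<subseteq> sys: symmetric_system "J_tilde J" "B_tilde J V B A" "H_tilde H"
proof
  define L :: "complex^'n^'n \<Rightarrow> complex^('n+'n)^('n+'n)" where "L M = block 0 (adj M) (- M) 0" for M
  have L: "bounded_linear L"
    unfolding L_def by (intro bounded_linear_block bounded_linear_zero bounded_linear_adj bounded_linear_minus bounded_linear_ident)
  have JL: "J_tilde J = (\<lambda>x. L (J x))" by (simp add: fun_eq_iff L_def J_tilde_def)
  show "loc_abs_cont (J_tilde J)" unfolding JL by (rule loc_abs_cont_linear[OF J_ac L])
  show "adj (J_tilde J x) = - J_tilde J x" for x
    by (simp add: J_tilde_def adj_block block_uminus adj_minus)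
  show "det (J_tilde J x) \<noteq> 0" for x
  proof -
    have ker: "v = 0" if "M *v v = 0" "det M \<noteq> 0" for M :: "complex^'n^'n" and v
      using that by (metis invertible_det_nz invertible_left_inverse matrix_left_invertible_ker)
    have "det (adj (J x)) \<noteq> 0"
    proof -
      obtain K where "K ** J x = mat 1" using J_det[of x] by (metis invertible_det_nz invertible_def)
      then have "adj (J x) ** adj K = mat 1" by (metis adj_mult adj_mat_1)
      then show ?thesis by (metis invertible_det_nz invertible_right_inverse)
    qed
    \<comment> \<open>The antidiagonal form decouples the kernel equation into one for each
      half.\<close>
    have "v = 0" if v: "J_tilde J x *v v = 0" for v
    proof -
      have "join (adj (J x) *v lower v) (- J x *v upper v) = join 0 0"
        using v block_mult_join[of 0 "adj (J x)" "- J x" 0 "upper v" "lower v"] by (simp add: J_tilde_def join_0)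
      then have "adj (J x) *v lower v = 0" "- J x *v upper v = 0"
        by (metis upper_join, metis lower_join)
      then have lu: "adj (J x) *v lower v = 0" "J x *v upper v = 0" by (simp_all add: mult_vec_simps)
      have "lower v = 0" "upper v = 0"
        by (rule ker[OF lu(1) \<open>det (adj (J x)) \<noteq> 0\<close>], rule ker[OF lu(2) J_det])
      then show ?thesis by (metis join_0 join_upper_lower)
    qed
    then show ?thesis by (metis invertible_det_nz invertible_left_inverse matrix_left_invertible_ker)
  qed
  have J': "loc_integrable (\<lambda>x. vector_derivative J (at x))"
    by (rule has_density_loc_integrable[OF loc_abs_cont_has_density[OF J_ac]])
  have "loc_integrable (\<lambda>x. adj (B x) + - vector_derivative J (at x))"
    by (intro loc_integrable_add loc_integrable_linear[OF B_int bounded_linear_adj]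
        loc_integrable_linear[OF J' bounded_linear_minus[OF bounded_linear_ident]])
  then show "loc_integrable (B_tilde J V B A)"
    unfolding B_tilde_def[abs_def]
    using loc_integrable_linear[OF A_int bounded_linear_minus[OF bounded_linear_ident]]
    by (intro loc_integrable_block V_int B_int) simp_all
  show "loc_integrable (H_tilde H)"
    unfolding H_tilde_def[abs_def] by (rule loc_integrable_linear[OF H_int bounded_linear_block_diag(2)])
  show "AE x in lebesgue. psd (H_tilde H x)"
    using H_psd by eventually_elim (simp add: H_tilde_def psd_block_diag psd_0)
  show "AE x in lebesgue. B_tilde J V B A x - adj (B_tilde J V B A x) = vector_derivative (J_tilde J) (at x)"
    using V_herm A_psd loc_abs_cont_AE_derivative[OF J_ac]
  proof eventually_elim
    case (elim x)
    have "vector_derivative (J_tilde J) (at x) = L (vector_derivative J (at x))"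
      unfolding JL by (rule vector_derivative_at[OF bounded_linear.has_vector_derivative[OF L elim(3)]])
    moreover have "adj (V x) = V x" "adj (A x) = A x" using elim(1,2) by (auto simp: hermitian_def psd_def)
    ultimately show ?case
      by (simp add: B_tilde_def L_def adj_block adj_diff adj_minus block_diff)
  qed
qed

context block_coefficients
begin

lemma H_tilde_cdot: "cdot f (H_tilde H x *v g) = cdot (upper f) (H x *v upper g)"
proof -
  have "cdot (join (upper f) (lower f)) (H_tilde H x *v join (upper g) (lower g)) = cdot (upper f) (H x *v upper g)"
    unfolding H_tilde_def block_mult_join cdot_join by simp
  then show ?thesis by simp
qed

lemma H_tilde_qf: "qf (H_tilde H x) f = qf (H x) (upper f)"
  by (simp add: qf_def H_tilde_cdot)

lemma J_tilde_cdot: "cdot f (J_tilde J x *v h) = cdot (J x *v upper f) (lower h) - cdot (lower f) (J x *v upper h)"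
proof -
  have "cdot (join (upper f) (lower f)) (J_tilde J x *v join (upper h) (lower h))
      = cdot (upper f) (adj (J x) *v lower h) + cdot (lower f) (- J x *v upper h)"
    unfolding J_tilde_def block_mult_join cdot_join by simp
  then show ?thesis by (simp add: cdot_mult_left mult_vec_simps cdot_minus_right)
qed

text \<open>The two rows of the system are inserted for \<open>adj J p'\<close> and for
  \<open>J u' + J' u\<close>; the contributions of \<open>B\<close> and \<open>adj B\<close> cancel
  between them, leaving the forms of \<open>H\<close>, \<open>V\<close> and \<open>A\<close>, the
  last with a definite sign.\<close>

lemma energy_density:
  assumes fg: "(f, g) \<in> sys.T_max"
  shows "has_density (\<lambda>x. Re (cdot (J x *v upper (f x)) (lower (f x))))
    (\<lambda>x. Re (cdot (upper (f x)) (H x *v upper (g x))) - qf (V x) (upper (f x)) - qf (A x) (lower (f x)))"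
proof -
  define f' where "f' x = vector_derivative f (at x)" for x
  define J' where "J' x = vector_derivative J (at x)" for x
  have sol: "sys.sol f (\<lambda>x. H_tilde H x *v g x)" using fg by (simp add: sys.T_max_def)
  have f: "has_density f f'" using sys.solD(1)[OF sol] by (simp add: f'_def[abs_def])
  have eq: "AE x in lebesgue. J_tilde J x *v f' x + B_tilde J V B A x *v f x = H_tilde H x *v g x"
    using sys.solD(2)[OF sol] by (simp add: f'_def)
  have J: "has_density J J'" using loc_abs_cont_has_density[OF J_ac] by (simp add: J'_def[abs_def])
  have "has_density (\<lambda>x. J x *v upper (f x)) (\<lambda>x. J x *v upper (f' x) + J' x *v upper (f x))"
    by (rule has_density_bilinear[OF J has_density_compose_linear[OF f bounded_linear_upper] bounded_bilinear_mult_vec])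
  from has_density_bilinear[OF this has_density_compose_linear[OF f bounded_linear_lower] bounded_bilinear_cdot]
  have "has_density (\<lambda>x. cdot (J x *v upper (f x)) (lower (f x)))
    (\<lambda>x. cdot (J x *v upper (f x)) (lower (f' x)) + cdot (J x *v upper (f' x) + J' x *v upper (f x)) (lower (f x)))" .
  from has_density_compose_linear[OF this bounded_linear_Re] show ?thesis
  proof (rule has_density_cong_AE)
    show "AE x in lebesgue. Re (cdot (J x *v upper (f x)) (lower (f' x)) + cdot (J x *v upper (f' x) + J' x *v upper (f x)) (lower (f x)))
        = Re (cdot (upper (f x)) (H x *v upper (g x))) - qf (V x) (upper (f x)) - qf (A x) (lower (f x))"
      using eq A_psd
    proof eventually_elim
      case (elim x)
      have hA: "hermitian (A x)" using elim(2) by (simp add: psd_def)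
      have "J_tilde J x *v join (upper (f' x)) (lower (f' x)) + B_tilde J V B A x *v join (upper (f x)) (lower (f x))
        = H_tilde H x *v join (upper (g x)) (lower (g x))" using elim(1) by simp
      then have "join (adj (J x) *v lower (f' x) + (V x *v upper (f x) + B x *v lower (f x)))
          (- J x *v upper (f' x) + ((adj (B x) - J' x) *v upper (f x) + - A x *v lower (f x)))
        = join (H x *v upper (g x)) 0"
        unfolding J_tilde_def B_tilde_def H_tilde_def block_mult_join join_add J'_def by simp
      then have e1: "adj (J x) *v lower (f' x) + (V x *v upper (f x) + B x *v lower (f x)) = H x *v upper (g x)"
        and e2: "- J x *v upper (f' x) + ((adj (B x) - J' x) *v upper (f x) + - A x *v lower (f x)) = 0"
        by (metis upper_join, metis lower_join)
      have e1': "adj (J x) *v lower (f' x) = H x *v upper (g x) - V x *v upper (f x) - B x *v lower (f x)"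
        using e1 by (simp add: algebra_simps)
      have e2': "J x *v upper (f' x) + J' x *v upper (f x) = adj (B x) *v upper (f x) - A x *v lower (f x)"
        using e2 by (simp add: mult_vec_simps algebra_simps)
      have "cdot (J x *v upper (f x)) (lower (f' x)) + cdot (J x *v upper (f' x) + J' x *v upper (f x)) (lower (f x))
        = cdot (upper (f x)) (H x *v upper (g x)) - cdot (upper (f x)) (V x *v upper (f x))
          - cdot (lower (f x)) (A x *v lower (f x))"
        unfolding e2' cdot_mult_left[of "J x"] e1'
        by (simp add: cdot_diff_left cdot_diff_right cdot_mult_left[of "adj (B x)"] hermitian_cdot[OF hA])
      then show ?case by (simp add: qf_def)
    qed
  qed
qed

end

section \<open>The energy estimate\<close>

locale cutoff_coefficients = block_coefficients J V B A H for J V B A H :: "real \<Rightarrow> complex^'n^'n" +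
  fixes q \<rho> \<rho>' k T :: "real \<Rightarrow> real" and \<delta> K :: real
  assumes \<delta>: "0 < \<delta>" and q: "\<And>x. \<delta> \<le> q x"
    and V_ge: "AE x in lebesgue. loewner_le (- (q x *\<^sub>R H x)) (V x)"
    and \<rho>: "has_density \<rho> \<rho>'" "\<And>x. 0 \<le> \<rho> x" "\<And>x. (\<rho> x)\<^sup>2 * q x \<le> 1"
    and k: "\<And>x. 0 \<le> k x" "\<And>x. ennreal (k x) * c_fun J A H x \<le> 1"
    and K: "0 \<le> K" "AE x in lebesgue. ennreal \<bar>\<rho>' x\<bar> * c_fun J A H x \<le> ennreal K"
    and T: "has_density T (\<lambda>x. \<rho> x * k x)" "filterlim T at_top at_top" "filterlim T at_bot at_bot"
begin

lemma \<rho>_square: "(\<rho> x)\<^sup>2 \<le> 1 / \<delta>"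
proof -
  have "(\<rho> x)\<^sup>2 * \<delta> \<le> (\<rho> x)\<^sup>2 * q x" by (rule mult_left_mono[OF q]) simp
  also have "\<dots> \<le> 1" by (rule \<rho>(3))
  finally show ?thesis using \<delta> by (simp add: le_divide_eq)
qed

lemma V_lower: "AE x in lebesgue. \<forall>v. - qf (V x) v \<le> q x * qf (H x) v"
  using V_ge
proof eventually_elim
  case (elim x)
  show ?case
  proof
    fix v
    have "0 \<le> qf (V x - - (q x *\<^sub>R H x)) v" using elim by (intro psd_qf_nonneg) (simp add: loewner_le_def)
    also have "\<dots> = qf (V x) v + q x * qf (H x) v"
      by (simp add: qf_def mult_vec_simps cdot_add_right scaleR_matrix_vector_assoc[symmetric] cdot_scaleR_right)
    finally show "- qf (V x) v \<le> q x * qf (H x) v" by simp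
  qed
qed

lemma k_bound: "psd (A x) \<Longrightarrow> psd (H x) \<Longrightarrow> k x * cmod (cdot p (J x *v u)) \<le> sqrt (qf (A x) p) * sqrt (qf (H x) u)"
  using c_fun_bound[of A x H "k x" 1 J p u] k by simp

lemma cutoff_integral_zero:
  fixes f :: "real \<Rightarrow> 'a::euclidean_space"
  assumes f: "has_density f f'"
  shows "integrable lebesgue (\<lambda>x. cutoff T n x *\<^sub>R f' x + vector_derivative (cutoff T n) (at x) *\<^sub>R f x)"
    "(LINT x|lebesgue. cutoff T n x *\<^sub>R f' x + vector_derivative (cutoff T n) (at x) *\<^sub>R f x) = 0"
proof -
  obtain R where R: "\<And>x. R < \<bar>x\<bar> \<Longrightarrow> cutoff T n x = 0" using cutoff_support[OF T(2,3)] by blast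
  have nn: "0 \<le> \<rho> x * k x" for x using \<rho>(2) k(1) by simp
  have "has_density (\<lambda>x. cutoff T n x *\<^sub>R f x) (\<lambda>x. cutoff T n x *\<^sub>R f' x + vector_derivative (cutoff T n) (at x) *\<^sub>R f x)"
    by (rule has_density_bilinear[OF cutoff_density(1)[OF T(1) nn] f bounded_bilinear_scaleR])
  note z = has_density_integral_zero[OF this, of R]
  show "integrable lebesgue (\<lambda>x. cutoff T n x *\<^sub>R f' x + vector_derivative (cutoff T n) (at x) *\<^sub>R f x)"
    by (rule z(1)) (simp add: R)
  show "(LINT x|lebesgue. cutoff T n x *\<^sub>R f' x + vector_derivative (cutoff T n) (at x) *\<^sub>R f x) = 0"
    by (rule z(2)) (simp add: R)
qed

text \<open>The energy identity is multiplied by the square of the cut-off weight \<open>\<psi> = \<rho> \<phi>\<close>;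
  the term with \<open>\<psi>'\<close> is absorbed by half of the term with \<open>A\<close>.\<close>
lemma energy_pointwise:
  fixes \<psi> \<psi>' a h g e v r w :: real
  assumes a: "0 \<le> a" and h: "0 \<le> h" and g: "0 \<le> g" and L: "0 \<le> L" and \<delta>: "0 < \<delta>"
    and e: "\<bar>\<psi>'\<bar> * \<bar>e\<bar> \<le> L * (sqrt a * sqrt h)" and r: "\<bar>r\<bar> \<le> sqrt h * sqrt g"
    and v: "- v \<le> w * h" and w: "\<psi>\<^sup>2 * w \<le> 1" and \<psi>: "\<psi>\<^sup>2 \<le> 1 / \<delta>"
  shows "\<psi>\<^sup>2 * a \<le> 2 * ((h + g) / \<delta> + h + 2 * L\<^sup>2 * h) - 2 * (\<psi>\<^sup>2 * (r - v - a) + 2 * \<psi> * \<psi>' * e)"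
proof -
  have am: "2 * (x * y) \<le> x\<^sup>2 + y\<^sup>2" for x y :: real using sum_squares_bound[of x y] by simp
  have "\<bar>r\<bar> \<le> h + g"
    using r am[of "sqrt h" "sqrt g"] h g mult_nonneg_nonneg[of "sqrt h" "sqrt g"] by simp
  then have 1: "\<psi>\<^sup>2 * r \<le> (h + g) / \<delta>"
    using mult_mono[OF \<psi>, of "\<bar>r\<bar>" "h + g"] \<delta> abs_ge_self[of r] mult_left_mono[of r "\<bar>r\<bar>" "\<psi>\<^sup>2"] by auto
  have "\<psi>\<^sup>2 * (- v) \<le> \<psi>\<^sup>2 * (w * h)" by (rule mult_left_mono[OF v]) simp
  also have "\<dots> \<le> 1 * h" unfolding mult.assoc[symmetric] by (rule mult_right_mono[OF w h])
  finally have 2: "\<psi>\<^sup>2 * (- v) \<le> h" by simp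
  have "2 * \<psi> * \<psi>' * e \<le> 2 * \<bar>\<psi>\<bar> * (\<bar>\<psi>'\<bar> * \<bar>e\<bar>)"
    using abs_ge_self[of "2 * \<psi> * \<psi>' * e"] by (simp add: abs_mult)
  also have "\<dots> \<le> 2 * \<bar>\<psi>\<bar> * (L * (sqrt a * sqrt h))" by (rule mult_left_mono[OF e]) simp
  \<comment> \<open>The factor \<open>sqrt 2\<close> is distributed so that the arithmetic-geometric
    inequality returns exactly half of \<open>\<psi>^2 a\<close>.\<close>
  also have "\<dots> = 2 * ((\<bar>\<psi>\<bar> * sqrt a / sqrt 2) * (sqrt 2 * L * sqrt h))" by simp
  also have "\<dots> \<le> (\<bar>\<psi>\<bar> * sqrt a / sqrt 2)\<^sup>2 + (sqrt 2 * L * sqrt h)\<^sup>2" by (rule am)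
  also have "\<dots> = \<psi>\<^sup>2 * a / 2 + 2 * L\<^sup>2 * h" using a h by (simp add: power_mult_distrib power_divide)
  finally have 3: "2 * \<psi> * \<psi>' * e \<le> \<psi>\<^sup>2 * a / 2 + 2 * L\<^sup>2 * h" .
  \<comment> \<open>The difference of the two sides is twice the sum of the slacks in facts
    \<open>1\<close>, \<open>2\<close> and \<open>3\<close>; \<open>X\<close> stands for
    \<open>(h + g) / \<delta>\<close>, which makes this a polynomial identity.\<close>
  have "2 * (X + h + 2 * L\<^sup>2 * h) - 2 * (\<psi>\<^sup>2 * (r - v - a) + 2 * \<psi> * \<psi>' * e) - \<psi>\<^sup>2 * a
    = 2 * (X - \<psi>\<^sup>2 * r) + 2 * (h - \<psi>\<^sup>2 * (- v)) + 2 * (\<psi>\<^sup>2 * a / 2 + 2 * L\<^sup>2 * h - 2 * \<psi> * \<psi>' * e)" for X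
    by (simp add: algebra_simps)
  note eq = this[of "(h + g) / \<delta>"]
  have "z \<le> x - y" if "x - y - z = 2 * s + 2 * t + 2 * u" "0 \<le> s" "0 \<le> t" "0 \<le> u" for x y z s t u :: real
    using that by linarith
  from this[OF eq] show ?thesis using 1 2 3 unfolding diff_ge_0_iff_ge by blast
qed

text \<open>The pointwise energy estimate is integrated: \<open>F n\<close> is the density of a
  compactly supported function and has integral \<open>0\<close>, so the integrals of
  \<open>(\<psi> n)^2\<close> times the form of \<open>A\<close> are at most the integral of
  \<open>D\<close>, uniformly in \<open>n\<close>. Monotone convergence removes the cut-off.\<close>

theorem lower_component_integrable:
  assumes fg: "(f, g) \<in> sys.T_max"
  shows "integrable lebesgue (\<lambda>x. (\<rho> x)\<^sup>2 * qf (A x) (lower (f x)))"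
proof -
  define a where "a x = qf (A x) (lower (f x))" for x
  define h where "h x = qf (H x) (upper (f x))" for x
  define hg where "hg x = qf (H x) (upper (g x))" for x
  define v where "v x = qf (V x) (upper (f x))" for x
  define r where "r x = Re (cdot (upper (f x)) (H x *v upper (g x)))" for x
  define E where "E x = Re (cdot (J x *v upper (f x)) (lower (f x)))" for x
  \<comment> \<open>\<open>K\<close> comes from \<open>\<rho>'\<close>; \<open>1 / \<delta>\<close>
    comes from the derivative of the cut-off, where \<open>\<bar>\<phi>'\<bar> \<rho> \<le> \<rho>^2
    k \<le> k / \<delta>\<close>.\<close>
  define L where "L = K + 1 / \<delta>"
  define D where "D x = 2 * ((h x + hg x) / \<delta> + h x + 2 * L\<^sup>2 * h x)" for x
  have L0: "0 \<le> L" using K(1) \<delta> by (simp add: L_def)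
  have fL: "f \<in> L2_fun (H_tilde H)" "g \<in> L2_fun (H_tilde H)" using fg by (auto simp: sys.T_max_def)
  have h_int: "integrable lebesgue h" and hg_int: "integrable lebesgue hg"
    using sys.L2_qf[OF fL(1)] sys.L2_qf[OF fL(2)] by (simp_all add: H_tilde_qf h_def[abs_def] hg_def[abs_def])
  then have D_int: "integrable lebesgue D" unfolding D_def[abs_def] by simp
  have E: "has_density E (\<lambda>x. r x - v x - a x)"
    using energy_density[OF fg] by (simp add: E_def[abs_def] r_def v_def a_def)
  have f_cont: "continuous_on UNIV f" using fg by (auto simp: sys.T_max_def intro: sys.sol_continuous)
  have p_cont: "continuous_on UNIV (\<lambda>x. lower (f x))"
    by (rule bounded_linear.continuous_on[OF bounded_linear_lower f_cont])
  have a_int: "loc_integrable a"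
  proof -
    have "loc_integrable (\<lambda>x. A x *v lower (f x))"
      by (rule loc_integrable_bilinear'[OF p_cont A_int bounded_bilinear_mult_vec])
    then have "loc_integrable (\<lambda>x. cdot (lower (f x)) (A x *v lower (f x)))"
      by (rule loc_integrable_bilinear[OF p_cont _ bounded_bilinear_cdot])
    then show ?thesis unfolding a_def[abs_def] qf_def by (rule loc_integrable_linear[OF _ bounded_linear_Re])
  qed
  have \<rho>_cont: "continuous_on UNIV \<rho>" by (rule has_density_continuous[OF \<rho>(1)])
  define \<psi> where "\<psi> n x = cutoff T n x * \<rho> x" for n x
  define \<phi>' where "\<phi>' n x = vector_derivative (cutoff T n) (at x)" for n x
  define \<psi>' where "\<psi>' n x = cutoff T n x * \<rho>' x + \<phi>' n x * \<rho> x" for n x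
  have nn: "0 \<le> \<rho> x * k x" for x using \<rho>(2) k(1) by simp
  have \<phi>: "has_density (cutoff T n) (\<phi>' n)" "AE x in lebesgue. \<bar>\<phi>' n x\<bar> \<le> \<rho> x * k x / real (Suc n)" for n
    using cutoff_density[OF T(1) nn] by (simp_all add: \<phi>'_def[abs_def])
  have \<psi>: "has_density (\<psi> n) (\<psi>' n)" for n
    unfolding \<psi>_def[abs_def] \<psi>'_def[abs_def] by (rule has_density_bilinear[OF \<phi>(1) \<rho>(1) bounded_bilinear_mult])
  have \<psi>0: "0 \<le> \<psi> n x" and \<psi>\<rho>: "\<psi> n x \<le> \<rho> x" for n x
    using cutoff_range[of T n x] \<rho>(2)[of x] by (auto simp: \<psi>_def mult_left_le_one_le)
  have \<psi>sq: "(\<psi> n x)\<^sup>2 \<le> (\<rho> x)\<^sup>2" for n x by (rule power_mono[OF \<psi>\<rho> \<psi>0])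
  define F where "F n x = (\<psi> n x)\<^sup>2 * (r x - v x - a x) + 2 * \<psi> n x * \<psi>' n x * E x" for n x
  have supp: "\<exists>R. \<forall>x. R < \<bar>x\<bar> \<longrightarrow> \<psi> n x = 0" for n
    using cutoff_support[OF T(2,3), of n] by (auto simp: \<psi>_def)
  have F: "integrable lebesgue (F n)" "integral\<^sup>L lebesgue (F n) = 0" for n
  proof -
    obtain R where R: "\<And>x. R < \<bar>x\<bar> \<Longrightarrow> \<psi> n x = 0" using supp by blast
    have "has_density (\<lambda>x. \<psi> n x * \<psi> n x) (\<lambda>x. \<psi> n x * \<psi>' n x + \<psi>' n x * \<psi> n x)"
      by (rule has_density_bilinear[OF \<psi> \<psi> bounded_bilinear_mult])
    from has_density_bilinear[OF this E bounded_bilinear_mult]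
    have d: "has_density (\<lambda>x. \<psi> n x * \<psi> n x * E x) (F n)"
      unfolding F_def[abs_def] by (simp add: algebra_simps power2_eq_square)
    show "integrable lebesgue (F n)" "integral\<^sup>L lebesgue (F n) = 0"
      using has_density_integral_zero[OF d, of R] R by auto
  qed
  have \<psi>a_int: "integrable lebesgue (\<lambda>x. (\<psi> n x)\<^sup>2 * a x)" for n
  proof -
    obtain R where R: "\<And>x. R < \<bar>x\<bar> \<Longrightarrow> \<psi> n x = 0" using supp by blast
    have "loc_integrable (\<lambda>x. (\<psi> n x)\<^sup>2 * a x)"
      by (rule loc_integrable_bilinear[OF _ a_int bounded_bilinear_mult])
        (intro continuous_on_power has_density_continuous[OF \<psi>])
    then show ?thesis
      by (rule loc_integrable_bounded_support(1)[of _ "- \<bar>R\<bar>" "\<bar>R\<bar>"]) (auto intro!: AE_I2 R)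
  qed
  have le: "AE x in lebesgue. (\<psi> n x)\<^sup>2 * a x \<le> D x - 2 * F n x" for n
    using A_psd H_psd K(2) V_lower \<phi>(2)[of n]
  proof eventually_elim
    case (elim x)
    have \<rho>'E: "\<bar>\<rho>' x\<bar> * \<bar>E x\<bar> \<le> K * (sqrt (a x) * sqrt (h x))"
      and kE: "k x * \<bar>E x\<bar> \<le> sqrt (a x) * sqrt (h x)"
    proof -
      have *: "\<bar>E x\<bar> \<le> cmod (cdot (lower (f x)) (J x *v upper (f x)))"
        unfolding E_def using abs_Re_le_cmod complex_mod_cnj cnj_cdot by metis
      show "\<bar>\<rho>' x\<bar> * \<bar>E x\<bar> \<le> K * (sqrt (a x) * sqrt (h x))"
        using mult_left_mono[OF *, of "\<bar>\<rho>' x\<bar>"]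
          c_fun_bound[OF elim(1,2) abs_ge_zero K(1) elim(3), of "lower (f x)" "upper (f x)"]
        unfolding a_def h_def by linarith
      show "k x * \<bar>E x\<bar> \<le> sqrt (a x) * sqrt (h x)"
        using mult_left_mono[OF * k(1), of x] k_bound[OF elim(1,2), of "lower (f x)" "upper (f x)"]
        unfolding a_def h_def by linarith
    qed
    have s0: "0 \<le> sqrt (a x) * sqrt (h x)"
      using elim(1,2) by (simp add: a_def h_def psd_qf_nonneg)
    have "\<bar>\<psi>' n x\<bar> \<le> \<bar>\<rho>' x\<bar> + (1 / \<delta>) * k x"
    proof -
      have "\<bar>cutoff T n x * \<rho>' x\<bar> \<le> \<bar>\<rho>' x\<bar>"
        using cutoff_range[of T n x] by (simp add: abs_mult mult_left_le_one_le)
      moreover have "\<bar>\<phi>' n x * \<rho> x\<bar> \<le> (1 / \<delta>) * k x"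
      proof -
        have "\<rho> x * k x / real (Suc n) \<le> \<rho> x * k x / 1" by (rule divide_left_mono) (use nn in auto)
        then have "\<bar>\<phi>' n x\<bar> * \<rho> x \<le> (\<rho> x * k x) * \<rho> x" using elim(5) \<rho>(2) by (intro mult_right_mono) auto
        also have "\<dots> = (\<rho> x)\<^sup>2 * k x" by (simp add: power2_eq_square)
        also have "\<dots> \<le> (1 / \<delta>) * k x" by (rule mult_right_mono[OF \<rho>_square k(1)])
        finally show ?thesis using \<rho>(2) by (simp add: abs_mult)
      qed
      ultimately show ?thesis unfolding \<psi>'_def by linarith
    qed
    then have "\<bar>\<psi>' n x\<bar> * \<bar>E x\<bar> \<le> (\<bar>\<rho>' x\<bar> + (1 / \<delta>) * k x) * \<bar>E x\<bar>" by (rule mult_right_mono) simp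
    also have "\<dots> = \<bar>\<rho>' x\<bar> * \<bar>E x\<bar> + (1 / \<delta>) * (k x * \<bar>E x\<bar>)" by (simp add: algebra_simps)
    also have "\<dots> \<le> K * (sqrt (a x) * sqrt (h x)) + (1 / \<delta>) * (sqrt (a x) * sqrt (h x))"
      by (intro add_mono \<rho>'E mult_left_mono kE) (use \<delta> in simp)
    also have "\<dots> = L * (sqrt (a x) * sqrt (h x))" by (simp add: L_def algebra_simps)
    finally have e: "\<bar>\<psi>' n x\<bar> * \<bar>E x\<bar> \<le> L * (sqrt (a x) * sqrt (h x))" .
    show ?case
      unfolding D_def F_def
    proof (rule energy_pointwise[OF _ _ _ L0 \<delta> e])
      show "0 \<le> a x" "0 \<le> h x" "0 \<le> hg x" using elim(1,2) by (simp_all add: a_def h_def hg_def psd_qf_nonneg)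
      show "\<bar>r x\<bar> \<le> sqrt (h x) * sqrt (hg x)"
        unfolding r_def h_def hg_def using abs_Re_le_cmod psd_cauchy_schwarz_sqrt[OF elim(2)] order_trans by blast
      show "- v x \<le> q x * h x" using elim(4) by (simp add: v_def h_def)
      show "(\<psi> n x)\<^sup>2 * q x \<le> 1"
        using mult_right_mono[OF \<psi>sq, of "q x"] \<rho>(3)[of x] q[of x] \<delta> by (meson less_imp_le order_trans)
      show "(\<psi> n x)\<^sup>2 \<le> 1 / \<delta>" using \<psi>sq \<rho>_square by (rule order_trans)
    qed
  qed
  have bound: "(LINT x|lebesgue. (\<psi> n x)\<^sup>2 * a x) \<le> integral\<^sup>L lebesgue D" for n
  proof -
    have "(LINT x|lebesgue. (\<psi> n x)\<^sup>2 * a x) \<le> (LINT x|lebesgue. D x - 2 * F n x)"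
      by (rule integral_mono_AE[OF \<psi>a_int _ le]) (use D_int F(1)[of n] in simp)
    also have "\<dots> = integral\<^sup>L lebesgue D" using D_int F[of n] by simp
    finally show ?thesis .
  qed
  have mono: "AE x in lebesgue. mono (\<lambda>n. (\<psi> n x)\<^sup>2 * a x)"
    using A_psd
  proof eventually_elim
    case (elim x)
    show ?case
      using elim \<rho>(2) cutoff_range cutoff_mono unfolding a_def \<psi>_def
      by (intro monoI mult_right_mono power_mono) (auto simp: psd_qf_nonneg)
  qed
  have "incseq (\<lambda>n. LINT x|lebesgue. (\<psi> n x)\<^sup>2 * a x)"
    using mono by (intro incseq_SucI integral_mono_AE \<psi>a_int) (auto elim!: eventually_mono simp: mono_iff_le_Suc)
  then obtain l where l: "(\<lambda>n. LINT x|lebesgue. (\<psi> n x)\<^sup>2 * a x) \<longlonglongrightarrow> l"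
    using incseq_convergent[of _ "integral\<^sup>L lebesgue D"] bound by blast
  have lim: "AE x in lebesgue. (\<lambda>n. (\<psi> n x)\<^sup>2 * a x) \<longlonglongrightarrow> (\<rho> x)\<^sup>2 * a x"
  proof (rule AE_I2)
    fix x
    have "(\<lambda>n. (cutoff T n x * \<rho> x)\<^sup>2 * a x) \<longlonglongrightarrow> (1 * \<rho> x)\<^sup>2 * a x"
      by (intro tendsto_intros cutoff_tendsto)
    then show "(\<lambda>n. (\<psi> n x)\<^sup>2 * a x) \<longlonglongrightarrow> (\<rho> x)\<^sup>2 * a x" by (simp add: \<psi>_def)
  qed
  have "loc_integrable (\<lambda>x. (\<rho> x)\<^sup>2 * a x)"
    by (rule loc_integrable_bilinear[OF _ a_int bounded_bilinear_mult]) (intro continuous_on_power \<rho>_cont)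
  then have "(\<lambda>x. (\<rho> x)\<^sup>2 * a x) \<in> borel_measurable lebesgue" by (rule loc_integrable_borel_measurable)
  from integrable_monotone_convergence[OF \<psi>a_int mono lim l this] show ?thesis by (simp add: a_def)
qed

text \<open>The difference of the two forms is the integral of \<open>d\<close>, the density of the
  boundary form \<open>W\<close>. Instead of pointwise limits of \<open>W\<close> at the ends, an
  average is controlled: \<open>\<rho> k \<bar>W\<bar>\<close> has an integrable majorant
  \<open>Q\<close>, so pairing \<open>W\<close> with the derivative of the \<open>n\<close>-th
  cut-off costs at most the integral of \<open>Q\<close> divided by \<open>n + 1\<close>.\<close>

theorem T_max_symmetric:
  assumes fg: "(f, g) \<in> sys.T_max" and hk: "(h, w) \<in> sys.T_max"
  shows "form (H_tilde H) f w = form (H_tilde H) g h"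
proof -
  define W where "W x = cdot (f x) (J_tilde J x *v h x)" for x
  define d where "d x = cdot (f x) (H_tilde H x *v w x) - cdot (H_tilde H x *v g x) (h x)" for x
  have sol: "sys.sol f (\<lambda>x. H_tilde H x *v g x)" "sys.sol h (\<lambda>x. H_tilde H x *v w x)"
    and L: "f \<in> L2_fun (H_tilde H)" "g \<in> L2_fun (H_tilde H)" "h \<in> L2_fun (H_tilde H)" "w \<in> L2_fun (H_tilde H)"
    using fg hk by (auto simp: sys.T_max_def)
  have W: "has_density W d" unfolding W_def[abs_def] d_def[abs_def] by (rule sys.lagrange[OF sol])
  have swap: "AE x in lebesgue. cdot (g x) (H_tilde H x *v h x) = cdot (H_tilde H x *v g x) (h x)"
    using sys.hermitian_swap_AE by eventually_elim simp
  have gh_int: "integrable lebesgue (\<lambda>x. cdot (H_tilde H x *v g x) (h x))"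
    using integrable_cong_AE_imp[OF sys.L2_sesq_integrable[OF L(2,3)] _ swap]
      loc_integrable_borel_measurable[OF loc_integrable_bilinear'[OF sys.sol_continuous[OF sol(2)] sys.weighted_loc_integrable[OF L(2)] bounded_bilinear_cdot]]
    by blast
  have gh: "form (H_tilde H) g h = (LINT x|lebesgue. cdot (H_tilde H x *v g x) (h x))"
    unfolding form_def by (rule integral_cong_AE) (use swap sys.L2_sesq_integrable[OF L(2,3)] gh_int in auto)
  have d_int: "integrable lebesgue d"
    unfolding d_def[abs_def] by (intro Bochner_Integration.integrable_diff sys.L2_sesq_integrable L gh_int)
  have d_eq: "integral\<^sup>L lebesgue d = form (H_tilde H) f w - form (H_tilde H) g h"
    unfolding d_def[abs_def] gh unfolding form_def
    by (rule Bochner_Integration.integral_diff[OF sys.L2_sesq_integrable[OF L(1,4)] gh_int])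
  \<comment> \<open>The boundary form pairs the lower half of each solution with the upper half of
    the other; \<open>Q\<close> collects the squares from both pairings.\<close>
  define Q where "Q x = ((\<rho> x)\<^sup>2 * qf (A x) (lower (h x)) + qf (H x) (upper (f x)))
    + ((\<rho> x)\<^sup>2 * qf (A x) (lower (f x)) + qf (H x) (upper (h x)))" for x
  have Q_int: "integrable lebesgue Q"
    unfolding Q_def[abs_def]
    by (intro Bochner_Integration.integrable_add lower_component_integrable[OF fg] lower_component_integrable[OF hk]
        sys.L2_qf[OF L(1), unfolded H_tilde_qf] sys.L2_qf[OF L(3), unfolded H_tilde_qf])
  have am: "2 * (x * y) \<le> x\<^sup>2 + y\<^sup>2" for x y :: real using sum_squares_bound[of x y] by simp
  have WQ: "AE x in lebesgue. \<rho> x * k x * cmod (W x) \<le> Q x"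
    using A_psd H_psd
  proof eventually_elim
    case (elim x)
    have b: "\<rho> x * (k x * cmod (cdot p (J x *v u))) \<le> (\<rho> x)\<^sup>2 * qf (A x) p + qf (H x) u" for p u
    proof -
      have nn: "0 \<le> qf (A x) p" "0 \<le> qf (H x) u" using elim by (simp_all add: psd_qf_nonneg)
      have "\<rho> x * (k x * cmod (cdot p (J x *v u))) \<le> \<rho> x * (sqrt (qf (A x) p) * sqrt (qf (H x) u))"
        by (rule mult_left_mono[OF k_bound[OF elim] \<rho>(2)])
      also have "\<dots> \<le> 2 * ((\<rho> x * sqrt (qf (A x) p)) * sqrt (qf (H x) u))" using nn \<rho>(2) by simp
      also have "\<dots> \<le> (\<rho> x * sqrt (qf (A x) p))\<^sup>2 + (sqrt (qf (H x) u))\<^sup>2" by (rule am)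
      also have "\<dots> = (\<rho> x)\<^sup>2 * qf (A x) p + qf (H x) u" using nn by (simp add: power_mult_distrib)
      finally show ?thesis .
    qed
    have "cmod (W x) \<le> cmod (cdot (J x *v upper (f x)) (lower (h x))) + cmod (cdot (lower (f x)) (J x *v upper (h x)))"
      unfolding W_def J_tilde_cdot by (rule norm_triangle_ineq4)
    also have "cmod (cdot (J x *v upper (f x)) (lower (h x))) = cmod (cdot (lower (h x)) (J x *v upper (f x)))"
      by (metis cnj_cdot complex_mod_cnj)
    finally have "\<rho> x * k x * cmod (W x) \<le> \<rho> x * k x * (cmod (cdot (lower (h x)) (J x *v upper (f x)))
        + cmod (cdot (lower (f x)) (J x *v upper (h x))))"
      using \<rho>(2) k(1) by (intro mult_left_mono) auto
    also have "\<dots> \<le> Q x"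
      using b[of "lower (h x)" "upper (f x)"] b[of "lower (f x)" "upper (h x)"]
      by (simp add: Q_def algebra_simps)
    finally show ?case .
  qed
  define \<phi>' where "\<phi>' n x = vector_derivative (cutoff T n) (at x)" for n x
  have nn: "0 \<le> \<rho> x * k x" for x using \<rho>(2) k(1) by simp
  have \<phi>: "has_density (cutoff T n) (\<phi>' n)" "AE x in lebesgue. \<bar>\<phi>' n x\<bar> \<le> \<rho> x * k x / real (Suc n)" for n
    using cutoff_density[OF T(1) nn] by (simp_all add: \<phi>'_def[abs_def])
  have meas: "cutoff T n \<in> borel_measurable lebesgue" for n
    by (intro borel_imp_lebesgue_measurable borel_measurable_continuous_onI has_density_continuous[OF \<phi>(1)])
  have d_meas: "d \<in> borel_measurable lebesgue" by (rule borel_measurable_integrable[OF d_int])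
  have \<phi>d_le: "cmod (cutoff T n x *\<^sub>R d x) \<le> cmod (d x)" for n x
    using cutoff_range[of T n x] by (simp add: mult_left_le_one_le)
  have \<phi>d_meas: "(\<lambda>x. cutoff T n x *\<^sub>R d x) \<in> borel_measurable lebesgue" for n
    using meas d_meas by (rule borel_measurable_scaleR)
  have \<phi>d_int: "integrable lebesgue (\<lambda>x. cutoff T n x *\<^sub>R d x)" for n
    by (rule Bochner_Integration.integrable_bound[OF d_int \<phi>d_meas]) (rule AE_I2, rule \<phi>d_le)
  have "(\<lambda>n. LINT x|lebesgue. cutoff T n x *\<^sub>R d x) \<longlonglongrightarrow> integral\<^sup>L lebesgue d"
  proof (rule integral_dominated_convergence[OF d_meas \<phi>d_meas integrable_norm[OF d_int]])
    have "(\<lambda>n. cutoff T n x *\<^sub>R d x) \<longlonglongrightarrow> 1 *\<^sub>R d x" for x by (intro tendsto_intros cutoff_tendsto)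
    then show "AE x in lebesgue. (\<lambda>n. cutoff T n x *\<^sub>R d x) \<longlonglongrightarrow> d x" by simp
    show "AE x in lebesgue. cmod (cutoff T n x *\<^sub>R d x) \<le> cmod (d x)" for n by (rule AE_I2, rule \<phi>d_le)
  qed
  moreover have "(\<lambda>n. LINT x|lebesgue. cutoff T n x *\<^sub>R d x) \<longlonglongrightarrow> 0"
  proof (rule Lim_null_comparison)
    show "(\<lambda>n. integral\<^sup>L lebesgue Q * inverse (real (Suc n))) \<longlonglongrightarrow> 0"
      by (rule tendsto_mult_right_zero[OF LIMSEQ_inverse_real_of_nat])
    show "\<forall>\<^sub>F n in sequentially. cmod (LINT x|lebesgue. cutoff T n x *\<^sub>R d x) \<le> integral\<^sup>L lebesgue Q * inverse (real (Suc n))"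
    proof (rule always_eventually, rule allI)
      fix n
      note z = cutoff_integral_zero[OF W, of n, folded \<phi>'_def]
      have \<phi>W_int: "integrable lebesgue (\<lambda>x. \<phi>' n x *\<^sub>R W x)"
        using Bochner_Integration.integrable_diff[OF z(1) \<phi>d_int[of n]] by simp
      have "(LINT x|lebesgue. cutoff T n x *\<^sub>R d x) = - (LINT x|lebesgue. \<phi>' n x *\<^sub>R W x)"
        using z(2) Bochner_Integration.integral_add[OF \<phi>d_int[of n] \<phi>W_int] by (simp add: eq_neg_iff_add_eq_0)
      then have "cmod (LINT x|lebesgue. cutoff T n x *\<^sub>R d x) = cmod (LINT x|lebesgue. \<phi>' n x *\<^sub>R W x)" by simp
      also have "\<dots> \<le> (LINT x|lebesgue. Q x * inverse (real (Suc n)))"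
      proof (rule order_trans[OF integral_norm_bound integral_mono_AE])
        show "integrable lebesgue (\<lambda>x. cmod (\<phi>' n x *\<^sub>R W x))" by (rule integrable_norm[OF \<phi>W_int])
        show "integrable lebesgue (\<lambda>x. Q x * inverse (real (Suc n)))" using Q_int by simp
        show "AE x in lebesgue. cmod (\<phi>' n x *\<^sub>R W x) \<le> Q x * inverse (real (Suc n))"
          using \<phi>(2)[of n] WQ
        proof eventually_elim
          case (elim x)
          have "cmod (\<phi>' n x *\<^sub>R W x) \<le> \<rho> x * k x / real (Suc n) * cmod (W x)"
            using mult_right_mono[OF elim(1), of "cmod (W x)"] by simp
          also have "\<dots> = (\<rho> x * k x * cmod (W x)) * inverse (real (Suc n))" by (simp add: divide_inverse ac_simps)
          also have "\<dots> \<le> Q x * inverse (real (Suc n))" by (rule mult_right_mono[OF elim(2)]) simp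
          finally show ?case .
        qed
      qed
      also have "\<dots> = integral\<^sup>L lebesgue Q * inverse (real (Suc n))" by simp
      finally show "cmod (LINT x|lebesgue. cutoff T n x *\<^sub>R d x) \<le> integral\<^sup>L lebesgue Q * inverse (real (Suc n))" .
    qed
  qed
  ultimately have "integral\<^sup>L lebesgue d = 0" by (rule LIMSEQ_unique)
  then show ?thesis unfolding d_eq by simp
qed

end

theorem theorem5p7:
  fixes J V B A H :: "real \<Rightarrow> complex^'n^'n"
    and q :: "real \<Rightarrow> real" and \<delta> :: real
  assumes J_ac: "loc_abs_cont J"
    and J_det: "\<And>x. det (J x) \<noteq> 0"
    and V_int: "loc_integrable V" and B_int: "loc_integrable B"
    and A_int: "loc_integrable A" and H_int: "loc_integrable H"
    and V_herm: "AE x in lebesgue. hermitian (V x)"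
    and A_psd: "AE x in lebesgue. psd (A x)"
    and H_psd: "AE x in lebesgue. psd (H x)"
    and delta_pos: "\<delta> > 0"
    and q_ge: "\<And>x. q x \<ge> \<delta>"
    and V_ge: "AE x in lebesgue. loewner_le (- (q x *\<^sub>R H x)) (V x)"
    and int_pos: "(\<integral>\<^sup>+x\<in>{0..}. 1 / (c_fun J A H x * ennreal (q x powr (1/2))) \<partial>lebesgue) = \<infinity>"
    and int_neg: "(\<integral>\<^sup>+x\<in>{..0}. 1 / (c_fun J A H x * ennreal (q x powr (1/2))) \<partial>lebesgue) = \<infinity>"
    and cases: "(loc_abs_cont q \<and>
        (\<exists>C1::real. AE x in lebesgue.
           ennreal \<bar>deriv (\<lambda>t. q t powr (-1/2)) x\<bar> * c_fun J A H x \<le> ennreal C1))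
      \<or> (antimono_on {..0} q \<and> mono_on {0..} q)"
  shows "ess_self_adjoint (H_tilde H)
           (S_min (J_tilde J) (B_tilde J V B A) (H_tilde H))"
proof -
  interpret block_coefficients J V B A H
    by unfold_locales (fact J_ac J_det V_int B_int A_int H_int V_herm A_psd H_psd)+
  \<comment> \<open>The maximum with \<open>1\<close> in \<open>c_fun\<close> is what bounds
    \<open>k\<close> by \<open>1\<close>, and so makes \<open>\<rho> k\<close> locally
    integrable.\<close>
  have c: "1 \<le> c_fun J A H x" for x by (simp add: c_fun_def)
  obtain \<rho> \<rho>' k T :: "real \<Rightarrow> real" and K :: real
    where w: "has_density \<rho> \<rho>'" "\<And>x. 0 \<le> \<rho> x" "\<And>x. (\<rho> x)\<^sup>2 * q x \<le> 1"
      "\<And>x. 0 \<le> k x" "\<And>x. ennreal (k x) * c_fun J A H x \<le> 1"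
      "0 \<le> K" "AE x in lebesgue. ennreal \<bar>\<rho>' x\<bar> * c_fun J A H x \<le> ennreal K"
      "has_density T (\<lambda>x. \<rho> x * k x)" "filterlim T at_top at_top" "filterlim T at_bot at_bot"
    by (rule cutoff_weight_exists[OF c delta_pos q_ge int_pos int_neg cases]) blast
  interpret cutoff_coefficients J V B A H q \<rho> \<rho>' k T \<delta> K
    by unfold_locales (fact delta_pos q_ge V_ge w)+
  show ?thesis by (rule sys.ess_self_adjointI) (rule T_max_symmetric)
qed

end
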